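(* Let $\mathcal{C}$ be a tensor category over a fixed field $k$ and let $G$ be a finite group acting on $\mathcal{C}$ by tensor autoequivalences. Then $H\mapsto K_0(\mathcal{C}^H)$ (for $H\le G$) defines a Green functor on $G$ over $k$.
   Context: Notation: ${}^xH=xHx^{-1}$. A tensor category over a field $k$ is a $k$-linear abelian rigid monoidal category whose tensor product is bilinear on morphisms and with $\mathrm{End}(1)=k$. $K_0$ denotes the Grothendieck group. Group actions by tensor autoequivalences. A finite group $G$ acts on $\mathcal{C}$ by tensor autoequivalences if we are given $k$-linear exact tensor autoequivalences $T^g:\mathcal{C}\to\mathcal{C}$ ($g\in G$) with tensor structures $(T_2^g)^{M,N}:T^g(M\otimes N)\to T^g(M)\otimes T^g(N)$, and natural isomorphisms of tensor functors $T_2^{g,h}:T^gT^h\to T^{gh}$ with $(T_2^{gh,l})_M(T_2^{g,h})_{T^l(M)}=(T_2^{g,hl})_M\,T^g((T_2^{h,l})_M)$; normalized so that $T^1=\mathrm{id}$ and $T_2^{g,1}$, $T_2^{1,g}$ are identities. Equivariantization. For $H\le G$, $\mathcal{C}^H$ is the category of pairs $(M,\mu)$, $M\in\mathcal{C}$, $\mu=(\mu^h:T^h(M)\xrightarrow{\sim}M)_{h\in H}$ with $\mu^gT^g(\mu^h)=\mu^{gh}(T_2^{g,h})_M$, $\mu^1=\mathrm{id}$; morphisms are the morphisms of $\mathcal{C}$ commuting with the $\mu$'s. It is a tensor category with $(M,\mu)\otimes(N,\nu)=(M\otimes N,((\mu^h\otimes\nu^h)(T_2^h)^{M,N})_{h\in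 H})$; the multiplication on $K_0(\mathcal{C}^H)$ is induced by this tensor product. Structure maps. Restriction, induction and conjugation on $K_0$ are the maps induced by the following functors. Restriction $\mathrm{Res}^H_K:\mathcal{C}^H\to\mathcal{C}^K$ ($K\le H$) keeps only $\mu^k$, $k\in K$. Induction $\mathrm{Ind}^H_K:\mathcal{C}^K\to\mathcal{C}^H$: for a set $\mathcal{R}$ of representatives of $H/K$, $\mathrm{Ind}_K^H(V,\mu)=(\bigoplus_{t\in\mathcal{R}}T^t(V),\nu)$ with $\nu^g$ given on $T^gT^t(V)$ by $T^s(\mu^u)(T_2^{s,u})_V^{-1}(T_2^{g,t})_V:T^gT^t(V)\to T^s(V)$, where $gt=su$, $s\in\mathcal{R}$, $u\in K$; it is left adjoint to $\mathrm{Res}^H_K$. Conjugation $T^x:\mathcal{C}^H\to\mathcal{C}^{{}^xH}$: $T^x(V,\mu)=(T^x(V),{}^x\mu)$ with ${}^x\mu^{xhx^{-1}}=T^x(\mu^h)(T_2^{x,h})_V^{-1}(T_2^{xhx^{-1},x})_V$. Mackey functor over a ring $R$: a family of $R$-modules $\{a(H)\}_{H\le G}$ with morphisms $I^H_K:a(K)\to a(H)$, $R^H_K:a(H)\to a(K)$, $c_{H,g}:a(H)\to a({}^gH)$ for $K\le H\le G$, $g\in G$, such that: (M0) $I^H_H$, $R^H_H$ and $c_{H,h}$ ($h\in H$) are identities; (M1) $R^K_JR^H_K=R^H_J$ for $J\le K\le H$; (M2) $I^H_KI^K_J=I^H_J$ for $J\le K\le H$; (M3) $c_{{}^gH,h}\,c_{H,g}=c_{H,hg}$;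 (M4) for all $K,H\le G$: $R^G_HI^G_K=\sum_{x\in H\backslash G/K}I^H_{{}^xK\cap H}\,R^{{}^xK}_{{}^xK\cap H}\,c_{K,x}$. Green functor over a commutative ring $R$: a Mackey functor $a$ over $R$ such that each $a(H)$ is an associative $R$-algebra with identity and (G1) all $R^H_K$ and $c_{H,g}$ are unitary $R$-algebra homomorphisms; (G2) $I^H_K(a\,R^H_K(b))=I^H_K(a)\,b$; (G3) $I^H_K(R^H_K(b)\,a)=b\,I^H_K(a)$, for all $K\le H$, $a\in a(K)$, $b\in a(H)$.
   Formalization: The Grothendieck group is only an abelian group (for vector spaces it is Z, not a k-module), so "over k" is stated in two forms: K_0(C^H) is a Green functor over Z, and K_0(C^H) with scalars extended to k is a Green functor over k. *)

theory Defs
  imports "HOL-Algebra.Module" "HOL-Algebra.IntRing"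
begin

section \<open>Linear and abelian categories\<close>

text \<open>A category is given by hom-sets.  Hom-sets of different pairs of objects may overlap, but
  composition (and later addition, scalar multiplication, tensor product of morphisms, functors on
  morphisms) depends only on the morphisms.  When the hom-sets are pairwise disjoint, which can
  always be arranged, this is no restriction; allowing overlaps makes the morphisms of an
  equivariantization literally morphisms of the original category.\<close>

record ('o, 'm) cat =
  Ob :: "'o set"
  Hom :: "'o \<Rightarrow> 'o \<Rightarrow> 'm set"
  Idn :: "'o \<Rightarrow> 'm"
  Comp :: "'m \<Rightarrow> 'm \<Rightarrow> 'm"  (infixl "\<cdot>\<index>" 70)

locale category =
  fixes C (structure)
  assumes Idn_in: "A \<in> Ob C \<Longrightarrow> Idn C A \<in> Hom C A A"
    and Comp_in: "\<lbrakk>A \<in> Ob C; B \<in> Ob C; D \<in> Ob C; f \<in> Hom C A B; g \<in> Hom C B D\<rbrakk>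
          \<Longrightarrow> g \<cdot> f \<in> Hom C A D"
    and Comp_Idn: "\<lbrakk>A \<in> Ob C; B \<in> Ob C; f \<in> Hom C A B\<rbrakk> \<Longrightarrow> f \<cdot> Idn C A = f"
    and Idn_Comp: "\<lbrakk>A \<in> Ob C; B \<in> Ob C; f \<in> Hom C A B\<rbrakk> \<Longrightarrow> Idn C B \<cdot> f = f"
    and Comp_assoc: "\<lbrakk>A \<in> Ob C; B \<in> Ob C; D \<in> Ob C; E \<in> Ob C;
            f \<in> Hom C A B; g \<in> Hom C B D; h \<in> Hom C D E\<rbrakk>
          \<Longrightarrow> (h \<cdot> g) \<cdot> f = h \<cdot> (g \<cdot> f)"

definition inverse_mors :: "('o, 'm, 'z) cat_scheme \<Rightarrow> 'o \<Rightarrow> 'o \<Rightarrow> 'm \<Rightarrow> 'm \<Rightarrow> bool" where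
  "inverse_mors C A B f g \<longleftrightarrow> f \<in> Hom C A B \<and> g \<in> Hom C B A \<and>
     g \<cdot>\<^bsub>C\<^esub> f = Idn C A \<and> f \<cdot>\<^bsub>C\<^esub> g = Idn C B"

definition is_iso :: "('o, 'm, 'z) cat_scheme \<Rightarrow> 'o \<Rightarrow> 'o \<Rightarrow> 'm \<Rightarrow> bool" where
  "is_iso C A B f \<longleftrightarrow> (\<exists>g. inverse_mors C A B f g)"

definition inv_mor :: "('o, 'm, 'z) cat_scheme \<Rightarrow> 'o \<Rightarrow> 'o \<Rightarrow> 'm \<Rightarrow> 'm" where
  "inv_mor C A B f = (THE g. inverse_mors C A B f g)"

definition is_mono :: "('o, 'm, 'z) cat_scheme \<Rightarrow> 'o \<Rightarrow> 'o \<Rightarrow> 'm \<Rightarrow> bool" where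
  "is_mono C A B f \<longleftrightarrow> f \<in> Hom C A B \<and>
     (\<forall>X \<in> Ob C. \<forall>g \<in> Hom C X A. \<forall>h \<in> Hom C X A. f \<cdot>\<^bsub>C\<^esub> g = f \<cdot>\<^bsub>C\<^esub> h \<longrightarrow> g = h)"

definition is_epi :: "('o, 'm, 'z) cat_scheme \<Rightarrow> 'o \<Rightarrow> 'o \<Rightarrow> 'm \<Rightarrow> bool" where
  "is_epi C A B f \<longleftrightarrow> f \<in> Hom C A B \<and>
     (\<forall>X \<in> Ob C. \<forall>g \<in> Hom C B X. \<forall>h \<in> Hom C B X. g \<cdot>\<^bsub>C\<^esub> f = h \<cdot>\<^bsub>C\<^esub> f \<longrightarrow> g = h)"

record ('k, 'o, 'm) lin_cat = "('o, 'm) cat" +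
  Zer :: "'o \<Rightarrow> 'o \<Rightarrow> 'm"
  Plus :: "'m \<Rightarrow> 'm \<Rightarrow> 'm"
  Scal :: "'k \<Rightarrow> 'm \<Rightarrow> 'm"

text \<open>The \<open>mult\<close> and \<open>one\<close> fields of a \<^typ>\<open>('a, 'b) module\<close> play no role in the locale
  \<^locale>\<open>module\<close>.\<close>

definition hom_module :: "('k, 'o, 'm, 'z) lin_cat_scheme \<Rightarrow> 'o \<Rightarrow> 'o \<Rightarrow> ('k, 'm) module" where
  "hom_module C A B = \<lparr>carrier = Hom C A B, monoid.mult = undefined, one = undefined,
     zero = Zer C A B, add = Plus C, smult = Scal C\<rparr>"

locale linear_category = category C + k: field k
  for k and C (structure) +
  assumes hom_module: "\<lbrakk>A \<in> Ob C; B \<in> Ob C\<rbrakk> \<Longrightarrow> module k (hom_module C A B)"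
    and Comp_Plus: "\<lbrakk>A \<in> Ob C; B \<in> Ob C; D \<in> Ob C; f \<in> Hom C A B; f' \<in> Hom C A B; g \<in> Hom C B D\<rbrakk>
          \<Longrightarrow> g \<cdot> Plus C f f' = Plus C (g \<cdot> f) (g \<cdot> f')"
    and Plus_Comp: "\<lbrakk>A \<in> Ob C; B \<in> Ob C; D \<in> Ob C; f \<in> Hom C A B; g \<in> Hom C B D; g' \<in> Hom C B D\<rbrakk>
          \<Longrightarrow> Plus C g g' \<cdot> f = Plus C (g \<cdot> f) (g' \<cdot> f)"
    and Comp_Scal: "\<lbrakk>A \<in> Ob C; B \<in> Ob C; D \<in> Ob C; f \<in> Hom C A B; g \<in> Hom C B D; a \<in> carrier k\<rbrakk>
          \<Longrightarrow> g \<cdot> Scal C a f = Scal C a (g \<cdot> f)"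
    and Scal_Comp: "\<lbrakk>A \<in> Ob C; B \<in> Ob C; D \<in> Ob C; f \<in> Hom C A B; g \<in> Hom C B D; a \<in> carrier k\<rbrakk>
          \<Longrightarrow> Scal C a g \<cdot> f = Scal C a (g \<cdot> f)"

definition is_zero_object :: "('k, 'o, 'm, 'z) lin_cat_scheme \<Rightarrow> 'o \<Rightarrow> bool" where
  "is_zero_object C Z \<longleftrightarrow> Z \<in> Ob C \<and>
     (\<forall>A \<in> Ob C. Hom C A Z = {Zer C A Z} \<and> Hom C Z A = {Zer C Z A})"

definition direct_sum :: "('k, 'o, 'm, 'z) lin_cat_scheme \<Rightarrow> 'i set \<Rightarrow> ('i \<Rightarrow> 'o) \<Rightarrow>
    'o \<Rightarrow> ('i \<Rightarrow> 'm) \<Rightarrow> ('i \<Rightarrow> 'm) \<Rightarrow> bool" where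
  "direct_sum C I X S \<iota> \<pi> \<longleftrightarrow> S \<in> Ob C \<and>
     (\<forall>i \<in> I. X i \<in> Ob C \<and> \<iota> i \<in> Hom C (X i) S \<and> \<pi> i \<in> Hom C S (X i)) \<and>
     (\<forall>i \<in> I. \<forall>j \<in> I. \<pi> j \<cdot>\<^bsub>C\<^esub> \<iota> i = (if i = j then Idn C (X i) else Zer C (X i) (X j))) \<and>
     (\<Oplus>\<^bsub>hom_module C S S\<^esub> i \<in> I. \<iota> i \<cdot>\<^bsub>C\<^esub> \<pi> i) = Idn C S"

definition is_kernel :: "('k, 'o, 'm, 'z) lin_cat_scheme \<Rightarrow> 'o \<Rightarrow> 'o \<Rightarrow> 'm \<Rightarrow> 'o \<Rightarrow> 'm \<Rightarrow> bool" where
  "is_kernel C A B f K i \<longleftrightarrow> K \<in> Ob C \<and> i \<in> Hom C K A \<and> f \<cdot>\<^bsub>C\<^esub> i = Zer C K B \<and>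
     (\<forall>X \<in> Ob C. \<forall>h \<in> Hom C X A. f \<cdot>\<^bsub>C\<^esub> h = Zer C X B \<longrightarrow>
        (\<exists>!h'. h' \<in> Hom C X K \<and> i \<cdot>\<^bsub>C\<^esub> h' = h))"

definition is_cokernel :: "('k, 'o, 'm, 'z) lin_cat_scheme \<Rightarrow> 'o \<Rightarrow> 'o \<Rightarrow> 'm \<Rightarrow> 'o \<Rightarrow> 'm \<Rightarrow> bool" where
  "is_cokernel C A B f Q p \<longleftrightarrow> Q \<in> Ob C \<and> p \<in> Hom C B Q \<and> p \<cdot>\<^bsub>C\<^esub> f = Zer C A Q \<and>
     (\<forall>X \<in> Ob C. \<forall>h \<in> Hom C B X. h \<cdot>\<^bsub>C\<^esub> f = Zer C A X \<longrightarrow>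
        (\<exists>!h'. h' \<in> Hom C Q X \<and> h' \<cdot>\<^bsub>C\<^esub> p = h))"

text \<open>\<open>0 \<rightarrow> A \<rightarrow> B \<rightarrow> D \<rightarrow> 0\<close> with maps \<open>f\<close>, \<open>g\<close> is short exact.\<close>

definition short_exact :: "('k, 'o, 'm, 'z) lin_cat_scheme \<Rightarrow> 'o \<Rightarrow> 'm \<Rightarrow> 'o \<Rightarrow> 'm \<Rightarrow> 'o \<Rightarrow> bool" where
  "short_exact C A f B g D \<longleftrightarrow> A \<in> Ob C \<and> B \<in> Ob C \<and> D \<in> Ob C \<and>
     f \<in> Hom C A B \<and> g \<in> Hom C B D \<and> is_kernel C B D g A f \<and> is_cokernel C A B f D g"

locale abelian_category = linear_category k C
  for k and C (structure) +
  assumes zero_object: "\<exists>Z. is_zero_object C Z"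
    and biproducts: "\<lbrakk>A \<in> Ob C; B \<in> Ob C\<rbrakk> \<Longrightarrow>
          \<exists>S \<iota> \<pi>. direct_sum C (UNIV :: bool set) (\<lambda>b. if b then A else B) S \<iota> \<pi>"
    and kernels: "\<lbrakk>A \<in> Ob C; B \<in> Ob C; f \<in> Hom C A B\<rbrakk> \<Longrightarrow> \<exists>K i. is_kernel C A B f K i"
    and cokernels: "\<lbrakk>A \<in> Ob C; B \<in> Ob C; f \<in> Hom C A B\<rbrakk> \<Longrightarrow> \<exists>Q p. is_cokernel C A B f Q p"
    and mono_is_kernel: "\<lbrakk>A \<in> Ob C; B \<in> Ob C; is_mono C A B f\<rbrakk> \<Longrightarrow>
          \<exists>D \<in> Ob C. \<exists>g \<in> Hom C B D. is_kernel C B D g A f"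
    and epi_is_cokernel: "\<lbrakk>A \<in> Ob C; B \<in> Ob C; is_epi C A B f\<rbrakk> \<Longrightarrow>
          \<exists>D \<in> Ob C. \<exists>g \<in> Hom C D A. is_cokernel C D A g B f"


section \<open>Tensor categories\<close>

text \<open>\<open>Assoc A B D : (A \<otimes> B) \<otimes> D \<rightarrow> A \<otimes> (B \<otimes> D)\<close>, \<open>LUnit A : 1 \<otimes> A \<rightarrow> A\<close>,
  \<open>RUnit A : A \<otimes> 1 \<rightarrow> A\<close>.\<close>

record ('k, 'o, 'm) mon_cat = "('k, 'o, 'm) lin_cat" +
  TObj :: "'o \<Rightarrow> 'o \<Rightarrow> 'o"
  TMor :: "'m \<Rightarrow> 'm \<Rightarrow> 'm"
  Unit :: "'o"
  Assoc :: "'o \<Rightarrow> 'o \<Rightarrow> 'o \<Rightarrow> 'm"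
  LUnit :: "'o \<Rightarrow> 'm"
  RUnit :: "'o \<Rightarrow> 'm"

text \<open>\<open>D\<close> is a left dual of \<open>A\<close> (equivalently, \<open>A\<close> is a right dual of \<open>D\<close>), with evaluation
  \<open>e : D \<otimes> A \<rightarrow> 1\<close> and coevaluation \<open>c : 1 \<rightarrow> A \<otimes> D\<close>.\<close>

definition is_left_dual :: "('k, 'o, 'm, 'z) mon_cat_scheme \<Rightarrow> 'o \<Rightarrow> 'o \<Rightarrow> 'm \<Rightarrow> 'm \<Rightarrow> bool" where
  "is_left_dual C A D e c \<longleftrightarrow> A \<in> Ob C \<and> D \<in> Ob C \<and>
     e \<in> Hom C (TObj C D A) (Unit C) \<and> c \<in> Hom C (Unit C) (TObj C A D) \<and>
     RUnit C A \<cdot>\<^bsub>C\<^esub> TMor C (Idn C A) e \<cdot>\<^bsub>C\<^esub> Assoc C A D A \<cdot>\<^bsub>C\<^esub> TMor C c (Idn C A) = LUnit C A \<and>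
     LUnit C D \<cdot>\<^bsub>C\<^esub> TMor C e (Idn C D) \<cdot>\<^bsub>C\<^esub>
       inv_mor C (TObj C (TObj C D A) D) (TObj C D (TObj C A D)) (Assoc C D A D) \<cdot>\<^bsub>C\<^esub>
       TMor C (Idn C D) c = RUnit C D"

locale tensor_category = abelian_category k C
  for k and C (structure) +
  assumes Unit_in: "Unit C \<in> Ob C"
    and TObj_in: "\<lbrakk>A \<in> Ob C; B \<in> Ob C\<rbrakk> \<Longrightarrow> TObj C A B \<in> Ob C"
    and TMor_in: "\<lbrakk>A \<in> Ob C; A' \<in> Ob C; B \<in> Ob C; B' \<in> Ob C; f \<in> Hom C A A'; g \<in> Hom C B B'\<rbrakk>
          \<Longrightarrow> TMor C f g \<in> Hom C (TObj C A B) (TObj C A' B')"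
    and TMor_Idn: "\<lbrakk>A \<in> Ob C; B \<in> Ob C\<rbrakk> \<Longrightarrow> TMor C (Idn C A) (Idn C B) = Idn C (TObj C A B)"
    and TMor_Comp: "\<lbrakk>A \<in> Ob C; A' \<in> Ob C; A'' \<in> Ob C; B \<in> Ob C; B' \<in> Ob C; B'' \<in> Ob C;
            f \<in> Hom C A A'; f' \<in> Hom C A' A''; g \<in> Hom C B B'; g' \<in> Hom C B' B''\<rbrakk>
          \<Longrightarrow> TMor C (f' \<cdot> f) (g' \<cdot> g) = TMor C f' g' \<cdot> TMor C f g"
    and TMor_Plus_left: "\<lbrakk>A \<in> Ob C; A' \<in> Ob C; B \<in> Ob C; B' \<in> Ob C;
            f \<in> Hom C A A'; f' \<in> Hom C A A'; g \<in> Hom C B B'\<rbrakk>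
          \<Longrightarrow> TMor C (Plus C f f') g = Plus C (TMor C f g) (TMor C f' g)"
    and TMor_Plus_right: "\<lbrakk>A \<in> Ob C; A' \<in> Ob C; B \<in> Ob C; B' \<in> Ob C;
            f \<in> Hom C A A'; g \<in> Hom C B B'; g' \<in> Hom C B B'\<rbrakk>
          \<Longrightarrow> TMor C f (Plus C g g') = Plus C (TMor C f g) (TMor C f g')"
    and TMor_Scal_left: "\<lbrakk>A \<in> Ob C; A' \<in> Ob C; B \<in> Ob C; B' \<in> Ob C;
            f \<in> Hom C A A'; g \<in> Hom C B B'; a \<in> carrier k\<rbrakk>
          \<Longrightarrow> TMor C (Scal C a f) g = Scal C a (TMor C f g)"
    and TMor_Scal_right: "\<lbrakk>A \<in> Ob C; A' \<in> Ob C; B \<in> Ob C; B' \<in> Ob C;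
            f \<in> Hom C A A'; g \<in> Hom C B B'; a \<in> carrier k\<rbrakk>
          \<Longrightarrow> TMor C f (Scal C a g) = Scal C a (TMor C f g)"
    and Assoc_iso: "\<lbrakk>A \<in> Ob C; B \<in> Ob C; D \<in> Ob C\<rbrakk>
          \<Longrightarrow> is_iso C (TObj C (TObj C A B) D) (TObj C A (TObj C B D)) (Assoc C A B D)"
    and LUnit_iso: "A \<in> Ob C \<Longrightarrow> is_iso C (TObj C (Unit C) A) A (LUnit C A)"
    and RUnit_iso: "A \<in> Ob C \<Longrightarrow> is_iso C (TObj C A (Unit C)) A (RUnit C A)"
    and Assoc_natural: "\<lbrakk>A \<in> Ob C; A' \<in> Ob C; B \<in> Ob C; B' \<in> Ob C; D \<in> Ob C; D' \<in> Ob C;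
            f \<in> Hom C A A'; g \<in> Hom C B B'; h \<in> Hom C D D'\<rbrakk>
          \<Longrightarrow> Assoc C A' B' D' \<cdot> TMor C (TMor C f g) h = TMor C f (TMor C g h) \<cdot> Assoc C A B D"
    and LUnit_natural: "\<lbrakk>A \<in> Ob C; B \<in> Ob C; f \<in> Hom C A B\<rbrakk>
          \<Longrightarrow> LUnit C B \<cdot> TMor C (Idn C (Unit C)) f = f \<cdot> LUnit C A"
    and RUnit_natural: "\<lbrakk>A \<in> Ob C; B \<in> Ob C; f \<in> Hom C A B\<rbrakk>
          \<Longrightarrow> RUnit C B \<cdot> TMor C f (Idn C (Unit C)) = f \<cdot> RUnit C A"
    and pentagon: "\<lbrakk>A \<in> Ob C; B \<in> Ob C; D \<in> Ob C; E \<in> Ob C\<rbrakk>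
          \<Longrightarrow> Assoc C A B (TObj C D E) \<cdot> Assoc C (TObj C A B) D E
            = TMor C (Idn C A) (Assoc C B D E) \<cdot> Assoc C A (TObj C B D) E
                \<cdot> TMor C (Assoc C A B D) (Idn C E)"
    and triangle: "\<lbrakk>A \<in> Ob C; B \<in> Ob C\<rbrakk>
          \<Longrightarrow> TMor C (Idn C A) (LUnit C B) \<cdot> Assoc C A (Unit C) B
            = TMor C (RUnit C A) (Idn C B)"
    and left_dual: "A \<in> Ob C \<Longrightarrow> \<exists>D e c. is_left_dual C A D e c"
    and right_dual: "A \<in> Ob C \<Longrightarrow> \<exists>D e c. is_left_dual C D A e c"
    and End_Unit: "bij_betw (\<lambda>a. Scal C a (Idn C (Unit C))) (carrier k) (Hom C (Unit C) (Unit C))"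


section \<open>Group actions by tensor autoequivalences\<close>

definition endo :: "('o, 'm, 'z) cat_scheme \<Rightarrow> ('o \<Rightarrow> 'o) \<Rightarrow> ('m \<Rightarrow> 'm) \<Rightarrow> bool" where
  "endo C F \<phi> \<longleftrightarrow>
     (\<forall>A \<in> Ob C. F A \<in> Ob C \<and> \<phi> (Idn C A) = Idn C (F A)) \<and>
     (\<forall>A \<in> Ob C. \<forall>B \<in> Ob C. \<forall>f \<in> Hom C A B. \<phi> f \<in> Hom C (F A) (F B)) \<and>
     (\<forall>A \<in> Ob C. \<forall>B \<in> Ob C. \<forall>D \<in> Ob C. \<forall>f \<in> Hom C A B. \<forall>g \<in> Hom C B D.
        \<phi> (g \<cdot>\<^bsub>C\<^esub> f) = \<phi> g \<cdot>\<^bsub>C\<^esub> \<phi> f)"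

definition nat_iso :: "('o, 'm, 'z) cat_scheme \<Rightarrow> ('o \<Rightarrow> 'o) \<Rightarrow> ('m \<Rightarrow> 'm) \<Rightarrow>
    ('o \<Rightarrow> 'o) \<Rightarrow> ('m \<Rightarrow> 'm) \<Rightarrow> ('o \<Rightarrow> 'm) \<Rightarrow> bool" where
  "nat_iso C F \<phi> F' \<phi>' \<eta> \<longleftrightarrow>
     (\<forall>A \<in> Ob C. is_iso C (F A) (F' A) (\<eta> A)) \<and>
     (\<forall>A \<in> Ob C. \<forall>B \<in> Ob C. \<forall>f \<in> Hom C A B. \<eta> B \<cdot>\<^bsub>C\<^esub> \<phi> f = \<phi>' f \<cdot>\<^bsub>C\<^esub> \<eta> A)"

definition autoequivalence :: "('o, 'm, 'z) cat_scheme \<Rightarrow> ('o \<Rightarrow> 'o) \<Rightarrow> ('m \<Rightarrow> 'm) \<Rightarrow> bool" where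
  "autoequivalence C F \<phi> \<longleftrightarrow> endo C F \<phi> \<and>
     (\<exists>F' \<phi>' \<eta> \<epsilon>. endo C F' \<phi>' \<and>
        nat_iso C (F' \<circ> F) (\<phi>' \<circ> \<phi>) id id \<eta> \<and> nat_iso C (F \<circ> F') (\<phi> \<circ> \<phi>') id id \<epsilon>)"

text \<open>A functor with tensor structure \<open>F2 A B : F (A \<otimes> B) \<rightarrow> F A \<otimes> F B\<close> and
  unit isomorphism \<open>F0 : F 1 \<rightarrow> 1\<close>.  The latter is determined by the former.\<close>

record ('o, 'm) tens_fun =
  FObj :: "'o \<Rightarrow> 'o"
  FMor :: "'m \<Rightarrow> 'm"
  F2 :: "'o \<Rightarrow> 'o \<Rightarrow> 'm"
  F0 :: "'m"

locale tensor_autoequivalence = tensor_category k C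
  for k and C (structure) and F :: "('o, 'm) tens_fun" +
  assumes equivalence: "autoequivalence C (FObj F) (FMor F)"
    and FMor_Plus: "\<lbrakk>A \<in> Ob C; B \<in> Ob C; f \<in> Hom C A B; g \<in> Hom C A B\<rbrakk>
          \<Longrightarrow> FMor F (Plus C f g) = Plus C (FMor F f) (FMor F g)"
    and FMor_Scal: "\<lbrakk>A \<in> Ob C; B \<in> Ob C; f \<in> Hom C A B; a \<in> carrier k\<rbrakk>
          \<Longrightarrow> FMor F (Scal C a f) = Scal C a (FMor F f)"
    and exact: "short_exact C A f B g D
          \<Longrightarrow> short_exact C (FObj F A) (FMor F f) (FObj F B) (FMor F g) (FObj F D)"
    and F2_iso: "\<lbrakk>A \<in> Ob C; B \<in> Ob C\<rbrakk>
          \<Longrightarrow> is_iso C (FObj F (TObj C A B)) (TObj C (FObj F A) (FObj F B)) (F2 F A B)"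
    and F0_iso: "is_iso C (FObj F (Unit C)) (Unit C) (F0 F)"
    and F2_natural: "\<lbrakk>A \<in> Ob C; A' \<in> Ob C; B \<in> Ob C; B' \<in> Ob C; f \<in> Hom C A A'; g \<in> Hom C B B'\<rbrakk>
          \<Longrightarrow> F2 F A' B' \<cdot> FMor F (TMor C f g) = TMor C (FMor F f) (FMor F g) \<cdot> F2 F A B"
    and F2_Assoc: "\<lbrakk>A \<in> Ob C; B \<in> Ob C; D \<in> Ob C\<rbrakk>
          \<Longrightarrow> Assoc C (FObj F A) (FObj F B) (FObj F D)
                \<cdot> TMor C (F2 F A B) (Idn C (FObj F D)) \<cdot> F2 F (TObj C A B) D
            = TMor C (Idn C (FObj F A)) (F2 F B D) \<cdot> F2 F A (TObj C B D) \<cdot> FMor F (Assoc C A B D)"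
    and F0_LUnit: "A \<in> Ob C
          \<Longrightarrow> LUnit C (FObj F A) \<cdot> TMor C (F0 F) (Idn C (FObj F A)) \<cdot> F2 F (Unit C) A
            = FMor F (LUnit C A)"
    and F0_RUnit: "A \<in> Ob C
          \<Longrightarrow> RUnit C (FObj F A) \<cdot> TMor C (Idn C (FObj F A)) (F0 F) \<cdot> F2 F A (Unit C)
            = FMor F (RUnit C A)"

text \<open>\<open>T g\<close> is the tensor functor \<open>T\<^sup>g\<close>, and \<open>\<gamma> g h M : T\<^sup>g (T\<^sup>h M) \<rightarrow> T\<^sup>g\<^sup>h M\<close> is the component
  at \<open>M\<close> of the isomorphism of tensor functors \<open>T\<^sup>g T\<^sup>h \<rightarrow> T\<^sup>g\<^sup>h\<close>.\<close>

locale tensor_action = tensor_category k C + G: group G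
  for k and C (structure) and G and T :: "'g \<Rightarrow> ('o, 'm) tens_fun" and \<gamma> :: "'g \<Rightarrow> 'g \<Rightarrow> 'o \<Rightarrow> 'm" +
  assumes tensor_autoequivalence: "g \<in> carrier G \<Longrightarrow> tensor_autoequivalence k C (T g)"
    and \<gamma>_nat_iso: "\<lbrakk>g \<in> carrier G; h \<in> carrier G\<rbrakk>
          \<Longrightarrow> nat_iso C (FObj (T g) \<circ> FObj (T h)) (FMor (T g) \<circ> FMor (T h))
                (FObj (T (g \<otimes>\<^bsub>G\<^esub> h))) (FMor (T (g \<otimes>\<^bsub>G\<^esub> h))) (\<gamma> g h)"
    and \<gamma>_F2: "\<lbrakk>g \<in> carrier G; h \<in> carrier G; M \<in> Ob C; N \<in> Ob C\<rbrakk>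
          \<Longrightarrow> TMor C (\<gamma> g h M) (\<gamma> g h N)
                \<cdot> F2 (T g) (FObj (T h) M) (FObj (T h) N) \<cdot> FMor (T g) (F2 (T h) M N)
            = F2 (T (g \<otimes>\<^bsub>G\<^esub> h)) M N \<cdot> \<gamma> g h (TObj C M N)"
    and \<gamma>_F0: "\<lbrakk>g \<in> carrier G; h \<in> carrier G\<rbrakk>
          \<Longrightarrow> F0 (T g) \<cdot> FMor (T g) (F0 (T h)) = F0 (T (g \<otimes>\<^bsub>G\<^esub> h)) \<cdot> \<gamma> g h (Unit C)"
    and \<gamma>_assoc: "\<lbrakk>g \<in> carrier G; h \<in> carrier G; l \<in> carrier G; M \<in> Ob C\<rbrakk>
          \<Longrightarrow> \<gamma> (g \<otimes>\<^bsub>G\<^esub> h) l M \<cdot> \<gamma> g h (FObj (T l) M)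
            = \<gamma> g (h \<otimes>\<^bsub>G\<^esub> l) M \<cdot> FMor (T g) (\<gamma> h l M)"
    and T_one_Ob: "M \<in> Ob C \<Longrightarrow> FObj (T \<one>\<^bsub>G\<^esub>) M = M"
    and T_one_Hom: "\<lbrakk>M \<in> Ob C; N \<in> Ob C; f \<in> Hom C M N\<rbrakk> \<Longrightarrow> FMor (T \<one>\<^bsub>G\<^esub>) f = f"
    and T_one_F2: "\<lbrakk>M \<in> Ob C; N \<in> Ob C\<rbrakk> \<Longrightarrow> F2 (T \<one>\<^bsub>G\<^esub>) M N = Idn C (TObj C M N)"
    and T_one_F0: "F0 (T \<one>\<^bsub>G\<^esub>) = Idn C (Unit C)"
    and \<gamma>_one_right: "\<lbrakk>g \<in> carrier G; M \<in> Ob C\<rbrakk> \<Longrightarrow> \<gamma> g \<one>\<^bsub>G\<^esub> M = Idn C (FObj (T g) M)"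
    and \<gamma>_one_left: "\<lbrakk>g \<in> carrier G; M \<in> Ob C\<rbrakk> \<Longrightarrow> \<gamma> \<one>\<^bsub>G\<^esub> g M = Idn C (FObj (T g) M)"


section \<open>Equivariantization\<close>

text \<open>The families \<open>\<mu>\<close> are functions that are \<^const>\<open>undefined\<close> outside \<open>H\<close>.\<close>

definition equivariantization :: "('g, 'y) monoid_scheme \<Rightarrow> ('k, 'o, 'm, 'z) mon_cat_scheme \<Rightarrow>
    ('g \<Rightarrow> ('o, 'm) tens_fun) \<Rightarrow> ('g \<Rightarrow> 'g \<Rightarrow> 'o \<Rightarrow> 'm) \<Rightarrow> 'g set \<Rightarrow>
    ('k, 'o \<times> ('g \<Rightarrow> 'm), 'm) mon_cat" where
  "equivariantization G C T \<gamma> H =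
    \<lparr>Ob = {(M, \<mu>). M \<in> Ob C \<and> \<mu> \<in> extensional H \<and>
             (\<forall>h \<in> H. is_iso C (FObj (T h) M) M (\<mu> h)) \<and>
             (\<forall>g \<in> H. \<forall>h \<in> H. \<mu> g \<cdot>\<^bsub>C\<^esub> FMor (T g) (\<mu> h) = \<mu> (g \<otimes>\<^bsub>G\<^esub> h) \<cdot>\<^bsub>C\<^esub> \<gamma> g h M) \<and>
             \<mu> \<one>\<^bsub>G\<^esub> = Idn C M},
     Hom = (\<lambda>(M, \<mu>) (N, \<nu>). {f \<in> Hom C M N. \<forall>h \<in> H. f \<cdot>\<^bsub>C\<^esub> \<mu> h = \<nu> h \<cdot>\<^bsub>C\<^esub> FMor (T h) f}),
     Idn = (\<lambda>(M, \<mu>). Idn C M),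
     Comp = Comp C,
     Zer = (\<lambda>(M, \<mu>) (N, \<nu>). Zer C M N),
     Plus = Plus C,
     Scal = Scal C,
     TObj = (\<lambda>(M, \<mu>) (N, \<nu>).
               (TObj C M N, \<lambda>h \<in> H. TMor C (\<mu> h) (\<nu> h) \<cdot>\<^bsub>C\<^esub> F2 (T h) M N)),
     TMor = TMor C,
     Unit = (Unit C, \<lambda>h \<in> H. F0 (T h)),
     Assoc = (\<lambda>(M, \<mu>) (N, \<nu>) (P, \<rho>). Assoc C M N P),
     LUnit = (\<lambda>(M, \<mu>). LUnit C M),
     RUnit = (\<lambda>(M, \<mu>). RUnit C M)\<rparr>"

abbreviation conj_set :: "('g, 'y) monoid_scheme \<Rightarrow> 'g \<Rightarrow> 'g set \<Rightarrow> 'g set" where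
  "conj_set G x H \<equiv> x <#\<^bsub>G\<^esub> H #>\<^bsub>G\<^esub> (inv\<^bsub>G\<^esub> x)"

definition left_coset_reps :: "('g, 'y) monoid_scheme \<Rightarrow> 'g set \<Rightarrow> 'g set \<Rightarrow> 'g set \<Rightarrow> bool" where
  "left_coset_reps G H K S \<longleftrightarrow> S \<subseteq> H \<and> (\<forall>g \<in> H. \<exists>!t. t \<in> S \<and> g \<in> t <#\<^bsub>G\<^esub> K)"

definition double_coset_reps :: "('g, 'y) monoid_scheme \<Rightarrow> 'g set \<Rightarrow> 'g set \<Rightarrow> 'g set \<Rightarrow> bool" where
  "double_coset_reps G H K X \<longleftrightarrow>
     X \<subseteq> carrier G \<and> (\<forall>g \<in> carrier G. \<exists>!x. x \<in> X \<and> g \<in> (H #>\<^bsub>G\<^esub> x) <#>\<^bsub>G\<^esub> K)"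

definition res_obj :: "'g set \<Rightarrow> 'o \<times> ('g \<Rightarrow> 'm) \<Rightarrow> 'o \<times> ('g \<Rightarrow> 'm)" where
  "res_obj K = (\<lambda>(M, \<mu>). (M, restrict \<mu> K))"

definition conj_obj :: "('g, 'y) monoid_scheme \<Rightarrow> ('k, 'o, 'm, 'z) mon_cat_scheme \<Rightarrow>
    ('g \<Rightarrow> ('o, 'm) tens_fun) \<Rightarrow> ('g \<Rightarrow> 'g \<Rightarrow> 'o \<Rightarrow> 'm) \<Rightarrow> 'g set \<Rightarrow> 'g \<Rightarrow>
    'o \<times> ('g \<Rightarrow> 'm) \<Rightarrow> 'o \<times> ('g \<Rightarrow> 'm)" where
  "conj_obj G C T \<gamma> H x = (\<lambda>(V, \<mu>).
     (FObj (T x) V,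
      \<lambda>l \<in> conj_set G x H. let h = inv\<^bsub>G\<^esub> x \<otimes>\<^bsub>G\<^esub> l \<otimes>\<^bsub>G\<^esub> x in
        FMor (T x) (\<mu> h) \<cdot>\<^bsub>C\<^esub>
        inv_mor C (FObj (T x) (FObj (T h) V)) (FObj (T (x \<otimes>\<^bsub>G\<^esub> h)) V) (\<gamma> x h V) \<cdot>\<^bsub>C\<^esub>
        \<gamma> l x V))"

text \<open>\<open>(S, \<nu>)\<close> is induced from \<open>(V, \<mu>)\<close>, for some choice of representatives of \<open>H / K\<close> and of a
  direct sum of the objects \<open>T\<^sup>t V\<close>.  As \<open>T\<^sup>g S\<close> is the direct sum of the \<open>T\<^sup>g (T\<^sup>t V)\<close> along the maps
  \<open>T\<^sup>g (\<iota> t)\<close>, the last condition determines \<open>\<nu> g\<close>.\<close>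

definition is_induced_obj :: "('g, 'y) monoid_scheme \<Rightarrow> ('k, 'o, 'm, 'z) mon_cat_scheme \<Rightarrow>
    ('g \<Rightarrow> ('o, 'm) tens_fun) \<Rightarrow> ('g \<Rightarrow> 'g \<Rightarrow> 'o \<Rightarrow> 'm) \<Rightarrow> 'g set \<Rightarrow> 'g set \<Rightarrow>
    'o \<times> ('g \<Rightarrow> 'm) \<Rightarrow> 'o \<times> ('g \<Rightarrow> 'm) \<Rightarrow> bool" where
  "is_induced_obj G C T \<gamma> H K = (\<lambda>(V, \<mu>) (S, \<nu>).
     \<exists>\<R> \<iota> \<pi>. left_coset_reps G H K \<R> \<and>
       direct_sum C \<R> (\<lambda>t. FObj (T t) V) S \<iota> \<pi> \<and>
       \<nu> \<in> extensional H \<and> (\<forall>g \<in> H. \<nu> g \<in> Hom C (FObj (T g) S) S) \<and>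
       (\<forall>g \<in> H. \<forall>t \<in> \<R>. \<forall>s \<in> \<R>. \<forall>u \<in> K. g \<otimes>\<^bsub>G\<^esub> t = s \<otimes>\<^bsub>G\<^esub> u \<longrightarrow>
          \<nu> g \<cdot>\<^bsub>C\<^esub> FMor (T g) (\<iota> t) =
          \<iota> s \<cdot>\<^bsub>C\<^esub> (FMor (T s) (\<mu> u) \<cdot>\<^bsub>C\<^esub>
            inv_mor C (FObj (T s) (FObj (T u) V)) (FObj (T (s \<otimes>\<^bsub>G\<^esub> u)) V) (\<gamma> s u V) \<cdot>\<^bsub>C\<^esub>
            \<gamma> g t V)))"


section \<open>Grothendieck groups with coefficients\<close>

definition free_module :: "('r, 'x) ring_scheme \<Rightarrow> 's set \<Rightarrow> ('r, 's \<Rightarrow> 'r) module" where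
  "free_module R S =
    \<lparr>carrier = {f. range f \<subseteq> carrier R \<and> finite {s. f s \<noteq> \<zero>\<^bsub>R\<^esub>} \<and> {s. f s \<noteq> \<zero>\<^bsub>R\<^esub>} \<subseteq> S},
     monoid.mult = undefined, one = undefined,
     zero = (\<lambda>s. \<zero>\<^bsub>R\<^esub>),
     add = (\<lambda>f g s. f s \<oplus>\<^bsub>R\<^esub> g s),
     smult = (\<lambda>r f s. r \<otimes>\<^bsub>R\<^esub> f s)\<rparr>"

definition single :: "('r, 'x) ring_scheme \<Rightarrow> 's \<Rightarrow> 's \<Rightarrow> 'r" where
  "single R s = (\<lambda>t. if t = s then \<one>\<^bsub>R\<^esub> else \<zero>\<^bsub>R\<^esub>)"

definition span_submodule :: "('r, 'x) ring_scheme \<Rightarrow> ('r, 'a, 'z) module_scheme \<Rightarrow> 'a set \<Rightarrow> 'a set" where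
  "span_submodule R M S = \<Inter>{N. submodule N R M \<and> S \<subseteq> N}"

definition quotient_module :: "('r, 'a, 'z) module_scheme \<Rightarrow> 'a set \<Rightarrow> ('r, 'a set) module" where
  "quotient_module M N =
    \<lparr>carrier = a_rcosets\<^bsub>M\<^esub> N,
     monoid.mult = undefined, one = undefined,
     zero = N,
     add = set_add M,
     smult = (\<lambda>r X. \<Union>x \<in> X. N +>\<^bsub>M\<^esub> (r \<odot>\<^bsub>M\<^esub> x))\<rparr>"

text \<open>\<open>K0 R C\<close> is the \<open>R\<close>-module generated by the objects of \<open>C\<close>, with a relation
  \<open>[B] = [A] + [D]\<close> for every short exact sequence \<open>0 \<rightarrow> A \<rightarrow> B \<rightarrow> D \<rightarrow> 0\<close> (in particular, isomorphic
  objects are identified).  So \<open>K0 \<Z> C\<close> is the Grothendieck group of \<open>C\<close>, and \<open>K0 R C\<close> is its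
  extension of scalars from \<open>\<Z>\<close> to \<open>R\<close>.\<close>

definition K0_relations :: "('r, 'x) ring_scheme \<Rightarrow> ('k, 'o, 'm, 'z) lin_cat_scheme \<Rightarrow> ('o \<Rightarrow> 'r) set" where
  "K0_relations R C = span_submodule R (free_module R (Ob C))
     {single R B \<ominus>\<^bsub>free_module R (Ob C)\<^esub> (single R A \<oplus>\<^bsub>free_module R (Ob C)\<^esub> single R D)
       | A f B g D. short_exact C A f B g D}"

definition K0 :: "('r, 'x) ring_scheme \<Rightarrow> ('k, 'o, 'm, 'z) lin_cat_scheme \<Rightarrow> ('r, ('o \<Rightarrow> 'r) set) module" where
  "K0 R C = quotient_module (free_module R (Ob C)) (K0_relations R C)"

definition K0_class :: "('r, 'x) ring_scheme \<Rightarrow> ('k, 'o, 'm, 'z) lin_cat_scheme \<Rightarrow> 'o \<Rightarrow> ('o \<Rightarrow> 'r) set" where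
  "K0_class R C A = K0_relations R C +>\<^bsub>free_module R (Ob C)\<^esub> single R A"


section \<open>Mackey and Green functors\<close>

text \<open>\<open>Ind a H K : a(K) \<rightarrow> a(H)\<close>, \<open>Res a H K : a(H) \<rightarrow> a(K)\<close> for \<open>K \<le> H\<close>, and
  \<open>Cnj a H g : a(H) \<rightarrow> a(gHg\<^sup>-\<^sup>1)\<close>.  The multiplications of the \<open>Val a H\<close> are used only for Green functors.\<close>

record ('r, 'g, 'a) mackey =
  Val :: "'g set \<Rightarrow> ('r, 'a) module"
  Ind :: "'g set \<Rightarrow> 'g set \<Rightarrow> 'a \<Rightarrow> 'a"
  Res :: "'g set \<Rightarrow> 'g set \<Rightarrow> 'a \<Rightarrow> 'a"
  Cnj :: "'g set \<Rightarrow> 'g \<Rightarrow> 'a \<Rightarrow> 'a"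

definition mod_hom :: "('r, 'x) ring_scheme \<Rightarrow> ('r, 'a, 'y) module_scheme \<Rightarrow>
    ('r, 'b, 'z) module_scheme \<Rightarrow> ('a \<Rightarrow> 'b) set" where
  "mod_hom R M N = {f \<in> carrier M \<rightarrow> carrier N.
     (\<forall>x \<in> carrier M. \<forall>y \<in> carrier M. f (x \<oplus>\<^bsub>M\<^esub> y) = f x \<oplus>\<^bsub>N\<^esub> f y) \<and>
     (\<forall>r \<in> carrier R. \<forall>x \<in> carrier M. f (r \<odot>\<^bsub>M\<^esub> x) = r \<odot>\<^bsub>N\<^esub> f x)}"

locale mackey_functor = R: cring R + G: group G
  for R :: "('r, 'x) ring_scheme" and G :: "('g, 'y) monoid_scheme" and a :: "('r, 'g, 'a) mackey" +
  assumes finite_G: "finite (carrier G)"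
    and Val_module: "subgroup H G \<Longrightarrow> module R (Val a H)"
    and Ind_hom: "\<lbrakk>subgroup H G; subgroup K G; K \<subseteq> H\<rbrakk> \<Longrightarrow> Ind a H K \<in> mod_hom R (Val a K) (Val a H)"
    and Res_hom: "\<lbrakk>subgroup H G; subgroup K G; K \<subseteq> H\<rbrakk> \<Longrightarrow> Res a H K \<in> mod_hom R (Val a H) (Val a K)"
    and Cnj_hom: "\<lbrakk>subgroup H G; g \<in> carrier G\<rbrakk>
          \<Longrightarrow> Cnj a H g \<in> mod_hom R (Val a H) (Val a (conj_set G g H))"
    and M0_Ind: "\<lbrakk>subgroup H G; v \<in> carrier (Val a H)\<rbrakk> \<Longrightarrow> Ind a H H v = v"
    and M0_Res: "\<lbrakk>subgroup H G; v \<in> carrier (Val a H)\<rbrakk> \<Longrightarrow> Res a H H v = v"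
    and M0_Cnj: "\<lbrakk>subgroup H G; h \<in> H; v \<in> carrier (Val a H)\<rbrakk> \<Longrightarrow> Cnj a H h v = v"
    and M1: "\<lbrakk>subgroup H G; subgroup K G; subgroup J G; J \<subseteq> K; K \<subseteq> H; v \<in> carrier (Val a H)\<rbrakk>
          \<Longrightarrow> Res a K J (Res a H K v) = Res a H J v"
    and M2: "\<lbrakk>subgroup H G; subgroup K G; subgroup J G; J \<subseteq> K; K \<subseteq> H; v \<in> carrier (Val a J)\<rbrakk>
          \<Longrightarrow> Ind a H K (Ind a K J v) = Ind a H J v"
    and M3: "\<lbrakk>subgroup H G; g \<in> carrier G; h \<in> carrier G; v \<in> carrier (Val a H)\<rbrakk>
          \<Longrightarrow> Cnj a (conj_set G g H) h (Cnj a H g v) = Cnj a H (h \<otimes>\<^bsub>G\<^esub> g) v"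
    and M4: "\<lbrakk>subgroup K G; subgroup H G; double_coset_reps G H K X; v \<in> carrier (Val a K)\<rbrakk>
          \<Longrightarrow> Res a (carrier G) H (Ind a (carrier G) K v) =
              (\<Oplus>\<^bsub>Val a H\<^esub> x \<in> X. Ind a H (conj_set G x K \<inter> H)
                 (Res a (conj_set G x K) (conj_set G x K \<inter> H) (Cnj a K x v)))"

text \<open>The locale \<^locale>\<open>algebra\<close> is not used here, since it requires commutativity.\<close>

locale green_functor = mackey_functor R G a
  for R :: "('r, 'x) ring_scheme" and G :: "('g, 'y) monoid_scheme" and a :: "('r, 'g, 'a) mackey" +
  assumes Val_ring: "subgroup H G \<Longrightarrow> ring (Val a H)"
    and Val_smult_left: "\<lbrakk>subgroup H G; r \<in> carrier R; v \<in> carrier (Val a H); w \<in> carrier (Val a H)\<rbrakk>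
          \<Longrightarrow> (r \<odot>\<^bsub>Val a H\<^esub> v) \<otimes>\<^bsub>Val a H\<^esub> w = r \<odot>\<^bsub>Val a H\<^esub> (v \<otimes>\<^bsub>Val a H\<^esub> w)"
    and Val_smult_right: "\<lbrakk>subgroup H G; r \<in> carrier R; v \<in> carrier (Val a H); w \<in> carrier (Val a H)\<rbrakk>
          \<Longrightarrow> v \<otimes>\<^bsub>Val a H\<^esub> (r \<odot>\<^bsub>Val a H\<^esub> w) = r \<odot>\<^bsub>Val a H\<^esub> (v \<otimes>\<^bsub>Val a H\<^esub> w)"
    and G1_Res: "\<lbrakk>subgroup H G; subgroup K G; K \<subseteq> H\<rbrakk> \<Longrightarrow> Res a H K \<in> ring_hom (Val a H) (Val a K)"
    and G1_Cnj: "\<lbrakk>subgroup H G; g \<in> carrier G\<rbrakk>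
          \<Longrightarrow> Cnj a H g \<in> ring_hom (Val a H) (Val a (conj_set G g H))"
    and G2: "\<lbrakk>subgroup H G; subgroup K G; K \<subseteq> H; v \<in> carrier (Val a K); w \<in> carrier (Val a H)\<rbrakk>
          \<Longrightarrow> Ind a H K (v \<otimes>\<^bsub>Val a K\<^esub> Res a H K w) = Ind a H K v \<otimes>\<^bsub>Val a H\<^esub> w"
    and G3: "\<lbrakk>subgroup H G; subgroup K G; K \<subseteq> H; v \<in> carrier (Val a K); w \<in> carrier (Val a H)\<rbrakk>
          \<Longrightarrow> Ind a H K (Res a H K w \<otimes>\<^bsub>Val a K\<^esub> v) = w \<otimes>\<^bsub>Val a H\<^esub> Ind a H K v"

text \<open>The data \<open>a\<close> consist of the modules \<open>K0 R (C\<^sup>H)\<close> with the operations induced by the tensor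
  products, restriction, induction and conjugation.  As \<open>K0 R (C\<^sup>H)\<close> is generated by the classes
  of objects, (bi)linear operations are determined by the conditions below.  For induction, every
  choice of representatives and of direct sums has to give the same class.\<close>

definition K0_data :: "('r, 'x) ring_scheme \<Rightarrow> ('g, 'y) monoid_scheme \<Rightarrow>
    ('k, 'o, 'm, 'z) mon_cat_scheme \<Rightarrow> ('g \<Rightarrow> ('o, 'm) tens_fun) \<Rightarrow> ('g \<Rightarrow> 'g \<Rightarrow> 'o \<Rightarrow> 'm) \<Rightarrow>
    ('r, 'g, ('o \<times> ('g \<Rightarrow> 'm) \<Rightarrow> 'r) set) mackey \<Rightarrow> bool" where
  "K0_data R G C T \<gamma> a \<longleftrightarrow>
    (let E = equivariantization G C T \<gamma>; cls = (\<lambda>H. K0_class R (E H)) in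
     (\<forall>H. subgroup H G \<longrightarrow>
        carrier (Val a H) = carrier (K0 R (E H)) \<and>
        zero (Val a H) = zero (K0 R (E H)) \<and>
        add (Val a H) = add (K0 R (E H)) \<and>
        smult (Val a H) = smult (K0 R (E H)) \<and>
        \<one>\<^bsub>Val a H\<^esub> = cls H (Unit (E H)) \<and>
        (\<forall>X \<in> Ob (E H). \<forall>Y \<in> Ob (E H). cls H X \<otimes>\<^bsub>Val a H\<^esub> cls H Y = cls H (TObj (E H) X Y))) \<and>
     (\<forall>H K. subgroup H G \<longrightarrow> subgroup K G \<longrightarrow> K \<subseteq> H \<longrightarrow>
        (\<forall>X \<in> Ob (E H). Res a H K (cls H X) = cls K (res_obj K X)) \<and>
        (\<forall>X \<in> Ob (E K). (\<exists>Y. is_induced_obj G C T \<gamma> H K X Y) \<and>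
           (\<forall>Y. is_induced_obj G C T \<gamma> H K X Y \<longrightarrow> Ind a H K (cls K X) = cls H Y))) \<and>
     (\<forall>H g. subgroup H G \<longrightarrow> g \<in> carrier G \<longrightarrow>
        (\<forall>X \<in> Ob (E H). Cnj a H g (cls H X) = cls (conj_set G g H) (conj_obj G C T \<gamma> H g X))))"

end

theory Submission
  imports Defs
begin

text \<open>The point is to describe induction intrinsically.  An object \<open>Y\<close> of \<open>C\<^sup>H\<close> is induced from \<open>X\<close> in
  \<open>C\<^sup>K\<close> iff there are morphisms \<open>j : X \<rightarrow> Y\<close> and \<open>q : Y \<rightarrow> X\<close> in \<open>C\<^sup>K\<close> with \<open>q j = 1\<close> such that the
  translates of \<open>j\<close> by \<open>H\<close> are jointly epimorphic and \<open>q\<close> kills the translates of \<open>j\<close> by \<open>h \<notin> K\<close>.  For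
  such a pair, the sum of \<open>(h j) (q h\<^sup>-\<^sup>1)\<close> over \<open>H / K\<close> is the identity of \<open>Y\<close>, so \<open>(Y, j)\<close> is a left
  adjoint object and \<open>(Y, q)\<close> a right adjoint object for restriction.  It follows that induction is
  unique and exact.  Composing the pairs gives transitivity, tensoring them with an object of
  \<open>C\<^sup>H\<close> gives the projection formulas, and extending the translates of \<open>j\<close> and \<open>q\<close> by representatives of
  the double cosets splits the restriction of \<open>Y\<close> as in the Mackey formula.

  Restriction, conjugation and the tensor product are exact as well: kernels and cokernels in
  \<open>C\<^sup>H\<close> are those of \<open>C\<close>, and tensoring with a rigid object has adjoints on both sides.  Hence every
  operation descends to the Grothendieck groups, with coefficients in any commutative ring, and
  the axioms only need to be checked on classes of objects.\<close>

section \<open>Grothendieck groups with coefficients\<close>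

text \<open>The defining construction of induction involves a system of representatives and a chosen
  direct sum, which makes iterated inductions, tensor products and double coset decompositions
  awkward to compare directly. The conditions on the pair (j, q) mention no representatives, so they
  survive composition and tensoring; representatives enter only when a morphism is written down as a
  sum over H/K. That sum carries no averaging factor, so the characteristic of \<open>k\<close> may
  divide the order of G. A translate h j starts at T^h X and not at X, so rules such as g (h j) = (g
  h) j hold up to the isomorphisms \<gamma>; many computations consist in cancelling one of them.
  Exactness in C and in C^H is compared in two different ways. A sequence exact in C is exact in C^H
  because factorizations found in C are automatically equivariant. The converse rests on induction:
  its two adjunctions make restriction to the trivial subgroup exact, and every object of C is a
  test object there.\<close>

lemma mod_hom_closed: "f \<in> mod_hom R M N \<Longrightarrow> x \<in> carrier M \<Longrightarrow> f x \<in> carrier N"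
  and mod_hom_add: "f \<in> mod_hom R M N \<Longrightarrow> x \<in> carrier M \<Longrightarrow> y \<in> carrier M \<Longrightarrow>
    f (x \<oplus>\<^bsub>M\<^esub> y) = f x \<oplus>\<^bsub>N\<^esub> f y"
  and mod_hom_smult: "f \<in> mod_hom R M N \<Longrightarrow> r \<in> carrier R \<Longrightarrow> x \<in> carrier M \<Longrightarrow>
    f (r \<odot>\<^bsub>M\<^esub> x) = r \<odot>\<^bsub>N\<^esub> f x"
  unfolding mod_hom_def by auto

lemma mod_homI:
  assumes "\<And>x. x \<in> carrier M \<Longrightarrow> f x \<in> carrier N"
    and "\<And>x y. \<lbrakk>x \<in> carrier M; y \<in> carrier M\<rbrakk> \<Longrightarrow> f (x \<oplus>\<^bsub>M\<^esub> y) = f x \<oplus>\<^bsub>N\<^esub> f y"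
    and "\<And>r x. \<lbrakk>r \<in> carrier R; x \<in> carrier M\<rbrakk> \<Longrightarrow> f (r \<odot>\<^bsub>M\<^esub> x) = r \<odot>\<^bsub>N\<^esub> f x"
  shows "f \<in> mod_hom R M N"
  using assms unfolding mod_hom_def by auto

text \<open>Homomorphisms are only required to respect sums and scalars; zero is handled as the
  scalar zero times itself.\<close>

lemma mod_hom_zero:
  assumes "module R M" "module R N" "f \<in> mod_hom R M N"
  shows "f \<zero>\<^bsub>M\<^esub> = \<zero>\<^bsub>N\<^esub>"
proof -
  interpret M: module R M by fact
  interpret N: module R N by fact
  have "f \<zero>\<^bsub>M\<^esub> = f (\<zero>\<^bsub>R\<^esub> \<odot>\<^bsub>M\<^esub> \<zero>\<^bsub>M\<^esub>)" by simp
  also have "\<dots> = \<zero>\<^bsub>R\<^esub> \<odot>\<^bsub>N\<^esub> f \<zero>\<^bsub>M\<^esub>"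
    using assms(3) by (intro mod_hom_smult) auto
  finally show ?thesis using mod_hom_closed[OF assms(3)] by simp
qed

lemma mod_hom_minus:
  assumes "module R M" "module R N" "f \<in> mod_hom R M N" "x \<in> carrier M" "y \<in> carrier M"
  shows "f (x \<ominus>\<^bsub>M\<^esub> y) = f x \<ominus>\<^bsub>N\<^esub> f y"
proof -
  interpret M: module R M by fact
  interpret N: module R N by fact
  note c = mod_hom_closed[OF assms(3)]
  have "f (x \<ominus>\<^bsub>M\<^esub> y) \<oplus>\<^bsub>N\<^esub> f y = f ((x \<ominus>\<^bsub>M\<^esub> y) \<oplus>\<^bsub>M\<^esub> y)"
    using assms by (simp add: mod_hom_add[symmetric])
  also have "(x \<ominus>\<^bsub>M\<^esub> y) \<oplus>\<^bsub>M\<^esub> y = x"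
    using assms by (simp add: M.minus_eq M.a_assoc M.l_neg)
  finally have "f (x \<ominus>\<^bsub>M\<^esub> y) \<oplus>\<^bsub>N\<^esub> f y = f x" .
  moreover have "(f (x \<ominus>\<^bsub>M\<^esub> y) \<oplus>\<^bsub>N\<^esub> f y) \<ominus>\<^bsub>N\<^esub> f y = f (x \<ominus>\<^bsub>M\<^esub> y)"
    using assms c by (simp add: N.minus_eq N.a_assoc N.r_neg)
  ultimately show ?thesis by simp
qed

lemma mod_hom_comp:
  "f \<in> mod_hom R M N \<Longrightarrow> g \<in> mod_hom R N P \<Longrightarrow> (\<lambda>x. g (f x)) \<in> mod_hom R M P"
  unfolding mod_hom_def by (auto simp: Pi_iff)

lemma mod_hom_finsum:
  assumes "module R M" "module R N" "f \<in> mod_hom R M N" "finite I" "F \<in> I \<rightarrow> carrier M"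
  shows "f (\<Oplus>\<^bsub>M\<^esub> i \<in> I. F i) = (\<Oplus>\<^bsub>N\<^esub> i \<in> I. f (F i))"
proof -
  interpret M: module R M by fact
  interpret N: module R N by fact
  note c = mod_hom_closed[OF assms(3)]
  show ?thesis using assms(4,5)
  proof (induction I)
    case empty
    then show ?case using mod_hom_zero[OF assms(1-3)] by simp
  next
    case (insert i I)
    then show ?case
      using c by (simp add: Pi_def mod_hom_add[OF assms(3)])
  qed
qed

section \<open>Free modules and linear extension\<close>

context cring
begin

lemma free_module_sel:
  "f \<in> carrier (free_module R S) \<longleftrightarrow>
     (\<forall>s. f s \<in> carrier R) \<and> finite {s. f s \<noteq> \<zero>} \<and> {s. f s \<noteq> \<zero>} \<subseteq> S"
  "zero (free_module R S) = (\<lambda>s. \<zero>)"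
  "add (free_module R S) = (\<lambda>f g s. f s \<oplus> g s)"
  "smult (free_module R S) = (\<lambda>r f s. r \<otimes> f s)"
  by (auto simp: free_module_def)

lemma free_module_module: "module R (free_module R S)"
proof (rule moduleI)
  show "cring R" ..
  have add: "f \<oplus>\<^bsub>free_module R S\<^esub> g \<in> carrier (free_module R S)"
    if "f \<in> carrier (free_module R S)" "g \<in> carrier (free_module R S)" for f g
  proof -
    have "{s. f s \<oplus> g s \<noteq> \<zero>} \<subseteq> {s. f s \<noteq> \<zero>} \<union> {s. g s \<noteq> \<zero>}"
      using that by (auto simp: free_module_sel)
    then show ?thesis using that
      by (auto simp: free_module_sel intro: finite_subset)
  qed
  show "abelian_group (free_module R S)"
  proof (rule abelian_groupI)
    fix f assume f: "f \<in> carrier (free_module R S)"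
    show "\<exists>g\<in>carrier (free_module R S). g \<oplus>\<^bsub>free_module R S\<^esub> f = \<zero>\<^bsub>free_module R S\<^esub>"
    proof (rule bexI[where x = "\<lambda>s. \<ominus> f s"])
      show "(\<lambda>s. \<ominus> f s) \<oplus>\<^bsub>free_module R S\<^esub> f = \<zero>\<^bsub>free_module R S\<^esub>"
        using f by (auto simp: free_module_sel l_neg)
      have "{s. \<ominus> f s \<noteq> \<zero>} \<subseteq> {s. f s \<noteq> \<zero>}" using f by (auto simp: free_module_sel)
      then show "(\<lambda>s. \<ominus> f s) \<in> carrier (free_module R S)"
        using f by (auto simp: free_module_sel intro: finite_subset)
    qed
  qed (auto simp: add, auto simp: free_module_sel a_ac)
  fix r f assume "r \<in> carrier R" "f \<in> carrier (free_module R S)"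
  moreover from this have "{s. r \<otimes> f s \<noteq> \<zero>} \<subseteq> {s. f s \<noteq> \<zero>}" by (auto simp: free_module_sel)
  ultimately show "r \<odot>\<^bsub>free_module R S\<^esub> f \<in> carrier (free_module R S)"
    by (auto simp: free_module_sel intro: finite_subset)
qed (auto simp: free_module_sel l_distr r_distr m_assoc)

lemma single_closed: "s \<in> S \<Longrightarrow> single R s \<in> carrier (free_module R S)"
  by (auto simp: free_module_sel single_def intro: finite_subset[of _ "{s}"])

text \<open>The induction runs over a finite set containing the support and strips off one
  coefficient at a time. It reduces linear statements on the free module to basis vectors.\<close>

lemma free_module_induct [consumes 1, case_names zero single add smult]:
  assumes f: "f \<in> carrier (free_module R S)"
    and zero: "P \<zero>\<^bsub>free_module R S\<^esub>"
    and single: "\<And>s. s \<in> S \<Longrightarrow> P (single R s)"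
    and add: "\<And>f g. \<lbrakk>f \<in> carrier (free_module R S); g \<in> carrier (free_module R S); P f; P g\<rbrakk>
      \<Longrightarrow> P (f \<oplus>\<^bsub>free_module R S\<^esub> g)"
    and smult: "\<And>r f. \<lbrakk>r \<in> carrier R; f \<in> carrier (free_module R S); P f\<rbrakk>
      \<Longrightarrow> P (r \<odot>\<^bsub>free_module R S\<^esub> f)"
  shows "P f"
proof -
  interpret F: module R "free_module R S" by (rule free_module_module)
  have "\<forall>f. f \<in> carrier (free_module R S) \<longrightarrow> {s. f s \<noteq> \<zero>} \<subseteq> A \<longrightarrow> P f" if "finite A" for A
    using that
  proof (induction A)
    case empty
    have "f = \<zero>\<^bsub>free_module R S\<^esub>" if "{s. f s \<noteq> \<zero>} \<subseteq> {}" for f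
      using that by (auto simp: free_module_sel)
    then show ?case using zero by metis
  next
    case (insert x A)
    show ?case
    proof (intro allI impI)
      fix f assume f: "f \<in> carrier (free_module R S)" and sub: "{s. f s \<noteq> \<zero>} \<subseteq> insert x A"
      show "P f"
      proof (cases "x \<in> S")
        case True
        let ?g = "f(x := \<zero>)"
        have sg: "{s. ?g s \<noteq> \<zero>} \<subseteq> {s. f s \<noteq> \<zero>} - {x}" by auto
        have g: "?g \<in> carrier (free_module R S)"
          using f sg finite_subset[OF sg] by (auto simp: free_module_sel)
        have "P ?g" using insert g sg sub by blast
        moreover have "P (f x \<odot>\<^bsub>free_module R S\<^esub> single R x)"
          using f True single single_closed[OF True]
          by (intro smult) (auto simp: free_module_sel)
        moreover have "f = ?g \<oplus>\<^bsub>free_module R S\<^esub> (f x \<odot>\<^bsub>free_module R S\<^esub> single R x)"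
          using f by (auto simp: free_module_sel single_def fun_eq_iff)
        ultimately show ?thesis
          using add[OF g, of "f x \<odot>\<^bsub>free_module R S\<^esub> single R x"] f single_closed[OF True]
          by (metis F.smult_closed free_module_sel(1))
      next
        case False
        then have "f x = \<zero>" using f by (auto simp: free_module_sel)
        then show ?thesis using insert f sub by blast
      qed
    qed
  qed
  then show ?thesis using f by (auto simp: free_module_sel)
qed

end

definition lin_ext :: "('r, 'x) ring_scheme \<Rightarrow> ('r, 'a, 'z) module_scheme \<Rightarrow> ('s \<Rightarrow> 'a) \<Rightarrow> ('s \<Rightarrow> 'r) \<Rightarrow> 'a"
  where "lin_ext R M \<phi> f = (\<Oplus>\<^bsub>M\<^esub> s \<in> {s. f s \<noteq> \<zero>\<^bsub>R\<^esub>}. f s \<odot>\<^bsub>M\<^esub> \<phi> s)"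

text \<open>Terms with coefficient zero contribute nothing. Enlarging the index set matters because
  \<open>lin_ext\<close> sums over the exact support, and the supports of f, g and f + g differ in
  general, also through cancellation.\<close>

lemma lin_ext_superset:
  assumes "module R M" "f \<in> carrier (free_module R S)" "\<phi> \<in> S \<rightarrow> carrier M"
    and "finite A" "A \<subseteq> S" "{s. f s \<noteq> \<zero>\<^bsub>R\<^esub>} \<subseteq> A"
  shows "lin_ext R M \<phi> f = (\<Oplus>\<^bsub>M\<^esub> s \<in> A. f s \<odot>\<^bsub>M\<^esub> \<phi> s)"
proof -
  interpret M: module R M by fact
  show ?thesis unfolding lin_ext_def
    using assms(2-) by (intro M.add.finprod_mono_neutral_cong_left) (auto simp: M.free_module_sel Pi_def subset_iff)
qed

lemma lin_ext_mod_hom: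
  assumes "module R M" "\<phi> \<in> S \<rightarrow> carrier M"
  shows "lin_ext R M \<phi> \<in> mod_hom R (free_module R S) M"
proof -
  interpret M: module R M by fact
  interpret F: module R "free_module R S" by (rule M.free_module_module)
  note sup = lin_ext_superset[OF assms(1) _ assms(2)]
  have c: "(\<lambda>s. f s \<odot>\<^bsub>M\<^esub> \<phi> s) \<in> A \<rightarrow> carrier M" if "f \<in> carrier (free_module R S)" "A \<subseteq> S" for f A
    using assms(2) that by (auto simp: M.free_module_sel Pi_def subset_iff)
  show ?thesis
  proof (rule mod_homI)
    fix f assume f: "f \<in> carrier (free_module R S)"
    show "lin_ext R M \<phi> f \<in> carrier M"
      unfolding lin_ext_def using f c by (intro M.add.finprod_closed) (auto simp: M.free_module_sel)
    fix g assume g: "g \<in> carrier (free_module R S)"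
    let ?A = "{s. f s \<noteq> \<zero>\<^bsub>R\<^esub>} \<union> {s. g s \<noteq> \<zero>\<^bsub>R\<^esub>}"
    have A: "finite ?A" "?A \<subseteq> S" using f g by (auto simp: M.free_module_sel)
    have "{s. (f \<oplus>\<^bsub>free_module R S\<^esub> g) s \<noteq> \<zero>\<^bsub>R\<^esub>} \<subseteq> ?A"
      using f g by (auto simp: M.free_module_sel)
    then have "lin_ext R M \<phi> (f \<oplus>\<^bsub>free_module R S\<^esub> g)
        = (\<Oplus>\<^bsub>M\<^esub> s \<in> ?A. (f \<oplus>\<^bsub>free_module R S\<^esub> g) s \<odot>\<^bsub>M\<^esub> \<phi> s)"
      using A f g by (intro sup) auto
    also have "\<dots> = (\<Oplus>\<^bsub>M\<^esub> s \<in> ?A. f s \<odot>\<^bsub>M\<^esub> \<phi> s \<oplus>\<^bsub>M\<^esub> g s \<odot>\<^bsub>M\<^esub> \<phi> s)"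
      using assms(2) f g A c[OF f A(2)] c[OF g A(2)]
      by (intro M.finsum_cong') (auto simp: M.free_module_sel Pi_def subset_iff M.smult_l_distr)
    also have "\<dots> = (\<Oplus>\<^bsub>M\<^esub> s \<in> ?A. f s \<odot>\<^bsub>M\<^esub> \<phi> s) \<oplus>\<^bsub>M\<^esub> (\<Oplus>\<^bsub>M\<^esub> s \<in> ?A. g s \<odot>\<^bsub>M\<^esub> \<phi> s)"
      using c[OF f A(2)] c[OF g A(2)] by (intro M.finsum_addf)
    also have "\<dots> = lin_ext R M \<phi> f \<oplus>\<^bsub>M\<^esub> lin_ext R M \<phi> g"
      using sup[OF f A] sup[OF g A] by auto
    finally show "lin_ext R M \<phi> (f \<oplus>\<^bsub>free_module R S\<^esub> g) = lin_ext R M \<phi> f \<oplus>\<^bsub>M\<^esub> lin_ext R M \<phi> g" .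
  next
    fix r f assume r: "r \<in> carrier R" and f: "f \<in> carrier (free_module R S)"
    let ?A = "{s. f s \<noteq> \<zero>\<^bsub>R\<^esub>}"
    have A: "finite ?A" "?A \<subseteq> S" using f by (auto simp: M.free_module_sel)
    have "{s. (r \<odot>\<^bsub>free_module R S\<^esub> f) s \<noteq> \<zero>\<^bsub>R\<^esub>} \<subseteq> ?A"
      using f r by (auto simp: M.free_module_sel)
    then have "lin_ext R M \<phi> (r \<odot>\<^bsub>free_module R S\<^esub> f)
        = (\<Oplus>\<^bsub>M\<^esub> s \<in> ?A. (r \<odot>\<^bsub>free_module R S\<^esub> f) s \<odot>\<^bsub>M\<^esub> \<phi> s)"
      using A f r by (intro sup) auto
    also have "\<dots> = (\<Oplus>\<^bsub>M\<^esub> s \<in> ?A. r \<odot>\<^bsub>M\<^esub> (f s \<odot>\<^bsub>M\<^esub> \<phi> s))"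
      using assms(2) f r A c[OF f A(2)]
      by (intro M.finsum_cong') (auto simp: M.free_module_sel Pi_def subset_iff M.smult_assoc1)
    also have "\<dots> = r \<odot>\<^bsub>M\<^esub> (\<Oplus>\<^bsub>M\<^esub> s \<in> ?A. f s \<odot>\<^bsub>M\<^esub> \<phi> s)"
      using c[OF f A(2)] r A by (intro M.finsum_smult_ldistr[symmetric])
    finally show "lin_ext R M \<phi> (r \<odot>\<^bsub>free_module R S\<^esub> f) = r \<odot>\<^bsub>M\<^esub> lin_ext R M \<phi> f"
      unfolding lin_ext_def .
  qed
qed

lemma lin_ext_single:
  assumes "module R M" "\<phi> \<in> S \<rightarrow> carrier M" "s \<in> S"
  shows "lin_ext R M \<phi> (single R s) = \<phi> s"
proof -
  interpret M: module R M by fact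
  have "lin_ext R M \<phi> (single R s) = (\<Oplus>\<^bsub>M\<^esub> t \<in> {s}. single R s t \<odot>\<^bsub>M\<^esub> \<phi> t)"
    using assms M.single_closed by (intro lin_ext_superset) (auto simp: single_def)
  also have "\<dots> = (\<Oplus>\<^bsub>M\<^esub> t \<in> {s}. \<phi> s)"
    using assms by (intro M.finsum_cong') (auto simp: single_def Pi_def)
  finally show ?thesis using assms by (auto simp: Pi_def)
qed

lemma span_submodule_submodule:
  assumes "module R M" "S \<subseteq> carrier M"
  shows "submodule (span_submodule R M S) R M"
proof -
  interpret M: module R M by fact
  \<comment> \<open>The family being intersected contains the whole module, so it is nonempty and
    its intersection stays inside the carrier.\<close>
  have c: "carrier M \<in> {N. submodule N R M \<and> S \<subseteq> N}"
    using M.carrier_is_submodule assms(2) by auto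
  show ?thesis unfolding span_submodule_def
  proof (rule M.submoduleI)
    show "\<Inter> {N. submodule N R M \<and> S \<subseteq> N} \<subseteq> carrier M" using c by blast
    show "\<zero>\<^bsub>M\<^esub> \<in> \<Inter> {N. submodule N R M \<and> S \<subseteq> N}"
      using subgroup.one_closed[OF submodule.axioms(1)] by fastforce
  qed (use M.submoduleE(3) M.submoduleE(4) M.submoduleE(5) in \<open>simp_all\<close>)
qed

lemma span_submodule_incl: "S \<subseteq> span_submodule R M S"
  unfolding span_submodule_def by blast

text \<open>The kernel of f is one of the submodules in the intersection that defines the
  span.\<close>

lemma span_submodule_kernel:
  assumes "module R M" "module R N" "f \<in> mod_hom R M N" "S \<subseteq> carrier M"
    and "\<And>x. x \<in> S \<Longrightarrow> f x = \<zero>\<^bsub>N\<^esub>" and "x \<in> span_submodule R M S"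
  shows "f x = \<zero>\<^bsub>N\<^esub>"
proof -
  interpret M: module R M by fact
  interpret N: module R N by fact
  let ?K = "{x \<in> carrier M. f x = \<zero>\<^bsub>N\<^esub>}"
  \<comment> \<open>The rule for submodules asks for closure under negation, while
    \<open>mod_hom\<close> speaks of sums and scalars; negation is therefore written as scaling by
    -1.\<close>
  have neg: "\<ominus>\<^bsub>M\<^esub> a = (\<ominus>\<^bsub>R\<^esub> \<one>\<^bsub>R\<^esub>) \<odot>\<^bsub>M\<^esub> a" if "a \<in> carrier M" for a
    using that by (simp add: M.smult_l_minus)
  have "submodule ?K R M"
  proof (rule M.submoduleI)
    fix a assume "a \<in> ?K"
    then show "\<ominus>\<^bsub>M\<^esub> a \<in> ?K"
      by (simp add: neg mod_hom_smult[OF assms(3)])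
  qed (auto simp: mod_hom_zero[OF assms(1-3)] mod_hom_add[OF assms(3)] mod_hom_smult[OF assms(3)])
  then have "span_submodule R M S \<subseteq> ?K"
    using assms(4,5) unfolding span_submodule_def by blast
  then show ?thesis using assms(6) by auto
qed

section \<open>Quotient modules\<close>

lemma submodule_abelian_subgroup:
  assumes "module R M" "submodule N R M"
  shows "abelian_subgroup N M"
proof -
  interpret M: module R M by fact
  show ?thesis
    using submodule.axioms(1)[OF assms(2)] M.a_comm_group by (intro abelian_subgroupI2)
qed

lemma quotient_module_sel:
  assumes "module R M" "submodule N R M"
  shows "X \<in> carrier (quotient_module M N) \<longleftrightarrow> (\<exists>x \<in> carrier M. X = N +>\<^bsub>M\<^esub> x)"
    and "zero (quotient_module M N) = N"
    and "\<lbrakk>x \<in> carrier M; y \<in> carrier M\<rbrakk> \<Longrightarrow>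
      (N +>\<^bsub>M\<^esub> x) \<oplus>\<^bsub>quotient_module M N\<^esub> (N +>\<^bsub>M\<^esub> y) = N +>\<^bsub>M\<^esub> (x \<oplus>\<^bsub>M\<^esub> y)"
    and "\<lbrakk>r \<in> carrier R; x \<in> carrier M\<rbrakk> \<Longrightarrow>
      r \<odot>\<^bsub>quotient_module M N\<^esub> (N +>\<^bsub>M\<^esub> x) = N +>\<^bsub>M\<^esub> (r \<odot>\<^bsub>M\<^esub> x)"
proof -
  interpret M: module R M by fact
  interpret N: abelian_subgroup N M by (rule submodule_abelian_subgroup[OF assms])
  show "X \<in> carrier (quotient_module M N) \<longleftrightarrow> (\<exists>x \<in> carrier M. X = N +>\<^bsub>M\<^esub> x)"
    by (auto simp: quotient_module_def A_RCOSETS_def')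
  show "zero (quotient_module M N) = N" by (simp add: quotient_module_def)
  show "(N +>\<^bsub>M\<^esub> x) \<oplus>\<^bsub>quotient_module M N\<^esub> (N +>\<^bsub>M\<^esub> y) = N +>\<^bsub>M\<^esub> (x \<oplus>\<^bsub>M\<^esub> y)"
    if "x \<in> carrier M" "y \<in> carrier M"
    using that by (simp add: quotient_module_def N.a_rcos_sum)
  show "r \<odot>\<^bsub>quotient_module M N\<^esub> (N +>\<^bsub>M\<^esub> x) = N +>\<^bsub>M\<^esub> (r \<odot>\<^bsub>M\<^esub> x)"
    if r: "r \<in> carrier R" and x: "x \<in> carrier M"
  proof -
    \<comment> \<open>The scalar multiple of a coset is defined as a union of cosets; all of them
      coincide because N is closed under scaling.\<close>
    have "N +>\<^bsub>M\<^esub> (r \<odot>\<^bsub>M\<^esub> y) = N +>\<^bsub>M\<^esub> (r \<odot>\<^bsub>M\<^esub> x)" if y: "y \<in> N +>\<^bsub>M\<^esub> x" for y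
    proof -
      obtain n where n: "n \<in> N" "y = n \<oplus>\<^bsub>M\<^esub> x" using y by (auto simp: a_r_coset_def')
      then have nc: "n \<in> carrier M" using N.a_subset by auto
      have "r \<odot>\<^bsub>M\<^esub> y = r \<odot>\<^bsub>M\<^esub> n \<oplus>\<^bsub>M\<^esub> r \<odot>\<^bsub>M\<^esub> x" using n nc r x by (simp add: M.smult_r_distr)
      moreover have "r \<odot>\<^bsub>M\<^esub> n \<in> N" using M.submoduleE(4)[OF assms(2)] r n by auto
      ultimately have "r \<odot>\<^bsub>M\<^esub> y \<in> N +>\<^bsub>M\<^esub> (r \<odot>\<^bsub>M\<^esub> x)" by (auto simp: a_r_coset_def')
      then show ?thesis using M.a_repr_independence[OF _ _ N.a_subgroup] r x by simp
    qed
    moreover have "x \<in> N +>\<^bsub>M\<^esub> x" using x N.zero_closed by (force simp: a_r_coset_def')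
    ultimately have "(\<Union>y \<in> N +>\<^bsub>M\<^esub> x. N +>\<^bsub>M\<^esub> (r \<odot>\<^bsub>M\<^esub> y)) = N +>\<^bsub>M\<^esub> (r \<odot>\<^bsub>M\<^esub> x)" by blast
    then show ?thesis by (simp add: quotient_module_def)
  qed
qed

lemma quotient_module_module:
  assumes "module R M" "submodule N R M"
  shows "module R (quotient_module M N)"
proof -
  interpret M: module R M by fact
  interpret N: abelian_subgroup N M by (rule submodule_abelian_subgroup[OF assms])
  note sel = quotient_module_sel[OF assms]
  have z: "zero (quotient_module M N) = N +>\<^bsub>M\<^esub> \<zero>\<^bsub>M\<^esub>" using N.a_subset by (simp add: sel)
  show ?thesis
  proof (rule moduleI)
    show "cring R" ..
    show "abelian_group (quotient_module M N)"
    proof (rule abelian_groupI)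
      fix x assume "x \<in> carrier (quotient_module M N)"
      then obtain a where "a \<in> carrier M" "x = N +>\<^bsub>M\<^esub> a" by (auto simp: sel)
      then show "\<exists>y\<in>carrier (quotient_module M N). y \<oplus>\<^bsub>quotient_module M N\<^esub> x = \<zero>\<^bsub>quotient_module M N\<^esub>"
        by (intro bexI[where x = "N +>\<^bsub>M\<^esub> (\<ominus>\<^bsub>M\<^esub> a)"]) (auto simp: sel(1,3) z M.l_neg)
    qed (auto simp: sel(1,3) z M.a_ac)
  qed (auto simp: sel(1,3,4) M.smult_l_distr M.smult_r_distr M.smult_assoc1)
qed

lemma quotient_module_lift:
  assumes "module R M" "submodule N R M" "module R P" "f \<in> mod_hom R M P"
    and "\<And>x. x \<in> N \<Longrightarrow> f x = \<zero>\<^bsub>P\<^esub>"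
  shows "\<exists>F \<in> mod_hom R (quotient_module M N) P. \<forall>x \<in> carrier M. F (N +>\<^bsub>M\<^esub> x) = f x"
proof -
  interpret M: module R M by fact
  interpret P: module R P by fact
  interpret N: abelian_subgroup N M by (rule submodule_abelian_subgroup[OF assms(1,2)])
  note sel = quotient_module_sel[OF assms(1,2)]
  \<comment> \<open>An arbitrary element of the class is chosen; any two differ by an element of N,
    on which f vanishes.\<close>
  define F where "F X = f (SOME x. x \<in> X)" for X
  have F: "F (N +>\<^bsub>M\<^esub> x) = f x" if x: "x \<in> carrier M" for x
  proof -
    have "x \<in> N +>\<^bsub>M\<^esub> x" using x N.zero_closed by (force simp: a_r_coset_def')
    then have "(SOME y. y \<in> N +>\<^bsub>M\<^esub> x) \<in> N +>\<^bsub>M\<^esub> x" by (rule someI)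
    then obtain n where n: "n \<in> N" "(SOME y. y \<in> N +>\<^bsub>M\<^esub> x) = n \<oplus>\<^bsub>M\<^esub> x" by (auto simp: a_r_coset_def')
    then have "f (n \<oplus>\<^bsub>M\<^esub> x) = f x"
      using N.a_subset x assms(5)[OF n(1)] mod_hom_closed[OF assms(4)]
      by (subst mod_hom_add[OF assms(4)]) auto
    then show ?thesis by (simp add: F_def n)
  qed
  have "F \<in> mod_hom R (quotient_module M N) P"
    by (rule mod_homI) (auto simp: sel F mod_hom_closed[OF assms(4)] mod_hom_add[OF assms(4)]
        mod_hom_smult[OF assms(4)])
  then show ?thesis using F by blast
qed

section \<open>Universal property of the Grothendieck group\<close>

lemma K0_relations_gens:
  assumes "cring R"
  shows "{single R B \<ominus>\<^bsub>free_module R (Ob L)\<^esub> (single R A \<oplus>\<^bsub>free_module R (Ob L)\<^esub> single R D)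
       | A f B g D. short_exact L A f B g D} \<subseteq> carrier (free_module R (Ob L))"
proof -
  interpret cring R by fact
  interpret F: module R "free_module R (Ob L)" by (rule free_module_module)
  show ?thesis by (auto simp: short_exact_def single_closed)
qed

lemma K0_relations_submodule:
  "cring R \<Longrightarrow> submodule (K0_relations R L) R (free_module R (Ob L))"
  unfolding K0_relations_def
  by (intro span_submodule_submodule cring.free_module_module K0_relations_gens)

lemma K0_module: "cring R \<Longrightarrow> module R (K0 R L)"
  unfolding K0_def
  by (intro quotient_module_module K0_relations_submodule cring.free_module_module)

lemma K0_class_closed: "cring R \<Longrightarrow> A \<in> Ob L \<Longrightarrow> K0_class R L A \<in> carrier (K0 R L)"
  unfolding K0_def K0_class_def
  by (auto simp: quotient_module_sel(1)[OF cring.free_module_module K0_relations_submodule]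
    intro!: bexI cring.single_closed)

text \<open>Classes of objects generate: the induction on the free module is carried along the
  quotient map.\<close>

lemma K0_induct [consumes 2, case_names zero cls add smult]:
  assumes R: "cring R" and v: "v \<in> carrier (K0 R L)"
    and zero: "P \<zero>\<^bsub>K0 R L\<^esub>"
    and cls: "\<And>A. A \<in> Ob L \<Longrightarrow> P (K0_class R L A)"
    and add: "\<And>v w. \<lbrakk>v \<in> carrier (K0 R L); w \<in> carrier (K0 R L); P v; P w\<rbrakk>
      \<Longrightarrow> P (v \<oplus>\<^bsub>K0 R L\<^esub> w)"
    and smult: "\<And>r v. \<lbrakk>r \<in> carrier R; v \<in> carrier (K0 R L); P v\<rbrakk>
      \<Longrightarrow> P (r \<odot>\<^bsub>K0 R L\<^esub> v)"
  shows "P v"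
proof -
  interpret cring R by fact
  let ?F = "free_module R (Ob L)" and ?N = "K0_relations R L"
  interpret F: module R ?F by (rule free_module_module)
  note sub = K0_relations_submodule[OF R, of L]
  interpret N: abelian_subgroup ?N ?F by (rule submodule_abelian_subgroup[OF free_module_module sub])
  note sel = quotient_module_sel[OF free_module_module sub, folded K0_def]
  have "P (?N +>\<^bsub>?F\<^esub> f)" if "f \<in> carrier ?F" for f
    using that
  proof (induction f rule: free_module_induct)
    case zero
    then show ?case using assms(3) N.a_subset by (simp add: sel(2))
  next
    case (single s)
    then show ?case using cls by (simp add: K0_class_def)
  next
    case (add f g)
    then show ?case using assms(5)[of "?N +>\<^bsub>?F\<^esub> f" "?N +>\<^bsub>?F\<^esub> g"] sel by auto
  next
    case (smult r f)
    then show ?case using assms(6)[of r "?N +>\<^bsub>?F\<^esub> f"] sel by auto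
  qed
  then show ?thesis using v sel(1) by auto
qed

lemma K0_class_ses:
  assumes R: "cring R" and ses: "short_exact L A f B g D"
  shows "K0_class R L B = K0_class R L A \<oplus>\<^bsub>K0 R L\<^esub> K0_class R L D"
proof -
  interpret cring R by fact
  let ?F = "free_module R (Ob L)" and ?N = "K0_relations R L"
  interpret F: module R ?F by (rule free_module_module)
  note sub = K0_relations_submodule[OF R, of L]
  interpret N: abelian_subgroup ?N ?F by (rule submodule_abelian_subgroup[OF free_module_module sub])
  note sel = quotient_module_sel[OF free_module_module sub, folded K0_def]
  have ob: "A \<in> Ob L" "B \<in> Ob L" "D \<in> Ob L" using ses by (auto simp: short_exact_def)
  note c = single_closed[OF ob(1)] single_closed[OF ob(2)] single_closed[OF ob(3)]
  define x y where "x = single R B" and "y = single R A \<oplus>\<^bsub>?F\<^esub> single R D"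
  have xy: "x \<in> carrier ?F" "y \<in> carrier ?F" using c by (auto simp: x_def y_def)
  \<comment> \<open>This difference is literally one of the generators of the relations, so x and y
    end up in the same coset.\<close>
  have "x \<ominus>\<^bsub>?F\<^esub> y \<in> ?N"
    unfolding K0_relations_def x_def y_def
    by (rule subsetD[OF span_submodule_incl], rule CollectI) (rule exI[of _ A], rule exI[of _ f], rule exI[of _ B], rule exI[of _ g], rule exI[of _ D],
        rule conjI[OF refl ses])
  moreover have "x = (x \<ominus>\<^bsub>?F\<^esub> y) \<oplus>\<^bsub>?F\<^esub> y"
    using xy by (simp add: F.minus_eq F.a_assoc F.l_neg)
  ultimately have "x \<in> ?N +>\<^bsub>?F\<^esub> y"
    using F.a_rcosI[OF _ N.a_subset xy(2)] by metis
  then have "?N +>\<^bsub>?F\<^esub> y = ?N +>\<^bsub>?F\<^esub> x"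
    using xy by (intro F.a_repr_independence N.a_subgroup)
  then show ?thesis using c by (simp add: K0_class_def sel(3) x_def y_def)
qed

text \<open>The linear extension of \<phi> to the free module kills each generating relation by
  additivity, hence their span, and so factors through the quotient.\<close>

lemma K0_lift_exists:
  assumes R: "cring R" and P: "module R P" and \<phi>: "\<phi> \<in> Ob L \<rightarrow> carrier P"
    and add: "\<And>A f B g D. short_exact L A f B g D \<Longrightarrow> \<phi> B = \<phi> A \<oplus>\<^bsub>P\<^esub> \<phi> D"
  shows "\<exists>F \<in> mod_hom R (K0 R L) P. \<forall>A \<in> Ob L. F (K0_class R L A) = \<phi> A"
proof -
  interpret cring R by fact
  interpret P: module R P by fact
  let ?F = "free_module R (Ob L)" and ?N = "K0_relations R L"
  interpret F: module R ?F by (rule free_module_module)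
  note sub = K0_relations_submodule[OF R, of L]
  note hom = lin_ext_mod_hom[OF P \<phi>]
  note si = lin_ext_single[OF P \<phi>]
  have "lin_ext R P \<phi> x = \<zero>\<^bsub>P\<^esub>" if x: "x \<in> ?N" for x
  proof (rule span_submodule_kernel[OF free_module_module P hom K0_relations_gens[OF R] _ x[unfolded K0_relations_def]])
    fix x assume "x \<in> {single R B \<ominus>\<^bsub>?F\<^esub> (single R A \<oplus>\<^bsub>?F\<^esub> single R D) | A f B g D. short_exact L A f B g D}"
    then obtain A f B g D where x: "x = single R B \<ominus>\<^bsub>?F\<^esub> (single R A \<oplus>\<^bsub>?F\<^esub> single R D)"
      and s: "short_exact L A f B g D" by auto
    have ob: "A \<in> Ob L" "B \<in> Ob L" "D \<in> Ob L" using s by (auto simp: short_exact_def)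
    have \<phi>c: "\<phi> A \<in> carrier P" "\<phi> D \<in> carrier P" using ob \<phi> by auto
    have "lin_ext R P \<phi> x = \<phi> B \<ominus>\<^bsub>P\<^esub> (\<phi> A \<oplus>\<^bsub>P\<^esub> \<phi> D)"
      unfolding x using ob
      by (simp add: mod_hom_minus[OF free_module_module P hom] mod_hom_add[OF hom] single_closed si)
    then show "lin_ext R P \<phi> x = \<zero>\<^bsub>P\<^esub>" using add[OF s] \<phi>c by (simp add: P.minus_eq P.r_neg)
  qed
  from quotient_module_lift[OF free_module_module sub P hom this] show ?thesis
    unfolding K0_def K0_class_def by (metis si single_closed)
qed

text \<open>A choice by \<open>SOME\<close>, meaningful for \<phi> additive on short exact
  sequences: then the lemma \<open>K0_lift\<close> gives existence, and \<open>K0_hom_eqI\<close>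
  gives uniqueness on the carrier.\<close>

definition K0_lift :: "('r, 'x) ring_scheme \<Rightarrow> ('k, 'o, 'm, 'z) lin_cat_scheme \<Rightarrow>
    ('r, 'a, 'w) module_scheme \<Rightarrow> ('o \<Rightarrow> 'a) \<Rightarrow> ('o \<Rightarrow> 'r) set \<Rightarrow> 'a" where
  "K0_lift R L P \<phi> = (SOME F. F \<in> mod_hom R (K0 R L) P \<and> (\<forall>A \<in> Ob L. F (K0_class R L A) = \<phi> A))"

lemma K0_lift:
  assumes "cring R" "module R P" "\<And>A. A \<in> Ob L \<Longrightarrow> \<phi> A \<in> carrier P"
    and "\<And>A f B g D. short_exact L A f B g D \<Longrightarrow> \<phi> B = \<phi> A \<oplus>\<^bsub>P\<^esub> \<phi> D"
  shows "K0_lift R L P \<phi> \<in> mod_hom R (K0 R L) P"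
    and "A \<in> Ob L \<Longrightarrow> K0_lift R L P \<phi> (K0_class R L A) = \<phi> A"
proof -
  have "\<exists>F. F \<in> mod_hom R (K0 R L) P \<and> (\<forall>A \<in> Ob L. F (K0_class R L A) = \<phi> A)"
    using K0_lift_exists[of R P \<phi> L] assms by blast
  from someI_ex[OF this, folded K0_lift_def]
  show "K0_lift R L P \<phi> \<in> mod_hom R (K0 R L) P"
    and "A \<in> Ob L \<Longrightarrow> K0_lift R L P \<phi> (K0_class R L A) = \<phi> A" by auto
qed

lemma K0_hom_eqI:
  assumes "cring R" "module R P" "F \<in> mod_hom R (K0 R L) P" "F' \<in> mod_hom R (K0 R L) P"
    and "\<And>A. A \<in> Ob L \<Longrightarrow> F (K0_class R L A) = F' (K0_class R L A)" and "v \<in> carrier (K0 R L)"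
  shows "F v = F' v"
  using assms(1,6)
proof (induction v rule: K0_induct)
  case zero
  then show ?case using mod_hom_zero[OF K0_module[OF assms(1)] assms(2)] assms(3,4) by metis
qed (use assms mod_hom_add[OF assms(3)] mod_hom_add[OF assms(4)] mod_hom_smult[OF assms(3)] mod_hom_smult[OF assms(4)] in auto)

section \<open>Typed morphisms\<close>

text \<open>Since hom-sets may overlap, a morphism does not determine its source and target.  Bundling
  them with the morphism turns the typing conditions of compositions into equations that the
  simplifier can decide.\<close>

datatype ('o, 'm) arrow = Arrow (src: 'o) (mor: 'm) (trg: 'o)

definition arr :: "('o, 'm, 'z) cat_scheme \<Rightarrow> ('o, 'm) arrow \<Rightarrow> bool" where
  "arr C t \<longleftrightarrow> src t \<in> Ob C \<and> trg t \<in> Ob C \<and> mor t \<in> Hom C (src t) (trg t)"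

definition cmp :: "('o, 'm, 'z) cat_scheme \<Rightarrow> ('o, 'm) arrow \<Rightarrow> ('o, 'm) arrow \<Rightarrow> ('o, 'm) arrow"
    (infixr "\<bullet>\<index>" 70) where
  "t \<bullet>\<^bsub>C\<^esub> u = Arrow (src u) (mor t \<cdot>\<^bsub>C\<^esub> mor u) (trg t)"

definition idn :: "('o, 'm, 'z) cat_scheme \<Rightarrow> 'o \<Rightarrow> ('o, 'm) arrow" where
  "idn C A = Arrow A (Idn C A) A"

definition hm :: "('o, 'm, 'z) cat_scheme \<Rightarrow> 'o \<Rightarrow> 'o \<Rightarrow> ('o, 'm) arrow set" where
  "hm C A B = {t. arr C t \<and> src t = A \<and> trg t = B}"

definition iso :: "('o, 'm, 'z) cat_scheme \<Rightarrow> ('o, 'm) arrow \<Rightarrow> bool" where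
  "iso C t \<longleftrightarrow> arr C t \<and> is_iso C (src t) (trg t) (mor t)"

definition inv_arr :: "('o, 'm, 'z) cat_scheme \<Rightarrow> ('o, 'm) arrow \<Rightarrow> ('o, 'm) arrow" where
  "inv_arr C t = Arrow (trg t) (inv_mor C (src t) (trg t) (mor t)) (src t)"

lemma hm_iff [simp]: "t \<in> hm C A B \<longleftrightarrow> arr C t \<and> src t = A \<and> trg t = B"
  by (simp add: hm_def)

lemma src_cmp [simp]: "src (t \<bullet>\<^bsub>C\<^esub> u) = src u"
  and trg_cmp [simp]: "trg (t \<bullet>\<^bsub>C\<^esub> u) = trg t"
  and mor_cmp: "mor (t \<bullet>\<^bsub>C\<^esub> u) = mor t \<cdot>\<^bsub>C\<^esub> mor u"
  and src_idn [simp]: "src (idn C A) = A"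
  and trg_idn [simp]: "trg (idn C A) = A"
  and mor_idn: "mor (idn C A) = Idn C A"
  and src_inv_arr [simp]: "src (inv_arr C t) = trg t"
  and trg_inv_arr [simp]: "trg (inv_arr C t) = src t"
  by (auto simp: cmp_def idn_def inv_arr_def)

lemma arrow_eqI: "src t = src u \<Longrightarrow> trg t = trg u \<Longrightarrow> mor t = mor u \<Longrightarrow> t = u"
  by (metis arrow.exhaust_sel)

lemma arr_src: "arr C t \<Longrightarrow> src t \<in> Ob C"
  and arr_trg: "arr C t \<Longrightarrow> trg t \<in> Ob C"
  and arr_mor: "arr C t \<Longrightarrow> mor t \<in> Hom C (src t) (trg t)"
  by (auto simp: arr_def)

lemma arr_Arrow: "arr C (Arrow A f B) \<longleftrightarrow> A \<in> Ob C \<and> B \<in> Ob C \<and> f \<in> Hom C A B"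
  by (simp add: arr_def)

context category
begin

lemma arr_idn [simp, intro]: "A \<in> Ob C \<Longrightarrow> arr C (idn C A)"
  by (simp add: arr_def idn_def Idn_in)

lemma arr_cmp [simp, intro]: "arr C t \<Longrightarrow> arr C u \<Longrightarrow> src t = trg u \<Longrightarrow> arr C (t \<bullet> u)"
  by (auto simp: arr_def cmp_def intro: Comp_in[of "src u" "trg u" "trg t"])

lemma cmp_idn [simp]: "arr C t \<Longrightarrow> src t = A \<Longrightarrow> t \<bullet> idn C A = t"
  by (auto simp: arr_def cmp_def idn_def intro!: arrow_eqI Comp_Idn)

lemma idn_cmp [simp]: "arr C t \<Longrightarrow> trg t = A \<Longrightarrow> idn C A \<bullet> t = t"
  by (auto simp: arr_def cmp_def idn_def intro!: arrow_eqI Idn_Comp)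

lemma cmp_assoc [simp]:
  "arr C t \<Longrightarrow> arr C u \<Longrightarrow> arr C v \<Longrightarrow> src t = trg u \<Longrightarrow> src u = trg v \<Longrightarrow>
    (t \<bullet> u) \<bullet> v = t \<bullet> u \<bullet> v"
  by (auto simp: arr_def cmp_def intro!: Comp_assoc[of "src v" "src u" "src t" "trg t"])

text \<open>Composites are normalized to be nested to the right, and there
  \<open>t \<bullet> u\<close> is not a subterm of \<open>t \<bullet> u \<bullet> x\<close>. This
  rule applies a known equation for the first two factors in that position.\<close>

lemma cmp_reassoc:
  assumes "t \<bullet> u = w" "arr C t" "arr C u" "src t = trg u" "arr C x" "src u = trg x"
  shows "t \<bullet> u \<bullet> x = w \<bullet> x"
  using assms by auto

lemma inverse_mors_unique:
  assumes "A \<in> Ob C" "B \<in> Ob C" "inverse_mors C A B f g" "inverse_mors C A B f g'"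
  shows "g = g'"
proof -
  have "g = (g' \<cdot> f) \<cdot> g"
    using assms by (auto simp: inverse_mors_def Idn_Comp[of B A])
  also have "\<dots> = g' \<cdot> (f \<cdot> g)"
    using assms by (intro Comp_assoc[of B A B A]) (auto simp: inverse_mors_def)
  also have "\<dots> = g'"
    using assms by (auto simp: inverse_mors_def Comp_Idn[of B A])
  finally show ?thesis .
qed

lemma inv_mor:
  assumes "A \<in> Ob C" "B \<in> Ob C" "is_iso C A B f"
  shows "inverse_mors C A B f (inv_mor C A B f)"
  using assms inverse_mors_unique unfolding is_iso_def inv_mor_def
  by (metis (no_types, lifting) theI)

lemma iso_arr [simp]: "iso C t \<Longrightarrow> arr C t"
  by (simp add: iso_def)

lemma iso_inverse_mors:
  "iso C t \<Longrightarrow> inverse_mors C (src t) (trg t) (mor t) (inv_mor C (src t) (trg t) (mor t))"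
  by (intro inv_mor) (auto simp: iso_def arr_def)

lemma arr_inv [simp]: "iso C t \<Longrightarrow> arr C (inv_arr C t)"
  using iso_inverse_mors[of t] by (auto simp: inv_arr_def arr_def inverse_mors_def iso_def)

lemma inv_cmp [simp]: "iso C t \<Longrightarrow> inv_arr C t \<bullet> t = idn C (src t)"
  and cmp_inv [simp]: "iso C t \<Longrightarrow> t \<bullet> inv_arr C t = idn C (trg t)"
  using iso_inverse_mors[of t] by (auto simp: inv_arr_def idn_def cmp_def inverse_mors_def)

text \<open>The cancellation rules once more, in the right-nested form to which composites are
  normalized.\<close>

lemma inv_cmp_cmp [simp]: "iso C t \<Longrightarrow> arr C u \<Longrightarrow> trg u = src t \<Longrightarrow> inv_arr C t \<bullet> t \<bullet> u = u"
  by (subst cmp_assoc[symmetric]) (auto simp del: cmp_assoc)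

lemma cmp_inv_cmp [simp]: "iso C t \<Longrightarrow> arr C u \<Longrightarrow> trg u = trg t \<Longrightarrow> t \<bullet> inv_arr C t \<bullet> u = u"
  by (subst cmp_assoc[symmetric]) (auto simp del: cmp_assoc)

lemma isoI:
  assumes "arr C t" "arr C u" "src t = trg u" "trg t = src u"
    "u \<bullet> t = idn C (src t)" "t \<bullet> u = idn C (trg t)"
  shows "iso C t"
proof -
  have "mor (u \<bullet> t) = Idn C (src t)" "mor (t \<bullet> u) = Idn C (trg t)"
    using assms(5,6) by (simp_all add: mor_idn)
  then have "inverse_mors C (src t) (trg t) (mor t) (mor u)"
    using assms(1-4) by (auto simp: arr_def inverse_mors_def mor_cmp)
  then show ?thesis using assms(1) by (auto simp: iso_def is_iso_def)
qed

text \<open>Composing with the known inverse on the right upgrades a left inverse to the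
  inverse.\<close>

lemma inv_unique:
  assumes "iso C t" "arr C u" "src t = trg u" "u \<bullet> t = idn C (src t)" "trg t = src u"
  shows "inv_arr C t = u"
proof -
  have "inv_arr C t = (u \<bullet> t) \<bullet> inv_arr C t"
    using assms by (metis arr_inv idn_cmp trg_inv_arr)
  also have "\<dots> = u" using assms(1,2,3,5) by simp
  finally show ?thesis .
qed

lemma iso_inv [simp]: "iso C t \<Longrightarrow> iso C (inv_arr C t)"
  by (rule isoI[of _ t]) auto

lemma inv_inv [simp]: "iso C t \<Longrightarrow> inv_arr C (inv_arr C t) = t"
  by (rule inv_unique) auto

lemma iso_idn [simp]: "A \<in> Ob C \<Longrightarrow> iso C (idn C A)"
  by (rule isoI[of _ "idn C A"]) auto

lemma inv_idn [simp]: "A \<in> Ob C \<Longrightarrow> inv_arr C (idn C A) = idn C A"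
  by (rule inv_unique) auto

lemma iso_cmp [simp]:
  assumes "iso C t" "iso C u" "src t = trg u"
  shows "iso C (t \<bullet> u)"
  using assms by (intro isoI[of _ "inv_arr C u \<bullet> inv_arr C t"]) auto

lemma inv_cmp_distrib:
  assumes "iso C t" "iso C u" "src t = trg u"
  shows "inv_arr C (t \<bullet> u) = inv_arr C u \<bullet> inv_arr C t"
  using assms by (intro inv_unique) auto

lemma iso_cancel_right:
  assumes "iso C t" "arr C u" "arr C v" "src u = trg t" "src v = trg t" "u \<bullet> t = v \<bullet> t"
  shows "u = v"
proof -
  have "(u \<bullet> t) \<bullet> inv_arr C t = (v \<bullet> t) \<bullet> inv_arr C t" using assms(6) by simp
  then show ?thesis using assms(1-5) by simp
qed

lemma split_epi_cancel:
  assumes "e \<bullet> s = idn C (trg e)" "arr C e" "arr C s" "src e = trg s" "arr C w" "arr C w'"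
    "src w = trg e" "src w' = trg e" "w \<bullet> e = w' \<bullet> e"
  shows "w = w'"
proof -
  have "w = (w \<bullet> e) \<bullet> s" using assms(1-8) by simp
  also have "\<dots> = (w' \<bullet> e) \<bullet> s" by (simp only: assms(9))
  also have "\<dots> = w'" using assms(1-8) by simp
  finally show ?thesis .
qed

lemma inv_swap_left:
  assumes "iso C t" "arr C u" "trg u = src t" "t \<bullet> u = v"
  shows "u = inv_arr C t \<bullet> v"
  using assms by (metis inv_cmp_cmp)

lemma inv_swap_right:
  assumes "iso C t" "arr C u" "src u = trg t" "u \<bullet> t = v"
  shows "u = v \<bullet> inv_arr C t"
proof -
  have "v \<bullet> inv_arr C t = (u \<bullet> t) \<bullet> inv_arr C t" using assms(4) by simp
  then show ?thesis using assms(1-3) by simp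
qed

end

section \<open>Linear structure, kernels and cokernels on typed morphisms\<close>

definition zer :: "('k, 'o, 'm, 'z) lin_cat_scheme \<Rightarrow> 'o \<Rightarrow> 'o \<Rightarrow> ('o, 'm) arrow" where
  "zer C A B = Arrow A (Zer C A B) B"

definition pl :: "('k, 'o, 'm, 'z) lin_cat_scheme \<Rightarrow> ('o, 'm) arrow \<Rightarrow> ('o, 'm) arrow \<Rightarrow> ('o, 'm) arrow" where
  "pl C t u = Arrow (src t) (Plus C (mor t) (mor u)) (trg t)"

text \<open>Source and target are explicit arguments because they cannot be read off an empty
  family. The sum is formed in the hom-module, on the bare morphisms.\<close>

definition sm :: "('k, 'o, 'm, 'z) lin_cat_scheme \<Rightarrow> 'o \<Rightarrow> 'o \<Rightarrow> 'i set \<Rightarrow> ('i \<Rightarrow> ('o, 'm) arrow) \<Rightarrow> ('o, 'm) arrow" where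
  "sm C A B I F = Arrow A (\<Oplus>\<^bsub>hom_module C A B\<^esub> i \<in> I. mor (F i)) B"

definition ker_arr :: "('k, 'o, 'm, 'z) lin_cat_scheme \<Rightarrow> ('o, 'm) arrow \<Rightarrow> ('o, 'm) arrow \<Rightarrow> bool" where
  "ker_arr C f i \<longleftrightarrow> trg i = src f \<and> is_kernel C (src f) (trg f) (mor f) (src i) (mor i)"

definition cok_arr :: "('k, 'o, 'm, 'z) lin_cat_scheme \<Rightarrow> ('o, 'm) arrow \<Rightarrow> ('o, 'm) arrow \<Rightarrow> bool" where
  "cok_arr C f p \<longleftrightarrow> src p = trg f \<and> is_cokernel C (src f) (trg f) (mor f) (trg p) (mor p)"

lemma src_zer [simp]: "src (zer C A B) = A" and trg_zer [simp]: "trg (zer C A B) = B"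
  and mor_zer: "mor (zer C A B) = Zer C A B"
  and src_sm [simp]: "src (sm C A B I F) = A" and trg_sm [simp]: "trg (sm C A B I F) = B"
  and src_pl [simp]: "src (pl C t u) = src t" and trg_pl [simp]: "trg (pl C t u) = trg t"
  by (auto simp: zer_def sm_def pl_def)

lemma hom_module_sel [simp]:
  "carrier (hom_module C A B) = Hom C A B"
  "zero (hom_module C A B) = Zer C A B"
  "add (hom_module C A B) = Plus C"
  "smult (hom_module C A B) = Scal C"
  by (auto simp: hom_module_def)

lemma short_exact_arr:
  "short_exact C A f B g D \<longleftrightarrow> arr C (Arrow A f B) \<and> arr C (Arrow B g D) \<and>
     ker_arr C (Arrow B g D) (Arrow A f B) \<and> cok_arr C (Arrow A f B) (Arrow B g D)"
  by (auto simp: short_exact_def ker_arr_def cok_arr_def arr_def)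

context linear_category
begin

lemma Zer_in: "A \<in> Ob C \<Longrightarrow> B \<in> Ob C \<Longrightarrow> Zer C A B \<in> Hom C A B"
  using abelian_groupE(2)[OF module.axioms(2)[OF hom_module]] by fastforce

lemma arr_zer [simp]: "A \<in> Ob C \<Longrightarrow> B \<in> Ob C \<Longrightarrow> arr C (zer C A B)"
  by (simp add: arr_def zer_def Zer_in)

text \<open>Packaging composition with a fixed morphism as a homomorphism of hom-modules makes the
  general facts on zero and finite sums available for it.\<close>

lemma Comp_mod_hom:
  assumes "A \<in> Ob C" "B \<in> Ob C" "D \<in> Ob C"
  shows "g \<in> Hom C B D \<Longrightarrow> (\<lambda>f. g \<cdot> f) \<in> mod_hom k (hom_module C A B) (hom_module C A D)"
    and "f \<in> Hom C A B \<Longrightarrow> (\<lambda>g. g \<cdot> f) \<in> mod_hom k (hom_module C B D) (hom_module C A D)"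
  using assms by (auto intro!: mod_homI simp: Comp_in[of A B D] Comp_Plus Plus_Comp[of A B D] Comp_Scal Scal_Comp[of A B D])

lemma cmp_zer [simp]: "arr C t \<Longrightarrow> A \<in> Ob C \<Longrightarrow> src t = B \<Longrightarrow> t \<bullet> zer C A B = zer C A (trg t)"
  using mod_hom_zero[OF hom_module hom_module Comp_mod_hom(1)[of A "src t" "trg t" "mor t"]]
  by (auto simp: cmp_def zer_def arr_def)

lemma zer_cmp [simp]: "arr C t \<Longrightarrow> B \<in> Ob C \<Longrightarrow> trg t = A \<Longrightarrow> zer C A B \<bullet> t = zer C (src t) B"
  using mod_hom_zero[OF hom_module hom_module Comp_mod_hom(2)[of "src t" "trg t" B "mor t"]]
  by (auto simp: cmp_def zer_def arr_def)

lemma mors_in: "F \<in> I \<rightarrow> hm C A B \<Longrightarrow> (\<lambda>i. mor (F i)) \<in> I \<rightarrow> carrier (hom_module C A B)"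
  by (fastforce simp: arr_def Pi_iff)

lemma arr_sm [simp]:
  assumes "F \<in> I \<rightarrow> hm C A B" "A \<in> Ob C" "B \<in> Ob C"
  shows "arr C (sm C A B I F)"
proof -
  interpret M: module k "hom_module C A B" using hom_module assms by simp
  show ?thesis
    using M.finsum_closed[OF mors_in[OF assms(1)]] assms by (simp add: arr_def sm_def)
qed

lemma sm_cong:
  assumes "A \<in> Ob C" "B \<in> Ob C" "\<And>i. i \<in> I \<Longrightarrow> F i = F' i" "F' \<in> I \<rightarrow> hm C A B"
  shows "sm C A B I F = sm C A B I F'"
proof -
  interpret M: module k "hom_module C A B" using hom_module assms by simp
  show ?thesis
    unfolding sm_def arrow.inject using assms mors_in[OF assms(4)]
    by (intro conjI refl M.finsum_cong') (auto)
qed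

text \<open>Common source of the distributivity rules: \<phi> will be composition with a morphism,
  tensoring with one, or the action of a linear functor.\<close>

lemma sm_mod_hom:
  assumes "A \<in> Ob C" "B \<in> Ob C" "A' \<in> Ob C" "B' \<in> Ob C" "finite I" "F \<in> I \<rightarrow> hm C A B"
    and "\<phi> \<in> mod_hom k (hom_module C A B) (hom_module C A' B')"
  shows "\<phi> (mor (sm C A B I F)) = mor (sm C A' B' I (\<lambda>i. Arrow A' (\<phi> (mor (F i))) B'))"
  using mod_hom_finsum[OF hom_module hom_module assms(7,5) mors_in[OF assms(6)]] assms(1-4)
  by (simp add: sm_def)

lemma cmp_sm:
  assumes "A \<in> Ob C" "finite I" "F \<in> I \<rightarrow> hm C A B" "arr C x" "src x = B"
  shows "x \<bullet> sm C A B I F = sm C A (trg x) I (\<lambda>i. x \<bullet> F i)"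
proof -
  have *: "(\<lambda>f. mor x \<cdot> f) \<in> mod_hom k (hom_module C A B) (hom_module C A (trg x))"
    using assms by (intro Comp_mod_hom(1)) (auto simp: arr_def)
  show ?thesis
    using sm_mod_hom[OF _ _ _ _ assms(2,3) *] assms
    by (auto simp: arr_def sm_def cmp_def)
qed

lemma sm_cmp:
  assumes "D \<in> Ob C" "finite I" "F \<in> I \<rightarrow> hm C B D" "arr C x" "trg x = B"
  shows "sm C B D I F \<bullet> x = sm C (src x) D I (\<lambda>i. F i \<bullet> x)"
proof -
  have *: "(\<lambda>f. f \<cdot> mor x) \<in> mod_hom k (hom_module C B D) (hom_module C (src x) D)"
    using assms by (intro Comp_mod_hom(2)) (auto simp: arr_def)
  show ?thesis
    using sm_mod_hom[OF _ _ _ _ assms(2,3) *] assms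
    by (auto simp: arr_def sm_def cmp_def)
qed

text \<open>Inserting the decomposition of the identity expands x into the sum of the
  \<open>x \<bullet> F i\<close>. Such a decomposition is visibly preserved by linear functors, so
  joint epimorphy can be transported by way of it.\<close>

lemma sm_jointly_epi:
  assumes "A \<in> Ob C" "finite I" "F \<in> I \<rightarrow> hm C A A" "sm C A A I F = idn C A"
    and "arr C x" "arr C y" "src x = A" "src y = A" "trg x = trg y" "\<And>i. i \<in> I \<Longrightarrow> x \<bullet> F i = y \<bullet> F i"
  shows "x = y"
proof -
  have "x = sm C A (trg x) I (\<lambda>i. x \<bullet> F i)" using cmp_sm[of A I F A x] assms by simp
  also have "\<dots> = sm C A (trg x) I (\<lambda>i. y \<bullet> F i)"
    using assms by (intro sm_cong) (auto simp: Pi_iff arr_trg)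
  also have "\<dots> = y" using cmp_sm[of A I F A y] assms by simp
  finally show ?thesis .
qed

lemma sm_jointly_mono:
  assumes "A \<in> Ob C" "finite I" "F \<in> I \<rightarrow> hm C A A" "sm C A A I F = idn C A"
    and "arr C x" "arr C y" "trg x = A" "trg y = A" "src x = src y" "\<And>i. i \<in> I \<Longrightarrow> F i \<bullet> x = F i \<bullet> y"
  shows "x = y"
proof -
  have "x = sm C (src x) A I (\<lambda>i. F i \<bullet> x)" using sm_cmp[of A I F A x] assms by simp
  also have "\<dots> = sm C (src x) A I (\<lambda>i. F i \<bullet> y)"
    using assms by (intro sm_cong) (auto simp: Pi_iff arr_src)
  also have "\<dots> = y" using sm_cmp[of A I F A y] assms by simp
  finally show ?thesis .
qed

lemma sm_neutral:
  assumes "A \<in> Ob C" "B \<in> Ob C" "finite I" "F \<in> I \<rightarrow> hm C A B" "J \<subseteq> I"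
    and "\<And>i. i \<in> I \<Longrightarrow> i \<notin> J \<Longrightarrow> F i = zer C A B"
  shows "sm C A B I F = sm C A B J F"
proof -
  interpret M: module k "hom_module C A B" using hom_module assms by simp
  show ?thesis
    unfolding sm_def arrow.inject using assms mors_in[OF assms(4)]
    by (intro conjI refl M.add.finprod_mono_neutral_cong_right) (auto simp: mor_zer)
qed

lemma sm_empty: "A \<in> Ob C \<Longrightarrow> B \<in> Ob C \<Longrightarrow> sm C A B {} F = zer C A B"
  using abelian_monoid.finsum_empty[OF abelian_group.axioms(1)[OF module.axioms(2)[OF hom_module]]]
  by (simp add: sm_def zer_def)

lemma sm_insert:
  assumes "A \<in> Ob C" "B \<in> Ob C" "finite I" "F \<in> insert i I \<rightarrow> hm C A B" "i \<notin> I"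
  shows "sm C A B (insert i I) F = pl C (F i) (sm C A B I F)"
proof -
  interpret M: module k "hom_module C A B" using hom_module assms by simp
  show ?thesis
    using assms M.finsum_insert[OF assms(3,5), of "\<lambda>i. mor (F i)"] mors_in[OF assms(4)]
    by (auto simp: sm_def pl_def)
qed

lemma pl_zer [simp]:
  assumes "arr C t" "A = src t" "B = trg t"
  shows "pl C t (zer C A B) = t"
proof -
  interpret M: module k "hom_module C (src t) (trg t)" using hom_module assms by (simp add: arr_def)
  show ?thesis
    using M.r_zero assms by (intro arrow_eqI) (auto simp: pl_def arr_def zer_def)
qed

lemma sm_single:
  assumes "A \<in> Ob C" "B \<in> Ob C" "finite I" "F \<in> I \<rightarrow> hm C A B" "j \<in> I"
    and "\<And>i. i \<in> I \<Longrightarrow> i \<noteq> j \<Longrightarrow> F i = zer C A B"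
  shows "sm C A B I F = F j"
proof -
  have "sm C A B I F = sm C A B {j} F"
    using assms by (intro sm_neutral) auto
  also have "\<dots> = F j"
    using assms sm_insert[of A B "{}" F j] funcset_mem[OF assms(4,5)] by (simp add: sm_empty Pi_iff)
  finally show ?thesis .
qed

text \<open>Splits the universal property into existence of factorizations and cancellability of i,
  which are proved by different arguments in the applications.\<close>

lemma ker_arrI:
  assumes "arr C f" "arr C i" "trg i = src f" "f \<bullet> i = zer C (src i) (trg f)"
    and "\<And>t. \<lbrakk>arr C t; trg t = src f; f \<bullet> t = zer C (src t) (trg f)\<rbrakk>
      \<Longrightarrow> \<exists>w. arr C w \<and> src w = src t \<and> trg w = src i \<and> i \<bullet> w = t"
    and "\<And>w w'. \<lbrakk>arr C w; arr C w'; src w = src w'; trg w = src i; trg w' = src i; i \<bullet> w = i \<bullet> w'\<rbrakk>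
      \<Longrightarrow> w = w'"
  shows "ker_arr C f i"
  unfolding ker_arr_def is_kernel_def
proof (intro conjI ballI impI)
  show "mor f \<cdot> mor i = Zer C (src i) (trg f)" using assms(4) by (auto simp: cmp_def zer_def)
  fix X h assume X: "X \<in> Ob C" and h: "h \<in> Hom C X (src f)" "mor f \<cdot> h = Zer C X (trg f)"
  have "\<exists>w. arr C w \<and> src w = src (Arrow X h (src f)) \<and> trg w = src i \<and> i \<bullet> w = Arrow X h (src f)"
    by (rule assms(5)) (use X h assms(1) in \<open>auto simp: arr_def cmp_def zer_def\<close>)
  then obtain w where w: "arr C w" "src w = X" "trg w = src i" "i \<bullet> w = Arrow X h (src f)" by auto
  show "\<exists>!h'. h' \<in> Hom C X (src i) \<and> mor i \<cdot> h' = h"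
  proof (rule ex1I[of _ "mor w"])
    show "mor w \<in> Hom C X (src i) \<and> mor i \<cdot> mor w = h"
      using w by (auto simp: arr_def cmp_def)
    fix h' assume h': "h' \<in> Hom C X (src i) \<and> mor i \<cdot> h' = h"
    have "Arrow X h' (src i) = w"
    proof (rule assms(6))
      show "i \<bullet> Arrow X h' (src i) = i \<bullet> w"
        unfolding w(4) using h' assms(3) by (simp add: cmp_def)
    qed (use h' X w assms(2) in \<open>auto simp: arr_def\<close>)
    then show "h' = mor w" by auto
  qed
qed (use assms in \<open>auto simp: arr_def\<close>)

lemma cok_arrI:
  assumes "arr C f" "arr C p" "src p = trg f" "p \<bullet> f = zer C (src f) (trg p)"
    and "\<And>t. \<lbrakk>arr C t; src t = trg f; t \<bullet> f = zer C (src f) (trg t)\<rbrakk>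
      \<Longrightarrow> \<exists>w. arr C w \<and> src w = trg p \<and> trg w = trg t \<and> w \<bullet> p = t"
    and "\<And>w w'. \<lbrakk>arr C w; arr C w'; trg w = trg w'; src w = trg p; src w' = trg p; w \<bullet> p = w' \<bullet> p\<rbrakk>
      \<Longrightarrow> w = w'"
  shows "cok_arr C f p"
  unfolding cok_arr_def is_cokernel_def
proof (intro conjI ballI impI)
  show "mor p \<cdot> mor f = Zer C (src f) (trg p)" using assms(4) by (auto simp: cmp_def zer_def)
  fix X h assume X: "X \<in> Ob C" and h: "h \<in> Hom C (trg f) X" "h \<cdot> mor f = Zer C (src f) X"
  have "\<exists>w. arr C w \<and> src w = trg p \<and> trg w = trg (Arrow (trg f) h X) \<and> w \<bullet> p = Arrow (trg f) h X"
    by (rule assms(5)) (use X h assms(1) in \<open>auto simp: arr_def cmp_def zer_def\<close>)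
  then obtain w where w: "arr C w" "src w = trg p" "trg w = X" "w \<bullet> p = Arrow (trg f) h X" by auto
  show "\<exists>!h'. h' \<in> Hom C (trg p) X \<and> h' \<cdot> mor p = h"
  proof (rule ex1I[of _ "mor w"])
    show "mor w \<in> Hom C (trg p) X \<and> mor w \<cdot> mor p = h"
      using w by (auto simp: arr_def cmp_def)
    fix h' assume h': "h' \<in> Hom C (trg p) X \<and> h' \<cdot> mor p = h"
    have "Arrow (trg p) h' X = w"
    proof (rule assms(6))
      show "Arrow (trg p) h' X \<bullet> p = w \<bullet> p"
        unfolding w(4) using h' assms(3) by (simp add: cmp_def)
    qed (use h' X w assms(2) in \<open>auto simp: arr_def\<close>)
    then show "h' = mor w" by auto
  qed
qed (use assms in \<open>auto simp: arr_def\<close>)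

lemma ker_arr_zero:
  assumes "ker_arr C f i"
  shows "f \<bullet> i = zer C (src i) (trg f)"
  using assms by (auto simp: ker_arr_def is_kernel_def cmp_def zer_def)

lemma ker_arr_arr:
  assumes "ker_arr C f i" "arr C f"
  shows "arr C i" "trg i = src f"
  using assms by (auto simp: ker_arr_def is_kernel_def arr_def)

lemma ker_arr_lift:
  assumes "ker_arr C f i" "arr C t" "trg t = src f" "f \<bullet> t = zer C (src t) (trg f)"
  obtains w where "arr C w" "src w = src t" "trg w = src i" "i \<bullet> w = t"
proof -
  have "mor f \<cdot> mor t = Zer C (src t) (trg f)"
    using assms(4) by (simp add: cmp_def zer_def)
  then obtain h where h: "h \<in> Hom C (src t) (src i)" "mor i \<cdot> h = mor t"
    using assms(1-3) unfolding ker_arr_def is_kernel_def arr_def by metis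
  show ?thesis
    by (rule that[of "Arrow (src t) h (src i)"])
      (use h assms(1-3) in \<open>auto simp: arr_def ker_arr_def is_kernel_def cmp_def intro!: arrow_eqI\<close>)
qed

text \<open>Both w and w' factor the same morphism \<open>i \<bullet> w\<close>, which f kills, so
  the uniqueness part of the kernel property applies.\<close>

lemma ker_arr_mono:
  assumes "ker_arr C f i" "arr C f" "arr C w" "arr C w'" "src w = src w'" "trg w = src i" "trg w' = src i"
    "i \<bullet> w = i \<bullet> w'"
  shows "w = w'"
proof -
  have a: "arr C i" "trg i = src f" by (rule ker_arr_arr[OF assms(1,2)])+
  have "f \<bullet> (i \<bullet> w) = zer C (src w) (trg f)"
    using a assms ker_arr_zero[OF assms(1)] by (simp del: cmp_assoc add: cmp_assoc[symmetric] arr_trg)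
  then have "mor f \<cdot> mor (i \<bullet> w) = Zer C (src w) (trg f)" by (simp add: cmp_def zer_def)
  moreover have "mor (i \<bullet> w) \<in> Hom C (src w) (src f)"
    using arr_cmp[OF a(1) assms(3)] a assms(6) by (auto simp: arr_def)
  ultimately have "\<exists>!h. h \<in> Hom C (src w) (src i) \<and> mor i \<cdot> h = mor (i \<bullet> w)"
    using assms(1,3) unfolding ker_arr_def is_kernel_def arr_def by blast
  moreover have "mor i \<cdot> mor w = mor (i \<bullet> w)" "mor i \<cdot> mor w' = mor (i \<bullet> w)"
    unfolding mor_cmp[symmetric] assms(8) by auto
  ultimately have "mor w = mor w'" using assms(3-7) unfolding arr_def by metis
  then show ?thesis using assms(5-7) by (intro arrow_eqI) auto
qed

lemma cok_arr_zero:
  assumes "cok_arr C f p"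
  shows "p \<bullet> f = zer C (src f) (trg p)"
  using assms by (auto simp: cok_arr_def is_cokernel_def cmp_def zer_def)

lemma cok_arr_arr:
  assumes "cok_arr C f p" "arr C f"
  shows "arr C p" "src p = trg f"
  using assms by (auto simp: cok_arr_def is_cokernel_def arr_def)

lemma cok_arr_lift:
  assumes "cok_arr C f p" "arr C t" "src t = trg f" "t \<bullet> f = zer C (src f) (trg t)"
  obtains w where "arr C w" "src w = trg p" "trg w = trg t" "w \<bullet> p = t"
proof -
  have "mor t \<cdot> mor f = Zer C (src f) (trg t)"
    using assms(4) by (simp add: cmp_def zer_def)
  then obtain h where h: "h \<in> Hom C (trg p) (trg t)" "h \<cdot> mor p = mor t"
    using assms(1-3) unfolding cok_arr_def is_cokernel_def arr_def by metis
  show ?thesis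
    by (rule that[of "Arrow (trg p) h (trg t)"])
      (use h assms(1-3) in \<open>auto simp: arr_def cok_arr_def is_cokernel_def cmp_def intro!: arrow_eqI\<close>)
qed

lemma cok_arr_epi:
  assumes "cok_arr C f p" "arr C f" "arr C w" "arr C w'" "trg w = trg w'" "src w = trg p" "src w' = trg p"
    "w \<bullet> p = w' \<bullet> p"
  shows "w = w'"
proof -
  have a: "arr C p" "src p = trg f" by (rule cok_arr_arr[OF assms(1,2)])+
  have "(w \<bullet> p) \<bullet> f = zer C (src f) (trg w)"
    using a assms(2-7) cok_arr_zero[OF assms(1)] by (simp add: arr_src)
  then have "mor (w \<bullet> p) \<cdot> mor f = Zer C (src f) (trg w)" by (simp add: cmp_def zer_def)
  moreover have "mor (w \<bullet> p) \<in> Hom C (trg f) (trg w)"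
    using arr_cmp[OF assms(3) a(1)] a assms(6) by (auto simp: arr_def)
  ultimately have "\<exists>!h. h \<in> Hom C (trg p) (trg w) \<and> h \<cdot> mor p = mor (w \<bullet> p)"
    using assms(1,3) unfolding cok_arr_def is_cokernel_def arr_def by blast
  moreover have "mor w \<cdot> mor p = mor (w \<bullet> p)" "mor w' \<cdot> mor p = mor (w \<bullet> p)"
    unfolding mor_cmp[symmetric] assms(8) by auto
  ultimately have "mor w = mor w'" using assms(3-7) unfolding arr_def by metis
  then show ?thesis using assms(5-7) by (intro arrow_eqI) auto
qed

lemma cmp_sm_distrib:
  assumes "A \<in> Ob C" "finite I" "F \<in> I \<rightarrow> hm C A B" "arr C x" "src x = B" "arr C y" "trg y = A"
  shows "x \<bullet> sm C A B I F \<bullet> y = sm C (src y) (trg x) I (\<lambda>i. x \<bullet> F i \<bullet> y)"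
proof -
  have B: "B \<in> Ob C" using assms by (auto simp: arr_def)
  have "x \<bullet> sm C A B I F \<bullet> y = x \<bullet> sm C (src y) B I (\<lambda>i. F i \<bullet> y)"
    using assms B by (simp add: sm_cmp)
  also have "\<dots> = sm C (src y) (trg x) I (\<lambda>i. x \<bullet> F i \<bullet> y)"
    using assms B by (intro cmp_sm) (auto simp: arr_src Pi_iff)
  finally show ?thesis .
qed

end

section \<open>Finite direct sums and their classes\<close>

definition dsum :: "('k, 'o, 'm, 'z) lin_cat_scheme \<Rightarrow> 'i set \<Rightarrow> ('i \<Rightarrow> 'o) \<Rightarrow> 'o \<Rightarrow>
    ('i \<Rightarrow> ('o, 'm) arrow) \<Rightarrow> ('i \<Rightarrow> ('o, 'm) arrow) \<Rightarrow> bool" where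
  "dsum C I X S \<iota> \<pi> \<longleftrightarrow> S \<in> Ob C \<and>
     (\<forall>i \<in> I. X i \<in> Ob C \<and> \<iota> i \<in> hm C (X i) S \<and> \<pi> i \<in> hm C S (X i)) \<and>
     (\<forall>i \<in> I. \<forall>j \<in> I. \<pi> j \<bullet>\<^bsub>C\<^esub> \<iota> i = (if i = j then idn C (X i) else zer C (X i) (X j))) \<and>
     sm C S S I (\<lambda>i. \<iota> i \<bullet>\<^bsub>C\<^esub> \<pi> i) = idn C S"

context linear_category
begin

lemma direct_sum_dsum:
  "direct_sum C I X S \<iota> \<pi> \<longleftrightarrow>
    dsum C I X S (\<lambda>i. Arrow (X i) (\<iota> i) S) (\<lambda>i. Arrow S (\<pi> i) (X i))"
proof -
  have "(\<pi> j \<cdot> \<iota> i = (if i = j then Idn C (X i) else Zer C (X i) (X j))) \<longleftrightarrow>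
      (Arrow S (\<pi> j) (X j) \<bullet> Arrow (X i) (\<iota> i) S = (if i = j then idn C (X i) else zer C (X i) (X j)))"
    for i j by (auto simp: cmp_def idn_def zer_def)
  then show ?thesis
    unfolding direct_sum_def dsum_def
    by (auto simp: arr_def sm_def mor_cmp idn_def)
qed

lemma dsum_direct_sum:
  assumes "dsum C I X S \<iota> \<pi>"
  shows "direct_sum C I X S (mor \<circ> \<iota>) (mor \<circ> \<pi>)"
proof -
  have *: "Arrow (X i) (mor (\<iota> i)) S = \<iota> i" "Arrow S (mor (\<pi> i)) (X i) = \<pi> i" if "i \<in> I" for i
    using assms that unfolding dsum_def by (metis arrow.exhaust_sel hm_iff)+
  have "sm C S S I (\<lambda>i. Arrow (X i) (mor (\<iota> i)) S \<bullet> Arrow S (mor (\<pi> i)) (X i)) = sm C S S I (\<lambda>i. \<iota> i \<bullet> \<pi> i)"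
    using assms by (intro sm_cong) (auto simp: * dsum_def)
  then show ?thesis
    using assms unfolding direct_sum_dsum by (simp add: dsum_def *)
qed

text \<open>The complement of the \<open>i\<close>-th summand is obtained as the kernel of the projection to it.\<close>

lemma dsum_split:
  assumes S: "dsum C (insert i I) X S \<iota> \<pi>" and i: "i \<notin> I" and fin: "finite I"
    and ker: "ker_arr C (\<pi> i) u"
  obtains \<iota>' \<pi>' where "dsum C I X (src u) \<iota>' \<pi>'" "cok_arr C u (\<pi> i)"
proof -
  have S_ob: "S \<in> Ob C" using S by (simp add: dsum_def)
  have X: "X j \<in> Ob C" "arr C (\<iota> j)" "arr C (\<pi> j)" "src (\<iota> j) = X j" "trg (\<iota> j) = S" "src (\<pi> j) = S" "trg (\<pi> j) = X j"
    if "j \<in> insert i I" for j using S that by (auto simp: dsum_def)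
  have \<pi>\<iota>: "\<pi> j \<bullet> \<iota> l = (if l = j then idn C (X l) else zer C (X l) (X j))"
    if "j \<in> insert i I" "l \<in> insert i I" for j l using S that by (auto simp: dsum_def)
  have id: "sm C S S (insert i I) (\<lambda>i. \<iota> i \<bullet> \<pi> i) = idn C S" using S by (simp add: dsum_def)
  have u: "arr C u" "trg u = S" using ker_arr_arr[OF ker] X by auto
  define U where "U = src u"
  have U: "U \<in> Ob C" "src u = U" using u by (auto simp: U_def arr_def)
  \<comment> \<open>The inclusion of a summand other than i is killed by \<open>\<pi> i\<close>, so
    it factors through the kernel u.\<close>
  have "\<exists>w. arr C w \<and> src w = X j \<and> trg w = U \<and> u \<bullet> w = \<iota> j" if j: "j \<in> I" for j
  proof -
    have "\<pi> i \<bullet> \<iota> j = zer C (X j) (X i)" using \<pi>\<iota>[of i j] i j by auto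
    then show ?thesis using ker_arr_lift[OF ker, of "\<iota> j"] X[of j] X[of i] j U by auto
  qed
  then obtain \<iota>' where \<iota>': "\<And>j. j \<in> I \<Longrightarrow> arr C (\<iota>' j) \<and> src (\<iota>' j) = X j \<and> trg (\<iota>' j) = U \<and> u \<bullet> \<iota>' j = \<iota> j"
    by metis
  have "dsum C I X U \<iota>' (\<lambda>j. \<pi> j \<bullet> u)"
    unfolding dsum_def
  proof (intro conjI ballI)
    fix j l assume j: "j \<in> I" and l: "l \<in> I"
    show "(\<pi> l \<bullet> u) \<bullet> \<iota>' j = (if j = l then idn C (X j) else zer C (X j) (X l))"
      using j l X \<iota>' u U \<pi>\<iota>[of l j] by simp
  next
    let ?s = "sm C U U I (\<lambda>j. \<iota>' j \<bullet> \<pi> j \<bullet> u)"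
    have F: "(\<lambda>j. \<iota>' j \<bullet> \<pi> j \<bullet> u) \<in> I \<rightarrow> hm C U U" using \<iota>' X u U by auto
    \<comment> \<open>As u is monic, the sum may be compared with the identity after composing with
      u. There it becomes the full decomposition of S, since the missing term contains
      \<open>\<pi> i \<bullet> u\<close>, which is zero.\<close>
    have "u \<bullet> ?s = sm C U S I (\<lambda>j. u \<bullet> \<iota>' j \<bullet> \<pi> j \<bullet> u)"
      using F U u fin by (subst cmp_sm) auto
    also have "\<dots> = sm C U S I (\<lambda>j. \<iota> j \<bullet> \<pi> j \<bullet> u)"
    proof (rule sm_cong)
      fix j assume j: "j \<in> I"
      then show "u \<bullet> \<iota>' j \<bullet> \<pi> j \<bullet> u = \<iota> j \<bullet> \<pi> j \<bullet> u"
        using cmp_reassoc[of u "\<iota>' j" "\<iota> j"] \<iota>' X u U by auto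
    qed (use X u U S_ob in auto)
    also have "\<dots> = sm C U S (insert i I) (\<lambda>j. \<iota> j \<bullet> \<pi> j \<bullet> u)"
      using X u U S_ob fin ker_arr_zero[OF ker]
      by (intro sm_neutral[symmetric]) auto
    also have "\<dots> = sm C S S (insert i I) (\<lambda>j. \<iota> j \<bullet> \<pi> j) \<bullet> u"
    proof -
      have "sm C S S (insert i I) (\<lambda>j. \<iota> j \<bullet> \<pi> j) \<bullet> u = sm C (src u) S (insert i I) (\<lambda>j. (\<iota> j \<bullet> \<pi> j) \<bullet> u)"
        using fin X u U S_ob by (intro sm_cmp) auto
      also have "\<dots> = sm C U S (insert i I) (\<lambda>j. \<iota> j \<bullet> \<pi> j \<bullet> u)"
        unfolding U(2) using fin X u U S_ob by (intro sm_cong) auto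
      finally show ?thesis by simp
    qed
    also have "\<dots> = u \<bullet> idn C U" using u U id by simp
    finally have "u \<bullet> ?s = u \<bullet> idn C U" .
    moreover have "arr C ?s" using F U by (intro arr_sm)
    ultimately have "?s = idn C U"
      using U X(3)[of i] by - (rule ker_arr_mono[OF ker], simp_all)
    then show "sm C U U I (\<lambda>i. \<iota>' i \<bullet> \<pi> i \<bullet> u) = idn C U" .
  qed (use X \<iota>' u U in auto)
  moreover have "cok_arr C u (\<pi> i)"
  proof (rule cok_arrI)
    show "\<pi> i \<bullet> u = zer C (src u) (trg (\<pi> i))" using ker_arr_zero[OF ker] .
    fix t assume t: "arr C t" "src t = trg u" "t \<bullet> u = zer C (src u) (trg t)"
    \<comment> \<open>A morphism t that vanishes on u vanishes on all summands except i, so it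
      equals \<open>(t \<bullet> \<iota> i) \<bullet> \<pi> i\<close>; this exhibits its
      factorization through \<open>\<pi> i\<close>.\<close>
    have z: "t \<bullet> \<iota> j \<bullet> \<pi> j = zer C S (trg t)" if j: "j \<in> I" for j
    proof -
      have "(t \<bullet> u) \<bullet> \<iota>' j \<bullet> \<pi> j = t \<bullet> u \<bullet> \<iota>' j \<bullet> \<pi> j"
        using \<iota>'[OF j] j X[of j] u t(1,2) U by (intro cmp_assoc) auto
      also have "u \<bullet> \<iota>' j \<bullet> \<pi> j = \<iota> j \<bullet> \<pi> j"
        using \<iota>'[OF j] j X[of j] u U by (intro cmp_reassoc) auto
      finally have "t \<bullet> \<iota> j \<bullet> \<pi> j = (t \<bullet> u) \<bullet> \<iota>' j \<bullet> \<pi> j" by (rule sym)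
      then show ?thesis using \<iota>'[OF j] j X[of j] u t U by (simp add: arr_trg)
    qed
    have "t = t \<bullet> sm C S S (insert i I) (\<lambda>j. \<iota> j \<bullet> \<pi> j)" using t u id by simp
    also have "\<dots> = sm C S (trg t) (insert i I) (\<lambda>j. t \<bullet> \<iota> j \<bullet> \<pi> j)"
      using t u X fin S_ob by (intro cmp_sm) auto
    also have "\<dots> = t \<bullet> \<iota> i \<bullet> \<pi> i"
      using t u X fin S_ob z by (intro sm_single) (auto simp: arr_trg)
    finally have "t = (t \<bullet> \<iota> i) \<bullet> \<pi> i" using t u X by simp
    then show "\<exists>w. arr C w \<and> src w = trg (\<pi> i) \<and> trg w = trg t \<and> w \<bullet> \<pi> i = t"
      using t u X by (intro exI[of _ "t \<bullet> \<iota> i"]) auto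
  next
    fix w w' assume w: "arr C w" "arr C w'" "trg w = trg w'" "src w = trg (\<pi> i)" "src w' = trg (\<pi> i)"
      "w \<bullet> \<pi> i = w' \<bullet> \<pi> i"
    then show "w = w'" using X[of i] \<pi>\<iota>[of i i] split_epi_cancel[of "\<pi> i" "\<iota> i" w w'] by auto
  qed (use X u in auto)
  ultimately show thesis using that U by blast
qed

lemma is_zero_object_arr:
  assumes "is_zero_object C Z" "arr C t"
  shows "src t = Z \<Longrightarrow> t = zer C Z (trg t)" and "trg t = Z \<Longrightarrow> t = zer C (src t) Z"
  using assms by (auto simp: is_zero_object_def arr_def zer_def intro!: arrow_eqI)

lemma is_zero_objectI:
  assumes Z: "Z \<in> Ob C"
    and to: "\<And>t. arr C t \<Longrightarrow> trg t = Z \<Longrightarrow> t = zer C (src t) Z"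
    and from_Z: "\<And>t. arr C t \<Longrightarrow> src t = Z \<Longrightarrow> t = zer C Z (trg t)"
  shows "is_zero_object C Z"
proof -
  have "f = Zer C A Z" if "A \<in> Ob C" "f \<in> Hom C A Z" for A f
    using to[of "Arrow A f Z"] that Z by (simp add: arr_Arrow zer_def)
  moreover have "f = Zer C Z A" if "A \<in> Ob C" "f \<in> Hom C Z A" for A f
    using from_Z[of "Arrow Z f A"] that Z by (simp add: arr_Arrow zer_def)
  ultimately have "Hom C A Z = {Zer C A Z} \<and> Hom C Z A = {Zer C Z A}" if "A \<in> Ob C" for A
    using Zer_in[OF that Z] Zer_in[OF Z that] that by blast
  then show ?thesis using Z unfolding is_zero_object_def by blast
qed

text \<open>An isomorphism has zero kernel. The resulting sequence is what makes the class vanish on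
  zero objects and agree on isomorphic ones.\<close>

lemma iso_short_exact:
  assumes Z: "is_zero_object C Z" and f: "iso C f"
  shows "short_exact C Z (Zer C Z (src f)) (src f) (mor f) (trg f)"
proof -
  have Zo: "Z \<in> Ob C" using Z by (simp add: is_zero_object_def)
  have ob: "src f \<in> Ob C" "trg f \<in> Ob C" using f by (auto simp: arr_src arr_trg)
  have "ker_arr C f (zer C Z (src f))"
  proof (rule ker_arrI)
    fix t assume t: "arr C t" "trg t = src f" "f \<bullet> t = zer C (src t) (trg f)"
    then have "t = inv_arr C f \<bullet> zer C (src t) (trg f)" using f by (intro inv_swap_left) auto
    then have "t = zer C (src t) (src f)" using f t by (simp add: arr_src)
    then show "\<exists>w. arr C w \<and> src w = src t \<and> trg w = src (zer C Z (src f)) \<and> zer C Z (src f) \<bullet> w = t"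
      using t f Zo ob by (intro exI[of _ "zer C (src t) Z"]) (auto simp: arr_src)
  qed (use f Zo ob is_zero_object_arr[OF Z] in \<open>auto simp del: cmp_zer simp: cmp_zer\<close>, metis is_zero_object_arr(2)[OF Z])
  moreover have "cok_arr C (zer C Z (src f)) f"
  proof (rule cok_arrI)
    fix t assume t: "arr C t" "src t = trg (zer C Z (src f))"
    then show "\<exists>w. arr C w \<and> src w = trg f \<and> trg w = trg t \<and> w \<bullet> f = t"
      using f by (intro exI[of _ "t \<bullet> inv_arr C f"]) auto
  next
    fix w w' assume "arr C w" "arr C w'" "trg w = trg w'" "src w = trg f" "src w' = trg f" "w \<bullet> f = w' \<bullet> f"
    then show "w = w'" using iso_cancel_right[OF f] by blast
  qed (use f Zo ob in auto)
  ultimately show ?thesis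
    using f Zo ob unfolding short_exact_arr zer_def[symmetric] by simp
qed

end

text \<open>Zero objects and kernels are what the splitting of classes of direct sums draws on; this
  is the interface through which C^H enters.\<close>

locale kernel_category = linear_category k C for k and C (structure) +
  assumes ex_zero_object: "\<exists>Z. is_zero_object C Z"
    and ex_kernel: "arr C f \<Longrightarrow> \<exists>u. ker_arr C f u"
begin

text \<open>The identity of a zero object yields a short exact sequence with [Z] = [Z] +
  [Z].\<close>

lemma K0_class_zero:
  assumes R: "cring R" and Z: "is_zero_object C Z"
  shows "K0_class R C Z = \<zero>\<^bsub>K0 R C\<^esub>"
proof -
  interpret M: module R "K0 R C" by (rule K0_module[OF R])
  have Zo: "Z \<in> Ob C" using Z by (simp add: is_zero_object_def)
  have "K0_class R C Z = K0_class R C Z \<oplus>\<^bsub>K0 R C\<^esub> K0_class R C Z"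
    using K0_class_ses[OF R iso_short_exact[OF Z iso_idn[OF Zo]]] by simp
  then show ?thesis using K0_class_closed[OF R Zo] M.add.r_cancel_one' by fastforce
qed

lemma K0_class_iso:
  assumes R: "cring R" and f: "iso C f"
  shows "K0_class R C (src f) = K0_class R C (trg f)"
proof -
  interpret M: module R "K0 R C" by (rule K0_module[OF R])
  obtain Z where Z: "is_zero_object C Z" using ex_zero_object by auto
  show ?thesis
    using K0_class_ses[OF R iso_short_exact[OF Z f]] K0_class_zero[OF R Z]
      K0_class_closed[OF R, of "trg f" C] iso_arr[OF f] by (simp add: arr_trg)
qed

text \<open>One summand is split off at a time: the kernel of its projection is a direct sum of the
  others, and the projection is the cokernel of that kernel.\<close>

lemma K0_class_dsum:
  assumes R: "cring R" and "finite I" "dsum C I X S \<iota> \<pi>"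
  shows "K0_class R C S = (\<Oplus>\<^bsub>K0 R C\<^esub> i \<in> I. K0_class R C (X i))"
  using assms(2,3)
proof (induction I arbitrary: S \<iota> \<pi>)
  case empty
  interpret M: module R "K0 R C" by (rule K0_module[OF R])
  \<comment> \<open>An empty direct sum has the empty sum as its identity, so every morphism into or
    out of S is zero.\<close>
  have S: "S \<in> Ob C" "idn C S = zer C S S"
    using empty by (auto simp: dsum_def sm_empty)
  have "t = zer C (src t) S" if "arr C t" "trg t = S" for t
    using idn_cmp[OF that] zer_cmp[OF that(1) S(1) that(2)] S(2) by simp
  moreover have "t = zer C S (trg t)" if "arr C t" "src t = S" for t
    using cmp_idn[OF that] cmp_zer[OF that(1) S(1) that(2)] S(2) by simp
  ultimately have "is_zero_object C S"
    using S(1) by (intro is_zero_objectI)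
  then show ?case using K0_class_zero[OF R] by simp
next
  case (insert i I)
  interpret M: module R "K0 R C" by (rule K0_module[OF R])
  have X: "X j \<in> Ob C" if "j \<in> insert i I" for j using insert.prems that by (auto simp: dsum_def)
  have \<pi>: "arr C (\<pi> i)" "src (\<pi> i) = S" "trg (\<pi> i) = X i" using insert.prems by (auto simp: dsum_def)
  obtain u where u: "ker_arr C (\<pi> i) u" using ex_kernel \<pi> by blast
  obtain \<iota>' \<pi>' where d: "dsum C I X (src u) \<iota>' \<pi>'" and c: "cok_arr C u (\<pi> i)"
    using dsum_split[OF insert.prems insert.hyps(2,1) u] .
  have u': "arr C u" "trg u = S" using ker_arr_arr[OF u] \<pi> by auto
  have "Arrow (src u) (mor u) S = u" "Arrow S (mor (\<pi> i)) (X i) = \<pi> i"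
    using u' \<pi> by (auto intro: arrow_eqI)
  then have "short_exact C (src u) (mor u) S (mor (\<pi> i)) (X i)"
    unfolding short_exact_arr using u c u' \<pi> by simp
  from K0_class_ses[OF R this] have "K0_class R C S = K0_class R C (src u) \<oplus>\<^bsub>K0 R C\<^esub> K0_class R C (X i)" .
  then show ?case
    using insert.IH[OF d] insert.hyps X K0_class_closed[OF R, of _ C]
    by (simp add: Pi_iff M.a_comm)
qed

end

section \<open>Exactness of the tensor product\<close>

definition tn :: "('k, 'o, 'm, 'z) mon_cat_scheme \<Rightarrow> ('o, 'm) arrow \<Rightarrow> ('o, 'm) arrow \<Rightarrow> ('o, 'm) arrow"
    (infixr "\<boxtimes>\<index>" 75) where
  "t \<boxtimes>\<^bsub>C\<^esub> u = Arrow (TObj C (src t) (src u)) (TMor C (mor t) (mor u)) (TObj C (trg t) (trg u))"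

definition al :: "('k, 'o, 'm, 'z) mon_cat_scheme \<Rightarrow> 'o \<Rightarrow> 'o \<Rightarrow> 'o \<Rightarrow> ('o, 'm) arrow" where
  "al C A B D = Arrow (TObj C (TObj C A B) D) (Assoc C A B D) (TObj C A (TObj C B D))"

definition lu :: "('k, 'o, 'm, 'z) mon_cat_scheme \<Rightarrow> 'o \<Rightarrow> ('o, 'm) arrow" where
  "lu C A = Arrow (TObj C (Unit C) A) (LUnit C A) A"

definition ru :: "('k, 'o, 'm, 'z) mon_cat_scheme \<Rightarrow> 'o \<Rightarrow> ('o, 'm) arrow" where
  "ru C A = Arrow (TObj C A (Unit C)) (RUnit C A) A"

lemma tn_sel [simp]:
  "src (t \<boxtimes>\<^bsub>C\<^esub> u) = TObj C (src t) (src u)"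
  "trg (t \<boxtimes>\<^bsub>C\<^esub> u) = TObj C (trg t) (trg u)"
  and al_sel [simp]: "src (al C A B D) = TObj C (TObj C A B) D" "trg (al C A B D) = TObj C A (TObj C B D)"
  and lu_sel [simp]: "src (lu C A) = TObj C (Unit C) A" "trg (lu C A) = A"
  and ru_sel [simp]: "src (ru C A) = TObj C A (Unit C)" "trg (ru C A) = A"
  by (simp_all add: tn_def al_def lu_def ru_def)

lemma mor_tn: "mor (t \<boxtimes>\<^bsub>C\<^esub> u) = TMor C (mor t) (mor u)" by (simp add: tn_def)

context tensor_category
begin

declare Unit_in [simp] TObj_in [simp]

lemma arr_tn [simp]: "arr C t \<Longrightarrow> arr C u \<Longrightarrow> arr C (t \<boxtimes> u)"
  by (auto simp: arr_def tn_def intro: TMor_in)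

lemma tn_idn [simp]: "A \<in> Ob C \<Longrightarrow> B \<in> Ob C \<Longrightarrow> idn C A \<boxtimes> idn C B = idn C (TObj C A B)"
  by (simp add: tn_def idn_def TMor_Idn)

lemma tn_cmp:
  assumes "arr C t" "arr C t'" "arr C u" "arr C u'" "src t' = trg t" "src u' = trg u"
  shows "(t' \<boxtimes> u') \<bullet> (t \<boxtimes> u) = (t' \<bullet> t) \<boxtimes> (u' \<bullet> u)"
  using assms by (auto simp: arr_def tn_def cmp_def
    intro!: TMor_Comp[symmetric, of "src t" "trg t" "trg t'" "src u" "trg u" "trg u'"])

lemma tn_cmp_cmp:
  assumes "arr C t" "arr C t'" "arr C u" "arr C u'" "src t' = trg t" "src u' = trg u"
    "arr C x" "trg x = TObj C (src t) (src u)"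
  shows "(t' \<boxtimes> u') \<bullet> (t \<boxtimes> u) \<bullet> x = (t' \<bullet> t) \<boxtimes> (u' \<bullet> u) \<bullet> x"
  using assms by (intro cmp_reassoc tn_cmp) auto

lemma iso_tn [simp]: "iso C t \<Longrightarrow> iso C u \<Longrightarrow> iso C (t \<boxtimes> u)"
  by (rule isoI[of _ "inv_arr C t \<boxtimes> inv_arr C u"]) (auto simp: tn_cmp arr_src arr_trg)

lemma inv_tn: "iso C t \<Longrightarrow> iso C u \<Longrightarrow> inv_arr C (t \<boxtimes> u) = inv_arr C t \<boxtimes> inv_arr C u"
  by (rule inv_unique) (auto simp: tn_cmp arr_src arr_trg)

lemma TMor_mod_hom:
  assumes "A \<in> Ob C" "A' \<in> Ob C" "B \<in> Ob C" "B' \<in> Ob C"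
  shows "f \<in> Hom C A A' \<Longrightarrow> (\<lambda>g. TMor C f g) \<in> mod_hom k (hom_module C B B') (hom_module C (TObj C A B) (TObj C A' B'))"
    and "g \<in> Hom C B B' \<Longrightarrow> (\<lambda>f. TMor C f g) \<in> mod_hom k (hom_module C A A') (hom_module C (TObj C A B) (TObj C A' B'))"
  using assms
  by (auto intro!: mod_homI TMor_in TMor_Plus_right[of A A' B B'] TMor_Plus_left[of A A' B B']
      TMor_Scal_left[of A A' B B'] TMor_Scal_right[of A A' B B'])

lemma tn_zer [simp]:
  assumes "arr C t" "A \<in> Ob C" "B \<in> Ob C"
  shows "t \<boxtimes> zer C A B = zer C (TObj C (src t) A) (TObj C (trg t) B)"
    and "zer C A B \<boxtimes> t = zer C (TObj C A (src t)) (TObj C B (trg t))"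
  using mod_hom_zero[OF hom_module hom_module TMor_mod_hom(1)[of "src t" "trg t" A B "mor t"]]
    mod_hom_zero[OF hom_module hom_module TMor_mod_hom(2)[of A B "src t" "trg t" "mor t"]] assms
  by (auto simp: tn_def zer_def arr_def)

lemma sm_tn:
  assumes "A \<in> Ob C" "B \<in> Ob C" "finite I" "F \<in> I \<rightarrow> hm C A B" "arr C x"
  shows "sm C A B I F \<boxtimes> x = sm C (TObj C A (src x)) (TObj C B (trg x)) I (\<lambda>i. F i \<boxtimes> x)"
    and "x \<boxtimes> sm C A B I F = sm C (TObj C (src x) A) (TObj C (trg x) B) I (\<lambda>i. x \<boxtimes> F i)"
proof -
  have *: "(\<lambda>f. TMor C f (mor x)) \<in> mod_hom k (hom_module C A B) (hom_module C (TObj C A (src x)) (TObj C B (trg x)))"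
    "(\<lambda>f. TMor C (mor x) f) \<in> mod_hom k (hom_module C A B) (hom_module C (TObj C (src x) A) (TObj C (trg x) B))"
    using assms by (auto intro!: TMor_mod_hom simp: arr_def)
  show "sm C A B I F \<boxtimes> x = sm C (TObj C A (src x)) (TObj C B (trg x)) I (\<lambda>i. F i \<boxtimes> x)"
    using sm_mod_hom[OF _ _ _ _ assms(3,4) *(1)] assms by (auto simp: arr_def sm_def tn_def)
  show "x \<boxtimes> sm C A B I F = sm C (TObj C (src x) A) (TObj C (trg x) B) I (\<lambda>i. x \<boxtimes> F i)"
    using sm_mod_hom[OF _ _ _ _ assms(3,4) *(2)] assms by (auto simp: arr_def sm_def tn_def)
qed

lemma iso_al [simp]: "A \<in> Ob C \<Longrightarrow> B \<in> Ob C \<Longrightarrow> D \<in> Ob C \<Longrightarrow> iso C (al C A B D)"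
  and iso_lu [simp]: "A \<in> Ob C \<Longrightarrow> iso C (lu C A)"
  and iso_ru [simp]: "A \<in> Ob C \<Longrightarrow> iso C (ru C A)"
  using Assoc_iso[of A B D] LUnit_iso[of A] RUnit_iso[of A]
  by (auto simp: iso_def arr_def al_def lu_def ru_def is_iso_def inverse_mors_def)

lemma al_natural:
  assumes "arr C f" "arr C g" "arr C h" "A' = trg f" "B' = trg g" "D' = trg h"
  shows "al C A' B' D' \<bullet> ((f \<boxtimes> g) \<boxtimes> h) = (f \<boxtimes> g \<boxtimes> h) \<bullet> al C (src f) (src g) (src h)"
  using assms Assoc_natural[of "src f" "trg f" "src g" "trg g" "src h" "trg h" "mor f" "mor g" "mor h"]
  by (simp add: al_def tn_def cmp_def arr_def)

lemma lu_natural: "arr C f \<Longrightarrow> A = trg f \<Longrightarrow> lu C A \<bullet> (idn C (Unit C) \<boxtimes> f) = f \<bullet> lu C (src f)"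
  using LUnit_natural[of "src f" "trg f" "mor f"] by (simp add: lu_def tn_def cmp_def arr_def idn_def)

lemma ru_natural: "arr C f \<Longrightarrow> A = trg f \<Longrightarrow> ru C A \<bullet> (f \<boxtimes> idn C (Unit C)) = f \<bullet> ru C (src f)"
  using RUnit_natural[of "src f" "trg f" "mor f"] by (simp add: ru_def tn_def cmp_def arr_def idn_def)

lemma pentagon_arr:
  assumes "A \<in> Ob C" "B \<in> Ob C" "D \<in> Ob C" "E \<in> Ob C"
  shows "al C A B (TObj C D E) \<bullet> al C (TObj C A B) D E =
    (idn C A \<boxtimes> al C B D E) \<bullet> al C A (TObj C B D) E \<bullet> (al C A B D \<boxtimes> idn C E)"
proof -
  have "al C A B (TObj C D E) \<bullet> al C (TObj C A B) D E =
    ((idn C A \<boxtimes> al C B D E) \<bullet> al C A (TObj C B D) E) \<bullet> (al C A B D \<boxtimes> idn C E)"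
    using pentagon[OF assms] by (simp add: al_def tn_def cmp_def idn_def)
  then show ?thesis using assms by simp
qed

lemma triangle_arr:
  "A \<in> Ob C \<Longrightarrow> B \<in> Ob C \<Longrightarrow> (idn C A \<boxtimes> lu C B) \<bullet> al C A (Unit C) B = ru C A \<boxtimes> idn C B"
  using triangle[of A B] by (simp add: al_def tn_def cmp_def idn_def lu_def ru_def)

text \<open>Kelly's argument: it suffices to check the identity after tensoring with the unit object.\<close>

lemma lu_TObj:
  assumes A: "A \<in> Ob C" and B: "B \<in> Ob C"
  shows "lu C (TObj C A B) \<bullet> al C (Unit C) A B = lu C A \<boxtimes> idn C B"
proof -
  let ?I = "Unit C" and ?i = "idn C (Unit C)"
  let ?x = "lu C (TObj C A B) \<bullet> al C ?I A B" and ?y = "lu C A \<boxtimes> idn C B"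
  \<comment> \<open>The two sides are compared after tensoring with 1 on the left and composing with
    this isomorphism, which consists of two edges of the pentagon for 1, 1, A, B.\<close>
  let ?p = "al C ?I (TObj C ?I A) B \<bullet> (al C ?I ?I A \<boxtimes> idn C B)"
  have p: "iso C ?p" using A B by simp
  have "(?i \<boxtimes> ?x) \<bullet> ?p = (?i \<boxtimes> lu C (TObj C A B)) \<bullet> (?i \<boxtimes> al C ?I A B) \<bullet> ?p"
    using A B by (simp add: tn_cmp_cmp)
  also have "\<dots> = (?i \<boxtimes> lu C (TObj C A B)) \<bullet> al C ?I ?I (TObj C A B) \<bullet> al C (TObj C ?I ?I) A B"
    using A B by (simp add: pentagon_arr)
  also have "\<dots> = (ru C ?I \<boxtimes> idn C (TObj C A B)) \<bullet> al C (TObj C ?I ?I) A B"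
    using A B by (intro cmp_reassoc triangle_arr) auto
  also have "\<dots> = al C ?I A B \<bullet> ((ru C ?I \<boxtimes> idn C A) \<boxtimes> idn C B)"
    using A B by (simp add: al_natural)
  also have "\<dots> = al C ?I A B \<bullet> (((?i \<boxtimes> lu C A) \<bullet> al C ?I ?I A) \<boxtimes> idn C B)"
    using A B by (simp add: triangle_arr)
  also have "\<dots> = al C ?I A B \<bullet> ((?i \<boxtimes> lu C A) \<boxtimes> idn C B) \<bullet> (al C ?I ?I A \<boxtimes> idn C B)"
    using A B by (simp add: tn_cmp)
  also have "\<dots> = ((?i \<boxtimes> ?y) \<bullet> al C ?I (TObj C ?I A) B) \<bullet> (al C ?I ?I A \<boxtimes> idn C B)"
    using A B by (intro cmp_reassoc) (auto simp: al_natural)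
  also have "\<dots> = (?i \<boxtimes> ?y) \<bullet> ?p" using A B by simp
  finally have "?i \<boxtimes> ?x = ?i \<boxtimes> ?y"
    using A B by - (rule iso_cancel_right[OF p], simp_all)
  \<comment> \<open>Tensoring with the unit object is faithful: by naturality of the left unit, the
    tensored morphisms determine the original ones.\<close>
  then have "lu C (TObj C A B) \<bullet> (?i \<boxtimes> ?x) = lu C (TObj C A B) \<bullet> (?i \<boxtimes> ?y)" by (rule arg_cong)
  moreover have "lu C (TObj C A B) \<bullet> (?i \<boxtimes> ?x) = ?x \<bullet> lu C (src ?x)"
    using A B by (intro lu_natural) auto
  moreover have "lu C (TObj C A B) \<bullet> (?i \<boxtimes> ?y) = ?y \<bullet> lu C (src ?y)"
    using A B by (intro lu_natural) auto
  ultimately have "?x \<bullet> lu C (src ?x) = ?y \<bullet> lu C (src ?x)" by simp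
  then show "?x = ?y"
    using A B by - (rule iso_cancel_right[of "lu C (src ?x)"], simp_all)
qed

text \<open>The counit at B of the adjunction that makes D \<otimes> - left adjoint to A \<otimes>
  -, built from an evaluation e : D \<otimes> A \<rightarrow> 1.\<close>

definition ev_arr where
  "ev_arr D A e B = lu C B \<bullet> (e \<boxtimes> idn C B) \<bullet> inv_arr C (al C D A B)"

text \<open>The unit at Z of the same adjunction, built from a coevaluation c : 1 \<rightarrow> A
  \<otimes> D.\<close>

definition coev_arr where
  "coev_arr A D c Z = al C A D Z \<bullet> (c \<boxtimes> idn C Z) \<bullet> inv_arr C (lu C Z)"

lemma ev_arr [simp]:
  assumes "D \<in> Ob C" "A \<in> Ob C" "e \<in> hm C (TObj C D A) (Unit C)" "B \<in> Ob C"
  shows "arr C (ev_arr D A e B)" "src (ev_arr D A e B) = TObj C D (TObj C A B)" "trg (ev_arr D A e B) = B"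
  using assms by (auto simp: ev_arr_def)

lemma coev_arr [simp]:
  assumes "D \<in> Ob C" "A \<in> Ob C" "c \<in> hm C (Unit C) (TObj C A D)" "B \<in> Ob C"
  shows "arr C (coev_arr A D c B)" "src (coev_arr A D c B) = B" "trg (coev_arr A D c B) = TObj C A (TObj C D B)"
  using assms by (auto simp: coev_arr_def)

lemma ev_natural:
  assumes "D \<in> Ob C" "A \<in> Ob C" "e \<in> hm C (TObj C D A) (Unit C)" "arr C f"
  shows "ev_arr D A e (trg f) \<bullet> (idn C D \<boxtimes> idn C A \<boxtimes> f) = f \<bullet> ev_arr D A e (src f)"
proof -
  have ob: "src f \<in> Ob C" "trg f \<in> Ob C" using assms by (auto simp: arr_def)
  have a: "inv_arr C (al C D A (trg f)) \<bullet> (idn C D \<boxtimes> idn C A \<boxtimes> f)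
      = (idn C (TObj C D A) \<boxtimes> f) \<bullet> inv_arr C (al C D A (src f))"
  proof -
    have "al C D A (trg f) \<bullet> (idn C (TObj C D A) \<boxtimes> f) = (idn C D \<boxtimes> idn C A \<boxtimes> f) \<bullet> al C D A (src f)"
      using al_natural[of "idn C D" "idn C A" f] assms ob by simp
    then have "idn C (TObj C D A) \<boxtimes> f = inv_arr C (al C D A (trg f)) \<bullet> (idn C D \<boxtimes> idn C A \<boxtimes> f) \<bullet> al C D A (src f)"
      using assms ob by (intro inv_swap_left) auto
    then show ?thesis using assms ob by simp
  qed
  have "ev_arr D A e (trg f) \<bullet> (idn C D \<boxtimes> idn C A \<boxtimes> f)
      = lu C (trg f) \<bullet> (e \<boxtimes> idn C (trg f)) \<bullet> (idn C (TObj C D A) \<boxtimes> f) \<bullet> inv_arr C (al C D A (src f))"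
    using assms ob by (simp add: ev_arr_def a)
  also have "\<dots> = lu C (trg f) \<bullet> (idn C (Unit C) \<boxtimes> f) \<bullet> (e \<boxtimes> idn C (src f)) \<bullet> inv_arr C (al C D A (src f))"
    using assms ob by (simp add: tn_cmp_cmp)
  also have "\<dots> = (f \<bullet> lu C (src f)) \<bullet> (e \<boxtimes> idn C (src f)) \<bullet> inv_arr C (al C D A (src f))"
    using assms ob by (intro cmp_reassoc lu_natural) auto
  finally show ?thesis using assms ob by (simp add: ev_arr_def)
qed

lemma coev_natural:
  assumes "D \<in> Ob C" "A \<in> Ob C" "c \<in> hm C (Unit C) (TObj C A D)" "arr C f"
  shows "(idn C A \<boxtimes> idn C D \<boxtimes> f) \<bullet> coev_arr A D c (src f) = coev_arr A D c (trg f) \<bullet> f"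
proof -
  have ob: "src f \<in> Ob C" "trg f \<in> Ob C" using assms by (auto simp: arr_def)
  have l: "(idn C (Unit C) \<boxtimes> f) \<bullet> inv_arr C (lu C (src f)) = inv_arr C (lu C (trg f)) \<bullet> f"
  proof -
    have "idn C (Unit C) \<boxtimes> f = inv_arr C (lu C (trg f)) \<bullet> f \<bullet> lu C (src f)"
      using assms ob by (intro inv_swap_left lu_natural) auto
    then show ?thesis using assms ob by simp
  qed
  have "(idn C A \<boxtimes> idn C D \<boxtimes> f) \<bullet> coev_arr A D c (src f)
      = (al C A D (trg f) \<bullet> (idn C (TObj C A D) \<boxtimes> f)) \<bullet> (c \<boxtimes> idn C (src f)) \<bullet> inv_arr C (lu C (src f))"
    unfolding coev_arr_def using assms ob al_natural[of "idn C A" "idn C D" f]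
    by (intro cmp_reassoc) auto
  also have "\<dots> = al C A D (trg f) \<bullet> (c \<boxtimes> idn C (trg f)) \<bullet> (idn C (Unit C) \<boxtimes> f) \<bullet> inv_arr C (lu C (src f))"
    using assms ob by (simp add: tn_cmp_cmp)
  finally show ?thesis using assms ob by (simp add: coev_arr_def l)
qed

text \<open>The zigzag identity for (e, c), tensored with B on the right and rebracketed by the
  pentagon, the triangle and \<open>lu_TObj\<close>. It is the triangle identity on the side of the
  right adjoint A \<otimes> -.\<close>

lemma ev_coev_left:
  assumes "D \<in> Ob C" "A \<in> Ob C" "e \<in> hm C (TObj C D A) (Unit C)" "c \<in> hm C (Unit C) (TObj C A D)"
    and zz: "ru C A \<bullet> (idn C A \<boxtimes> e) \<bullet> al C A D A \<bullet> (c \<boxtimes> idn C A) = lu C A" and B: "B \<in> Ob C"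
  shows "(idn C A \<boxtimes> ev_arr D A e B) \<bullet> coev_arr A D c (TObj C A B) = idn C (TObj C A B)"
proof -
  let ?I = "Unit C" and ?a = "idn C A" and ?b = "idn C B" and ?AB = "TObj C A B"
  \<comment> \<open>Composed with the associator of 1, A, B so that the pentagon and
    \<open>lu_TObj\<close> become applicable; it is cancelled at the end.\<close>
  have "(?a \<boxtimes> ev_arr D A e B) \<bullet> al C A D ?AB \<bullet> (c \<boxtimes> idn C ?AB) \<bullet> al C ?I A B
      = (?a \<boxtimes> ev_arr D A e B) \<bullet> al C A D ?AB \<bullet> al C (TObj C A D) A B \<bullet> ((c \<boxtimes> ?a) \<boxtimes> ?b)"
    using assms al_natural[of c ?a ?b] by simp
  also have "\<dots> = (?a \<boxtimes> ev_arr D A e B) \<bullet> ((?a \<boxtimes> al C D A B) \<bullet> al C A (TObj C D A) B \<bullet> (al C A D A \<boxtimes> ?b)) \<bullet> ((c \<boxtimes> ?a) \<boxtimes> ?b)"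
    using assms by (intro arg_cong[where f = "\<lambda>x. _ \<bullet> x"] cmp_reassoc pentagon_arr) auto
  also have "\<dots> = (?a \<boxtimes> (lu C B \<bullet> (e \<boxtimes> ?b))) \<bullet> al C A (TObj C D A) B \<bullet> ((al C A D A \<bullet> (c \<boxtimes> ?a)) \<boxtimes> ?b)"
    using assms by (simp add: tn_cmp_cmp tn_cmp) (simp add: ev_arr_def)
  also have "\<dots> = (?a \<boxtimes> lu C B) \<bullet> (?a \<boxtimes> e \<boxtimes> ?b) \<bullet> al C A (TObj C D A) B \<bullet> ((al C A D A \<bullet> (c \<boxtimes> ?a)) \<boxtimes> ?b)"
    using assms by (simp add: tn_cmp_cmp)
  also have "\<dots> = (?a \<boxtimes> lu C B) \<bullet> (al C A ?I B \<bullet> ((?a \<boxtimes> e) \<boxtimes> ?b)) \<bullet> ((al C A D A \<bullet> (c \<boxtimes> ?a)) \<boxtimes> ?b)"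
    using assms al_natural[of ?a e ?b]
    by (intro arg_cong[where f = "\<lambda>x. _ \<bullet> x"] cmp_reassoc) auto
  also have "\<dots> = (?a \<boxtimes> lu C B) \<bullet> al C A ?I B \<bullet> (((?a \<boxtimes> e) \<bullet> al C A D A \<bullet> (c \<boxtimes> ?a)) \<boxtimes> ?b)"
    using assms by (simp add: tn_cmp)
  also have "\<dots> = (ru C A \<boxtimes> ?b) \<bullet> (((?a \<boxtimes> e) \<bullet> al C A D A \<bullet> (c \<boxtimes> ?a)) \<boxtimes> ?b)"
    using assms by (intro cmp_reassoc triangle_arr) auto
  also have "\<dots> = lu C A \<boxtimes> ?b" using assms by (simp add: tn_cmp)
  also have "\<dots> = lu C ?AB \<bullet> al C ?I A B" using assms by (simp add: lu_TObj)
  finally have "((?a \<boxtimes> ev_arr D A e B) \<bullet> al C A D ?AB \<bullet> (c \<boxtimes> idn C ?AB)) \<bullet> al C ?I A B = lu C ?AB \<bullet> al C ?I A B"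
    using assms by simp
  then have "(?a \<boxtimes> ev_arr D A e B) \<bullet> al C A D ?AB \<bullet> (c \<boxtimes> idn C ?AB) = lu C ?AB"
    using assms by - (rule iso_cancel_right[of "al C ?I A B"], simp_all)
  then have "((?a \<boxtimes> ev_arr D A e B) \<bullet> al C A D ?AB \<bullet> (c \<boxtimes> idn C ?AB)) \<bullet> inv_arr C (lu C ?AB) = idn C ?AB"
    using assms by simp
  then show ?thesis using assms by (simp add: coev_arr_def)
qed

text \<open>The counterpart of \<open>ev_coev_left\<close> with the roles of the objects exchanged:
  here A \<otimes> - is the left adjoint, and the other zigzag identity gives the triangle identity
  on its side.\<close>

lemma ev_coev_right:
  assumes "D \<in> Ob C" "A \<in> Ob C" "e \<in> hm C (TObj C A D) (Unit C)" "c \<in> hm C (Unit C) (TObj C D A)"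
    and zz: "lu C A \<bullet> (e \<boxtimes> idn C A) \<bullet> inv_arr C (al C A D A) \<bullet> (idn C A \<boxtimes> c) = ru C A" and Z: "Z \<in> Ob C"
  shows "ev_arr A D e (TObj C A Z) \<bullet> (idn C A \<boxtimes> coev_arr D A c Z) = idn C (TObj C A Z)"
proof -
  let ?I = "Unit C" and ?a = "idn C A" and ?z = "idn C Z" and ?AZ = "TObj C A Z"
  \<comment> \<open>The pentagon for A, D, A, Z with two of its edges moved to the opposite side by
    inversion.\<close>
  have pent: "inv_arr C (al C A D ?AZ) \<bullet> (?a \<boxtimes> al C D A Z) \<bullet> al C A (TObj C D A) Z
      = al C (TObj C A D) A Z \<bullet> (inv_arr C (al C A D A) \<boxtimes> ?z)"
  proof -
    have "((?a \<boxtimes> al C D A Z) \<bullet> al C A (TObj C D A) Z) \<bullet> (al C A D A \<boxtimes> ?z) = al C A D ?AZ \<bullet> al C (TObj C A D) A Z"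
      using assms by (simp add: pentagon_arr)
    then have "(?a \<boxtimes> al C D A Z) \<bullet> al C A (TObj C D A) Z
        = (al C A D ?AZ \<bullet> al C (TObj C A D) A Z) \<bullet> inv_arr C (al C A D A \<boxtimes> ?z)"
      using assms by (intro inv_swap_right) auto
    then show ?thesis using assms by (simp add: inv_tn)
  qed
  have "(ev_arr A D e ?AZ \<bullet> (?a \<boxtimes> al C D A Z) \<bullet> (?a \<boxtimes> c \<boxtimes> ?z)) \<bullet> al C A ?I Z
      = ev_arr A D e ?AZ \<bullet> (?a \<boxtimes> al C D A Z) \<bullet> al C A (TObj C D A) Z \<bullet> ((?a \<boxtimes> c) \<boxtimes> ?z)"
    using assms al_natural[of ?a c ?z] by simp
  also have "\<dots> = lu C ?AZ \<bullet> (e \<boxtimes> idn C ?AZ) \<bullet> (inv_arr C (al C A D ?AZ) \<bullet> (?a \<boxtimes> al C D A Z) \<bullet> al C A (TObj C D A) Z) \<bullet> ((?a \<boxtimes> c) \<boxtimes> ?z)"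
    using assms by (simp add: ev_arr_def)
  also have "\<dots> = lu C ?AZ \<bullet> (e \<boxtimes> ?a \<boxtimes> ?z) \<bullet> al C (TObj C A D) A Z \<bullet> ((inv_arr C (al C A D A) \<bullet> (?a \<boxtimes> c)) \<boxtimes> ?z)"
    unfolding pent using assms by (simp add: tn_cmp)
  also have "\<dots> = lu C ?AZ \<bullet> (al C ?I A Z \<bullet> ((e \<boxtimes> ?a) \<boxtimes> ?z)) \<bullet> ((inv_arr C (al C A D A) \<bullet> (?a \<boxtimes> c)) \<boxtimes> ?z)"
    using assms al_natural[of e ?a ?z]
    by (intro arg_cong[where f = "\<lambda>x. _ \<bullet> x"] cmp_reassoc) auto
  also have "\<dots> = lu C ?AZ \<bullet> al C ?I A Z \<bullet> (((e \<boxtimes> ?a) \<bullet> inv_arr C (al C A D A) \<bullet> (?a \<boxtimes> c)) \<boxtimes> ?z)"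
    using assms by (simp add: tn_cmp)
  also have "\<dots> = (lu C A \<boxtimes> ?z) \<bullet> (((e \<boxtimes> ?a) \<bullet> inv_arr C (al C A D A) \<bullet> (?a \<boxtimes> c)) \<boxtimes> ?z)"
    using assms by (intro cmp_reassoc lu_TObj) auto
  also have "\<dots> = ru C A \<boxtimes> ?z" using assms by (simp add: tn_cmp)
  also have "\<dots> = (?a \<boxtimes> lu C Z) \<bullet> al C A ?I Z" using assms by (simp add: triangle_arr)
  finally have "ev_arr A D e ?AZ \<bullet> (?a \<boxtimes> al C D A Z) \<bullet> (?a \<boxtimes> c \<boxtimes> ?z) = ?a \<boxtimes> lu C Z"
    using assms by - (rule iso_cancel_right[of "al C A ?I Z"], simp_all)
  then have "(ev_arr A D e ?AZ \<bullet> (?a \<boxtimes> al C D A Z) \<bullet> (?a \<boxtimes> c \<boxtimes> ?z)) \<bullet> (?a \<boxtimes> inv_arr C (lu C Z)) = idn C ?AZ"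
    using assms by (simp add: tn_cmp)
  then show ?thesis using assms by (simp add: coev_arr_def tn_cmp)
qed

lemma left_dual_arr:
  assumes "is_left_dual C A D e c"
  defines "e' \<equiv> Arrow (TObj C D A) e (Unit C)" and "c' \<equiv> Arrow (Unit C) c (TObj C A D)"
  shows "A \<in> Ob C" "D \<in> Ob C" "e' \<in> hm C (TObj C D A) (Unit C)" "c' \<in> hm C (Unit C) (TObj C A D)"
    "ru C A \<bullet> (idn C A \<boxtimes> e') \<bullet> al C A D A \<bullet> (c' \<boxtimes> idn C A) = lu C A"
    "lu C D \<bullet> (e' \<boxtimes> idn C D) \<bullet> inv_arr C (al C D A D) \<bullet> (idn C D \<boxtimes> c') = ru C D"
proof -
  show ob: "A \<in> Ob C" "D \<in> Ob C" "e' \<in> hm C (TObj C D A) (Unit C)" "c' \<in> hm C (Unit C) (TObj C A D)"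
    using assms by (auto simp: is_left_dual_def arr_def)
  have "((ru C A \<bullet> (idn C A \<boxtimes> e')) \<bullet> al C A D A) \<bullet> (c' \<boxtimes> idn C A) = lu C A"
    "((lu C D \<bullet> (e' \<boxtimes> idn C D)) \<bullet> inv_arr C (al C D A D)) \<bullet> (idn C D \<boxtimes> c') = ru C D"
    using assms by (auto simp: is_left_dual_def cmp_def tn_def al_def lu_def ru_def idn_def inv_arr_def)
  then show "ru C A \<bullet> (idn C A \<boxtimes> e') \<bullet> al C A D A \<bullet> (c' \<boxtimes> idn C A) = lu C A"
    "lu C D \<bullet> (e' \<boxtimes> idn C D) \<bullet> inv_arr C (al C D A D) \<bullet> (idn C D \<boxtimes> c') = ru C D"
    using ob by auto
qed

text \<open>Only one of the two triangle identities of the adjunction between tensoring with an object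
  and tensoring with its dual is needed, on either side.\<close>

lemma ker_arr_tn_left:
  assumes A: "A \<in> Ob C" and f: "arr C f" and ker: "ker_arr C f i"
  shows "ker_arr C (idn C A \<boxtimes> f) (idn C A \<boxtimes> i)"
proof -
  obtain D e c where "is_left_dual C A D e c" using left_dual[OF A] by blast
  note d = left_dual_arr[OF this]
  obtain e c where D: "D \<in> Ob C" and e: "e \<in> hm C (TObj C D A) (Unit C)" and c: "c \<in> hm C (Unit C) (TObj C A D)"
    and zz: "ru C A \<bullet> (idn C A \<boxtimes> e) \<bullet> al C A D A \<bullet> (c \<boxtimes> idn C A) = lu C A"
    using d by blast
  have i: "arr C i" "trg i = src f" using ker_arr_arr[OF ker f] by auto
  have ob: "src f \<in> Ob C" "trg f \<in> Ob C" "src i \<in> Ob C" using f i by (auto simp: arr_src arr_trg)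
  \<comment> \<open>\<Phi> is the transposition Hom(Z, A \<otimes> B) \<rightarrow> Hom(D \<otimes>
    Z, B) and \<Psi> goes back. That \<Psi> undoes \<Phi> is the triangle identity of
    \<open>ev_coev_left\<close>.\<close>
  define \<Phi> where "\<Phi> B z = ev_arr D A e B \<bullet> (idn C D \<boxtimes> z)" for B z
  define \<Psi> where "\<Psi> Z w = (idn C A \<boxtimes> w) \<bullet> coev_arr A D c Z" for Z w
  have \<Phi>: "arr C (\<Phi> B z)" "src (\<Phi> B z) = TObj C D (src z)" "trg (\<Phi> B z) = B"
    if "arr C z" "trg z = TObj C A B" "B \<in> Ob C" for z B
    using that D A e by (auto simp: \<Phi>_def)
  have \<Psi>\<Phi>: "\<Psi> (src z) (\<Phi> B z) = z" if z: "arr C z" "trg z = TObj C A B" "B \<in> Ob C" for z B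
  proof -
    have "\<Psi> (src z) (\<Phi> B z) = (idn C A \<boxtimes> ev_arr D A e B) \<bullet> (idn C A \<boxtimes> idn C D \<boxtimes> z) \<bullet> coev_arr A D c (src z)"
      using z D A e c by (simp add: \<Phi>_def \<Psi>_def tn_cmp_cmp arr_src)
    also have "\<dots> = (idn C A \<boxtimes> ev_arr D A e B) \<bullet> coev_arr A D c (TObj C A B) \<bullet> z"
      using z D A e c by (simp add: coev_natural)
    also have "\<dots> = idn C (TObj C A B) \<bullet> z"
      using z D A e c by (intro cmp_reassoc ev_coev_left zz) auto
    finally show ?thesis using z by simp
  qed
  have \<Phi>f: "\<Phi> (trg g) ((idn C A \<boxtimes> g) \<bullet> z) = g \<bullet> \<Phi> (src g) z"
    if g: "arr C g" and z: "arr C z" "trg z = TObj C A (src g)" for g z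
  proof -
    have gob: "src g \<in> Ob C" "trg g \<in> Ob C" using g by (auto simp: arr_def)
    have "\<Phi> (trg g) ((idn C A \<boxtimes> g) \<bullet> z) = ev_arr D A e (trg g) \<bullet> (idn C D \<boxtimes> idn C A \<boxtimes> g) \<bullet> (idn C D \<boxtimes> z)"
      using g z gob D A by (simp add: \<Phi>_def tn_cmp)
    also have "\<dots> = (g \<bullet> ev_arr D A e (src g)) \<bullet> (idn C D \<boxtimes> z)"
      using g z gob D A e by (intro cmp_reassoc ev_natural) auto
    finally show ?thesis using g z gob D A e by (simp add: \<Phi>_def)
  qed
  show ?thesis
  proof (rule ker_arrI)
    show "(idn C A \<boxtimes> f) \<bullet> (idn C A \<boxtimes> i) = zer C (src (idn C A \<boxtimes> i)) (trg (idn C A \<boxtimes> f))"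
      using A f i ob ker_arr_zero[OF ker] by (simp add: tn_cmp)
    fix z assume z: "arr C z" "trg z = src (idn C A \<boxtimes> f)"
      "(idn C A \<boxtimes> f) \<bullet> z = zer C (src z) (trg (idn C A \<boxtimes> f))"
    have zob: "src z \<in> Ob C" using z by (simp add: arr_src)
    have z2: "trg z = TObj C A (src f)" using z by simp
    \<comment> \<open>Transposition turns a morphism killed by A \<otimes> f into one killed by f.
      The latter factors through i, and the factorization is transposed back.\<close>
    have "f \<bullet> \<Phi> (src f) z = zer C (TObj C D (src z)) (trg f)"
      using \<Phi>f[OF f z(1) z2] z(3) zob ob D A e by (simp add: \<Phi>_def)
    then obtain w where w: "arr C w" "src w = TObj C D (src z)" "trg w = src i" "i \<bullet> w = \<Phi> (src f) z"
      using ker_arr_lift[OF ker, of "\<Phi> (src f) z"] \<Phi>[OF z(1) z2 ob(1)] by auto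
    have "(idn C A \<boxtimes> i) \<bullet> \<Psi> (src z) w = \<Psi> (src z) (i \<bullet> w)"
      using w(1-3) i A D c zob by (simp add: \<Psi>_def tn_cmp_cmp)
    then have "(idn C A \<boxtimes> i) \<bullet> \<Psi> (src z) w = z" using w(4) \<Psi>\<Phi>[OF z(1) z2 ob(1)] by simp
    then show "\<exists>w. arr C w \<and> src w = src z \<and> trg w = src (idn C A \<boxtimes> i) \<and> (idn C A \<boxtimes> i) \<bullet> w = z"
      using w(1-3) A D c zob by (intro exI[of _ "\<Psi> (src z) w"]) (auto simp: \<Psi>_def)
  next
    fix z z' assume z: "arr C z" "arr C z'" "src z = src z'" "trg z = src (idn C A \<boxtimes> i)"
      "trg z' = src (idn C A \<boxtimes> i)" "(idn C A \<boxtimes> i) \<bullet> z = (idn C A \<boxtimes> i) \<bullet> z'"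
    have z2: "trg z = TObj C A (src i)" "trg z' = TObj C A (src i)" using z by simp_all
    have "i \<bullet> \<Phi> (src i) z = i \<bullet> \<Phi> (src i) z'"
      using \<Phi>f[OF i(1) z(1) z2(1)] \<Phi>f[OF i(1) z(2) z2(2)] z(6) by simp
    then have "\<Phi> (src i) z = \<Phi> (src i) z'"
      using \<Phi>[OF z(1) z2(1) ob(3)] \<Phi>[OF z(2) z2(2) ob(3)] z(3) f
      by - (rule ker_arr_mono[OF ker], simp_all)
    then show "z = z'"
      using \<Psi>\<Phi>[OF z(1) z2(1) ob(3)] \<Psi>\<Phi>[OF z(2) z2(2) ob(3)] z(3) by metis
  qed (use A f i in auto)
qed

text \<open>Dually, A is a left dual of some D, which makes A \<otimes> - a left adjoint, and left
  adjoints preserve cokernels.\<close>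

lemma cok_arr_tn_left:
  assumes A: "A \<in> Ob C" and f: "arr C f" and cok: "cok_arr C f p"
  shows "cok_arr C (idn C A \<boxtimes> f) (idn C A \<boxtimes> p)"
proof -
  obtain D e c where "is_left_dual C D A e c" using right_dual[OF A] by blast
  note d = left_dual_arr[OF this]
  obtain e c where D: "D \<in> Ob C" and e: "e \<in> hm C (TObj C A D) (Unit C)" and c: "c \<in> hm C (Unit C) (TObj C D A)"
    and zz: "lu C A \<bullet> (e \<boxtimes> idn C A) \<bullet> inv_arr C (al C A D A) \<bullet> (idn C A \<boxtimes> c) = ru C A"
    using d by blast
  have p: "arr C p" "src p = trg f" using cok_arr_arr[OF cok f] by auto
  have ob: "src f \<in> Ob C" "trg f \<in> Ob C" "trg p \<in> Ob C" using f p by (auto simp: arr_src arr_trg)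
  define \<Phi> where "\<Phi> Z x = (idn C D \<boxtimes> x) \<bullet> coev_arr D A c Z" for Z x
  define \<Psi> where "\<Psi> W y = ev_arr A D e W \<bullet> (idn C A \<boxtimes> y)" for W y
  have \<Phi>: "arr C (\<Phi> Z x)" "src (\<Phi> Z x) = Z" "trg (\<Phi> Z x) = TObj C D (trg x)"
    if "arr C x" "src x = TObj C A Z" "Z \<in> Ob C" for x Z
    using that D A c by (auto simp: \<Phi>_def)
  have \<Psi>\<Phi>: "\<Psi> (trg x) (\<Phi> Z x) = x" if x: "arr C x" "src x = TObj C A Z" "Z \<in> Ob C" for x Z
  proof -
    have "\<Psi> (trg x) (\<Phi> Z x) = ev_arr A D e (trg x) \<bullet> (idn C A \<boxtimes> idn C D \<boxtimes> x) \<bullet> (idn C A \<boxtimes> coev_arr D A c Z)"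
      using x D A e c by (simp add: \<Phi>_def \<Psi>_def tn_cmp arr_trg)
    also have "\<dots> = (x \<bullet> ev_arr A D e (src x)) \<bullet> (idn C A \<boxtimes> coev_arr D A c Z)"
      using x D A e c by (intro cmp_reassoc ev_natural) (auto simp: arr_trg)
    also have "\<dots> = x \<bullet> idn C (TObj C A Z)"
      using x D A e c by (simp add: ev_coev_right[OF D A e c zz])
    finally show ?thesis using x by simp
  qed
  have \<Phi>f: "\<Phi> (src g) (x \<bullet> (idn C A \<boxtimes> g)) = \<Phi> (trg g) x \<bullet> g"
    if g: "arr C g" and x: "arr C x" "src x = TObj C A (trg g)" for g x
  proof -
    have gob: "src g \<in> Ob C" "trg g \<in> Ob C" using g by (auto simp: arr_def)
    have "\<Phi> (src g) (x \<bullet> (idn C A \<boxtimes> g)) = (idn C D \<boxtimes> x) \<bullet> (idn C D \<boxtimes> idn C A \<boxtimes> g) \<bullet> coev_arr D A c (src g)"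
      using g x gob D A c by (simp add: \<Phi>_def tn_cmp_cmp)
    also have "\<dots> = (idn C D \<boxtimes> x) \<bullet> coev_arr D A c (trg g) \<bullet> g"
      using g x gob D A c by (simp add: coev_natural)
    finally show ?thesis using g x gob D A c by (simp add: \<Phi>_def)
  qed
  show ?thesis
  proof (rule cok_arrI)
    show "(idn C A \<boxtimes> p) \<bullet> (idn C A \<boxtimes> f) = zer C (src (idn C A \<boxtimes> f)) (trg (idn C A \<boxtimes> p))"
      using A f p ob cok_arr_zero[OF cok] by (simp add: tn_cmp)
    fix x assume x: "arr C x" "src x = trg (idn C A \<boxtimes> f)"
      "x \<bullet> (idn C A \<boxtimes> f) = zer C (src (idn C A \<boxtimes> f)) (trg x)"
    have xob: "trg x \<in> Ob C" using x by (simp add: arr_trg)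
    have x2: "src x = TObj C A (trg f)" using x by simp
    have "\<Phi> (trg f) x \<bullet> f = zer C (src f) (TObj C D (trg x))"
      using \<Phi>f[OF f x(1) x2] x(3) xob ob D A c by (simp add: \<Phi>_def)
    then obtain w where w: "arr C w" "src w = trg p" "trg w = TObj C D (trg x)" "w \<bullet> p = \<Phi> (trg f) x"
      using cok_arr_lift[OF cok, of "\<Phi> (trg f) x"] \<Phi>[OF x(1) x2 ob(2)] by auto
    have "\<Psi> (trg x) w \<bullet> (idn C A \<boxtimes> p) = \<Psi> (trg x) (w \<bullet> p)"
      using w(1-3) p A D e xob by (simp add: \<Psi>_def tn_cmp)
    then have "\<Psi> (trg x) w \<bullet> (idn C A \<boxtimes> p) = x" using w(4) \<Psi>\<Phi>[OF x(1) x2 ob(2)] by simp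
    then show "\<exists>w. arr C w \<and> src w = trg (idn C A \<boxtimes> p) \<and> trg w = trg x \<and> w \<bullet> (idn C A \<boxtimes> p) = x"
      using w(1-3) A D e xob by (intro exI[of _ "\<Psi> (trg x) w"]) (auto simp: \<Psi>_def)
  next
    fix x x' assume x: "arr C x" "arr C x'" "trg x = trg x'" "src x = trg (idn C A \<boxtimes> p)"
      "src x' = trg (idn C A \<boxtimes> p)" "x \<bullet> (idn C A \<boxtimes> p) = x' \<bullet> (idn C A \<boxtimes> p)"
    have x2: "src x = TObj C A (trg p)" "src x' = TObj C A (trg p)" using x by simp_all
    have "\<Phi> (trg p) x \<bullet> p = \<Phi> (trg p) x' \<bullet> p"
      using \<Phi>f[OF p(1) x(1) x2(1)] \<Phi>f[OF p(1) x(2) x2(2)] x(6) by simp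
    then have "\<Phi> (trg p) x = \<Phi> (trg p) x'"
      using \<Phi>[OF x(1) x2(1) ob(3)] \<Phi>[OF x(2) x2(2) ob(3)] x(3) f
      by - (rule cok_arr_epi[OF cok], simp_all)
    then show "x = x'"
      using \<Psi>\<Phi>[OF x(1) x2(1) ob(3)] \<Psi>\<Phi>[OF x(2) x2(2) ob(3)] x(3) by metis
  qed (use A f p in auto)
qed

end

text \<open>Reversing the tensor product exchanges left and right duals, which reduces tensoring on the
  right to tensoring on the left.\<close>

definition rev_cat :: "('k, 'o, 'm, 'z) mon_cat_scheme \<Rightarrow> ('k, 'o, 'm, 'z) mon_cat_scheme" where
  "rev_cat C = C\<lparr>TObj := \<lambda>A B. TObj C B A, TMor := \<lambda>f g. TMor C g f,
     Assoc := \<lambda>A B D. inv_mor C (TObj C (TObj C D B) A) (TObj C D (TObj C B A)) (Assoc C D B A),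
     LUnit := RUnit C, RUnit := LUnit C\<rparr>"

lemma rev_cat_sel [simp]:
  "Ob (rev_cat C) = Ob C" "Hom (rev_cat C) = Hom C" "Idn (rev_cat C) = Idn C" "Comp (rev_cat C) = Comp C"
  "Zer (rev_cat C) = Zer C" "Plus (rev_cat C) = Plus C" "Scal (rev_cat C) = Scal C" "Unit (rev_cat C) = Unit C"
  "TObj (rev_cat C) A B = TObj C B A" "TMor (rev_cat C) f g = TMor C g f"
  "Assoc (rev_cat C) A B D = inv_mor C (TObj C (TObj C D B) A) (TObj C D (TObj C B A)) (Assoc C D B A)"
  "LUnit (rev_cat C) = RUnit C" "RUnit (rev_cat C) = LUnit C"
  by (simp_all add: rev_cat_def)

text \<open>These notions look only at the linear category, which reversal leaves unchanged.\<close>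

lemma rev_cat_notions [simp]:
  "hom_module (rev_cat C) = hom_module C"
  "inverse_mors (rev_cat C) = inverse_mors C"
  "is_iso (rev_cat C) = is_iso C"
  "inv_mor (rev_cat C) = inv_mor C"
  "is_mono (rev_cat C) = is_mono C"
  "is_epi (rev_cat C) = is_epi C"
  "is_zero_object (rev_cat C) = is_zero_object C"
  "is_kernel (rev_cat C) = is_kernel C"
  "is_cokernel (rev_cat C) = is_cokernel C"
proof -
  show h: "hom_module (rev_cat C) = hom_module C"
    by (intro ext) (simp add: hom_module_def)
  show i: "inverse_mors (rev_cat C) = inverse_mors C"
    by (intro ext) (simp add: inverse_mors_def)
  then show "is_iso (rev_cat C) = is_iso C" "inv_mor (rev_cat C) = inv_mor C"
    by (intro ext, simp add: is_iso_def inv_mor_def)+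
qed (intro ext, simp add: is_mono_def is_epi_def is_zero_object_def is_kernel_def is_cokernel_def)+

lemma rev_cat_direct_sum [simp]: "direct_sum (rev_cat C) = direct_sum C"
  by (intro ext) (simp add: direct_sum_def)

lemma rev_cat_arrows [simp]:
  "arr (rev_cat C) = arr C" "cmp (rev_cat C) = cmp C" "idn (rev_cat C) = idn C"
  "t \<boxtimes>\<^bsub>rev_cat C\<^esub> u = u \<boxtimes>\<^bsub>C\<^esub> t" "ker_arr (rev_cat C) = ker_arr C" "cok_arr (rev_cat C) = cok_arr C"
  by (intro ext, simp add: arr_def cmp_def idn_def ker_arr_def cok_arr_def)+ (simp_all add: tn_def,
    (intro ext, simp add: arr_def cmp_def idn_def ker_arr_def cok_arr_def)+)

context tensor_category
begin

lemma inv_al_mor: "mor (inv_arr C (al C A B D)) =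
    inv_mor C (TObj C (TObj C A B) D) (TObj C A (TObj C B D)) (Assoc C A B D)"
  by (simp add: inv_arr_def al_def)

lemma rev_tensor_category: "tensor_category k (rev_cat C)"
proof (intro tensor_category.intro abelian_category.intro linear_category.intro)
  show "category (rev_cat C)"
    using category_axioms unfolding category_def rev_cat_sel .
  show "linear_category_axioms k (rev_cat C)"
    using linear_category.axioms(3)[OF linear_category_axioms]
    unfolding linear_category_axioms_def rev_cat_sel rev_cat_notions .
  show "abelian_category_axioms (rev_cat C)"
    using abelian_category.axioms(2)[OF abelian_category_axioms]
    unfolding abelian_category_axioms_def rev_cat_sel rev_cat_notions rev_cat_direct_sum .
  show "field k" ..
  show "tensor_category_axioms k (rev_cat C)"
  proof (rule tensor_category_axioms.intro, unfold rev_cat_sel rev_cat_notions)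
    fix A B D E assume ob: "A \<in> Ob C" "B \<in> Ob C" "D \<in> Ob C" "E \<in> Ob C"
    \<comment> \<open>The pentagon of the reversed category is the inverse of the original one with
      the objects in the opposite order. The triangle and the naturality of the associator are
      treated below by inversion as well.\<close>
    have "inv_arr C (al C E D (TObj C B A) \<bullet> al C (TObj C E D) B A) =
        inv_arr C ((idn C E \<boxtimes> al C D B A) \<bullet> al C E (TObj C D B) A \<bullet> (al C E D B \<boxtimes> idn C A))"
      using ob by (simp only: pentagon_arr)
    then have "inv_arr C (al C (TObj C E D) B A) \<bullet> inv_arr C (al C E D (TObj C B A)) =
      ((inv_arr C (al C E D B) \<boxtimes> idn C A) \<bullet> inv_arr C (al C E (TObj C D B) A)) \<bullet> (idn C E \<boxtimes> inv_arr C (al C D B A))"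
      using ob by (simp add: inv_cmp_distrib inv_tn)
    from arg_cong[OF this, of mor] show
      "inv_mor C (TObj C (TObj C (TObj C E D) B) A) (TObj C (TObj C E D) (TObj C B A)) (Assoc C (TObj C E D) B A) \<cdot>
        inv_mor C (TObj C (TObj C E D) (TObj C B A)) (TObj C E (TObj C D (TObj C B A))) (Assoc C E D (TObj C B A)) =
        TMor C (inv_mor C (TObj C (TObj C E D) B) (TObj C E (TObj C D B)) (Assoc C E D B)) (Idn C A) \<cdot>
        inv_mor C (TObj C (TObj C E (TObj C D B)) A) (TObj C E (TObj C (TObj C D B) A)) (Assoc C E (TObj C D B) A) \<cdot>
        TMor C (Idn C E) (inv_mor C (TObj C (TObj C D B) A) (TObj C D (TObj C B A)) (Assoc C D B A))"
      by (simp add: mor_cmp mor_tn mor_idn inv_al_mor)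
  next
    fix A B assume ob: "A \<in> Ob C" "B \<in> Ob C"
    have "(ru C B \<boxtimes> idn C A) \<bullet> inv_arr C (al C B (Unit C) A) = idn C B \<boxtimes> lu C A"
      using ob by (simp flip: triangle_arr)
    from arg_cong[OF this, of mor] show
      "TMor C (RUnit C B) (Idn C A) \<cdot> inv_mor C (TObj C (TObj C B (Unit C)) A) (TObj C B (TObj C (Unit C) A)) (Assoc C B (Unit C) A) =
        TMor C (Idn C B) (LUnit C A)"
      by (simp add: mor_cmp mor_tn mor_idn inv_al_mor lu_def ru_def)
  next
    fix A B D assume ob: "A \<in> Ob C" "B \<in> Ob C" "D \<in> Ob C"
    have "iso C (inv_arr C (al C D B A))" using ob by simp
    then show "is_iso C (TObj C D (TObj C B A)) (TObj C (TObj C D B) A)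
        (inv_mor C (TObj C (TObj C D B) A) (TObj C D (TObj C B A)) (Assoc C D B A))"
      by (simp add: iso_def inv_al_mor)
  next
    fix A A' B B' D D' f g h
    assume ob: "A \<in> Ob C" "A' \<in> Ob C" "B \<in> Ob C" "B' \<in> Ob C" "D \<in> Ob C" "D' \<in> Ob C"
      and h: "f \<in> Hom C A A'" "g \<in> Hom C B B'" "h \<in> Hom C D D'"
    define f' g' h' where "f' = Arrow A f A'" and "g' = Arrow B g B'" and "h' = Arrow D h D'"
    have fgh: "arr C f'" "arr C g'" "arr C h'" and s: "src f' = A" "trg f' = A'" "src g' = B" "trg g' = B'"
      "src h' = D" "trg h' = D'" "mor f' = f" "mor g' = g" "mor h' = h"
      using ob h by (auto simp: f'_def g'_def h'_def arr_def)
    have "(h' \<boxtimes> g') \<boxtimes> f' = inv_arr C (al C D' B' A') \<bullet> (h' \<boxtimes> g' \<boxtimes> f') \<bullet> al C D B A"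
      using fgh s ob al_natural[of h' g' f'] by (intro inv_swap_left) auto
    then have "inv_arr C (al C D' B' A') \<bullet> (h' \<boxtimes> g' \<boxtimes> f') = ((h' \<boxtimes> g') \<boxtimes> f') \<bullet> inv_arr C (al C D B A)"
      using fgh s ob by simp
    from arg_cong[OF this, of mor] show
      "inv_mor C (TObj C (TObj C D' B') A') (TObj C D' (TObj C B' A')) (Assoc C D' B' A') \<cdot> TMor C h (TMor C g f) =
       TMor C (TMor C h g) f \<cdot> inv_mor C (TObj C (TObj C D B) A) (TObj C D (TObj C B A)) (Assoc C D B A)"
      by (simp add: mor_cmp mor_tn mor_idn inv_al_mor s)
  next
    \<comment> \<open>Reversal exchanges the two zigzag identities, with a double inverse of the
      associator cancelling, so existence of left duals and of right duals are interchanged.\<close>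
    have *: "is_left_dual (rev_cat C) A D e c \<longleftrightarrow> is_left_dual C D A e c" for A D e c
    proof (cases "A \<in> Ob C \<and> D \<in> Ob C \<and> e \<in> Hom C (TObj C A D) (Unit C) \<and> c \<in> Hom C (Unit C) (TObj C D A)")
      case True
      let ?e = "Arrow (TObj C A D) e (Unit C)" and ?c = "Arrow (Unit C) c (TObj C D A)"
      have "inv_arr C (inv_arr C (al C D A D)) = al C D A D" using True by simp
      from arg_cong[OF this, of mor] have a: "inv_mor C (TObj C D (TObj C A D)) (TObj C (TObj C D A) D)
          (inv_mor C (TObj C (TObj C D A) D) (TObj C D (TObj C A D)) (Assoc C D A D)) = Assoc C D A D"
        by (simp add: inv_arr_def al_def)
      show ?thesis unfolding is_left_dual_def using True a by (auto)
    next
      case False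
      then show ?thesis unfolding is_left_dual_def by auto
    qed
    show "A \<in> Ob C \<Longrightarrow> \<exists>D e c. is_left_dual (rev_cat C) A D e c" for A
      using right_dual unfolding * .
    show "A \<in> Ob C \<Longrightarrow> \<exists>D e c. is_left_dual (rev_cat C) D A e c" for A
      using left_dual unfolding * .
  qed ((rule Unit_in TObj_in TMor_in TMor_Idn TMor_Comp TMor_Plus_left TMor_Plus_right TMor_Scal_left
      TMor_Scal_right LUnit_iso RUnit_iso LUnit_natural RUnit_natural End_Unit; assumption)+)
qed

lemma ker_arr_tn_right:
  "A \<in> Ob C \<Longrightarrow> arr C f \<Longrightarrow> ker_arr C f i \<Longrightarrow> ker_arr C (f \<boxtimes> idn C A) (i \<boxtimes> idn C A)"
  using tensor_category.ker_arr_tn_left[OF rev_tensor_category, of A f i] by simp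

lemma cok_arr_tn_right:
  "A \<in> Ob C \<Longrightarrow> arr C f \<Longrightarrow> cok_arr C f p \<Longrightarrow> cok_arr C (f \<boxtimes> idn C A) (p \<boxtimes> idn C A)"
  using tensor_category.cok_arr_tn_left[OF rev_tensor_category, of A f p] by simp

end

section \<open>Existence of finite direct sums\<close>

context abelian_category
begin

lemma ex_dsum:
  assumes "finite I" "\<And>i. i \<in> I \<Longrightarrow> X i \<in> Ob C"
  shows "\<exists>S \<iota> \<pi>. dsum C I X S \<iota> \<pi>"
  using assms
proof (induction I)
  case empty
  obtain Z where Z: "is_zero_object C Z" using zero_object by auto
  then have Zo: "Z \<in> Ob C" by (simp add: is_zero_object_def)
  have "idn C Z = zer C Z Z" using is_zero_object_arr(1)[OF Z arr_idn[OF Zo]] by simp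
  then show ?case using Zo by (auto simp: dsum_def sm_empty)
next
  case (insert i I)
  then obtain S \<iota> \<pi> where d: "dsum C I X S \<iota> \<pi>" by auto
  have S: "S \<in> Ob C" using d by (simp add: dsum_def)
  have Xi: "X i \<in> Ob C" using insert by simp
  obtain B \<beta> \<rho> where "direct_sum C (UNIV :: bool set) (\<lambda>b. if b then X i else S) B \<beta> \<rho>"
    using biproducts[OF Xi S] by blast
  \<comment> \<open>The new summand sits at index \<open>True\<close>, the sum already constructed
    at index \<open>False\<close>.\<close>
  then obtain b p where b: "dsum C (UNIV :: bool set) (\<lambda>b. if b then X i else S) B b p"
    unfolding direct_sum_dsum by blast
  have B: "B \<in> Ob C" and bt: "arr C (b True)" "src (b True) = X i" "trg (b True) = B"
    and bf: "arr C (b False)" "src (b False) = S" "trg (b False) = B"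
    and pt: "arr C (p True)" "trg (p True) = X i" "src (p True) = B"
    and pf: "arr C (p False)" "trg (p False) = S" "src (p False) = B"
    and pb: "p True \<bullet> b True = idn C (X i)" "p False \<bullet> b False = idn C S"
      "p True \<bullet> b False = zer C S (X i)" "p False \<bullet> b True = zer C (X i) S"
    and sb: "sm C B B UNIV (\<lambda>i. b i \<bullet> p i) = idn C B"
    using b unfolding dsum_def by auto
  have X: "X j \<in> Ob C" "arr C (\<iota> j)" "arr C (\<pi> j)" "src (\<iota> j) = X j" "trg (\<iota> j) = S" "src (\<pi> j) = S" "trg (\<pi> j) = X j"
    if "j \<in> I" for j using d that by (auto simp: dsum_def)
  have \<pi>\<iota>: "\<pi> j \<bullet> \<iota> l = (if l = j then idn C (X l) else zer C (X l) (X j))"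
    if "j \<in> I" "l \<in> I" for j l using d that by (auto simp: dsum_def)
  have sI: "sm C S S I (\<lambda>i. \<iota> i \<bullet> \<pi> i) = idn C S" using d by (simp add: dsum_def)
  define \<iota>' where "\<iota>' j = (if j = i then b True else b False \<bullet> \<iota> j)" for j
  define \<pi>' where "\<pi>' j = (if j = i then p True else \<pi> j \<bullet> p False)" for j
  have r: "p False \<bullet> b False \<bullet> x = x" if "arr C x" "trg x = S" for x
    using that cmp_reassoc[OF pb(2)] bf pf by simp
  have r0: "p True \<bullet> b False \<bullet> x = zer C (src x) (X i)" if "arr C x" "trg x = S" for x
    using that cmp_reassoc[OF pb(3)] bf pt Xi by simp
  have "dsum C (insert i I) X B \<iota>' \<pi>'"
    unfolding dsum_def
  proof (intro conjI ballI)
    fix j l assume "j \<in> insert i I" "l \<in> insert i I"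
    then show "\<pi>' l \<bullet> \<iota>' j = (if j = l then idn C (X j) else zer C (X j) (X l))"
      using bt bf pt pf pb Xi X \<pi>\<iota>[of l j] insert.hyps r r0 unfolding \<iota>'_def \<pi>'_def by auto
  next
    have F: "(\<lambda>j. \<iota>' j \<bullet> \<pi>' j) \<in> insert i I \<rightarrow> hm C B B"
      using bt bf pt pf X unfolding \<iota>'_def \<pi>'_def by auto
    have "sm C B B I (\<lambda>j. \<iota>' j \<bullet> \<pi>' j) = sm C (src (p False)) (trg (b False)) I (\<lambda>j. b False \<bullet> (\<iota> j \<bullet> \<pi> j) \<bullet> p False)"
      unfolding pf bf using bf pf X insert.hyps B unfolding \<iota>'_def \<pi>'_def
      by (intro sm_cong) auto
    also have "\<dots> = b False \<bullet> sm C S S I (\<lambda>j. \<iota> j \<bullet> \<pi> j) \<bullet> p False"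
      using bf pf X insert.hyps B S by (intro cmp_sm_distrib[symmetric]) auto
    finally have *: "sm C B B I (\<lambda>j. \<iota>' j \<bullet> \<pi>' j) = b False \<bullet> p False" using sI pf by simp
    have "sm C B B (insert i I) (\<lambda>j. \<iota>' j \<bullet> \<pi>' j) = pl C (b True \<bullet> p True) (b False \<bullet> p False)"
      using sm_insert[OF B B insert.hyps(1) F insert.hyps(2)] * by (simp add: \<iota>'_def \<pi>'_def)
    also have "\<dots> = sm C B B (insert True {False}) (\<lambda>j. b j \<bullet> p j)"
      using bt bf pt pf B by (subst sm_insert) (auto simp: sm_insert sm_empty)
    also have "insert True {False} = UNIV" by auto
    finally show "sm C B B (insert i I) (\<lambda>j. \<iota>' j \<bullet> \<pi>' j) = idn C B" using sb by simp
  qed (use bt bf pt pf X insert B in \<open>auto simp: \<iota>'_def \<pi>'_def\<close>)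
  then show ?case by blast
qed

end

section \<open>Tensor autoequivalences on typed morphisms\<close>

definition fm :: "('o, 'm) tens_fun \<Rightarrow> ('o, 'm) arrow \<Rightarrow> ('o, 'm) arrow" where
  "fm F t = Arrow (FObj F (src t)) (FMor F (mor t)) (FObj F (trg t))"

definition f2 :: "('k, 'o, 'm, 'z) mon_cat_scheme \<Rightarrow> ('o, 'm) tens_fun \<Rightarrow> 'o \<Rightarrow> 'o \<Rightarrow> ('o, 'm) arrow" where
  "f2 C F A B = Arrow (FObj F (TObj C A B)) (F2 F A B) (TObj C (FObj F A) (FObj F B))"

definition f0 :: "('k, 'o, 'm, 'z) mon_cat_scheme \<Rightarrow> ('o, 'm) tens_fun \<Rightarrow> ('o, 'm) arrow" where
  "f0 C F = Arrow (FObj F (Unit C)) (F0 F) (Unit C)"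

lemma fm_sel [simp]: "src (fm F t) = FObj F (src t)" "trg (fm F t) = FObj F (trg t)"
  and f2_sel [simp]: "src (f2 C F A B) = FObj F (TObj C A B)" "trg (f2 C F A B) = TObj C (FObj F A) (FObj F B)"
  and f0_sel [simp]: "src (f0 C F) = FObj F (Unit C)" "trg (f0 C F) = Unit C"
  by (simp_all add: fm_def f2_def f0_def)

context tensor_autoequivalence
begin

lemma FObj_in [simp]: "A \<in> Ob C \<Longrightarrow> FObj F A \<in> Ob C"
  using equivalence by (auto simp: autoequivalence_def endo_def)

lemma FMor_in: "A \<in> Ob C \<Longrightarrow> B \<in> Ob C \<Longrightarrow> f \<in> Hom C A B \<Longrightarrow> FMor F f \<in> Hom C (FObj F A) (FObj F B)"
  using equivalence by (auto simp: autoequivalence_def endo_def)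

lemma arr_fm [simp]: "arr C t \<Longrightarrow> arr C (fm F t)"
  by (auto simp: arr_def fm_def intro: FMor_in)

lemma fm_idn [simp]: "A \<in> Ob C \<Longrightarrow> fm F (idn C A) = idn C (FObj F A)"
  using equivalence by (auto simp: autoequivalence_def endo_def fm_def idn_def)

lemma fm_cmp [simp]: "arr C t \<Longrightarrow> arr C u \<Longrightarrow> src t = trg u \<Longrightarrow> fm F (t \<bullet> u) = fm F t \<bullet> fm F u"
  using equivalence by (auto simp: autoequivalence_def endo_def fm_def cmp_def arr_def)

lemma FMor_mod_hom:
  "A \<in> Ob C \<Longrightarrow> B \<in> Ob C \<Longrightarrow> FMor F \<in> mod_hom k (hom_module C A B) (hom_module C (FObj F A) (FObj F B))"
  by (auto intro!: mod_homI FMor_in FMor_Plus FMor_Scal)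

lemma fm_zer [simp]: "A \<in> Ob C \<Longrightarrow> B \<in> Ob C \<Longrightarrow> fm F (zer C A B) = zer C (FObj F A) (FObj F B)"
  using mod_hom_zero[OF hom_module hom_module FMor_mod_hom[of A B]] by (simp add: fm_def zer_def)

lemma fm_sm:
  assumes "A \<in> Ob C" "B \<in> Ob C" "finite I" "G \<in> I \<rightarrow> hm C A B"
  shows "fm F (sm C A B I G) = sm C (FObj F A) (FObj F B) I (\<lambda>i. fm F (G i))"
  using sm_mod_hom[OF _ _ _ _ assms(3,4) FMor_mod_hom[of A B]] assms by (auto simp: arr_def sm_def fm_def)

lemma iso_fm [simp]: "iso C t \<Longrightarrow> iso C (fm F t)"
  by (rule isoI[of _ "fm F (inv_arr C t)"]) (simp_all add: arr_src arr_trg flip: fm_cmp)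

lemma inv_fm: "iso C t \<Longrightarrow> inv_arr C (fm F t) = fm F (inv_arr C t)"
  by (rule inv_unique) (simp_all add: arr_src arr_trg flip: fm_cmp)

lemma iso_f2 [simp]: "A \<in> Ob C \<Longrightarrow> B \<in> Ob C \<Longrightarrow> iso C (f2 C F A B)"
  using F2_iso[of A B] by (auto simp: iso_def arr_def f2_def is_iso_def inverse_mors_def)

lemma iso_f0 [simp]: "iso C (f0 C F)"
  using F0_iso by (auto simp: iso_def arr_def f0_def is_iso_def inverse_mors_def)

lemma f2_natural:
  "arr C t \<Longrightarrow> arr C u \<Longrightarrow> A = trg t \<Longrightarrow> B = trg u \<Longrightarrow>
    f2 C F A B \<bullet> fm F (t \<boxtimes> u) = (fm F t \<boxtimes> fm F u) \<bullet> f2 C F (src t) (src u)"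
  using F2_natural[of "src t" "trg t" "src u" "trg u" "mor t" "mor u"]
  by (simp add: f2_def fm_def tn_def cmp_def arr_def)

lemma f2_al:
  assumes "A \<in> Ob C" "B \<in> Ob C" "D \<in> Ob C"
  shows "al C (FObj F A) (FObj F B) (FObj F D) \<bullet> (f2 C F A B \<boxtimes> idn C (FObj F D)) \<bullet> f2 C F (TObj C A B) D
    = (idn C (FObj F A) \<boxtimes> f2 C F B D) \<bullet> f2 C F A (TObj C B D) \<bullet> fm F (al C A B D)"
proof -
  have "(al C (FObj F A) (FObj F B) (FObj F D) \<bullet> (f2 C F A B \<boxtimes> idn C (FObj F D))) \<bullet> f2 C F (TObj C A B) D
    = ((idn C (FObj F A) \<boxtimes> f2 C F B D) \<bullet> f2 C F A (TObj C B D)) \<bullet> fm F (al C A B D)"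
    using F2_Assoc[OF assms] by (simp add: al_def f2_def fm_def tn_def cmp_def idn_def)
  then show ?thesis using assms by simp
qed

lemma f0_lu:
  assumes "A \<in> Ob C"
  shows "lu C (FObj F A) \<bullet> (f0 C F \<boxtimes> idn C (FObj F A)) \<bullet> f2 C F (Unit C) A = fm F (lu C A)"
proof -
  have "(lu C (FObj F A) \<bullet> (f0 C F \<boxtimes> idn C (FObj F A))) \<bullet> f2 C F (Unit C) A = fm F (lu C A)"
    using F0_LUnit[OF assms] by (simp add: lu_def f0_def f2_def fm_def tn_def cmp_def idn_def)
  then show ?thesis using assms by simp
qed

lemma f0_ru:
  assumes "A \<in> Ob C"
  shows "ru C (FObj F A) \<bullet> (idn C (FObj F A) \<boxtimes> f0 C F) \<bullet> f2 C F A (Unit C) = fm F (ru C A)"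
proof -
  have "(ru C (FObj F A) \<bullet> (idn C (FObj F A) \<boxtimes> f0 C F)) \<bullet> f2 C F A (Unit C) = fm F (ru C A)"
    using F0_RUnit[OF assms] by (simp add: ru_def f0_def f2_def fm_def tn_def cmp_def idn_def)
  then show ?thesis using assms by simp
qed

lemma fm_ses:
  assumes "arr C f" "arr C g" "ker_arr C g f" "cok_arr C f g"
  shows "ker_arr C (fm F g) (fm F f)" "cok_arr C (fm F f) (fm F g)"
proof -
  have t: "src g = trg f" using assms(3) by (simp add: ker_arr_def)
  then have e: "Arrow (src f) (mor f) (trg f) = f" "Arrow (trg f) (mor g) (trg g) = g"
    by (auto intro: arrow_eqI)
  have e': "Arrow (FObj F (src f)) (FMor F (mor f)) (FObj F (trg f)) = fm F f"
    "Arrow (FObj F (trg f)) (FMor F (mor g)) (FObj F (trg g)) = fm F g"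
    using t by (auto simp: fm_def)
  have "short_exact C (src f) (mor f) (trg f) (mor g) (trg g)"
    unfolding short_exact_arr e using assms by simp
  from exact[OF this] show "ker_arr C (fm F g) (fm F f)" "cok_arr C (fm F f) (fm F g)"
    unfolding short_exact_arr e' by auto
qed

end

section \<open>Equivariant objects\<close>

definition ga :: "('g, 'y) monoid_scheme \<Rightarrow> ('g \<Rightarrow> ('o, 'm) tens_fun) \<Rightarrow> ('g \<Rightarrow> 'g \<Rightarrow> 'o \<Rightarrow> 'm) \<Rightarrow>
    'g \<Rightarrow> 'g \<Rightarrow> 'o \<Rightarrow> ('o, 'm) arrow" where
  "ga G T \<gamma> g h M = Arrow (FObj (T g) (FObj (T h) M)) (\<gamma> g h M) (FObj (T (g \<otimes>\<^bsub>G\<^esub> h)) M)"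

lemma ga_sel [simp]:
  "src (ga G T \<gamma> g h M) = FObj (T g) (FObj (T h) M)" "trg (ga G T \<gamma> g h M) = FObj (T (g \<otimes>\<^bsub>G\<^esub> h)) M"
  by (simp_all add: ga_def)

definition ac :: "('g \<Rightarrow> ('o, 'm) tens_fun) \<Rightarrow> 'o \<times> ('g \<Rightarrow> 'm) \<Rightarrow> 'g \<Rightarrow> ('o, 'm) arrow" where
  "ac T X h = Arrow (FObj (T h) (fst X)) (snd X h) (fst X)"

lemma ac_sel [simp]: "src (ac T X h) = FObj (T h) (fst X)" "trg (ac T X h) = fst X"
  by (simp_all add: ac_def)

context tensor_action
begin

abbreviation "E \<equiv> equivariantization G C T \<gamma>"
abbreviation "A \<equiv> ac T"
abbreviation "gam \<equiv> ga G T \<gamma>"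
abbreviation "F g \<equiv> fm (T g)"
abbreviation "cj \<equiv> conj_obj G C T \<gamma>"

lemmas T_simps [simp] =
  tensor_autoequivalence.FObj_in[OF tensor_autoequivalence]
  tensor_autoequivalence.arr_fm[OF tensor_autoequivalence]
  tensor_autoequivalence.fm_idn[OF tensor_autoequivalence]
  tensor_autoequivalence.fm_cmp[OF tensor_autoequivalence]
  tensor_autoequivalence.fm_zer[OF tensor_autoequivalence]
  tensor_autoequivalence.iso_fm[OF tensor_autoequivalence]
  tensor_autoequivalence.inv_fm[OF tensor_autoequivalence]
  tensor_autoequivalence.iso_f2[OF tensor_autoequivalence]
  tensor_autoequivalence.iso_f0[OF tensor_autoequivalence]

lemmas T_f2_natural = tensor_autoequivalence.f2_natural[OF tensor_autoequivalence]

lemma iso_ga [simp]: "g \<in> carrier G \<Longrightarrow> h \<in> carrier G \<Longrightarrow> M \<in> Ob C \<Longrightarrow> iso C (gam g h M)"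
  using \<gamma>_nat_iso[of g h] by (auto simp: nat_iso_def iso_def ga_def arr_def is_iso_def inverse_mors_def)

lemma ga_natural:
  "g \<in> carrier G \<Longrightarrow> h \<in> carrier G \<Longrightarrow> arr C t \<Longrightarrow> M = trg t \<Longrightarrow>
    gam g h M \<bullet> F g (F h t) = F (g \<otimes>\<^bsub>G\<^esub> h) t \<bullet> gam g h (src t)"
  using \<gamma>_nat_iso[of g h] by (auto simp: nat_iso_def ga_def arr_def fm_def cmp_def)

lemma ga_assoc:
  "g \<in> carrier G \<Longrightarrow> h \<in> carrier G \<Longrightarrow> l \<in> carrier G \<Longrightarrow> M \<in> Ob C \<Longrightarrow>
    gam (g \<otimes>\<^bsub>G\<^esub> h) l M \<bullet> gam g h (FObj (T l) M) = gam g (h \<otimes>\<^bsub>G\<^esub> l) M \<bullet> F g (gam h l M)"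
  using \<gamma>_assoc[of g h l M] by (simp add: ga_def fm_def cmp_def G.m_assoc)

lemma ga_f2:
  assumes "g \<in> carrier G" "h \<in> carrier G" "M \<in> Ob C" "N \<in> Ob C"
  shows "(gam g h M \<boxtimes> gam g h N) \<bullet> f2 C (T g) (FObj (T h) M) (FObj (T h) N) \<bullet> F g (f2 C (T h) M N)
    = f2 C (T (g \<otimes>\<^bsub>G\<^esub> h)) M N \<bullet> gam g h (TObj C M N)"
proof -
  have "((gam g h M \<boxtimes> gam g h N) \<bullet> f2 C (T g) (FObj (T h) M) (FObj (T h) N)) \<bullet> F g (f2 C (T h) M N)
    = f2 C (T (g \<otimes>\<^bsub>G\<^esub> h)) M N \<bullet> gam g h (TObj C M N)"
    using \<gamma>_F2[OF assms] by (simp add: ga_def fm_def tn_def f2_def cmp_def)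
  then show ?thesis using assms by simp
qed

lemma ga_f0:
  "g \<in> carrier G \<Longrightarrow> h \<in> carrier G \<Longrightarrow>
    f0 C (T g) \<bullet> F g (f0 C (T h)) = f0 C (T (g \<otimes>\<^bsub>G\<^esub> h)) \<bullet> gam g h (Unit C)"
  using \<gamma>_F0[of g h] by (simp add: ga_def fm_def f0_def cmp_def)

lemma T_one_simps [simp]:
  "M \<in> Ob C \<Longrightarrow> FObj (T \<one>\<^bsub>G\<^esub>) M = M"
  "arr C t \<Longrightarrow> F \<one>\<^bsub>G\<^esub> t = t"
  "M \<in> Ob C \<Longrightarrow> N \<in> Ob C \<Longrightarrow> f2 C (T \<one>\<^bsub>G\<^esub>) M N = idn C (TObj C M N)"
  "f0 C (T \<one>\<^bsub>G\<^esub>) = idn C (Unit C)"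
  "g \<in> carrier G \<Longrightarrow> M \<in> Ob C \<Longrightarrow> gam g \<one>\<^bsub>G\<^esub> M = idn C (FObj (T g) M)"
  "g \<in> carrier G \<Longrightarrow> M \<in> Ob C \<Longrightarrow> gam \<one>\<^bsub>G\<^esub> g M = idn C (FObj (T g) M)"
  using T_one_Ob T_one_Hom T_one_F2 T_one_F0 \<gamma>_one_left[of g M] \<gamma>_one_right[of g M]
  by (auto simp: fm_def f2_def f0_def ga_def idn_def arr_def intro!: arrow_eqI)

lemma E_sel [simp]:
  "Idn (E H) X = Idn C (fst X)" "Comp (E H) = Comp C" "Zer (E H) X Y = Zer C (fst X) (fst Y)"
  "Plus (E H) = Plus C" "Scal (E H) = Scal C" "TMor (E H) = TMor C"
  by (auto simp: equivariantization_def split: prod.split)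

lemma E_Ob_iff:
  assumes "subgroup H G"
  shows "X \<in> Ob (E H) \<longleftrightarrow> fst X \<in> Ob C \<and> snd X \<in> extensional H \<and> (\<forall>h \<in> H. iso C (A X h)) \<and>
    (\<forall>g \<in> H. \<forall>h \<in> H. A X g \<bullet> F g (A X h) = A X (g \<otimes>\<^bsub>G\<^esub> h) \<bullet> gam g h (fst X)) \<and>
    A X \<one>\<^bsub>G\<^esub> = idn C (fst X)"
proof (cases X)
  case (Pair M \<mu>)
  have H: "h \<in> carrier G" if "h \<in> H" for h using subgroup.mem_carrier[OF assms that] .
  show ?thesis
  proof (cases "M \<in> Ob C")
    case True
    then show ?thesis
      using H unfolding Pair equivariantization_def
      by (auto simp: ac_def iso_def arr_def cmp_def fm_def ga_def idn_def is_iso_def inverse_mors_def)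
  next
    case False
    then show ?thesis unfolding Pair equivariantization_def by auto
  qed
qed

lemma E_ObD:
  assumes "X \<in> Ob (E H)" "subgroup H G"
  shows "fst X \<in> Ob C" "snd X \<in> extensional H" "h \<in> H \<Longrightarrow> iso C (A X h)"
    "g \<in> H \<Longrightarrow> h \<in> H \<Longrightarrow> A X g \<bullet> F g (A X h) = A X (g \<otimes>\<^bsub>G\<^esub> h) \<bullet> gam g h (fst X)"
    "A X \<one>\<^bsub>G\<^esub> = idn C (fst X)"
  using assms E_Ob_iff by auto

text \<open>The cocycle condition for h and its inverse, together with the unit condition, forces
  the structure maps to be invertible. So the constructions of equivariant objects only have to
  supply morphisms.\<close>

lemma E_ObI:
  assumes H: "subgroup H G" and X: "fst X \<in> Ob C" "snd X \<in> extensional H" "\<And>h. h \<in> H \<Longrightarrow> arr C (A X h)"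
    "\<And>g h. g \<in> H \<Longrightarrow> h \<in> H \<Longrightarrow> A X g \<bullet> F g (A X h) = A X (g \<otimes>\<^bsub>G\<^esub> h) \<bullet> gam g h (fst X)"
    "A X \<one>\<^bsub>G\<^esub> = idn C (fst X)"
  shows "X \<in> Ob (E H)"
proof -
  interpret H: subgroup H G by fact
  let ?i = "\<lambda>h. inv\<^bsub>G\<^esub> h"
  have inv: "A X h \<bullet> F h (A X (?i h)) = gam h (?i h) (fst X)" if "h \<in> H" for h
  proof -
    have "arr C (gam h (?i h) (fst X))" using that X(1) by simp
    then show ?thesis using X(4)[of h "?i h"] X(1,5) that by simp
  qed
  \<comment> \<open>A right inverse of \<open>A X h\<close>, read off from the cocycle condition for
    h and its inverse.\<close>
  define r where "r h = F h (A X (?i h)) \<bullet> inv_arr C (gam h (?i h) (fst X))" for h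
  have r: "arr C (r h)" "src (r h) = fst X" "trg (r h) = FObj (T h) (fst X)" "A X h \<bullet> r h = idn C (fst X)"
    if "h \<in> H" for h
  proof -
    show "arr C (r h)" "src (r h) = fst X" "trg (r h) = FObj (T h) (fst X)"
      using that X by (auto simp: r_def)
    have "A X h \<bullet> r h = gam h (?i h) (fst X) \<bullet> inv_arr C (gam h (?i h) (fst X))"
      unfolding r_def using that X by (intro cmp_reassoc inv) auto
    then show "A X h \<bullet> r h = idn C (fst X)" using that X by simp
  qed
  have "iso C (A X h)" if h: "h \<in> H" for h
  proof -
    let ?b = "F h (A X (?i h))" and ?c = "gam h (?i h) (fst X)"
    have c: "iso C ?c" using h X by simp
    have b: "arr C ?b" using h X by simp
    \<comment> \<open>The cocycle condition gives \<open>?b\<close> a left inverse, and T^h of the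
      right inverse of the structure map at \<open>?i h\<close> gives it a right inverse. Then
      \<open>A X h\<close> is \<open>?c\<close> composed with the inverse of
      \<open>?b\<close>.\<close>
    have "iso C ?b"
    proof (rule isoI[of _ "inv_arr C ?c \<bullet> A X h"])
      show 1: "(inv_arr C ?c \<bullet> A X h) \<bullet> ?b = idn C (src ?b)"
        using h X inv[OF h] c b by simp
      let ?s = "F h (r (?i h))"
      have s: "?b \<bullet> ?s = idn C (FObj (T h) (fst X))" "arr C ?s" "src ?s = FObj (T h) (fst X)"
        "trg ?s = src ?b"
        using h X r[of "?i h"] by (simp_all flip: tensor_autoequivalence.fm_cmp[OF tensor_autoequivalence])
      have "inv_arr C ?c \<bullet> A X h = (inv_arr C ?c \<bullet> A X h) \<bullet> ?b \<bullet> ?s"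
        unfolding s(1) using c h X by simp
      also have "\<dots> = ((inv_arr C ?c \<bullet> A X h) \<bullet> ?b) \<bullet> ?s"
        using s(2-) c h X by (intro cmp_assoc[symmetric]) auto
      also have "\<dots> = ?s" unfolding 1 using s by simp
      finally show "?b \<bullet> inv_arr C ?c \<bullet> A X h = idn C (trg ?b)" using s by simp
    qed (use h X in auto)
    moreover from this have "A X h = ?c \<bullet> inv_arr C ?b"
      using h X inv[OF h] by (intro inv_swap_right) auto
    ultimately show ?thesis using c h X
      by (metis iso_cmp iso_inv src_inv_arr ga_sel(1) trg_inv_arr fm_sel(1) ac_sel(1))
  qed
  then show ?thesis using E_Ob_iff[OF H] X by auto
qed

text \<open>The hom-sets of C^H as typed morphisms of C. Only the structure maps at elements of H
  are consulted, so X and Y may carry the action of a larger group, and restriction need not be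
  written.\<close>

definition eh where
  "eh H X Y = {t. arr C t \<and> src t = fst X \<and> trg t = fst Y \<and> (\<forall>h \<in> H. t \<bullet> A X h = A Y h \<bullet> F h t)}"

lemma ehD:
  assumes "t \<in> eh H X Y"
  shows "arr C t" "src t = fst X" "trg t = fst Y" "h \<in> H \<Longrightarrow> t \<bullet> A X h = A Y h \<bullet> F h t"
  using assms by (auto simp: eh_def)

lemma ehI:
  assumes "arr C t" "src t = fst X" "trg t = fst Y" "\<And>h. h \<in> H \<Longrightarrow> t \<bullet> A X h = A Y h \<bullet> F h t"
  shows "t \<in> eh H X Y"
  using assms by (auto simp: eh_def)

lemma E_Hom:
  assumes "fst X \<in> Ob C" "fst Y \<in> Ob C"
  shows "f \<in> Hom (E H) X Y \<longleftrightarrow> Arrow (fst X) f (fst Y) \<in> eh H X Y"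
  using assms
  by (cases X; cases Y) (auto simp: equivariantization_def eh_def arr_def ac_def cmp_def fm_def)

lemma eh_Arrow: "t \<in> eh H X Y \<Longrightarrow> Arrow (fst X) (mor t) (fst Y) = t"
  by (auto simp: eh_def intro: arrow_eqI)

lemma E_Hom_mor: "t \<in> eh H X Y \<Longrightarrow> mor t \<in> Hom (E H) X Y"
  using eh_Arrow[of t H X Y] ehD(1-3)[of t H X Y] E_Hom[of X Y "mor t" H] by (auto simp: arr_def)

lemma idn_eh: "X \<in> Ob (E H) \<Longrightarrow> subgroup H G \<Longrightarrow> idn C (fst X) \<in> eh H X X"
  by (auto intro!: ehI simp: E_ObD subgroup.mem_carrier)

lemma cmp_eh:
  assumes H: "subgroup H G" and X: "X \<in> Ob (E H)" "Y \<in> Ob (E H)" "Z \<in> Ob (E H)"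
    and u: "u \<in> eh H X Y" and t: "t \<in> eh H Y Z"
  shows "t \<bullet> u \<in> eh H X Z"
proof (rule ehI)
  note d = ehD(1-3)[OF u] ehD(1-3)[OF t]
  show "arr C (t \<bullet> u)" "src (t \<bullet> u) = fst X" "trg (t \<bullet> u) = fst Z" using d by auto
  fix h assume h: "h \<in> H"
  have hG: "h \<in> carrier G" using h H by (rule subgroup.mem_carrier[rotated])
  note iso = E_ObD(3)[OF X(1) H h] E_ObD(3)[OF X(2) H h] E_ObD(3)[OF X(3) H h]
  have "(t \<bullet> u) \<bullet> A X h = t \<bullet> A Y h \<bullet> F h u" using d iso h hG ehD(4)[OF u h] by simp
  also have "\<dots> = (A Z h \<bullet> F h t) \<bullet> F h u"
    using d iso h hG ehD(4)[OF t h] by (intro cmp_reassoc) auto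
  finally show "(t \<bullet> u) \<bullet> A X h = A Z h \<bullet> F h (t \<bullet> u)" using d iso hG by simp
qed

lemma inv_eh:
  assumes H: "subgroup H G" and X: "X \<in> Ob (E H)" "Y \<in> Ob (E H)" and t: "t \<in> eh H X Y" and i: "iso C t"
  shows "inv_arr C t \<in> eh H Y X"
proof (rule ehI)
  note d = ehD(1-3)[OF t]
  show "arr C (inv_arr C t)" "src (inv_arr C t) = fst Y" "trg (inv_arr C t) = fst X" using d i by auto
  fix h assume h: "h \<in> H"
  have hG: "h \<in> carrier G" using h H by (rule subgroup.mem_carrier[rotated])
  note iso = E_ObD(3)[OF X(1) H h] E_ObD(3)[OF X(2) H h]
  have "A X h = inv_arr C t \<bullet> A Y h \<bullet> F h t"
    using d i iso hG ehD(4)[OF t h] by (intro inv_swap_left) auto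
  then have "A X h \<bullet> F h (inv_arr C t) = (inv_arr C t \<bullet> A Y h \<bullet> F h t) \<bullet> F h (inv_arr C t)"
    by (rule arg_cong)
  also have "\<dots> = inv_arr C t \<bullet> A Y h \<bullet> (F h t \<bullet> F h (inv_arr C t))"
    using d i iso hG by (simp del: T_simps(4) T_simps(7))
  also have "F h t \<bullet> F h (inv_arr C t) = idn C (FObj (T h) (fst Y))"
    using d i iso hG E_ObD(1)[OF X(2) H] by (simp flip: T_simps(4))
  finally show "inv_arr C t \<bullet> A Y h = A X h \<bullet> F h (inv_arr C t)" using d i iso hG by simp
qed

lemma zer_eh:
  assumes H: "subgroup H G" and X: "X \<in> Ob (E H)" "Y \<in> Ob (E H)"
  shows "zer C (fst X) (fst Y) \<in> eh H X Y"
  using assms by (auto intro!: ehI simp: E_ObD[OF X(1) H] E_ObD[OF X(2) H] subgroup.mem_carrier[OF H])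

lemma E_category: assumes H: "subgroup H G" shows "category (E H)"
proof (rule category.intro)
  note ob = E_ObD(1)[OF _ H]
  have hom: "f \<in> Hom C (fst X) (fst Y)" if "f \<in> Hom (E H) X Y" "X \<in> Ob (E H)" "Y \<in> Ob (E H)" for f X Y
    using that ob E_Hom[of X Y f H] by (auto simp: eh_def arr_def)
  show "Idn (E H) X \<in> Hom (E H) X X" if "X \<in> Ob (E H)" for X
    using E_Hom_mor[OF idn_eh[OF that H]] by (simp add: mor_idn)
  show "g \<cdot>\<^bsub>E H\<^esub> f \<in> Hom (E H) X Z"
    if "X \<in> Ob (E H)" "Y \<in> Ob (E H)" "Z \<in> Ob (E H)" "f \<in> Hom (E H) X Y" "g \<in> Hom (E H) Y Z" for X Y Z f g
    using cmp_eh[OF H that(1-3), of "Arrow (fst X) f (fst Y)" "Arrow (fst Y) g (fst Z)"] that ob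
    by (auto simp: E_Hom cmp_def)
  show "f \<cdot>\<^bsub>E H\<^esub> Idn (E H) X = f" if "X \<in> Ob (E H)" "Y \<in> Ob (E H)" "f \<in> Hom (E H) X Y" for X Y f
    using Comp_Idn[OF ob[OF that(1)] ob[OF that(2)] hom[OF that(3,1,2)]] by simp
  show "Idn (E H) Y \<cdot>\<^bsub>E H\<^esub> f = f" if "X \<in> Ob (E H)" "Y \<in> Ob (E H)" "f \<in> Hom (E H) X Y" for X Y f
    using Idn_Comp[OF ob[OF that(1)] ob[OF that(2)] hom[OF that(3,1,2)]] by simp
  show "h \<cdot>\<^bsub>E H\<^esub> g \<cdot>\<^bsub>E H\<^esub> f = h \<cdot>\<^bsub>E H\<^esub> (g \<cdot>\<^bsub>E H\<^esub> f)"
    if o: "X \<in> Ob (E H)" "Y \<in> Ob (E H)" "Z \<in> Ob (E H)" "W \<in> Ob (E H)"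
      and h: "f \<in> Hom (E H) X Y" "g \<in> Hom (E H) Y Z" "h \<in> Hom (E H) Z W" for X Y Z W f g h
    using Comp_assoc[OF ob[OF o(1)] ob[OF o(2)] ob[OF o(3)] ob[OF o(4)] hom[OF h(1) o(1,2)] hom[OF h(2) o(2,3)] hom[OF h(3) o(3,4)]]
    by simp
qed

section \<open>The linear category of equivariant objects\<close>

lemma E_hom_module: "hom_module (E H) X Y = (hom_module C (fst X) (fst Y))\<lparr>carrier := Hom (E H) X Y\<rparr>"
  by (simp add: hom_module_def)

text \<open>Compatibility with each structure map is a linear condition, because composition and T^h
  are linear.\<close>

lemma E_hom_submodule:
  assumes H: "subgroup H G" and X: "X \<in> Ob (E H)" "Y \<in> Ob (E H)"
  shows "submodule (Hom (E H) X Y) k (hom_module C (fst X) (fst Y))"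
proof -
  note ob = E_ObD(1)[OF _ H]
  interpret M: module k "hom_module C (fst X) (fst Y)" using hom_module X ob by blast
  have hom: "f \<in> Hom (E H) X Y \<longleftrightarrow> f \<in> Hom C (fst X) (fst Y) \<and> (\<forall>h \<in> H. f \<cdot> snd X h = snd Y h \<cdot> FMor (T h) f)" for f
    by (cases X; cases Y) (simp add: equivariantization_def)
  have act: "snd X h \<in> Hom C (FObj (T h) (fst X)) (fst X)" "snd Y h \<in> Hom C (FObj (T h) (fst Y)) (fst Y)"
    "h \<in> carrier G" "FObj (T h) (fst X) \<in> Ob C" "FObj (T h) (fst Y) \<in> Ob C" if "h \<in> H" for h
    using E_ObD(3)[OF X(1) H that] E_ObD(3)[OF X(2) H that] subgroup.mem_carrier[OF H that] X ob
    by (auto simp: iso_def arr_def ac_def)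
  have Th: "FMor (T h) f \<in> Hom C (FObj (T h) (fst X)) (FObj (T h) (fst Y))" if "f \<in> Hom C (fst X) (fst Y)" "h \<in> H" for f h
    using tensor_autoequivalence.FMor_in[OF tensor_autoequivalence] act(3) that X ob by blast
  have add: "Plus C f f' \<in> Hom (E H) X Y" if f: "f \<in> Hom (E H) X Y" "f' \<in> Hom (E H) X Y" for f f'
  proof -
    have "Plus C f f' \<cdot> snd X h = snd Y h \<cdot> FMor (T h) (Plus C f f')" if h: "h \<in> H" for h
      using f h act[OF h] X ob Th[of _ h]
      by (simp add: hom Plus_Comp[of "FObj (T h) (fst X)" "fst X" "fst Y"]
          tensor_autoequivalence.FMor_Plus[OF tensor_autoequivalence, of h "fst X" "fst Y"]
          Comp_Plus[of "FObj (T h) (fst X)" "FObj (T h) (fst Y)" "fst Y"])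
    then show ?thesis using f M.a_closed by (simp add: hom)
  qed
  have smult: "Scal C a f \<in> Hom (E H) X Y" if f: "f \<in> Hom (E H) X Y" and a: "a \<in> carrier k" for a f
  proof -
    have "Scal C a f \<cdot> snd X h = snd Y h \<cdot> FMor (T h) (Scal C a f)" if h: "h \<in> H" for h
      using f h a act[OF h] X ob Th[of _ h]
      by (simp add: hom Scal_Comp[of "FObj (T h) (fst X)" "fst X" "fst Y"]
          tensor_autoequivalence.FMor_Scal[OF tensor_autoequivalence, of h "fst X" "fst Y"]
          Comp_Scal[of "FObj (T h) (fst X)" "FObj (T h) (fst Y)" "fst Y"])
    then show ?thesis using f M.smult_closed[OF a, of f] by (simp add: hom)
  qed
  show ?thesis
  proof (rule M.submoduleI)
    show "Hom (E H) X Y \<subseteq> carrier (hom_module C (fst X) (fst Y))" by (auto simp: hom)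
    show "\<zero>\<^bsub>hom_module C (fst X) (fst Y)\<^esub> \<in> Hom (E H) X Y"
      using E_Hom_mor[OF zer_eh[OF H X]] by (simp add: mor_zer)
    fix f assume f: "f \<in> Hom (E H) X Y"
    then have "\<ominus>\<^bsub>hom_module C (fst X) (fst Y)\<^esub> f = (\<ominus>\<^bsub>k\<^esub> \<one>\<^bsub>k\<^esub>) \<odot>\<^bsub>hom_module C (fst X) (fst Y)\<^esub> f"
      by (simp add: hom M.smult_l_minus del: hom_module_sel(4))
    then show "\<ominus>\<^bsub>hom_module C (fst X) (fst Y)\<^esub> f \<in> Hom (E H) X Y"
      using smult[OF f, of "\<ominus>\<^bsub>k\<^esub> \<one>\<^bsub>k\<^esub>"] by simp
  qed (use add smult in auto)
qed

lemma E_linear_category: assumes H: "subgroup H G" shows "linear_category k (E H)"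
proof (intro linear_category.intro E_category[OF H] linear_category_axioms.intro)
  note ob = E_ObD(1)[OF _ H]
  have hom: "f \<in> Hom C (fst X) (fst Y)" if "f \<in> Hom (E H) X Y" "X \<in> Ob (E H)" "Y \<in> Ob (E H)" for f X Y
    using that ob E_Hom[of X Y f H] by (auto simp: eh_def arr_def)
  show "field k" ..
  fix X Y Z assume X: "X \<in> Ob (E H)" "Y \<in> Ob (E H)"
  show "module k (hom_module (E H) X Y)"
    unfolding E_hom_module using E_hom_submodule[OF H X] hom_module X ob
    by (intro submodule.submodule_is_module) auto
  fix f f' g g' a assume Z: "Z \<in> Ob (E H)"
  show "f \<in> Hom (E H) X Y \<Longrightarrow> f' \<in> Hom (E H) X Y \<Longrightarrow> g \<in> Hom (E H) Y Z \<Longrightarrow>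
      g \<cdot>\<^bsub>E H\<^esub> Plus (E H) f f' = Plus (E H) (g \<cdot>\<^bsub>E H\<^esub> f) (g \<cdot>\<^bsub>E H\<^esub> f')"
    using X Z hom ob Comp_Plus[of "fst X" "fst Y" "fst Z"] by simp
  show "f \<in> Hom (E H) X Y \<Longrightarrow> g \<in> Hom (E H) Y Z \<Longrightarrow> g' \<in> Hom (E H) Y Z \<Longrightarrow>
      Plus (E H) g g' \<cdot>\<^bsub>E H\<^esub> f = Plus (E H) (g \<cdot>\<^bsub>E H\<^esub> f) (g' \<cdot>\<^bsub>E H\<^esub> f)"
    using X Z hom ob Plus_Comp[of "fst X" "fst Y" "fst Z"] by simp
  show "f \<in> Hom (E H) X Y \<Longrightarrow> g \<in> Hom (E H) Y Z \<Longrightarrow> a \<in> carrier k \<Longrightarrow>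
      g \<cdot>\<^bsub>E H\<^esub> Scal (E H) a f = Scal (E H) a (g \<cdot>\<^bsub>E H\<^esub> f)"
    using X Z hom ob Comp_Scal[of "fst X" "fst Y" "fst Z"] by simp
  show "f \<in> Hom (E H) X Y \<Longrightarrow> g \<in> Hom (E H) Y Z \<Longrightarrow> a \<in> carrier k \<Longrightarrow>
      Scal (E H) a g \<cdot>\<^bsub>E H\<^esub> f = Scal (E H) a (g \<cdot>\<^bsub>E H\<^esub> f)"
    using X Z hom ob Scal_Comp[of "fst X" "fst Y" "fst Z"] by simp
qed

subsection \<open>Kernels and exact sequences of equivariant objects\<close>

text \<open>The forgetful functor C^H \<rightarrow> C on typed morphisms.\<close>

definition un where
  "un t = Arrow (fst (src t)) (mor t) (fst (trg t))"

lemma un_sel [simp]: "src (un t) = fst (src t)" "trg (un t) = fst (trg t)" "mor (un t) = mor t"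
  by (simp_all add: un_def)

lemma E_arr:
  "subgroup H G \<Longrightarrow> arr (E H) t \<longleftrightarrow> src t \<in> Ob (E H) \<and> trg t \<in> Ob (E H) \<and> un t \<in> eh H (src t) (trg t)"
  using E_Hom[of "src t" "trg t" "mor t" H] E_ObD(1)[of "src t" H] E_ObD(1)[of "trg t" H]
  by (auto simp: arr_def un_def)

lemma un_cmp: "un (t \<bullet>\<^bsub>E H\<^esub> u) = un t \<bullet> un u" and un_zer: "un (zer (E H) X Y) = zer C (fst X) (fst Y)"
  and un_idn: "un (idn (E H) X) = idn C (fst X)"
  by (simp_all add: un_def cmp_def zer_def idn_def)

lemma un_inject: "src t = src u \<Longrightarrow> trg t = trg u \<Longrightarrow> un t = un u \<longleftrightarrow> t = u"
  by (auto simp: un_def intro: arrow_eqI)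

lemma E_arr_eh:
  assumes "subgroup H G" "X \<in> Ob (E H)" "Y \<in> Ob (E H)" "t \<in> eh H X Y"
  shows "arr (E H) (Arrow X (mor t) Y)" "un (Arrow X (mor t) Y) = t"
  using assms eh_Arrow[OF assms(4)] by (simp_all add: E_arr un_def)

text \<open>Moves the universal property of kernels in C^H into C, with \<open>eh\<close> as the
  class of test morphisms, so that later computations take place in C.\<close>

lemma E_ker_arr:
  assumes H: "subgroup H G" and o: "X \<in> Ob (E H)" "Y \<in> Ob (E H)" "K \<in> Ob (E H)"
    and f: "f \<in> eh H X Y" and i: "i \<in> eh H K X"
  shows "ker_arr (E H) (Arrow X (mor f) Y) (Arrow K (mor i) X) \<longleftrightarrow>
    f \<bullet> i = zer C (fst K) (fst Y) \<and>
    (\<forall>Z \<in> Ob (E H). \<forall>t \<in> eh H Z X. f \<bullet> t = zer C (fst Z) (fst Y) \<longrightarrow> (\<exists>!w. w \<in> eh H Z K \<and> i \<bullet> w = t))"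
    (is "?L \<longleftrightarrow> ?z \<and> ?R")
proof -
  interpret E: linear_category k "E H" by (rule E_linear_category[OF H])
  let ?f = "Arrow X (mor f) Y" and ?i = "Arrow K (mor i) X"
  note af = E_arr_eh[OF H o(1,2) f] and ai = E_arr_eh[OF H o(3,1) i]
  have zi: "?f \<bullet>\<^bsub>E H\<^esub> ?i = zer (E H) K Y \<longleftrightarrow> ?z"
    using un_inject[of "?f \<bullet>\<^bsub>E H\<^esub> ?i" "zer (E H) K Y"] af ai by (simp add: un_cmp un_zer)
  have zt: "?f \<bullet>\<^bsub>E H\<^esub> Arrow Z (mor t) X = zer (E H) Z Y \<longleftrightarrow> f \<bullet> t = zer C (fst Z) (fst Y)"
    if "t \<in> eh H Z X" "Z \<in> Ob (E H)" for Z t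
    using un_inject[of "?f \<bullet>\<^bsub>E H\<^esub> Arrow Z (mor t) X" "zer (E H) Z Y"] af E_arr_eh[OF H that(2) o(1) that(1)]
    by (simp add: un_cmp un_zer)
  have it: "?i \<bullet>\<^bsub>E H\<^esub> Arrow Z (mor w) K = Arrow Z (mor t) X \<longleftrightarrow> i \<bullet> w = t"
    if "w \<in> eh H Z K" "t \<in> eh H Z X" "Z \<in> Ob (E H)" for Z t w
    using un_inject[of "?i \<bullet>\<^bsub>E H\<^esub> Arrow Z (mor w) K" "Arrow Z (mor t) X"] ai
      E_arr_eh[OF H that(3) o(3) that(1)] E_arr_eh[OF H that(3) o(1) that(2)]
    by (simp add: un_cmp)
  show ?thesis
  proof
    assume L: ?L
    have ?z using E.ker_arr_zero[OF L] zi by simp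
    moreover have "\<exists>!w. w \<in> eh H Z K \<and> i \<bullet> w = t"
      if Z: "Z \<in> Ob (E H)" and t: "t \<in> eh H Z X" and ft: "f \<bullet> t = zer C (fst Z) (fst Y)" for Z t
    proof -
      obtain w where w: "arr (E H) w" "src w = Z" "trg w = K" "?i \<bullet>\<^bsub>E H\<^esub> w = Arrow Z (mor t) X"
        using E.ker_arr_lift[OF L E_arr_eh(1)[OF H Z o(1) t]] zt[OF t Z] ft by auto
      have "un w \<in> eh H Z K" using w H by (simp add: E_arr)
      moreover have "Arrow Z (mor (un w)) K = w" using w by (auto intro: arrow_eqI)
      ultimately have ex: "un w \<in> eh H Z K" "i \<bullet> un w = t" using it[of "un w" Z t] t Z w by auto
      have "w' = w''" if w': "w' \<in> eh H Z K" "i \<bullet> w' = t" "w'' \<in> eh H Z K" "i \<bullet> w'' = t" for w' w''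
      proof -
        have "?i \<bullet>\<^bsub>E H\<^esub> Arrow Z (mor w') K = ?i \<bullet>\<^bsub>E H\<^esub> Arrow Z (mor w'') K"
          using it w' t Z by metis
        then have "Arrow Z (mor w') K = Arrow Z (mor w'') K"
          using af E_arr_eh(1)[OF H Z o(3)] w' by - (rule E.ker_arr_mono[OF L], simp_all)
        then show ?thesis using w'(1,3) by (metis arrow.inject eh_Arrow)
      qed
      then show ?thesis using ex by blast
    qed
    ultimately show "?z \<and> ?R" by blast
  next
    assume R: "?z \<and> ?R"
    show ?L
    proof (rule E.ker_arrI)
      fix t assume t: "arr (E H) t" "trg t = src ?f" "?f \<bullet>\<^bsub>E H\<^esub> t = zer (E H) (src t) (trg ?f)"
      have ut: "un t \<in> eh H (src t) X" "src t \<in> Ob (E H)" using t H by (auto simp: E_arr)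
      have st: "Arrow (src t) (mor (un t)) X = t" using t by (auto intro: arrow_eqI)
      have "f \<bullet> un t = zer C (fst (src t)) (fst Y)" using zt[OF ut] t(3) st by simp
      then have "\<exists>!w. w \<in> eh H (src t) K \<and> i \<bullet> w = un t" using R ut by blast
      then obtain w where w: "w \<in> eh H (src t) K" "i \<bullet> w = un t" by blast
      show "\<exists>w. arr (E H) w \<and> src w = src t \<and> trg w = src ?i \<and> ?i \<bullet>\<^bsub>E H\<^esub> w = t"
        using it[OF w(1) ut] w(2) st E_arr_eh(1)[OF H ut(2) o(3) w(1)]
        by (intro exI[of _ "Arrow (src t) (mor w) K"]) simp
    next
      fix w w' assume w: "arr (E H) w" "arr (E H) w'" "src w = src w'" "trg w = src ?i" "trg w' = src ?i"
        "?i \<bullet>\<^bsub>E H\<^esub> w = ?i \<bullet>\<^bsub>E H\<^esub> w'"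
      have u: "un w \<in> eh H (src w) K" "un w' \<in> eh H (src w) K" "src w \<in> Ob (E H)"
        using w H by (auto simp: E_arr)
      have iw: "i \<bullet> un w = i \<bullet> un w'"
        using arg_cong[OF w(6), of un] ai by (simp add: un_cmp)
      have tt: "i \<bullet> un w \<in> eh H (src w) X" using cmp_eh[OF H u(3) o(3,1) u(1) i] .
      have "f \<bullet> i \<bullet> un w = zer C (fst K) (fst Y) \<bullet> un w"
        using R ehD[OF f] ehD[OF i] ehD[OF u(1)] by (intro cmp_reassoc) auto
      then have "f \<bullet> i \<bullet> un w = zer C (fst (src w)) (fst Y)"
        using ehD[OF u(1)] E_ObD(1)[OF o(2) H] by simp
      then have "un w = un w'" using R u tt iw by metis
      then show "w = w'" using un_inject[of w w'] w(3-5) by simp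
    qed (use af ai R zi in auto)
  qed
qed

lemma E_cok_arr:
  assumes H: "subgroup H G" and o: "X \<in> Ob (E H)" "Y \<in> Ob (E H)" "Q \<in> Ob (E H)"
    and f: "f \<in> eh H X Y" and p: "p \<in> eh H Y Q"
  shows "cok_arr (E H) (Arrow X (mor f) Y) (Arrow Y (mor p) Q) \<longleftrightarrow>
    p \<bullet> f = zer C (fst X) (fst Q) \<and>
    (\<forall>Z \<in> Ob (E H). \<forall>t \<in> eh H Y Z. t \<bullet> f = zer C (fst X) (fst Z) \<longrightarrow> (\<exists>!w. w \<in> eh H Q Z \<and> w \<bullet> p = t))"
    (is "?L \<longleftrightarrow> ?z \<and> ?R")
proof -
  interpret E: linear_category k "E H" by (rule E_linear_category[OF H])
  let ?f = "Arrow X (mor f) Y" and ?p = "Arrow Y (mor p) Q"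
  note af = E_arr_eh[OF H o(1,2) f] and ap = E_arr_eh[OF H o(2,3) p]
  have zp: "?p \<bullet>\<^bsub>E H\<^esub> ?f = zer (E H) X Q \<longleftrightarrow> ?z"
    using un_inject[of "?p \<bullet>\<^bsub>E H\<^esub> ?f" "zer (E H) X Q"] af ap by (simp add: un_cmp un_zer)
  have zt: "Arrow Y (mor t) Z \<bullet>\<^bsub>E H\<^esub> ?f = zer (E H) X Z \<longleftrightarrow> t \<bullet> f = zer C (fst X) (fst Z)"
    if "t \<in> eh H Y Z" "Z \<in> Ob (E H)" for Z t
    using un_inject[of "Arrow Y (mor t) Z \<bullet>\<^bsub>E H\<^esub> ?f" "zer (E H) X Z"] af E_arr_eh[OF H o(2) that(2,1)]
    by (simp add: un_cmp un_zer)
  have pt: "Arrow Q (mor w) Z \<bullet>\<^bsub>E H\<^esub> ?p = Arrow Y (mor t) Z \<longleftrightarrow> w \<bullet> p = t"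
    if "w \<in> eh H Q Z" "t \<in> eh H Y Z" "Z \<in> Ob (E H)" for Z t w
    using un_inject[of "Arrow Q (mor w) Z \<bullet>\<^bsub>E H\<^esub> ?p" "Arrow Y (mor t) Z"] ap
      E_arr_eh[OF H o(3) that(3,1)] E_arr_eh[OF H o(2) that(3,2)]
    by (simp add: un_cmp)
  show ?thesis
  proof
    assume L: ?L
    have ?z using E.cok_arr_zero[OF L] zp by simp
    moreover have "\<exists>!w. w \<in> eh H Q Z \<and> w \<bullet> p = t"
      if Z: "Z \<in> Ob (E H)" and t: "t \<in> eh H Y Z" and ft: "t \<bullet> f = zer C (fst X) (fst Z)" for Z t
    proof -
      obtain w where w: "arr (E H) w" "src w = Q" "trg w = Z" "w \<bullet>\<^bsub>E H\<^esub> ?p = Arrow Y (mor t) Z"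
        using E.cok_arr_lift[OF L E_arr_eh(1)[OF H o(2) Z t]] zt[OF t Z] ft by auto
      have "un w \<in> eh H Q Z" using w H by (simp add: E_arr)
      moreover have "Arrow Q (mor (un w)) Z = w" using w by (auto intro: arrow_eqI)
      ultimately have ex: "un w \<in> eh H Q Z" "un w \<bullet> p = t" using pt[of "un w" Z t] t Z w by auto
      have "w' = w''" if w': "w' \<in> eh H Q Z" "w' \<bullet> p = t" "w'' \<in> eh H Q Z" "w'' \<bullet> p = t" for w' w''
      proof -
        have "Arrow Q (mor w') Z \<bullet>\<^bsub>E H\<^esub> ?p = Arrow Q (mor w'') Z \<bullet>\<^bsub>E H\<^esub> ?p"
          using pt w' t Z by metis
        then have "Arrow Q (mor w') Z = Arrow Q (mor w'') Z"
          using af E_arr_eh(1)[OF H o(3) Z] w' by - (rule E.cok_arr_epi[OF L], simp_all)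
        then show ?thesis using w'(1,3) by (metis arrow.inject eh_Arrow)
      qed
      then show ?thesis using ex by blast
    qed
    ultimately show "?z \<and> ?R" by blast
  next
    assume R: "?z \<and> ?R"
    show ?L
    proof (rule E.cok_arrI)
      fix t assume t: "arr (E H) t" "src t = trg ?f" "t \<bullet>\<^bsub>E H\<^esub> ?f = zer (E H) (src ?f) (trg t)"
      have ut: "un t \<in> eh H Y (trg t)" "trg t \<in> Ob (E H)" using t H by (auto simp: E_arr)
      have st: "Arrow Y (mor (un t)) (trg t) = t" using t by (auto intro: arrow_eqI)
      have "un t \<bullet> f = zer C (fst X) (fst (trg t))" using zt[OF ut] t(3) st by simp
      then have "\<exists>!w. w \<in> eh H Q (trg t) \<and> w \<bullet> p = un t" using R ut by blast
      then obtain w where w: "w \<in> eh H Q (trg t)" "w \<bullet> p = un t" by blast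
      show "\<exists>w. arr (E H) w \<and> src w = trg ?p \<and> trg w = trg t \<and> w \<bullet>\<^bsub>E H\<^esub> ?p = t"
        using pt[OF w(1) ut] w(2) st E_arr_eh(1)[OF H o(3) ut(2) w(1)]
        by (intro exI[of _ "Arrow Q (mor w) (trg t)"]) simp
    next
      fix w w' assume w: "arr (E H) w" "arr (E H) w'" "trg w = trg w'" "src w = trg ?p" "src w' = trg ?p"
        "w \<bullet>\<^bsub>E H\<^esub> ?p = w' \<bullet>\<^bsub>E H\<^esub> ?p"
      have u: "un w \<in> eh H Q (trg w)" "un w' \<in> eh H Q (trg w)" "trg w \<in> Ob (E H)"
        using w H by (auto simp: E_arr)
      have iw: "un w \<bullet> p = un w' \<bullet> p"
        using arg_cong[OF w(6), of un] ap by (simp add: un_cmp)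
      have tt: "un w \<bullet> p \<in> eh H Y (trg w)" using cmp_eh[OF H o(2,3) u(3) p u(1)] .
      have "(un w \<bullet> p) \<bullet> f = un w \<bullet> p \<bullet> f"
        using ehD[OF f] ehD[OF p] ehD[OF u(1)] by (intro cmp_assoc) auto
      then have "(un w \<bullet> p) \<bullet> f = zer C (fst X) (fst (trg w))"
        using R ehD[OF u(1)] E_ObD(1)[OF o(1) H] by simp
      then have "un w = un w'" using R u tt iw by metis
      then show "w = w'" using un_inject[of w w'] w(3-5) by simp
    qed (use af ap R zp in auto)
  qed
qed

definition ses where
  "ses H X f Y g Z \<longleftrightarrow> X \<in> Ob (E H) \<and> Y \<in> Ob (E H) \<and> Z \<in> Ob (E H) \<and> f \<in> eh H X Y \<and> g \<in> eh H Y Z \<and>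
     ker_arr (E H) (Arrow Y (mor g) Z) (Arrow X (mor f) Y) \<and>
     cok_arr (E H) (Arrow X (mor f) Y) (Arrow Y (mor g) Z)"

lemma short_exact_ses:
  assumes H: "subgroup H G"
  shows "short_exact (E H) X f Y g Z \<longleftrightarrow> ses H X (Arrow (fst X) f (fst Y)) Y (Arrow (fst Y) g (fst Z)) Z"
  by (auto simp: short_exact_arr ses_def E_arr[OF H] un_def)

lemma ses_short_exact:
  assumes H: "subgroup H G" and "ses H X f Y g Z"
  shows "short_exact (E H) X (mor f) Y (mor g) Z"
proof -
  have "Arrow (fst X) (mor f) (fst Y) = f" "Arrow (fst Y) (mor g) (fst Z) = g"
    using assms(2) by (auto simp: ses_def intro: eh_Arrow)
  then show ?thesis using assms by (simp add: short_exact_ses[OF H])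
qed

text \<open>A factorization found in C is automatically equivariant. For kernels this holds because
  f is monic; for cokernels because T^h g is again epic, as T^h is exact.\<close>

lemma sesI:
  assumes H: "subgroup H G" and o: "X \<in> Ob (E H)" "Y \<in> Ob (E H)" "Z \<in> Ob (E H)"
    and f: "f \<in> eh H X Y" and g: "g \<in> eh H Y Z"
    and k: "ker_arr C g f" and c: "cok_arr C f g"
  shows "ses H X f Y g Z"
proof -
  note df = ehD(1-3)[OF f] and dg = ehD(1-3)[OF g]
  note isoX = E_ObD(3)[OF o(1) H] and isoY = E_ObD(3)[OF o(2) H] and isoZ = E_ObD(3)[OF o(3) H]
  have HG: "h \<in> H \<Longrightarrow> h \<in> carrier G" for h by (rule subgroup.mem_carrier[OF H])
  have "ker_arr (E H) (Arrow Y (mor g) Z) (Arrow X (mor f) Y)"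
    unfolding E_ker_arr[OF H o(2,3,1) g f]
  proof (intro conjI ballI impI)
    show "g \<bullet> f = zer C (fst X) (fst Z)" using ker_arr_zero[OF k] df dg by simp
    fix W t assume W: "W \<in> Ob (E H)" and t: "t \<in> eh H W Y" and z: "g \<bullet> t = zer C (fst W) (fst Z)"
    note dt = ehD(1-3)[OF t]
    obtain w where w: "arr C w" "src w = fst W" "trg w = fst X" "f \<bullet> w = t"
      using ker_arr_lift[OF k, of t] dt dg df z by auto
    have "w \<in> eh H W X"
    proof (rule ehI)
      fix h assume h: "h \<in> H"
      note i = isoX[OF h] isoY[OF h] E_ObD(3)[OF W H h] HG[OF h]
      have "f \<bullet> w \<bullet> A W h = t \<bullet> A W h" using w df i by (intro cmp_reassoc) auto
      also have "\<dots> = A Y h \<bullet> F h (f \<bullet> w)" using ehD(4)[OF t h] w by simp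
      also have "\<dots> = A Y h \<bullet> F h f \<bullet> F h w" using w(1-3) df i by simp
      also have "\<dots> = (f \<bullet> A X h) \<bullet> F h w"
        using ehD(4)[OF f h] w(1-3) df i by (intro cmp_reassoc) auto
      also have "\<dots> = f \<bullet> A X h \<bullet> F h w" using w(1-3) df i by simp
      finally show "w \<bullet> A W h = A X h \<bullet> F h w"
        using w df dg i by - (rule ker_arr_mono[OF k], simp_all)
    qed (use w in auto)
    moreover have "w' = w" if "w' \<in> eh H W X" "f \<bullet> w' = t" for w'
      using that ehD(1-3)[OF that(1)] w df dg by - (rule ker_arr_mono[OF k], simp_all)
    ultimately show "\<exists>!w. w \<in> eh H W X \<and> f \<bullet> w = t" using w by blast
  qed
  moreover have "cok_arr (E H) (Arrow X (mor f) Y) (Arrow Y (mor g) Z)"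
    unfolding E_cok_arr[OF H o f g]
  proof (intro conjI ballI impI)
    show "g \<bullet> f = zer C (fst X) (fst Z)" using ker_arr_zero[OF k] df dg by simp
    fix W t assume W: "W \<in> Ob (E H)" and t: "t \<in> eh H Y W" and z: "t \<bullet> f = zer C (fst X) (fst W)"
    note dt = ehD(1-3)[OF t]
    obtain w where w: "arr C w" "src w = fst Z" "trg w = fst W" "w \<bullet> g = t"
      using cok_arr_lift[OF c, of t] dt dg df z by auto
    have "w \<in> eh H Z W"
    proof (rule ehI)
      fix h assume h: "h \<in> H"
      note i = isoX[OF h] isoY[OF h] isoZ[OF h] E_ObD(3)[OF W H h] HG[OF h]
      have e: "cok_arr C (F h f) (F h g)"
        using tensor_autoequivalence.fm_ses[OF tensor_autoequivalence[OF i(5)]] df dg k c by blast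
      have "(w \<bullet> A Z h) \<bullet> F h g = w \<bullet> g \<bullet> A Y h" using ehD(4)[OF g h] w(1-3) dg i by simp
      also have "\<dots> = t \<bullet> A Y h" using w dg i by (intro cmp_reassoc) auto
      also have "\<dots> = A W h \<bullet> F h (w \<bullet> g)" using ehD(4)[OF t h] w by simp
      also have "\<dots> = (A W h \<bullet> F h w) \<bullet> F h g" using w(1-3) dg i by simp
      finally show "w \<bullet> A Z h = A W h \<bullet> F h w"
        using w df dg i by - (rule cok_arr_epi[OF e], simp_all)
    qed (use w in auto)
    moreover have "w' = w" if "w' \<in> eh H Z W" "w' \<bullet> g = t" for w'
      using that ehD(1-3)[OF that(1)] w df dg by - (rule cok_arr_epi[OF c], simp_all)
    ultimately show "\<exists>!w. w \<in> eh H Z W \<and> w \<bullet> g = t" using w by blast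
  qed
  ultimately show ?thesis using o f g by (simp add: ses_def)
qed

text \<open>The kernel in C inherits an action: since f is equivariant, each structure map of X
  sends T^h of the kernel into the kernel.\<close>

lemma E_ex_kernel:
  assumes H: "subgroup H G" and o: "X \<in> Ob (E H)" "Y \<in> Ob (E H)" and f: "f \<in> eh H X Y"
  shows "\<exists>K \<in> Ob (E H). \<exists>i \<in> eh H K X. ker_arr (E H) (Arrow X (mor f) Y) (Arrow K (mor i) X)"
proof -
  interpret H: subgroup H G by fact
  note df = ehD(1-3)[OF f]
  note isoX = E_ObD(3)[OF o(1) H] and isoY = E_ObD(3)[OF o(2) H]
  note ob = E_ObD(1)[OF o(1) H] E_ObD(1)[OF o(2) H]
  obtain N n where "is_kernel C (src f) (trg f) (mor f) N n" using kernels[of "src f" "trg f" "mor f"] df ob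
    by (auto simp: arr_def)
  then have k: "ker_arr C f (Arrow N n (src f))" by (simp add: ker_arr_def)
  define i where "i = Arrow N n (src f)"
  note k = k[folded i_def]
  have i: "arr C i" "trg i = fst X" "src i = N" using ker_arr_arr[OF k] df by (auto simp: i_def)
  then have N: "N \<in> Ob C" by (auto simp: arr_def)
  have "\<exists>w. arr C w \<and> src w = FObj (T h) N \<and> trg w = N \<and> i \<bullet> w = A X h \<bullet> F h i" if h: "h \<in> H" for h
  proof -
    have "f \<bullet> A X h \<bullet> F h i = (A Y h \<bullet> F h f) \<bullet> F h i"
      using isoX[OF h] isoY[OF h] h df i ehD(4)[OF f h] by (intro cmp_reassoc) auto
    also have "\<dots> = A Y h \<bullet> F h (f \<bullet> i)" using isoY[OF h] h df i by simp
    also have "\<dots> = zer C (FObj (T h) N) (fst Y)"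
      using isoY[OF h] h df i ob N ker_arr_zero[OF k] by (simp del: T_simps(4))
    finally show ?thesis
      using ker_arr_lift[OF k, of "A X h \<bullet> F h i"] isoX[OF h] h df i by auto
  qed
  then obtain \<kappa> where \<kappa>: "\<And>h. h \<in> H \<Longrightarrow> arr C (\<kappa> h) \<and> src (\<kappa> h) = FObj (T h) N \<and> trg (\<kappa> h) = N \<and> i \<bullet> \<kappa> h = A X h \<bullet> F h i"
    by metis
  define K where "K = (N, \<lambda>h\<in>H. mor (\<kappa> h))"
  have AK: "A K h = \<kappa> h" if "h \<in> H" for h
    using \<kappa>[OF that] that by (auto simp: ac_def K_def intro: arrow_eqI)
  have K: "K \<in> Ob (E H)"
  proof (rule E_ObI[OF H])
    fix g h assume g: "g \<in> H" and h: "h \<in> H"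
    note \<kappa>g = \<kappa>[OF g] and \<kappa>h = \<kappa>[OF h] and \<kappa>gh = \<kappa>[OF H.m_closed[OF g h]]
    note iso = isoX[OF g] isoX[OF h] isoX[OF H.m_closed[OF g h]]
    \<comment> \<open>The cocycle condition is compared after composing with the monomorphism i,
      where it becomes that of X.\<close>
    have "i \<bullet> \<kappa> g \<bullet> F g (\<kappa> h) = (A X g \<bullet> F g i) \<bullet> F g (\<kappa> h)"
      using g h \<kappa>g \<kappa>h i by (intro cmp_reassoc) auto
    also have "\<dots> = A X g \<bullet> F g (i \<bullet> \<kappa> h)"
      using g h \<kappa>g conjunct1[OF \<kappa>h] conjunct2[OF \<kappa>h, THEN conjunct1]
        conjunct2[OF \<kappa>h, THEN conjunct2, THEN conjunct1] i iso by simp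
    also have "\<dots> = A X g \<bullet> F g (A X h) \<bullet> F g (F h i)" using g h \<kappa>h i iso by simp
    also have "\<dots> = (A X (g \<otimes>\<^bsub>G\<^esub> h) \<bullet> gam g h (fst X)) \<bullet> F g (F h i)"
      using g h i iso ob E_ObD(4)[OF o(1) H g h] by (intro cmp_reassoc) auto
    also have "\<dots> = A X (g \<otimes>\<^bsub>G\<^esub> h) \<bullet> F (g \<otimes>\<^bsub>G\<^esub> h) i \<bullet> gam g h N"
      using g h i iso ob by (simp add: ga_natural)
    also have "\<dots> = (i \<bullet> \<kappa> (g \<otimes>\<^bsub>G\<^esub> h)) \<bullet> gam g h N" using g h i iso ob N \<kappa>gh by simp
    also have "\<dots> = i \<bullet> \<kappa> (g \<otimes>\<^bsub>G\<^esub> h) \<bullet> gam g h N"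
      using g h i N \<kappa>gh by (intro cmp_assoc) auto
    finally have "\<kappa> g \<bullet> F g (\<kappa> h) = \<kappa> (g \<otimes>\<^bsub>G\<^esub> h) \<bullet> gam g h N"
      using g h i N \<kappa>g \<kappa>h \<kappa>gh df by - (rule ker_arr_mono[OF k], simp_all)
    then show "A K g \<bullet> F g (A K h) = A K (g \<otimes>\<^bsub>G\<^esub> h) \<bullet> gam g h (fst K)"
      using AK g h by (simp add: K_def)
  next
    have "i \<bullet> \<kappa> \<one>\<^bsub>G\<^esub> = i \<bullet> idn C N"
      using \<kappa>[OF H.one_closed] i N ob E_ObD(5)[OF o(1) H] by simp
    then have "\<kappa> \<one>\<^bsub>G\<^esub> = idn C N"
      using \<kappa>[OF H.one_closed] i N df by - (rule ker_arr_mono[OF k], simp_all)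
    then show "A K \<one>\<^bsub>G\<^esub> = idn C (fst K)" using AK by (simp add: K_def)
  qed (use AK \<kappa> N in \<open>auto simp: K_def\<close>)
  have iK: "i \<in> eh H K X"
    using i AK \<kappa> by (intro ehI) (auto simp: K_def)
  have "ker_arr (E H) (Arrow X (mor f) Y) (Arrow K (mor i) X)"
    unfolding E_ker_arr[OF H o K f iK]
  proof (intro conjI ballI impI)
    show "f \<bullet> i = zer C (fst K) (fst Y)" using ker_arr_zero[OF k] i df by (simp add: K_def)
    fix W t assume W: "W \<in> Ob (E H)" and t: "t \<in> eh H W X" and z: "f \<bullet> t = zer C (fst W) (fst Y)"
    note dt = ehD(1-3)[OF t]
    obtain w where w: "arr C w" "src w = fst W" "trg w = N" "i \<bullet> w = t"
      using ker_arr_lift[OF k, of t] dt i df z by auto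
    have "w \<in> eh H W K"
    proof (rule ehI)
      fix h assume h: "h \<in> H"
      note iso = isoX[OF h] E_ObD(3)[OF W H h] H.mem_carrier[OF h]
      have "i \<bullet> w \<bullet> A W h = t \<bullet> A W h" using w i iso by (intro cmp_reassoc) auto
      also have "\<dots> = A X h \<bullet> F h (i \<bullet> w)" using ehD(4)[OF t h] w by simp
      also have "\<dots> = A X h \<bullet> F h i \<bullet> F h w" using w(1-3) i iso by simp
      also have "\<dots> = (i \<bullet> \<kappa> h) \<bullet> F h w"
        using \<kappa>[OF h] w(1-3) i iso by (intro cmp_reassoc) auto
      also have "\<dots> = i \<bullet> \<kappa> h \<bullet> F h w" using w(1-3) i iso \<kappa>[OF h] by (intro cmp_assoc) auto
      finally show "w \<bullet> A W h = A K h \<bullet> F h w"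
        unfolding AK[OF h] using w i df iso \<kappa>[OF h] by - (rule ker_arr_mono[OF k], simp_all)
    qed (use w in \<open>auto simp: K_def\<close>)
    moreover have "w' = w" if "w' \<in> eh H W K" "i \<bullet> w' = t" for w'
      using that ehD(1-3)[OF that(1)] w i df by - (rule ker_arr_mono[OF k], simp_all add: K_def)
    ultimately show "\<exists>!w. w \<in> eh H W K \<and> i \<bullet> w = t" using w by blast
  qed
  then show ?thesis using K iK by blast
qed

lemma E_kernel_category:
  assumes H: "subgroup H G"
  shows "kernel_category k (E H)"
proof (intro kernel_category.intro E_linear_category[OF H] kernel_category_axioms.intro)
  interpret H: subgroup H G by fact
  interpret E: linear_category k "E H" by (rule E_linear_category[OF H])
  obtain Z where Z: "is_zero_object C Z" using zero_object by auto
  then have Zo: "Z \<in> Ob C" by (simp add: is_zero_object_def)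
  \<comment> \<open>A zero object of C with zero maps as action; the unit condition holds because
    its identity is zero.\<close>
  define N where "N = (Z, \<lambda>h\<in>H. Zer C (FObj (T h) Z) Z)"
  have AO: "A N h = zer C (FObj (T h) Z) Z" if "h \<in> H" for h
    using that by (simp add: N_def ac_def zer_def)
  have "idn C Z = zer C Z Z" using is_zero_object_arr(1)[OF Z arr_idn[OF Zo]] by simp
  then have N: "N \<in> Ob (E H)"
    using Zo AO by (intro E_ObI[OF H]) (auto simp: N_def)
  have un0: "t = u" if "un t = un u" "src t = src u" "trg t = trg u" for t u
    using that un_inject by blast
  have "is_zero_object (E H) N"
  proof (rule E.is_zero_objectI[OF N])
    show "t = zer (E H) (src t) N" if "arr (E H) t" "trg t = N" for t
    proof (rule un0)
      have "arr C (un t)" "trg (un t) = Z" using that H by (auto simp: E_arr N_def eh_def)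
      then show "un t = un (zer (E H) (src t) N)"
        using is_zero_object_arr(2)[OF Z, of "un t"] by (simp add: un_zer N_def)
    qed (use that in auto)
    show "t = zer (E H) N (trg t)" if "arr (E H) t" "src t = N" for t
    proof (rule un0)
      have "arr C (un t)" "src (un t) = Z" using that H by (auto simp: E_arr N_def eh_def)
      then show "un t = un (zer (E H) N (trg t))"
        using is_zero_object_arr(1)[OF Z, of "un t"] by (simp add: un_zer N_def)
    qed (use that in auto)
  qed
  then show "\<exists>Z. is_zero_object (E H) Z" by blast
  fix f assume f: "arr (E H) f"
  then have "un f \<in> eh H (src f) (trg f)" "src f \<in> Ob (E H)" "trg f \<in> Ob (E H)" using H by (auto simp: E_arr)
  from E_ex_kernel[OF H this(2,3,1)] show "\<exists>u. ker_arr (E H) f u"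
    by auto
qed

lemma E_iso:
  assumes H: "subgroup H G" and o: "X \<in> Ob (E H)" "Y \<in> Ob (E H)" and t: "t \<in> eh H X Y" and i: "iso C t"
  shows "iso (E H) (Arrow X (mor t) Y)"
proof -
  interpret E: linear_category k "E H" by (rule E_linear_category[OF H])
  note ti = inv_eh[OF H o t i]
  note a = E_arr_eh[OF H o t] E_arr_eh[OF H o(2,1) ti]
  show ?thesis
  proof (rule E.isoI)
    show "Arrow Y (mor (inv_arr C t)) X \<bullet>\<^bsub>E H\<^esub> Arrow X (mor t) Y = idn (E H) (src (Arrow X (mor t) Y))"
      using a i ehD(2)[OF t] by (subst un_inject[symmetric]) (simp_all add: un_cmp un_idn)
    show "Arrow X (mor t) Y \<bullet>\<^bsub>E H\<^esub> Arrow Y (mor (inv_arr C t)) X = idn (E H) (trg (Arrow X (mor t) Y))"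
      using a i ehD(3)[OF t] by (subst un_inject[symmetric]) (simp_all add: un_cmp un_idn)
  qed (use a in auto)
qed

lemma E_class_iso:
  assumes "cring R" "subgroup H G" "X \<in> Ob (E H)" "Y \<in> Ob (E H)" "t \<in> eh H X Y" "iso C t"
  shows "K0_class R (E H) X = K0_class R (E H) Y"
  using kernel_category.K0_class_iso[OF E_kernel_category[OF assms(2)] assms(1) E_iso[OF assms(2-6)]]
  by simp

text \<open>The inclusion of the hom-modules of C^H into those of C is linear, so sums agree, and a
  decomposition by equivariant maps may be verified in C.\<close>

lemma E_class_dsum:
  assumes R: "cring R" and H: "subgroup H G" and fin: "finite I" and S: "S \<in> Ob (E H)"
    and X: "\<And>i. i \<in> I \<Longrightarrow> X i \<in> Ob (E H)" "\<And>i. i \<in> I \<Longrightarrow> \<iota> i \<in> eh H (X i) S" "\<And>i. i \<in> I \<Longrightarrow> \<pi> i \<in> eh H S (X i)"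
    and orth: "\<And>i j. i \<in> I \<Longrightarrow> j \<in> I \<Longrightarrow> \<pi> j \<bullet> \<iota> i = (if i = j then idn C (fst (X i)) else zer C (fst (X i)) (fst (X j)))"
    and id: "sm C (fst S) (fst S) I (\<lambda>i. \<iota> i \<bullet> \<pi> i) = idn C (fst S)"
  shows "K0_class R (E H) S = (\<Oplus>\<^bsub>K0 R (E H)\<^esub> i \<in> I. K0_class R (E H) (X i))"
proof -
  interpret E: kernel_category k "E H" by (rule E_kernel_category[OF H])
  let ?i = "\<lambda>i. Arrow (X i) (mor (\<iota> i)) S" and ?p = "\<lambda>i. Arrow S (mor (\<pi> i)) (X i)"
  note ai = E_arr_eh[OF H X(1) S X(2)] and ap = E_arr_eh[OF H S X(1) X(3)]
  have "dsum (E H) I X S ?i ?p"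
    unfolding dsum_def
  proof (intro conjI ballI)
    fix i j assume i: "i \<in> I" and j: "j \<in> I"
    show "?p j \<bullet>\<^bsub>E H\<^esub> ?i i = (if i = j then idn (E H) (X i) else zer (E H) (X i) (X j))"
      using ai[OF i i] ap[OF j j] orth[OF i j]
      by (subst un_inject[symmetric]) (auto simp: un_cmp un_idn un_zer)
  next
    have F: "(\<lambda>i. ?i i \<bullet>\<^bsub>E H\<^esub> ?p i) \<in> I \<rightarrow> hm (E H) S S" using ai ap by auto
    have So: "fst S \<in> Ob C" using E_ObD(1)[OF S H] .
    have "(\<lambda>f. f) \<in> mod_hom k (hom_module (E H) S S) (hom_module C (fst S) (fst S))"
      by (rule mod_homI) (use So in \<open>auto simp: E_Hom eh_def arr_def\<close>)
    from mod_hom_finsum[OF E.hom_module[OF S S] hom_module[OF So So] this fin E.mors_in[OF F]]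
    have "(\<Oplus>\<^bsub>hom_module (E H) S S\<^esub> i \<in> I. mor (?i i \<bullet>\<^bsub>E H\<^esub> ?p i)) =
        (\<Oplus>\<^bsub>hom_module C (fst S) (fst S)\<^esub> i \<in> I. mor (\<iota> i \<bullet> \<pi> i))"
      by (simp add: mor_cmp)
    also have "\<dots> = Idn C (fst S)" using id by (simp add: sm_def idn_def)
    finally show "sm (E H) S S I (\<lambda>i. ?i i \<bullet>\<^bsub>E H\<^esub> ?p i) = idn (E H) S" by (simp add: sm_def idn_def)
  qed (use X S ai ap in auto)
  from E.K0_class_dsum[OF R fin this] show ?thesis .
qed

end

context tensor_action
begin

subsection \<open>Restriction and conjugation of equivariant objects\<close>

lemma fst_res_obj [simp]: "fst (res_obj K X) = fst X"
  and A_res_obj [simp]: "h \<in> K \<Longrightarrow> A (res_obj K X) h = A X h"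
  by (simp_all add: res_obj_def ac_def split: prod.split)

lemma eh_res_obj [simp]: "eh K (res_obj K X) Y = eh K X Y" "eh K X (res_obj K Y) = eh K X Y"
  by (simp_all add: eh_def)

lemma eh_mono: "K \<subseteq> H \<Longrightarrow> t \<in> eh H X Y \<Longrightarrow> t \<in> eh K X Y"
  by (auto simp: eh_def)

lemma res_obj_Ob:
  assumes "subgroup H G" "subgroup K G" "K \<subseteq> H" "X \<in> Ob (E H)"
  shows "res_obj K X \<in> Ob (E K)"
proof (rule E_ObI[OF assms(2)])
  show "snd (res_obj K X) \<in> extensional K" by (simp add: res_obj_def split: prod.split)
  show "arr C (A (res_obj K X) h)" if "h \<in> K" for h
    using that assms E_ObD(3)[OF assms(4,1)] by auto
  show "A (res_obj K X) g \<bullet> F g (A (res_obj K X) h) = A (res_obj K X) (g \<otimes>\<^bsub>G\<^esub> h) \<bullet> gam g h (fst (res_obj K X))"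
    if "g \<in> K" "h \<in> K" for g h
    using that assms E_ObD(4)[OF assms(4,1), of g h] subgroup.m_closed[OF assms(2) that] by auto
  show "A (res_obj K X) \<one>\<^bsub>G\<^esub> = idn C (fst (res_obj K X))"
    using assms E_ObD(5)[OF assms(4,1)] subgroup.one_closed[OF assms(2)] by auto
qed (use assms E_ObD(1)[OF assms(4,1)] in auto)

lemma inv_ga_natural:
  assumes "g \<in> carrier G" "h \<in> carrier G" "arr C t" "M = trg t"
  shows "inv_arr C (gam g h M) \<bullet> F (g \<otimes>\<^bsub>G\<^esub> h) t = F g (F h t) \<bullet> inv_arr C (gam g h (src t))"
proof -
  have "F (g \<otimes>\<^bsub>G\<^esub> h) t = (gam g h M \<bullet> F g (F h t)) \<bullet> inv_arr C (gam g h (src t))"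
    using assms by (intro inv_swap_right) (auto simp: ga_natural arr_src arr_trg)
  then show ?thesis using assms by (simp add: arr_src arr_trg)
qed

text \<open>Carries a morphism j out of T^x V over to T^(xu) V, along the isomorphism between the
  two given by the structure map at u. Conjugation and induction both use this expression, with
  different j.\<close>

definition ph where
  "ph X x j u = j \<bullet> F x (A X u) \<bullet> inv_arr C (gam x u (fst X))"

context
  fixes K X x j V
  assumes K: "subgroup K G" and X: "X \<in> Ob (E K)" and x: "x \<in> carrier G"
    and j: "arr C j" "src j = FObj (T x) V" and V: "V = fst X"
begin

lemma ph_arr:
  assumes "u \<in> K"
  shows "arr C (ph X x j u)" "src (ph X x j u) = FObj (T (x \<otimes>\<^bsub>G\<^esub> u)) V" "trg (ph X x j u) = trg j"
  using assms E_ObD(1)[OF X K] E_ObD(3)[OF X K assms] subgroup.mem_carrier[OF K assms] x j V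
  by (auto simp: ph_def)

lemma ph_ga: "u \<in> K \<Longrightarrow> ph X x j u \<bullet> gam x u V = j \<bullet> F x (A X u)"
  using E_ObD(1)[OF X K] E_ObD(3)[OF X K] subgroup.mem_carrier[OF K] x j V
  by (simp add: ph_def)

text \<open>Carrying over by u and then by v amounts to carrying over by their product. Both sides
  are compared after the isomorphism \<open>gam x u\<close>, where naturality and coherence of
  \<gamma> apply.\<close>

lemma ph_act:
  assumes u: "u \<in> K" and v: "v \<in> K"
  shows "ph X x j u \<bullet> F (x \<otimes>\<^bsub>G\<^esub> u) (A X v) = ph X x j (u \<otimes>\<^bsub>G\<^esub> v) \<bullet> gam (x \<otimes>\<^bsub>G\<^esub> u) v V"
proof -
  have uv: "u \<otimes>\<^bsub>G\<^esub> v \<in> K" using K u v by (rule subgroup.m_closed)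
  note c = subgroup.mem_carrier[OF K u] subgroup.mem_carrier[OF K v] x
  note i = E_ObD(3)[OF X K u] E_ObD(3)[OF X K v] E_ObD(3)[OF X K uv]
  have Vo: "V \<in> Ob C" using E_ObD(1)[OF X K] V by simp
  note p = ph_arr[OF u] ph_arr[OF uv]
  have "(ph X x j u \<bullet> F (x \<otimes>\<^bsub>G\<^esub> u) (A X v)) \<bullet> gam x u (FObj (T v) V)
      = ph X x j u \<bullet> gam x u V \<bullet> F x (F u (A X v))"
    using c i p Vo V by (simp add: ga_natural)
  also have "\<dots> = (j \<bullet> F x (A X u)) \<bullet> F x (F u (A X v))"
    using c i p Vo V by (intro cmp_reassoc ph_ga u) auto
  also have "\<dots> = j \<bullet> F x (A X u \<bullet> F u (A X v))" using c i j V by simp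
  also have "\<dots> = j \<bullet> F x (A X (u \<otimes>\<^bsub>G\<^esub> v)) \<bullet> F x (gam u v V)"
    unfolding E_ObD(4)[OF X K u v] using c i j V Vo by simp
  also have "\<dots> = (ph X x j (u \<otimes>\<^bsub>G\<^esub> v) \<bullet> gam x (u \<otimes>\<^bsub>G\<^esub> v) V) \<bullet> F x (gam u v V)"
    unfolding ph_ga[OF uv] using c i j V Vo by simp
  also have "\<dots> = ph X x j (u \<otimes>\<^bsub>G\<^esub> v) \<bullet> gam (x \<otimes>\<^bsub>G\<^esub> u) v V \<bullet> gam x u (FObj (T v) V)"
    using c i p Vo by (simp add: ga_assoc)
  also have "\<dots> = (ph X x j (u \<otimes>\<^bsub>G\<^esub> v) \<bullet> gam (x \<otimes>\<^bsub>G\<^esub> u) v V) \<bullet> gam x u (FObj (T v) V)"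
    using c i p Vo by (simp add: G.m_assoc)
  finally show ?thesis
    using c i p Vo V by - (rule iso_cancel_right[of "gam x u (FObj (T v) V)"], simp_all add: G.m_assoc)
qed

end

lemma conj_set_mem:
  assumes "subgroup H G" "x \<in> carrier G"
  shows "l \<in> conj_set G x H \<longleftrightarrow> (\<exists>h \<in> H. l = x \<otimes>\<^bsub>G\<^esub> h \<otimes>\<^bsub>G\<^esub> inv\<^bsub>G\<^esub> x)"
  unfolding r_coset_def l_coset_def by auto

lemma conj_setE:
  assumes "subgroup H G" "x \<in> carrier G" "l \<in> conj_set G x H"
  obtains h where "h \<in> H" "l = x \<otimes>\<^bsub>G\<^esub> h \<otimes>\<^bsub>G\<^esub> inv\<^bsub>G\<^esub> x" "l \<otimes>\<^bsub>G\<^esub> x = x \<otimes>\<^bsub>G\<^esub> h"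
    "inv\<^bsub>G\<^esub> x \<otimes>\<^bsub>G\<^esub> l \<otimes>\<^bsub>G\<^esub> x = h" "l \<in> carrier G"
proof -
  obtain h where h: "h \<in> H" "l = x \<otimes>\<^bsub>G\<^esub> h \<otimes>\<^bsub>G\<^esub> inv\<^bsub>G\<^esub> x"
    using assms conj_set_mem by blast
  have c: "h \<in> carrier G" using assms(1) h(1) by (rule subgroup.mem_carrier)
  have lx: "l \<otimes>\<^bsub>G\<^esub> x = x \<otimes>\<^bsub>G\<^esub> h" unfolding h(2) using c assms(2) by (simp add: G.m_assoc)
  have l: "l \<in> carrier G" unfolding h(2) using c assms(2) by simp
  have "inv\<^bsub>G\<^esub> x \<otimes>\<^bsub>G\<^esub> l \<otimes>\<^bsub>G\<^esub> x = inv\<^bsub>G\<^esub> x \<otimes>\<^bsub>G\<^esub> (x \<otimes>\<^bsub>G\<^esub> h)"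
    using l assms(2) by (simp add: G.m_assoc lx)
  also have "\<dots> = h" using c assms(2) by (simp flip: G.m_assoc)
  finally show thesis using that h lx l by blast
qed

text \<open>Membership in the form l x = x h is what makes the targets of \<open>gam l x\<close> and
  \<open>gam x h\<close> agree, so it is the form in which the conjugate action is computed.\<close>

lemma conj_setI:
  assumes "subgroup H G" "x \<in> carrier G" "h \<in> H" "l \<in> carrier G" "l \<otimes>\<^bsub>G\<^esub> x = x \<otimes>\<^bsub>G\<^esub> h"
  shows "l \<in> conj_set G x H"
proof -
  have "(l \<otimes>\<^bsub>G\<^esub> x) \<otimes>\<^bsub>G\<^esub> inv\<^bsub>G\<^esub> x = l" using assms(1-4) by (simp add: G.m_assoc)
  then show ?thesis using assms conj_set_mem by metis
qed

lemma conj_set_subgroup: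
  assumes H: "subgroup H G" and x: "x \<in> carrier G"
  shows "subgroup (conj_set G x H) G"
proof -
  interpret H: subgroup H G by fact
  show ?thesis
  proof (rule G.subgroupI)
    show "conj_set G x H \<subseteq> carrier G" using conj_setE[OF H x] by blast
    show "conj_set G x H \<noteq> {}" using conj_setI[OF H x H.one_closed, of "\<one>\<^bsub>G\<^esub>"] x by auto
    fix l assume l: "l \<in> conj_set G x H"
    then obtain h where h: "h \<in> H" "l \<otimes>\<^bsub>G\<^esub> x = x \<otimes>\<^bsub>G\<^esub> h" "l \<in> carrier G" using conj_setE[OF H x] by metis
    have "inv\<^bsub>G\<^esub> l \<otimes>\<^bsub>G\<^esub> x = inv\<^bsub>G\<^esub> l \<otimes>\<^bsub>G\<^esub> (x \<otimes>\<^bsub>G\<^esub> h) \<otimes>\<^bsub>G\<^esub> inv\<^bsub>G\<^esub> h" using h x by (simp add: G.m_assoc)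
    also have "\<dots> = x \<otimes>\<^bsub>G\<^esub> inv\<^bsub>G\<^esub> h"
      using h(1,3) x by (simp add: h(2)[symmetric]) (simp flip: G.m_assoc)
    finally show "inv\<^bsub>G\<^esub> l \<in> conj_set G x H" using conj_setI[OF H x, of "inv\<^bsub>G\<^esub> h"] h by auto
    fix m assume m: "m \<in> conj_set G x H"
    then obtain h' where h': "h' \<in> H" "m \<otimes>\<^bsub>G\<^esub> x = x \<otimes>\<^bsub>G\<^esub> h'" "m \<in> carrier G" using conj_setE[OF H x] by metis
    have "l \<otimes>\<^bsub>G\<^esub> m \<otimes>\<^bsub>G\<^esub> x = (l \<otimes>\<^bsub>G\<^esub> x) \<otimes>\<^bsub>G\<^esub> h'" using h(1,3) h' x by (simp add: G.m_assoc)
    also have "\<dots> = x \<otimes>\<^bsub>G\<^esub> (h \<otimes>\<^bsub>G\<^esub> h')" using h h' x by (simp add: G.m_assoc)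
    finally show "l \<otimes>\<^bsub>G\<^esub> m \<in> conj_set G x H" using conj_setI[OF H x, of "h \<otimes>\<^bsub>G\<^esub> h'"] h h' by auto
  qed
qed

lemma fst_cj [simp]: "fst (cj H x X) = FObj (T x) (fst X)"
  by (simp add: conj_obj_def split: prod.split)

text \<open>The conjugate action is \<open>ph\<close> applied to the identity of T^x V, which makes
  \<open>ph_act\<close> available for its cocycle condition.\<close>

lemma A_cj:
  assumes H: "subgroup H G" and x: "x \<in> carrier G" and X: "X \<in> Ob (E H)" and h: "h \<in> H"
    and l: "l \<in> carrier G" "l \<otimes>\<^bsub>G\<^esub> x = x \<otimes>\<^bsub>G\<^esub> h"
  shows "A (cj H x X) l = ph X x (idn C (FObj (T x) (fst X))) h \<bullet> gam l x (fst X)"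
proof -
  have c: "h \<in> carrier G" using H h by (rule subgroup.mem_carrier)
  have l2: "l \<in> conj_set G x H" by (rule conj_setI[OF H x h l])
  have "inv\<^bsub>G\<^esub> x \<otimes>\<^bsub>G\<^esub> l \<otimes>\<^bsub>G\<^esub> x = inv\<^bsub>G\<^esub> x \<otimes>\<^bsub>G\<^esub> (x \<otimes>\<^bsub>G\<^esub> h)"
    using l x by (simp add: G.m_assoc)
  also have "\<dots> = h" using c x by (simp flip: G.m_assoc)
  finally have e: "inv\<^bsub>G\<^esub> x \<otimes>\<^bsub>G\<^esub> l \<otimes>\<^bsub>G\<^esub> x = h" .
  have "A (cj H x X) l = (F x (A X h) \<bullet> inv_arr C (gam x h (fst X))) \<bullet> gam l x (fst X)"
    using l2 e by (simp add: conj_obj_def ac_def fm_def inv_arr_def ga_def cmp_def Let_def split: prod.split)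
  also have "\<dots> = ph X x (idn C (FObj (T x) (fst X))) h \<bullet> gam l x (fst X)"
    using x c h E_ObD(1)[OF X H] E_ObD(3)[OF X H h] by (simp add: ph_def)
  finally show ?thesis .
qed

lemma cj_Ob:
  assumes H: "subgroup H G" and x: "x \<in> carrier G" and X: "X \<in> Ob (E H)"
  shows "cj H x X \<in> Ob (E (conj_set G x H))"
proof (rule E_ObI[OF conj_set_subgroup[OF H x]])
  define V where "V = fst X"
  have Vo: "V \<in> Ob C" using E_ObD(1)[OF X H] V_def by simp
  define p where "p = ph X x (idn C (FObj (T x) V))"
  note ph = ph_arr[OF H X x _ _ V_def, of "idn C (FObj (T x) V)", folded p_def]
    ph_act[OF H X x _ _ V_def, of "idn C (FObj (T x) V)", folded p_def]
  note Acj = A_cj[OF H x X, folded V_def, folded p_def]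
  show "fst (cj H x X) \<in> Ob C" using x Vo V_def by simp
  show "snd (cj H x X) \<in> extensional (conj_set G x H)"
    by (simp add: conj_obj_def split: prod.split)
  fix l assume l: "l \<in> conj_set G x H"
  then obtain h where h: "h \<in> H" "l \<otimes>\<^bsub>G\<^esub> x = x \<otimes>\<^bsub>G\<^esub> h" "l \<in> carrier G" using conj_setE[OF H x] by metis
  have hc: "h \<in> carrier G" using H h(1) by (rule subgroup.mem_carrier)
  have pl: "arr C (p h)" "src (p h) = FObj (T (x \<otimes>\<^bsub>G\<^esub> h)) V" "trg (p h) = FObj (T x) V"
    using ph(1-3)[OF _ _ h(1)] x Vo by auto
  show "arr C (A (cj H x X) l)"
    using Acj[OF h(1,3,2)] pl h x Vo by simp
  fix m assume m: "m \<in> conj_set G x H"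
  then obtain h' where h': "h' \<in> H" "m \<otimes>\<^bsub>G\<^esub> x = x \<otimes>\<^bsub>G\<^esub> h'" "m \<in> carrier G" using conj_setE[OF H x] by metis
  have hc': "h' \<in> carrier G" using H h'(1) by (rule subgroup.mem_carrier)
  have hh: "h \<otimes>\<^bsub>G\<^esub> h' \<in> H" using H h(1) h'(1) by (rule subgroup.m_closed)
  have pm: "arr C (p h')" "src (p h') = FObj (T (x \<otimes>\<^bsub>G\<^esub> h')) V" "trg (p h') = FObj (T x) V"
    using ph(1-3)[OF _ _ h'(1)] x Vo by auto
  have plm: "arr C (p (h \<otimes>\<^bsub>G\<^esub> h'))" "src (p (h \<otimes>\<^bsub>G\<^esub> h')) = FObj (T (x \<otimes>\<^bsub>G\<^esub> (h \<otimes>\<^bsub>G\<^esub> h'))) V"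
    "trg (p (h \<otimes>\<^bsub>G\<^esub> h')) = FObj (T x) V"
    using ph(1-3)[OF _ _ hh] x Vo by auto
  have lm: "(l \<otimes>\<^bsub>G\<^esub> m) \<otimes>\<^bsub>G\<^esub> x = x \<otimes>\<^bsub>G\<^esub> (h \<otimes>\<^bsub>G\<^esub> h')"
  proof -
    have "(l \<otimes>\<^bsub>G\<^esub> m) \<otimes>\<^bsub>G\<^esub> x = (l \<otimes>\<^bsub>G\<^esub> x) \<otimes>\<^bsub>G\<^esub> h'" using h(3) h' x hc' by (simp add: G.m_assoc)
    then show ?thesis using h hc hc' x by (simp add: G.m_assoc)
  qed
  have iA: "arr C (A X h')" using E_ObD(3)[OF X H h'(1)] by simp
  \<comment> \<open>Moves the carried-over identity past T^l. It is checked after the invertible T^l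
    of \<open>gam x h'\<close>; the cocycle condition then follows from the coherence of \<gamma>
    for l, m, x.\<close>
  have key: "p h \<bullet> gam l x V \<bullet> F l (p h') = p (h \<otimes>\<^bsub>G\<^esub> h') \<bullet> gam l (x \<otimes>\<^bsub>G\<^esub> h') V"
  proof -
    have c: "gam l x V \<bullet> F l (F x (A X h')) = F (x \<otimes>\<^bsub>G\<^esub> h) (A X h') \<bullet> gam l x (FObj (T h') V)"
      using ga_natural[of l x "A X h'" V] h x iA V_def by simp
    have i: "p h' \<bullet> gam x h' V = F x (A X h')"
      using ph_ga[OF H X x _ _ V_def h'(1), of "idn C (FObj (T x) V)", folded p_def] x Vo iA hc' V_def by simp
    have "(p h \<bullet> gam l x V \<bullet> F l (p h')) \<bullet> F l (gam x h' V) = p h \<bullet> gam l x V \<bullet> F l (p h' \<bullet> gam x h' V)"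
      using pl pm h h' x hc' Vo by simp
    also have "\<dots> = p h \<bullet> F (x \<otimes>\<^bsub>G\<^esub> h) (A X h') \<bullet> gam l x (FObj (T h') V)"
      unfolding i c ..
    also have "\<dots> = (p (h \<otimes>\<^bsub>G\<^esub> h') \<bullet> gam (x \<otimes>\<^bsub>G\<^esub> h) h' V) \<bullet> gam l x (FObj (T h') V)"
      using pl h h' x hc hc' Vo iA V_def by (intro cmp_reassoc ph(4)) auto
    also have "\<dots> = p (h \<otimes>\<^bsub>G\<^esub> h') \<bullet> gam (l \<otimes>\<^bsub>G\<^esub> x) h' V \<bullet> gam l x (FObj (T h') V)"
      using plm h h' x hc hc' Vo by (simp add: G.m_assoc)
    also have "\<dots> = p (h \<otimes>\<^bsub>G\<^esub> h') \<bullet> gam l (x \<otimes>\<^bsub>G\<^esub> h') V \<bullet> F l (gam x h' V)"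
      using h(3) x hc' Vo by (simp add: ga_assoc)
    also have "\<dots> = (p (h \<otimes>\<^bsub>G\<^esub> h') \<bullet> gam l (x \<otimes>\<^bsub>G\<^esub> h') V) \<bullet> F l (gam x h' V)"
    proof -
      have "l \<otimes>\<^bsub>G\<^esub> (x \<otimes>\<^bsub>G\<^esub> h') = x \<otimes>\<^bsub>G\<^esub> (h \<otimes>\<^bsub>G\<^esub> h')"
        using h x hc hc' by (simp flip: G.m_assoc)
      then show ?thesis using plm h h' x hc hc' Vo by (intro cmp_assoc[symmetric]) auto
    qed
    finally show ?thesis
    proof -
      assume *: "(p h \<bullet> gam l x V \<bullet> F l (p h')) \<bullet> F l (gam x h' V) = (p (h \<otimes>\<^bsub>G\<^esub> h') \<bullet> gam l (x \<otimes>\<^bsub>G\<^esub> h') V) \<bullet> F l (gam x h' V)"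
      have e: "l \<otimes>\<^bsub>G\<^esub> (x \<otimes>\<^bsub>G\<^esub> h') = x \<otimes>\<^bsub>G\<^esub> (h \<otimes>\<^bsub>G\<^esub> h')"
        using h x hc hc' by (simp flip: G.m_assoc)
      show ?thesis
        by (rule iso_cancel_right[OF _ _ _ _ _ *]) (use pl pm plm h h' x hc' Vo e in auto)
    qed
  qed
  have "A (cj H x X) l \<bullet> F l (A (cj H x X) m) = (p h \<bullet> gam l x V \<bullet> F l (p h')) \<bullet> F l (gam m x V)"
    unfolding Acj[OF h(1,3,2)] Acj[OF h'(1,3,2)] using pl pm h h' x hc' Vo by simp
  also have "\<dots> = (p (h \<otimes>\<^bsub>G\<^esub> h') \<bullet> gam l (x \<otimes>\<^bsub>G\<^esub> h') V) \<bullet> F l (gam m x V)" unfolding key ..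
  also have "\<dots> = p (h \<otimes>\<^bsub>G\<^esub> h') \<bullet> gam l (x \<otimes>\<^bsub>G\<^esub> h') V \<bullet> F l (gam m x V)"
  proof -
    have "l \<otimes>\<^bsub>G\<^esub> (x \<otimes>\<^bsub>G\<^esub> h') = x \<otimes>\<^bsub>G\<^esub> (h \<otimes>\<^bsub>G\<^esub> h')"
      using h x hc hc' by (simp flip: G.m_assoc)
    then show ?thesis using plm h h' x hc hc' Vo by (intro cmp_assoc) auto
  qed
  also have "\<dots> = p (h \<otimes>\<^bsub>G\<^esub> h') \<bullet> gam (l \<otimes>\<^bsub>G\<^esub> m) x V \<bullet> gam l m (FObj (T x) V)"
    using ga_assoc[of l m x V] h h' x Vo by simp
  also have "\<dots> = A (cj H x X) (l \<otimes>\<^bsub>G\<^esub> m) \<bullet> gam l m (fst (cj H x X))"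
    using Acj[OF hh _ lm] plm h h' x hc hc' Vo lm by (simp add: V_def)
  finally show "A (cj H x X) l \<bullet> F l (A (cj H x X) m) = A (cj H x X) (l \<otimes>\<^bsub>G\<^esub> m) \<bullet> gam l m (fst (cj H x X))" .
next
  have "\<one>\<^bsub>G\<^esub> \<in> H" using H by (rule subgroup.one_closed)
  from A_cj[OF H x X this, of "\<one>\<^bsub>G\<^esub>"] show "A (cj H x X) \<one>\<^bsub>G\<^esub> = idn C (fst (cj H x X))"
    using x E_ObD(1)[OF X H] E_ObD(5)[OF X H] by (simp add: ph_def)
qed

lemma F_cj_eh:
  assumes H: "subgroup H G" and x: "x \<in> carrier G" and X: "X \<in> Ob (E H)" "Y \<in> Ob (E H)" and t: "t \<in> eh H X Y"
  shows "F x t \<in> eh (conj_set G x H) (cj H x X) (cj H x Y)"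
proof (rule ehI)
  note dt = ehD(1-3)[OF t]
  show "arr C (F x t)" "src (F x t) = fst (cj H x X)" "trg (F x t) = fst (cj H x Y)" using dt x by auto
  note ob = E_ObD(1)[OF X(1) H] E_ObD(1)[OF X(2) H]
  fix l assume "l \<in> conj_set G x H"
  then obtain h where h: "h \<in> H" "l \<otimes>\<^bsub>G\<^esub> x = x \<otimes>\<^bsub>G\<^esub> h" "l \<in> carrier G" using conj_setE[OF H x] by metis
  have hc: "h \<in> carrier G" using H h(1) by (rule subgroup.mem_carrier)
  note i = E_ObD(3)[OF X(1) H h(1)] E_ObD(3)[OF X(2) H h(1)]
  have "F x t \<bullet> A (cj H x X) l = F x (t \<bullet> A X h) \<bullet> inv_arr C (gam x h (fst X)) \<bullet> gam l x (fst X)"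
    unfolding A_cj[OF H x X(1) h(1,3,2)] ph_def using x h hc ob i dt by simp
  also have "\<dots> = F x (A Y h) \<bullet> (F x (F h t) \<bullet> inv_arr C (gam x h (fst X))) \<bullet> gam l x (fst X)"
    unfolding ehD(4)[OF t h(1)] using x h hc ob i dt by simp
  also have "\<dots> = F x (A Y h) \<bullet> (inv_arr C (gam x h (fst Y)) \<bullet> F (x \<otimes>\<^bsub>G\<^esub> h) t) \<bullet> gam l x (fst X)"
    using inv_ga_natural[of x h t "fst Y"] x hc dt by simp
  also have "\<dots> = F x (A Y h) \<bullet> inv_arr C (gam x h (fst Y)) \<bullet> F (l \<otimes>\<^bsub>G\<^esub> x) t \<bullet> gam l x (fst X)"
    using x h hc ob i dt by simp
  also have "F (l \<otimes>\<^bsub>G\<^esub> x) t \<bullet> gam l x (fst X) = gam l x (fst Y) \<bullet> F l (F x t)"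
    using ga_natural[of l x t "fst Y"] x h dt by simp
  finally show "F x t \<bullet> A (cj H x X) l = A (cj H x Y) l \<bullet> F l (F x t)"
    unfolding A_cj[OF H x X(2) h(1,3,2)] ph_def using x h hc ob i dt by simp
qed

lemma conj_set_mem_eq:
  assumes H: "subgroup H G" and x: "x \<in> H"
  shows "conj_set G x H = H"
proof (intro equalityI subsetI)
  interpret H: subgroup H G by fact
  have xc: "x \<in> carrier G" using x by simp
  show "l \<in> H" if "l \<in> conj_set G x H" for l
    using conj_setE[OF H xc that] x by (metis H.m_closed H.m_inv_closed)
  show "l \<in> conj_set G x H" if "l \<in> H" for l
    using conj_setI[OF H xc, of "inv\<^bsub>G\<^esub> x \<otimes>\<^bsub>G\<^esub> l \<otimes>\<^bsub>G\<^esub> x" l] x that by (simp flip: G.m_assoc)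
qed

text \<open>For x in H the structure map at x identifies the conjugate T^x X with X itself. This is
  why conjugation by elements of H is trivial on classes.\<close>

lemma A_cj_eh:
  assumes H: "subgroup H G" and x: "x \<in> H" and X: "X \<in> Ob (E H)"
  shows "A X x \<in> eh (conj_set G x H) (cj H x X) X"
proof -
  interpret H: subgroup H G by fact
  have xc: "x \<in> carrier G" using x by simp
  have c: "conj_set G x H = H" by (rule conj_set_mem_eq[OF H x])
  show "A X x \<in> eh (conj_set G x H) (cj H x X) X"
    unfolding c
  proof (rule ehI)
    note Vo = E_ObD(1)[OF X H] and i = E_ObD(3)[OF X H]
    show "arr C (A X x)" "src (A X x) = fst (cj H x X)" "trg (A X x) = fst X" using i[OF x] by auto
    fix l assume l: "l \<in> H"
    define h where "h = inv\<^bsub>G\<^esub> x \<otimes>\<^bsub>G\<^esub> l \<otimes>\<^bsub>G\<^esub> x"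
    have h: "h \<in> H" using l x by (simp add: h_def)
    have lx: "l \<otimes>\<^bsub>G\<^esub> x = x \<otimes>\<^bsub>G\<^esub> h" using l x by (simp add: h_def flip: G.m_assoc)
    have "A X x \<bullet> A (cj H x X) l = (A X x \<bullet> F x (A X h)) \<bullet> inv_arr C (gam x h (fst X)) \<bullet> gam l x (fst X)"
      using A_cj[OF H xc X h _ lx] l x h i lx Vo by (simp add: ph_def)
    also have "\<dots> = A X (l \<otimes>\<^bsub>G\<^esub> x) \<bullet> gam l x (fst X)"
      unfolding E_ObD(4)[OF X H x h] using l x h i[of "x \<otimes>\<^bsub>G\<^esub> h"] lx Vo by simp
    finally show "A X x \<bullet> A (cj H x X) l = A X l \<bullet> F l (A X x)" using E_ObD(4)[OF X H l x] by simp
  qed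
qed

lemma conj_set_conj:
  assumes H: "subgroup H G" and g: "g \<in> carrier G" and h: "h \<in> carrier G"
  shows "conj_set G h (conj_set G g H) = conj_set G (h \<otimes>\<^bsub>G\<^esub> g) H"
proof -
  note gH = conj_set_subgroup[OF H g]
  have hg: "h \<otimes>\<^bsub>G\<^esub> g \<in> carrier G" using g h by simp
  show ?thesis
  proof (intro equalityI subsetI)
    fix m assume "m \<in> conj_set G h (conj_set G g H)"
    then obtain l where l: "l \<in> conj_set G g H" "m \<otimes>\<^bsub>G\<^esub> h = h \<otimes>\<^bsub>G\<^esub> l" "m \<in> carrier G"
      using conj_setE[OF gH h] by metis
    then obtain u where u: "u \<in> H" "l \<otimes>\<^bsub>G\<^esub> g = g \<otimes>\<^bsub>G\<^esub> u" "l \<in> carrier G"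
      using conj_setE[OF H g] by metis
    have uc: "u \<in> carrier G" using H u(1) by (rule subgroup.mem_carrier)
    have "m \<otimes>\<^bsub>G\<^esub> (h \<otimes>\<^bsub>G\<^esub> g) = h \<otimes>\<^bsub>G\<^esub> (l \<otimes>\<^bsub>G\<^esub> g)" using l u(3) g h by (metis G.m_assoc)
    then have "m \<otimes>\<^bsub>G\<^esub> (h \<otimes>\<^bsub>G\<^esub> g) = (h \<otimes>\<^bsub>G\<^esub> g) \<otimes>\<^bsub>G\<^esub> u" using u uc g h by (simp add: G.m_assoc)
    then show "m \<in> conj_set G (h \<otimes>\<^bsub>G\<^esub> g) H" using conj_setI[OF H hg u(1) l(3)] by simp
  next
    fix m assume "m \<in> conj_set G (h \<otimes>\<^bsub>G\<^esub> g) H"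
    then obtain u where u: "u \<in> H" "m \<otimes>\<^bsub>G\<^esub> (h \<otimes>\<^bsub>G\<^esub> g) = (h \<otimes>\<^bsub>G\<^esub> g) \<otimes>\<^bsub>G\<^esub> u" "m \<in> carrier G"
      using conj_setE[OF H hg] by metis
    have uc: "u \<in> carrier G" using H u(1) by (rule subgroup.mem_carrier)
    define l where "l = g \<otimes>\<^bsub>G\<^esub> u \<otimes>\<^bsub>G\<^esub> inv\<^bsub>G\<^esub> g"
    have l: "l \<in> carrier G" "l \<otimes>\<^bsub>G\<^esub> g = g \<otimes>\<^bsub>G\<^esub> u" using g uc by (simp_all add: l_def G.m_assoc)
    then have lH: "l \<in> conj_set G g H" using conj_setI[OF H g u(1)] by simp
    have "(m \<otimes>\<^bsub>G\<^esub> h) \<otimes>\<^bsub>G\<^esub> g = (h \<otimes>\<^bsub>G\<^esub> l) \<otimes>\<^bsub>G\<^esub> g" using u(2,3) uc l g h by (simp add: G.m_assoc)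
    then have "m \<otimes>\<^bsub>G\<^esub> h = h \<otimes>\<^bsub>G\<^esub> l" using u(3) l g h by (metis G.m_closed G.right_cancel)
    then show "m \<in> conj_set G h (conj_set G g H)" using conj_setI[OF gH h lH u(3)] by simp
  qed
qed

text \<open>Coherence of \<gamma> makes T^h T^g \<rightarrow> T^(hg) equivariant, so iterated
  conjugates are isomorphic in the equivariant category; on classes this is (M3).\<close>

lemma gam_cj_eh:
  assumes H: "subgroup H G" and g: "g \<in> carrier G" and h: "h \<in> carrier G" and X: "X \<in> Ob (E H)"
  shows "gam h g (fst X) \<in> eh (conj_set G (h \<otimes>\<^bsub>G\<^esub> g) H) (cj (conj_set G g H) h (cj H g X)) (cj H (h \<otimes>\<^bsub>G\<^esub> g) X)"
proof (rule ehI)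
  define V where "V = fst X"
  have Vo: "V \<in> Ob C" using E_ObD(1)[OF X H] V_def by simp
  note gH = conj_set_subgroup[OF H g]
  have hg: "h \<otimes>\<^bsub>G\<^esub> g \<in> carrier G" using g h by simp
  show "arr C (gam h g (fst X))" "src (gam h g (fst X)) = fst (cj (conj_set G g H) h (cj H g X))"
    "trg (gam h g (fst X)) = fst (cj H (h \<otimes>\<^bsub>G\<^esub> g) X)"
    using g h Vo by (simp_all add: V_def)
  fix m assume "m \<in> conj_set G (h \<otimes>\<^bsub>G\<^esub> g) H"
  then have "m \<in> conj_set G h (conj_set G g H)" using conj_set_conj[OF H g h] by simp
  then obtain l where l: "l \<in> conj_set G g H" "m \<otimes>\<^bsub>G\<^esub> h = h \<otimes>\<^bsub>G\<^esub> l" "m \<in> carrier G"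
    using conj_setE[OF gH h] by metis
  then obtain u where u: "u \<in> H" "l \<otimes>\<^bsub>G\<^esub> g = g \<otimes>\<^bsub>G\<^esub> u" "l \<in> carrier G"
    using conj_setE[OF H g] by metis
  have uc: "u \<in> carrier G" using H u(1) by (rule subgroup.mem_carrier)
  have m1: "m \<otimes>\<^bsub>G\<^esub> (h \<otimes>\<^bsub>G\<^esub> g) = h \<otimes>\<^bsub>G\<^esub> (l \<otimes>\<^bsub>G\<^esub> g)" using l u(3) g h by (metis G.m_assoc)
  have m2: "m \<otimes>\<^bsub>G\<^esub> (h \<otimes>\<^bsub>G\<^esub> g) = (h \<otimes>\<^bsub>G\<^esub> g) \<otimes>\<^bsub>G\<^esub> u" using m1 u uc g h by (simp add: G.m_assoc)
  have iA: "arr C (A X u)" using E_ObD(3)[OF X H u(1)] by simp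
  define p where "p = F g (A X u) \<bullet> inv_arr C (gam g u V)"
  have p: "arr C p" "src p = FObj (T (g \<otimes>\<^bsub>G\<^esub> u)) V" "trg p = FObj (T g) V"
    using g uc Vo iA by (auto simp: p_def V_def)
  define p' where "p' = F (h \<otimes>\<^bsub>G\<^esub> g) (A X u) \<bullet> inv_arr C (gam (h \<otimes>\<^bsub>G\<^esub> g) u V)"
  have p': "arr C p'" "src p' = FObj (T (h \<otimes>\<^bsub>G\<^esub> g \<otimes>\<^bsub>G\<^esub> u)) V" "trg p' = FObj (T (h \<otimes>\<^bsub>G\<^esub> g)) V"
    using g h uc Vo iA by (auto simp: p'_def V_def)
  have Al: "A (cj H g X) l = p \<bullet> gam l g V"
    using A_cj[OF H g X u(1,3,2)] g u uc Vo iA by (simp add: ph_def p_def V_def)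
  have Am: "A (cj (conj_set G g H) h (cj H g X)) m
      = F h (p \<bullet> gam l g V) \<bullet> inv_arr C (gam h l (FObj (T g) V)) \<bullet> gam m h (FObj (T g) V)"
    using A_cj[OF gH h cj_Ob[OF H g X] l(1,3,2)] g h u uc Vo p l by (simp add: ph_def Al V_def[symmetric])
  have Am': "A (cj H (h \<otimes>\<^bsub>G\<^esub> g) X) m = p' \<bullet> gam m (h \<otimes>\<^bsub>G\<^esub> g) V"
    using A_cj[OF H hg X u(1) l(3) m2] g h u uc l Vo iA m2 by (simp add: ph_def p'_def V_def)
  \<comment> \<open>Compatibility of \<gamma> with the carried-over structure maps at u, tested
    after the invertible T^h of \<open>gam g u\<close>.\<close>
  have key: "gam h g V \<bullet> F h p = p' \<bullet> gam h (g \<otimes>\<^bsub>G\<^esub> u) V"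
  proof -
    have "gam h g V \<bullet> F h (F g (A X u)) = F (h \<otimes>\<^bsub>G\<^esub> g) (A X u) \<bullet> gam h g (FObj (T u) V)"
      using ga_natural[of h g "A X u" V] g h iA by (simp add: V_def)
    moreover have "F g (A X u) = p \<bullet> gam g u V"
      unfolding p_def using g h uc Vo iA by (simp add: V_def)
    ultimately have 1: "(gam h g V \<bullet> F h p) \<bullet> F h (gam g u V) = F (h \<otimes>\<^bsub>G\<^esub> g) (A X u) \<bullet> gam h g (FObj (T u) V)"
      using g h uc Vo p by simp
    have "(p' \<bullet> gam h (g \<otimes>\<^bsub>G\<^esub> u) V) \<bullet> F h (gam g u V) = p' \<bullet> gam (h \<otimes>\<^bsub>G\<^esub> g) u V \<bullet> gam h g (FObj (T u) V)"
      using g h uc Vo p' by (simp add: ga_assoc G.m_assoc)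
    also have "\<dots> = F (h \<otimes>\<^bsub>G\<^esub> g) (A X u) \<bullet> gam h g (FObj (T u) V)"
      unfolding p'_def using g h uc Vo iA by (simp add: V_def)
    finally have *: "(gam h g V \<bullet> F h p) \<bullet> F h (gam g u V) = (p' \<bullet> gam h (g \<otimes>\<^bsub>G\<^esub> u) V) \<bullet> F h (gam g u V)"
      using 1 by simp
    show ?thesis
      by (rule iso_cancel_right[OF _ _ _ _ _ *]) (use g h uc Vo p p' in \<open>auto simp: G.m_assoc\<close>)
  qed
  \<comment> \<open>The coherence of \<gamma> for h, l, g, rearranged for the inverse that occurs in
    the iterated conjugate action.\<close>
  have sh: "F h (gam l g V) \<bullet> inv_arr C (gam h l (FObj (T g) V)) = inv_arr C (gam h (g \<otimes>\<^bsub>G\<^esub> u) V) \<bullet> gam (h \<otimes>\<^bsub>G\<^esub> l) g V"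
  proof -
    have "F h (gam l g V) = inv_arr C (gam h (l \<otimes>\<^bsub>G\<^esub> g) V) \<bullet> gam (h \<otimes>\<^bsub>G\<^esub> l) g V \<bullet> gam h l (FObj (T g) V)"
      using g h u uc Vo by (intro inv_swap_left) (auto simp: ga_assoc)
    then show ?thesis using g h u uc Vo m1 by (simp add: G.m_assoc)
  qed
  have hlg: "h \<otimes>\<^bsub>G\<^esub> l \<otimes>\<^bsub>G\<^esub> g = h \<otimes>\<^bsub>G\<^esub> (g \<otimes>\<^bsub>G\<^esub> u)" using u g h by (simp add: G.m_assoc)
  have "gam h g V \<bullet> A (cj (conj_set G g H) h (cj H g X)) m
      = gam h g V \<bullet> F h p \<bullet> (F h (gam l g V) \<bullet> inv_arr C (gam h l (FObj (T g) V))) \<bullet> gam m h (FObj (T g) V)"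
    unfolding Am using g h u uc Vo p l by simp
  also have "\<dots> = gam h g V \<bullet> F h p \<bullet> inv_arr C (gam h (g \<otimes>\<^bsub>G\<^esub> u) V) \<bullet> gam (h \<otimes>\<^bsub>G\<^esub> l) g V \<bullet> gam m h (FObj (T g) V)"
    unfolding sh using g h u uc Vo p l hlg by simp
  also have "\<dots> = (p' \<bullet> gam h (g \<otimes>\<^bsub>G\<^esub> u) V) \<bullet> inv_arr C (gam h (g \<otimes>\<^bsub>G\<^esub> u) V) \<bullet> gam (h \<otimes>\<^bsub>G\<^esub> l) g V \<bullet> gam m h (FObj (T g) V)"
    using g h u uc Vo p l hlg by (intro cmp_reassoc key) auto
  also have "\<dots> = p' \<bullet> gam (m \<otimes>\<^bsub>G\<^esub> h) g V \<bullet> gam m h (FObj (T g) V)"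
  proof -
    have e: "h \<otimes>\<^bsub>G\<^esub> g \<otimes>\<^bsub>G\<^esub> u = h \<otimes>\<^bsub>G\<^esub> (g \<otimes>\<^bsub>G\<^esub> u)" using g h uc by (simp add: G.m_assoc)
    show ?thesis using g h u uc Vo p' l hlg e by simp
  qed
  also have "\<dots> = p' \<bullet> gam m (h \<otimes>\<^bsub>G\<^esub> g) V \<bullet> F m (gam h g V)"
    using ga_assoc[of m h g V] g h l Vo by simp
  also have "\<dots> = A (cj H (h \<otimes>\<^bsub>G\<^esub> g) X) m \<bullet> F m (gam h g V)"
  proof -
    have e: "h \<otimes>\<^bsub>G\<^esub> g \<otimes>\<^bsub>G\<^esub> u = m \<otimes>\<^bsub>G\<^esub> (h \<otimes>\<^bsub>G\<^esub> g)" using m2 by simp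
    show ?thesis unfolding Am' using g h u uc Vo p' l e by (intro cmp_assoc[symmetric]) auto
  qed
  finally show "gam h g (fst X) \<bullet> A (cj (conj_set G g H) h (cj H g X)) m = A (cj H (h \<otimes>\<^bsub>G\<^esub> g) X) m \<bullet> F m (gam h g (fst X))"
    by (simp add: V_def)
qed

end

context tensor_action
begin

subsection \<open>Tensor products of equivariant objects\<close>

abbreviation "eT H X Y \<equiv> TObj (E H) X Y"

lemma fst_eT [simp]: "fst (eT H X Y) = TObj C (fst X) (fst Y)"
  and fst_eU [simp]: "fst (Unit (E H)) = Unit C"
  by (simp_all add: equivariantization_def split: prod.split)

lemma A_eT: "h \<in> H \<Longrightarrow> A (eT H X Y) h = (A X h \<boxtimes> A Y h) \<bullet> f2 C (T h) (fst X) (fst Y)"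
  by (simp add: equivariantization_def ac_def tn_def f2_def cmp_def split: prod.split)

lemma A_eU: "h \<in> H \<Longrightarrow> A (Unit (E H)) h = f0 C (T h)"
  by (simp add: equivariantization_def ac_def f0_def)

text \<open>The cocycle condition of the product rests on \<open>ga_f2\<close>, the compatibility of
  \<gamma> with the tensor structures.\<close>

lemma eT_Ob:
  assumes H: "subgroup H G" and X: "X \<in> Ob (E H)" and Y: "Y \<in> Ob (E H)"
  shows "eT H X Y \<in> Ob (E H)"
proof (rule E_ObI[OF H])
  interpret H: subgroup H G by fact
  note ob = E_ObD(1)[OF X H] E_ObD(1)[OF Y H]
  note iX = E_ObD(3)[OF X H] and iY = E_ObD(3)[OF Y H]
  show "fst (eT H X Y) \<in> Ob C" using ob by simp
  show "snd (eT H X Y) \<in> extensional H"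
    by (simp add: equivariantization_def split: prod.split)
  show "arr C (A (eT H X Y) h)" if "h \<in> H" for h
    using that ob iX iY by (simp add: A_eT)
  fix g h assume g: "g \<in> H" and h: "h \<in> H"
  note iso = iX[OF g] iX[OF h] iX[OF H.m_closed[OF g h]] iY[OF g] iY[OF h] iY[OF H.m_closed[OF g h]]
  let ?M = "fst X" and ?N = "fst Y"
  have "A (eT H X Y) g \<bullet> F g (A (eT H X Y) h)
      = (A X g \<boxtimes> A Y g) \<bullet> (f2 C (T g) ?M ?N \<bullet> F g (A X h \<boxtimes> A Y h)) \<bullet> F g (f2 C (T h) ?M ?N)"
    using g h ob iso by (simp add: A_eT)
  also have "\<dots> = (A X g \<boxtimes> A Y g) \<bullet> (F g (A X h) \<boxtimes> F g (A Y h)) \<bullet> f2 C (T g) (FObj (T h) ?M) (FObj (T h) ?N) \<bullet> F g (f2 C (T h) ?M ?N)"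
    using g h ob iso by (simp add: T_f2_natural)
  also have "\<dots> = ((A X g \<bullet> F g (A X h)) \<boxtimes> (A Y g \<bullet> F g (A Y h))) \<bullet> f2 C (T g) (FObj (T h) ?M) (FObj (T h) ?N) \<bullet> F g (f2 C (T h) ?M ?N)"
    using g h ob iso by (simp add: tn_cmp_cmp)
  also have "\<dots> = (A X (g \<otimes>\<^bsub>G\<^esub> h) \<boxtimes> A Y (g \<otimes>\<^bsub>G\<^esub> h)) \<bullet> (gam g h ?M \<boxtimes> gam g h ?N) \<bullet> f2 C (T g) (FObj (T h) ?M) (FObj (T h) ?N) \<bullet> F g (f2 C (T h) ?M ?N)"
    unfolding E_ObD(4)[OF X H g h] E_ObD(4)[OF Y H g h] using g h ob iso by (simp add: tn_cmp_cmp)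
  also have "\<dots> = A (eT H X Y) (g \<otimes>\<^bsub>G\<^esub> h) \<bullet> gam g h (fst (eT H X Y))"
    using g h ob iso by (simp add: A_eT ga_f2)
  finally show "A (eT H X Y) g \<bullet> F g (A (eT H X Y) h) = A (eT H X Y) (g \<otimes>\<^bsub>G\<^esub> h) \<bullet> gam g h (fst (eT H X Y))" .
next
  have "\<one>\<^bsub>G\<^esub> \<in> H" using H by (rule subgroup.one_closed)
  then show "A (eT H X Y) \<one>\<^bsub>G\<^esub> = idn C (fst (eT H X Y))"
    using E_ObD(1,5)[OF X H] E_ObD(1,5)[OF Y H] by (simp add: A_eT)
qed

lemma eU_Ob:
  assumes H: "subgroup H G"
  shows "Unit (E H) \<in> Ob (E H)"
proof (rule E_ObI[OF H])
  interpret H: subgroup H G by fact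
  show "snd (Unit (E H)) \<in> extensional H" by (simp add: equivariantization_def)
qed (use subgroup.mem_carrier[OF H] subgroup.one_closed[OF H] subgroup.m_closed[OF H] in \<open>auto simp: A_eU ga_f0\<close>)

lemma tn_eh:
  assumes H: "subgroup H G" and X: "X \<in> Ob (E H)" "X' \<in> Ob (E H)" "Y \<in> Ob (E H)" "Y' \<in> Ob (E H)"
    and t: "t \<in> eh H X X'" and u: "u \<in> eh H Y Y'"
  shows "t \<boxtimes> u \<in> eh H (eT H X Y) (eT H X' Y')"
proof (rule ehI)
  note d = ehD(1-3)[OF t] ehD(1-3)[OF u]
  show "arr C (t \<boxtimes> u)" "src (t \<boxtimes> u) = fst (eT H X Y)" "trg (t \<boxtimes> u) = fst (eT H X' Y')" using d by auto
  fix h assume h: "h \<in> H"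
  note hc = subgroup.mem_carrier[OF H h]
  note ob = E_ObD(1)[OF X(1) H] E_ObD(1)[OF X(2) H] E_ObD(1)[OF X(3) H] E_ObD(1)[OF X(4) H]
  note i = E_ObD(3)[OF X(1) H h] E_ObD(3)[OF X(2) H h] E_ObD(3)[OF X(3) H h] E_ObD(3)[OF X(4) H h]
  have "(t \<boxtimes> u) \<bullet> A (eT H X Y) h = ((t \<bullet> A X h) \<boxtimes> (u \<bullet> A Y h)) \<bullet> f2 C (T h) (fst X) (fst Y)"
    using h hc ob i d by (simp add: A_eT tn_cmp_cmp)
  also have "\<dots> = (A X' h \<boxtimes> A Y' h) \<bullet> (F h t \<boxtimes> F h u) \<bullet> f2 C (T h) (fst X) (fst Y)"
    unfolding ehD(4)[OF t h] ehD(4)[OF u h] using h hc ob i d by (simp add: tn_cmp_cmp)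
  also have "(F h t \<boxtimes> F h u) \<bullet> f2 C (T h) (fst X) (fst Y) = f2 C (T h) (fst X') (fst Y') \<bullet> F h (t \<boxtimes> u)"
    using T_f2_natural[of h t u "fst X'" "fst Y'"] hc d by simp
  finally show "(t \<boxtimes> u) \<bullet> A (eT H X Y) h = A (eT H X' Y') h \<bullet> F h (t \<boxtimes> u)"
    using h hc ob i d by (simp add: A_eT)
qed

text \<open>This is the associativity coherence of the tensor functor T^h, combined with naturality
  of the associator. It yields associativity of the product on classes.\<close>

lemma al_eh:
  assumes H: "subgroup H G" and X: "X \<in> Ob (E H)" "Y \<in> Ob (E H)" "Z \<in> Ob (E H)"
  shows "al C (fst X) (fst Y) (fst Z) \<in> eh H (eT H (eT H X Y) Z) (eT H X (eT H Y Z))"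
proof (rule ehI)
  let ?M = "fst X" and ?N = "fst Y" and ?P = "fst Z"
  note ob = E_ObD(1)[OF X(1) H] E_ObD(1)[OF X(2) H] E_ObD(1)[OF X(3) H]
  show "arr C (al C ?M ?N ?P)" using ob by simp
  fix h assume h: "h \<in> H"
  note hc = subgroup.mem_carrier[OF H h]
  note i = E_ObD(3)[OF X(1) H h] E_ObD(3)[OF X(2) H h] E_ObD(3)[OF X(3) H h]
  let ?f = "f2 C (T h)" and ?m = "FObj (T h) ?M" and ?n = "FObj (T h) ?N" and ?p = "FObj (T h) ?P"
  have e1: "((A X h \<boxtimes> A Y h) \<bullet> ?f ?M ?N) \<boxtimes> A Z h = ((A X h \<boxtimes> A Y h) \<boxtimes> A Z h) \<bullet> (?f ?M ?N \<boxtimes> idn C ?p)"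
    using hc ob i by (simp add: tn_cmp)
  have e2: "A X h \<boxtimes> ((A Y h \<boxtimes> A Z h) \<bullet> ?f ?N ?P) = (A X h \<boxtimes> A Y h \<boxtimes> A Z h) \<bullet> (idn C ?m \<boxtimes> ?f ?N ?P)"
    using hc ob i by (simp add: tn_cmp)
  have "al C ?M ?N ?P \<bullet> A (eT H (eT H X Y) Z) h
      = al C ?M ?N ?P \<bullet> ((A X h \<boxtimes> A Y h) \<boxtimes> A Z h) \<bullet> (?f ?M ?N \<boxtimes> idn C ?p) \<bullet> ?f (TObj C ?M ?N) ?P"
    using h hc ob i by (simp add: A_eT e1)
  also have "\<dots> = ((A X h \<boxtimes> A Y h \<boxtimes> A Z h) \<bullet> al C ?m ?n ?p) \<bullet> (?f ?M ?N \<boxtimes> idn C ?p) \<bullet> ?f (TObj C ?M ?N) ?P"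
    using hc ob i al_natural[of "A X h" "A Y h" "A Z h"] by (intro cmp_reassoc) auto
  also have "\<dots> = (A X h \<boxtimes> A Y h \<boxtimes> A Z h) \<bullet> (idn C ?m \<boxtimes> ?f ?N ?P) \<bullet> ?f ?M (TObj C ?N ?P) \<bullet> F h (al C ?M ?N ?P)"
    using hc ob i tensor_autoequivalence.f2_al[OF tensor_autoequivalence[OF hc] ob] by simp
  also have "\<dots> = A (eT H X (eT H Y Z)) h \<bullet> F h (al C ?M ?N ?P)"
    using h hc ob i by (simp add: A_eT e2)
  finally show "al C ?M ?N ?P \<bullet> A (eT H (eT H X Y) Z) h = A (eT H X (eT H Y Z)) h \<bullet> F h (al C ?M ?N ?P)" .
qed auto

lemma lu_eh:
  assumes H: "subgroup H G" and X: "X \<in> Ob (E H)"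
  shows "lu C (fst X) \<in> eh H (eT H (Unit (E H)) X) X"
proof (rule ehI)
  let ?M = "fst X"
  note ob = E_ObD(1)[OF X H]
  show "arr C (lu C ?M)" using ob by simp
  fix h assume h: "h \<in> H"
  note hc = subgroup.mem_carrier[OF H h]
  note i = E_ObD(3)[OF X(1) H h]
  have "f0 C (T h) \<boxtimes> A X h = (idn C (Unit C) \<boxtimes> A X h) \<bullet> (f0 C (T h) \<boxtimes> idn C (FObj (T h) ?M))"
    using hc ob i by (simp add: tn_cmp)
  then have "lu C ?M \<bullet> A (eT H (Unit (E H)) X) h
      = lu C ?M \<bullet> (idn C (Unit C) \<boxtimes> A X h) \<bullet> (f0 C (T h) \<boxtimes> idn C (FObj (T h) ?M)) \<bullet> f2 C (T h) (Unit C) ?M"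
    using h hc ob i by (simp add: A_eT A_eU)
  also have "\<dots> = (A X h \<bullet> lu C (FObj (T h) ?M)) \<bullet> (f0 C (T h) \<boxtimes> idn C (FObj (T h) ?M)) \<bullet> f2 C (T h) (Unit C) ?M"
    using hc ob i lu_natural[of "A X h" ?M] by (intro cmp_reassoc) auto
  also have "\<dots> = A X h \<bullet> F h (lu C ?M)"
    using hc ob i tensor_autoequivalence.f0_lu[OF tensor_autoequivalence[OF hc] ob] by simp
  finally show "lu C ?M \<bullet> A (eT H (Unit (E H)) X) h = A X h \<bullet> F h (lu C ?M)" .
qed auto

lemma ru_eh:
  assumes H: "subgroup H G" and X: "X \<in> Ob (E H)"
  shows "ru C (fst X) \<in> eh H (eT H X (Unit (E H))) X"
proof (rule ehI)
  let ?M = "fst X"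
  note ob = E_ObD(1)[OF X H]
  show "arr C (ru C ?M)" using ob by simp
  fix h assume h: "h \<in> H"
  note hc = subgroup.mem_carrier[OF H h]
  note i = E_ObD(3)[OF X(1) H h]
  have "A X h \<boxtimes> f0 C (T h) = (A X h \<boxtimes> idn C (Unit C)) \<bullet> (idn C (FObj (T h) ?M) \<boxtimes> f0 C (T h))"
    using hc ob i by (simp add: tn_cmp)
  then have "ru C ?M \<bullet> A (eT H X (Unit (E H))) h
      = ru C ?M \<bullet> (A X h \<boxtimes> idn C (Unit C)) \<bullet> (idn C (FObj (T h) ?M) \<boxtimes> f0 C (T h)) \<bullet> f2 C (T h) ?M (Unit C)"
    using h hc ob i by (simp add: A_eT A_eU)
  also have "\<dots> = (A X h \<bullet> ru C (FObj (T h) ?M)) \<bullet> (idn C (FObj (T h) ?M) \<boxtimes> f0 C (T h)) \<bullet> f2 C (T h) ?M (Unit C)"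
    using hc ob i ru_natural[of "A X h" ?M] by (intro cmp_reassoc) auto
  also have "\<dots> = A X h \<bullet> F h (ru C ?M)"
    using hc ob i tensor_autoequivalence.f0_ru[OF tensor_autoequivalence[OF hc] ob] by simp
  finally show "ru C ?M \<bullet> A (eT H X (Unit (E H))) h = A X h \<bullet> F h (ru C ?M)" .
qed auto

text \<open>An equality and not just an isomorphism, since restriction only discards structure maps;
  multiplicativity of restriction is then immediate on classes.\<close>

lemma res_obj_eT:
  assumes "K \<subseteq> H"
  shows "res_obj K (eT H X Y) = eT K (res_obj K X) (res_obj K Y)"
  using assms by (cases X; cases Y) (auto simp: equivariantization_def res_obj_def fun_eq_iff)

lemma res_obj_eU:
  assumes "K \<subseteq> H"
  shows "res_obj K (Unit (E H)) = Unit (E K)"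
  using assms by (auto simp: equivariantization_def res_obj_def fun_eq_iff)

text \<open>The tensor structure of T^x is an isomorphism of equivariant objects by
  \<open>ga_f2\<close>, used for (x, h) and for (l, x). It makes conjugation multiplicative.\<close>

lemma f2_cj_eh:
  assumes H: "subgroup H G" and x: "x \<in> carrier G" and X: "X \<in> Ob (E H)" "Y \<in> Ob (E H)"
  shows "f2 C (T x) (fst X) (fst Y) \<in> eh (conj_set G x H) (cj H x (eT H X Y)) (eT (conj_set G x H) (cj H x X) (cj H x Y))"
proof (rule ehI)
  let ?M = "fst X" and ?N = "fst Y"
  note ob = E_ObD(1)[OF X(1) H] E_ObD(1)[OF X(2) H]
  show "arr C (f2 C (T x) ?M ?N)" using x ob by simp
  show "src (f2 C (T x) ?M ?N) = fst (cj H x (eT H X Y))"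
    "trg (f2 C (T x) ?M ?N) = fst (eT (conj_set G x H) (cj H x X) (cj H x Y))" using x by auto
  fix l assume l: "l \<in> conj_set G x H"
  then obtain h where h: "h \<in> H" "l \<otimes>\<^bsub>G\<^esub> x = x \<otimes>\<^bsub>G\<^esub> h" "l \<in> carrier G" using conj_setE[OF H x] by metis
  note hc = subgroup.mem_carrier[OF H h(1)]
  note i = E_ObD(3)[OF X(1) H h(1)] E_ObD(3)[OF X(2) H h(1)]
  let ?f = "\<lambda>g. f2 C (T g)" and ?MN = "TObj C ?M ?N"
  let ?hM = "FObj (T h) ?M" and ?hN = "FObj (T h) ?N" and ?xM = "FObj (T x) ?M" and ?xN = "FObj (T x) ?N"
  have AX: "A (cj H x X) l = F x (A X h) \<bullet> inv_arr C (gam x h ?M) \<bullet> gam l x ?M"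
    unfolding A_cj[OF H x X(1) h(1,3,2)] ph_def using x h hc ob i by simp
  have AY: "A (cj H x Y) l = F x (A Y h) \<bullet> inv_arr C (gam x h ?N) \<bullet> gam l x ?N"
    unfolding A_cj[OF H x X(2) h(1,3,2)] ph_def using x h hc ob i by simp
  have AXY: "A (cj H x (eT H X Y)) l = F x (A X h \<boxtimes> A Y h) \<bullet> F x (?f h ?M ?N) \<bullet> inv_arr C (gam x h ?MN) \<bullet> gam l x ?MN"
    unfolding A_cj[OF H x eT_Ob[OF H X] h(1,3,2)] ph_def using x h hc ob i by (simp add: A_eT)
  \<comment> \<open>Compatibility of \<gamma> with the tensor structures for x and h, with the
    occurrences of \<open>gam x h\<close> inverted.\<close>
  have g2: "?f x ?hM ?hN \<bullet> F x (?f h ?M ?N) \<bullet> inv_arr C (gam x h ?MN)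
      = (inv_arr C (gam x h ?M) \<boxtimes> inv_arr C (gam x h ?N)) \<bullet> ?f (x \<otimes>\<^bsub>G\<^esub> h) ?M ?N"
  proof -
    have "?f x ?hM ?hN \<bullet> F x (?f h ?M ?N) = inv_arr C (gam x h ?M \<boxtimes> gam x h ?N) \<bullet> ?f (x \<otimes>\<^bsub>G\<^esub> h) ?M ?N \<bullet> gam x h ?MN"
      using x hc ob by (intro inv_swap_left ga_f2) auto
    then have "(?f x ?hM ?hN \<bullet> F x (?f h ?M ?N)) \<bullet> inv_arr C (gam x h ?MN)
        = (inv_arr C (gam x h ?M \<boxtimes> gam x h ?N) \<bullet> ?f (x \<otimes>\<^bsub>G\<^esub> h) ?M ?N \<bullet> gam x h ?MN) \<bullet> inv_arr C (gam x h ?MN)"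
      by (rule arg_cong)
    then show ?thesis using x hc ob by (simp add: inv_tn)
  qed
  have "?f x ?M ?N \<bullet> A (cj H x (eT H X Y)) l
      = (?f x ?M ?N \<bullet> F x (A X h \<boxtimes> A Y h)) \<bullet> F x (?f h ?M ?N) \<bullet> inv_arr C (gam x h ?MN) \<bullet> gam l x ?MN"
    unfolding AXY using x h hc ob i by simp
  also have "\<dots> = (F x (A X h) \<boxtimes> F x (A Y h)) \<bullet> (?f x ?hM ?hN \<bullet> F x (?f h ?M ?N) \<bullet> inv_arr C (gam x h ?MN)) \<bullet> gam l x ?MN"
    using x h hc ob i by (simp add: T_f2_natural)
  also have "\<dots> = (F x (A X h) \<boxtimes> F x (A Y h)) \<bullet> (inv_arr C (gam x h ?M) \<boxtimes> inv_arr C (gam x h ?N)) \<bullet> ?f (l \<otimes>\<^bsub>G\<^esub> x) ?M ?N \<bullet> gam l x ?MN"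
    unfolding g2 using x h hc ob i by simp
  also have "?f (l \<otimes>\<^bsub>G\<^esub> x) ?M ?N \<bullet> gam l x ?MN = (gam l x ?M \<boxtimes> gam l x ?N) \<bullet> ?f l ?xM ?xN \<bullet> F l (?f x ?M ?N)"
    using ga_f2[of l x ?M ?N] x h ob by simp
  also have "(F x (A X h) \<boxtimes> F x (A Y h)) \<bullet> (inv_arr C (gam x h ?M) \<boxtimes> inv_arr C (gam x h ?N)) \<bullet> (gam l x ?M \<boxtimes> gam l x ?N) \<bullet> ?f l ?xM ?xN \<bullet> F l (?f x ?M ?N)
      = (A (cj H x X) l \<boxtimes> A (cj H x Y) l) \<bullet> ?f l ?xM ?xN \<bullet> F l (?f x ?M ?N)"
    unfolding AX AY using x h hc ob i by (simp add: tn_cmp_cmp)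
  also have "\<dots> = A (eT (conj_set G x H) (cj H x X) (cj H x Y)) l \<bullet> F l (?f x ?M ?N)"
    using AX AY x h hc ob i l by (simp add: A_eT)
  finally show "?f x ?M ?N \<bullet> A (cj H x (eT H X Y)) l = A (eT (conj_set G x H) (cj H x X) (cj H x Y)) l \<bullet> F l (?f x ?M ?N)" .
qed

lemma f0_cj_eh:
  assumes H: "subgroup H G" and x: "x \<in> carrier G"
  shows "f0 C (T x) \<in> eh (conj_set G x H) (cj H x (Unit (E H))) (Unit (E (conj_set G x H)))"
proof (rule ehI)
  show "arr C (f0 C (T x))" using x by simp
  fix l assume l: "l \<in> conj_set G x H"
  then obtain h where h: "h \<in> H" "l \<otimes>\<^bsub>G\<^esub> x = x \<otimes>\<^bsub>G\<^esub> h" "l \<in> carrier G" using conj_setE[OF H x] by metis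
  note hc = subgroup.mem_carrier[OF H h(1)]
  have e: "f0 C (T x) \<bullet> F x (f0 C (T h)) \<bullet> inv_arr C (gam x h (Unit C)) = f0 C (T (x \<otimes>\<^bsub>G\<^esub> h))"
  proof -
    have "(f0 C (T x) \<bullet> F x (f0 C (T h))) \<bullet> inv_arr C (gam x h (Unit C)) = f0 C (T (x \<otimes>\<^bsub>G\<^esub> h))"
      using x hc by (simp only: ga_f0) simp
    then show ?thesis using x hc by simp
  qed
  have "f0 C (T x) \<bullet> A (cj H x (Unit (E H))) l = (f0 C (T x) \<bullet> F x (f0 C (T h)) \<bullet> inv_arr C (gam x h (Unit C))) \<bullet> gam l x (Unit C)"
    unfolding A_cj[OF H x eU_Ob[OF H] h(1,3,2)] ph_def using x h hc by (simp add: A_eU)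
  also have "\<dots> = f0 C (T (l \<otimes>\<^bsub>G\<^esub> x)) \<bullet> gam l x (Unit C)" unfolding e using h by simp
  also have "\<dots> = f0 C (T l) \<bullet> F l (f0 C (T x))" using ga_f0[of l x] x h by simp
  finally show "f0 C (T x) \<bullet> A (cj H x (Unit (E H))) l = A (Unit (E (conj_set G x H))) l \<bullet> F l (f0 C (T x))"
    using l by (simp add: A_eU)
qed (auto)

end

context tensor_action
begin

subsection \<open>Induced objects\<close>

lemma left_coset_iff:
  assumes "subgroup K G" "t \<in> carrier G" "g \<in> carrier G"
  shows "g \<in> t <#\<^bsub>G\<^esub> K \<longleftrightarrow> inv\<^bsub>G\<^esub> t \<otimes>\<^bsub>G\<^esub> g \<in> K"
proof
  assume "g \<in> t <#\<^bsub>G\<^esub> K"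
  then obtain u where u: "u \<in> K" "g = t \<otimes>\<^bsub>G\<^esub> u" by (auto simp: l_coset_def)
  then show "inv\<^bsub>G\<^esub> t \<otimes>\<^bsub>G\<^esub> g \<in> K"
    using assms subgroup.mem_carrier[OF assms(1)] by (simp flip: G.m_assoc)
next
  assume "inv\<^bsub>G\<^esub> t \<otimes>\<^bsub>G\<^esub> g \<in> K"
  moreover have "g = t \<otimes>\<^bsub>G\<^esub> (inv\<^bsub>G\<^esub> t \<otimes>\<^bsub>G\<^esub> g)" using assms by (simp flip: G.m_assoc)
  ultimately show "g \<in> t <#\<^bsub>G\<^esub> K" unfolding l_coset_def by blast
qed

lemma left_coset_repsE:
  assumes K: "subgroup K G" and H: "subgroup H G" and R: "left_coset_reps G H K R" and h: "h \<in> H"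
  obtains t u where "t \<in> R" "t \<in> H" "u \<in> K" "h = t \<otimes>\<^bsub>G\<^esub> u"
    "\<And>s. s \<in> R \<Longrightarrow> s \<noteq> t \<Longrightarrow> inv\<^bsub>G\<^esub> s \<otimes>\<^bsub>G\<^esub> h \<notin> K"
proof -
  have R': "R \<subseteq> H" "\<exists>!t. t \<in> R \<and> h \<in> t <#\<^bsub>G\<^esub> K" using R h by (auto simp: left_coset_reps_def)
  then obtain t where t: "t \<in> R" "h \<in> t <#\<^bsub>G\<^esub> K" by blast
  then obtain u where u: "u \<in> K" "h = t \<otimes>\<^bsub>G\<^esub> u" by (auto simp: l_coset_def)
  have "s = t" if s: "s \<in> R" "inv\<^bsub>G\<^esub> s \<otimes>\<^bsub>G\<^esub> h \<in> K" for s
  proof -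
    have "h \<in> s <#\<^bsub>G\<^esub> K"
      using s left_coset_iff[OF K, of s h] R'(1) h subgroup.mem_carrier[OF H] by auto
    then show ?thesis using R'(2) s(1) t by blast
  qed
  then show thesis using that t(1) u R'(1) by blast
qed

lemma ex_left_coset_reps:
  assumes K: "subgroup K G" and H: "subgroup H G" and KH: "K \<subseteq> H"
  shows "\<exists>R. left_coset_reps G H K R"
proof -
  \<comment> \<open>Chosen as a function of the coset, so that equal cosets receive equal
    representatives.\<close>
  define r where "r c = (SOME t. t \<in> c)" for c :: "'g set"
  define R where "R = (\<lambda>g. r (g <#\<^bsub>G\<^esub> K)) ` H"
  have r: "r (g <#\<^bsub>G\<^esub> K) \<in> g <#\<^bsub>G\<^esub> K" if g: "g \<in> H" for g
  proof -
    have "g \<in> g <#\<^bsub>G\<^esub> K"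
      using left_coset_iff[OF K, of g g] subgroup.mem_carrier[OF H g] subgroup.one_closed[OF K] by simp
    then show ?thesis unfolding r_def by (rule someI)
  qed
  have coset: "t <#\<^bsub>G\<^esub> K = g <#\<^bsub>G\<^esub> K" if "t \<in> g <#\<^bsub>G\<^esub> K" "g \<in> H" for t g
    using G.l_repr_independence[OF that(1) subgroup.mem_carrier[OF H that(2)] K] by simp
  have sub: "R \<subseteq> H"
  proof
    fix t assume "t \<in> R"
    then obtain g where g: "g \<in> H" "t \<in> g <#\<^bsub>G\<^esub> K" using r by (auto simp: R_def)
    then obtain u where "u \<in> K" "t = g \<otimes>\<^bsub>G\<^esub> u" by (auto simp: l_coset_def)
    then show "t \<in> H" using KH g subgroup.m_closed[OF H] by auto
  qed
  have "\<exists>!t. t \<in> R \<and> g \<in> t <#\<^bsub>G\<^esub> K" if g: "g \<in> H" for g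
  proof (rule ex1I[of _ "r (g <#\<^bsub>G\<^esub> K)"])
    have "g \<in> g <#\<^bsub>G\<^esub> K"
      using left_coset_iff[OF K, of g g] subgroup.mem_carrier[OF H g] subgroup.one_closed[OF K] by simp
    then show "r (g <#\<^bsub>G\<^esub> K) \<in> R \<and> g \<in> r (g <#\<^bsub>G\<^esub> K) <#\<^bsub>G\<^esub> K"
      using coset[OF r[OF g] g] g by (auto simp: R_def)
    fix t assume t: "t \<in> R \<and> g \<in> t <#\<^bsub>G\<^esub> K"
    then obtain g' where g': "g' \<in> H" "t = r (g' <#\<^bsub>G\<^esub> K)" by (auto simp: R_def)
    have "g <#\<^bsub>G\<^esub> K = t <#\<^bsub>G\<^esub> K" using coset[of g t] t sub by auto
    also have "\<dots> = g' <#\<^bsub>G\<^esub> K" unfolding g'(2) by (rule coset[OF r[OF g'(1)] g'(1)])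
    finally show "t = r (g <#\<^bsub>G\<^esub> K)" using g' by simp
  qed
  then have "left_coset_reps G H K R" using sub unfolding left_coset_reps_def by simp
  then show ?thesis ..
qed

text \<open>For j : X \<rightarrow> Y and q : Y \<rightarrow> X these are the translates:
  \<open>jj Y j h\<close> is h j : T^h X \<rightarrow> Y, and \<open>qq Y q h\<close> is q h^-1 : Y
  \<rightarrow> T^h X.\<close>

definition jj where "jj Y j h = A Y h \<bullet> F h j"
definition qq where "qq Y q h = F h q \<bullet> inv_arr C (A Y h)"

text \<open>An intrinsic description of the induced object: \<open>j\<close> and \<open>q\<close> are the inclusion of and the
  projection to the summand of the trivial coset, and the translates of \<open>j\<close> are jointly
  epimorphic.\<close>

definition ind where
  "ind H K X Y j q \<longleftrightarrow> subgroup H G \<and> subgroup K G \<and> K \<subseteq> H \<and> finite H \<and> X \<in> Ob (E K) \<and> Y \<in> Ob (E H) \<and>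
     j \<in> eh K X Y \<and> q \<in> eh K Y X \<and> q \<bullet> j = idn C (fst X) \<and>
     (\<forall>h \<in> H - K. q \<bullet> jj Y j h = zer C (FObj (T h) (fst X)) (fst X)) \<and>
     (\<forall>f f'. arr C f \<longrightarrow> arr C f' \<longrightarrow> src f = fst Y \<longrightarrow> src f' = fst Y \<longrightarrow> trg f = trg f' \<longrightarrow>
        (\<forall>h \<in> H. f \<bullet> jj Y j h = f' \<bullet> jj Y j h) \<longrightarrow> f = f')"

lemma jj_arr:
  assumes "subgroup H G" "Y \<in> Ob (E H)" "j \<in> eh K X Y" "h \<in> H"
  shows "arr C (jj Y j h)" "src (jj Y j h) = FObj (T h) (fst X)" "trg (jj Y j h) = fst Y"
  using E_ObD(3)[OF assms(2,1,4)] subgroup.mem_carrier[OF assms(1,4)] ehD(1-3)[OF assms(3)]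
  by (auto simp: jj_def)

lemma qq_arr:
  assumes "subgroup H G" "Y \<in> Ob (E H)" "q \<in> eh K Y X" "h \<in> H"
  shows "arr C (qq Y q h)" "src (qq Y q h) = fst Y" "trg (qq Y q h) = FObj (T h) (fst X)"
  using E_ObD(3)[OF assms(2,1,4)] subgroup.mem_carrier[OF assms(1,4)] ehD(1-3)[OF assms(3)]
  by (auto simp: qq_def)

lemma jj_one:
  assumes "subgroup H G" "Y \<in> Ob (E H)" "j \<in> eh K X Y"
  shows "jj Y j \<one>\<^bsub>G\<^esub> = j"
  using E_ObD(5)[OF assms(2,1)] ehD(1-3)[OF assms(3)] by (simp add: jj_def)

lemma qq_one:
  assumes "subgroup H G" "Y \<in> Ob (E H)" "q \<in> eh K Y X"
  shows "qq Y q \<one>\<^bsub>G\<^esub> = q"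
  using E_ObD(1,5)[OF assms(2,1)] ehD(1-3)[OF assms(3)] by (simp add: qq_def)

text \<open>Cocycle condition of Y and naturality of \<gamma>: the action permutes the translates, g
  (h j) = (g h) j.\<close>

lemma A_jj:
  assumes H: "subgroup H G" and Y: "Y \<in> Ob (E H)" and j: "j \<in> eh K X Y" and g: "g \<in> H" and h: "h \<in> H"
  shows "A Y g \<bullet> F g (jj Y j h) = jj Y j (g \<otimes>\<^bsub>G\<^esub> h) \<bullet> gam g h (fst X)"
proof -
  have gh: "g \<otimes>\<^bsub>G\<^esub> h \<in> H" using H g h by (rule subgroup.m_closed)
  note i = E_ObD(3)[OF Y H g] E_ObD(3)[OF Y H h] E_ObD(3)[OF Y H gh]
  note c = subgroup.mem_carrier[OF H g] subgroup.mem_carrier[OF H h]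
  note d = ehD(1-3)[OF j]
  have Yo: "fst Y \<in> Ob C" using E_ObD(1)[OF Y H] .
  have Xo: "fst X \<in> Ob C" using d arr_src by metis
  have "A Y g \<bullet> F g (jj Y j h) = A Y g \<bullet> F g (A Y h) \<bullet> F g (F h j)" using c i d by (simp add: jj_def)
  also have "\<dots> = (A Y (g \<otimes>\<^bsub>G\<^esub> h) \<bullet> gam g h (fst Y)) \<bullet> F g (F h j)"
    using c i d by (intro cmp_reassoc E_ObD(4)[OF Y H g h]) auto
  also have "\<dots> = A Y (g \<otimes>\<^bsub>G\<^esub> h) \<bullet> F (g \<otimes>\<^bsub>G\<^esub> h) j \<bullet> gam g h (fst X)"
    using c i d Yo by (simp add: ga_natural)
  finally show ?thesis using c i d Xo by (simp add: jj_def)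
qed

text \<open>Equivariance of j under K lets u pass from X to the translate. So h j and (h u) j differ
  by an isomorphism of their sources, and only the coset h K matters.\<close>

lemma jj_act:
  assumes H: "subgroup H G" and K: "subgroup K G" and KH: "K \<subseteq> H" and X: "X \<in> Ob (E K)" and Y: "Y \<in> Ob (E H)"
    and j: "j \<in> eh K X Y" and h: "h \<in> H" and u: "u \<in> K"
  shows "jj Y j h \<bullet> F h (A X u) = jj Y j (h \<otimes>\<^bsub>G\<^esub> u) \<bullet> gam h u (fst X)"
proof -
  have uH: "u \<in> H" using u KH by auto
  have hu: "h \<otimes>\<^bsub>G\<^esub> u \<in> H" using H h uH by (rule subgroup.m_closed)
  note i = E_ObD(3)[OF Y H h] E_ObD(3)[OF Y H uH] E_ObD(3)[OF Y H hu] E_ObD(3)[OF X K u]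
  note c = subgroup.mem_carrier[OF H h] subgroup.mem_carrier[OF H uH]
  note d = ehD(1-3)[OF j]
  have "jj Y j h \<bullet> F h (A X u) = A Y h \<bullet> F h (j \<bullet> A X u)" using c i d by (simp add: jj_def)
  also have "\<dots> = A Y h \<bullet> F h (jj Y j u)" unfolding ehD(4)[OF j u] jj_def ..
  finally show ?thesis using A_jj[OF H Y j h uH] by simp
qed

lemma jj_cmp:
  assumes H: "subgroup H G" and Y: "Y \<in> Ob (E H)" "Z \<in> Ob (E H)" and j: "j \<in> eh K X Y" and f: "f \<in> eh H Y Z"
    and h: "h \<in> H"
  shows "f \<bullet> jj Y j h = jj Z (f \<bullet> j) h"
proof -
  note i = E_ObD(3)[OF Y(1) H h] E_ObD(3)[OF Y(2) H h]
  note c = subgroup.mem_carrier[OF H h]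
  note d = ehD(1-3)[OF j] ehD(1-3)[OF f]
  have "f \<bullet> jj Y j h = (A Z h \<bullet> F h f) \<bullet> F h j"
    unfolding jj_def using c i d by (intro cmp_reassoc ehD(4)[OF f h]) auto
  then show ?thesis using c i d by (simp add: jj_def)
qed

lemma jj_cmp_right:
  assumes H: "subgroup H G" and Y: "Y \<in> Ob (E H)" and j: "j \<in> eh K X Y" and a: "arr C a" "trg a = fst X" and h: "h \<in> H"
  shows "jj Y (j \<bullet> a) h = jj Y j h \<bullet> F h a"
  using E_ObD(3)[OF Y H h] subgroup.mem_carrier[OF H h] ehD(1-3)[OF j] a by (simp add: jj_def)

lemma qq_cmp:
  assumes H: "subgroup H G" and Y: "Y \<in> Ob (E H)" "Z \<in> Ob (E H)" and q: "q \<in> eh K Y X" and f: "f \<in> eh H Z Y"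
    and h: "h \<in> H"
  shows "qq Y q h \<bullet> f = qq Z (q \<bullet> f) h"
proof -
  note i = E_ObD(3)[OF Y(1) H h] E_ObD(3)[OF Y(2) H h]
  note c = subgroup.mem_carrier[OF H h]
  note d = ehD(1-3)[OF q] ehD(1-3)[OF f]
  have "inv_arr C (A Y h) \<bullet> f = F h f \<bullet> inv_arr C (A Z h)"
  proof -
    have "f = (A Y h \<bullet> F h f) \<bullet> inv_arr C (A Z h)"
      using c i d ehD(4)[OF f h] by (intro inv_swap_right) auto
    then have "inv_arr C (A Y h) \<bullet> f = inv_arr C (A Y h) \<bullet> (A Y h \<bullet> F h f) \<bullet> inv_arr C (A Z h)" by (rule arg_cong)
    then show ?thesis using c i d by simp
  qed
  then show ?thesis using c i d by (simp add: qq_def)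
qed

lemma inv_A_A:
  assumes H: "subgroup H G" and Y: "Y \<in> Ob (E H)" and g: "g \<in> H" and h: "h \<in> H"
  shows "inv_arr C (A Y (g \<otimes>\<^bsub>G\<^esub> h)) \<bullet> A Y g = gam g h (fst Y) \<bullet> F g (inv_arr C (A Y h))"
    and "inv_arr C (A Y g) \<bullet> A Y (g \<otimes>\<^bsub>G\<^esub> h) = F g (A Y h) \<bullet> inv_arr C (gam g h (fst Y))"
proof -
  have gh: "g \<otimes>\<^bsub>G\<^esub> h \<in> H" using H g h by (rule subgroup.m_closed)
  note i = E_ObD(3)[OF Y H g] E_ObD(3)[OF Y H h] E_ObD(3)[OF Y H gh]
  note c = subgroup.mem_carrier[OF H g] subgroup.mem_carrier[OF H h]
  have Yo: "fst Y \<in> Ob C" using E_ObD(1)[OF Y H] .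
  have "A Y g = (A Y (g \<otimes>\<^bsub>G\<^esub> h) \<bullet> gam g h (fst Y)) \<bullet> inv_arr C (F g (A Y h))"
    using c i by (intro inv_swap_right E_ObD(4)[OF Y H g h]) auto
  then have "inv_arr C (A Y (g \<otimes>\<^bsub>G\<^esub> h)) \<bullet> A Y g
      = inv_arr C (A Y (g \<otimes>\<^bsub>G\<^esub> h)) \<bullet> (A Y (g \<otimes>\<^bsub>G\<^esub> h) \<bullet> gam g h (fst Y)) \<bullet> inv_arr C (F g (A Y h))"
    by (rule arg_cong)
  then show "inv_arr C (A Y (g \<otimes>\<^bsub>G\<^esub> h)) \<bullet> A Y g = gam g h (fst Y) \<bullet> F g (inv_arr C (A Y h))"
    using c i Yo by simp
  have "A Y (g \<otimes>\<^bsub>G\<^esub> h) = (A Y g \<bullet> F g (A Y h)) \<bullet> inv_arr C (gam g h (fst Y))"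
    using c i Yo E_ObD(4)[OF Y H g h] by (intro inv_swap_right) auto
  then have "inv_arr C (A Y g) \<bullet> A Y (g \<otimes>\<^bsub>G\<^esub> h)
      = inv_arr C (A Y g) \<bullet> (A Y g \<bullet> F g (A Y h)) \<bullet> inv_arr C (gam g h (fst Y))"
    by (rule arg_cong)
  then show "inv_arr C (A Y g) \<bullet> A Y (g \<otimes>\<^bsub>G\<^esub> h) = F g (A Y h) \<bullet> inv_arr C (gam g h (fst Y))"
    using c i Yo by simp
qed

text \<open>Dual to \<open>A_jj\<close>: the action permutes the translates q h^-1.\<close>

lemma qq_A:
  assumes H: "subgroup H G" and Y: "Y \<in> Ob (E H)" and q: "q \<in> eh K Y X" and g: "g \<in> H" and h: "h \<in> H"
  shows "qq Y q (g \<otimes>\<^bsub>G\<^esub> h) \<bullet> A Y g = gam g h (fst X) \<bullet> F g (qq Y q h)"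
proof -
  have gh: "g \<otimes>\<^bsub>G\<^esub> h \<in> H" using H g h by (rule subgroup.m_closed)
  note i = E_ObD(3)[OF Y H g] E_ObD(3)[OF Y H h] E_ObD(3)[OF Y H gh]
  note c = subgroup.mem_carrier[OF H g] subgroup.mem_carrier[OF H h]
  note d = ehD(1-3)[OF q]
  have Yo: "fst Y \<in> Ob C" using E_ObD(1)[OF Y H] .
  have Xo: "fst X \<in> Ob C" using d arr_trg by metis
  have "qq Y q (g \<otimes>\<^bsub>G\<^esub> h) \<bullet> A Y g = F (g \<otimes>\<^bsub>G\<^esub> h) q \<bullet> gam g h (fst Y) \<bullet> F g (inv_arr C (A Y h))"
    using c i d inv_A_A(1)[OF H Y g h] by (simp add: qq_def)
  also have "\<dots> = (gam g h (fst X) \<bullet> F g (F h q)) \<bullet> F g (inv_arr C (A Y h))"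
    using c i d Yo Xo ga_natural[of g h q "fst X"] by (intro cmp_reassoc) auto
  finally show ?thesis using c i d Xo by (simp add: qq_def)
qed

text \<open>Dual to \<open>jj_act\<close>: equivariance of q under K absorbs u.\<close>

lemma qq_act:
  assumes H: "subgroup H G" and K: "subgroup K G" and KH: "K \<subseteq> H" and X: "X \<in> Ob (E K)" and Y: "Y \<in> Ob (E H)"
    and q: "q \<in> eh K Y X" and h: "h \<in> H" and u: "u \<in> K"
  shows "F h (A X u) \<bullet> inv_arr C (gam h u (fst X)) \<bullet> qq Y q (h \<otimes>\<^bsub>G\<^esub> u) = qq Y q h"
proof -
  have uH: "u \<in> H" using u KH by auto
  have hu: "h \<otimes>\<^bsub>G\<^esub> u \<in> H" using H h uH by (rule subgroup.m_closed)
  note i = E_ObD(3)[OF Y H h] E_ObD(3)[OF Y H uH] E_ObD(3)[OF Y H hu] E_ObD(3)[OF X K u]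
  note c = subgroup.mem_carrier[OF H h] subgroup.mem_carrier[OF H uH]
  note d = ehD(1-3)[OF q]
  have Xo: "fst X \<in> Ob C" using E_ObD(1)[OF X K] .
  note a = qq_arr[OF H Y q h] qq_arr[OF H Y q uH] qq_arr[OF H Y q hu]
  have "(F h (A X u) \<bullet> inv_arr C (gam h u (fst X)) \<bullet> qq Y q (h \<otimes>\<^bsub>G\<^esub> u)) \<bullet> A Y h = F h (A X u \<bullet> qq Y q u)"
    using c i d a Xo qq_A[OF H Y q h uH] by simp
  also have "A X u \<bullet> qq Y q u = q"
  proof -
    have "A X u \<bullet> qq Y q u = (q \<bullet> A Y u) \<bullet> inv_arr C (A Y u)"
      unfolding ehD(4)[OF q u] qq_def using c i d by simp
    then show ?thesis using i d by simp
  qed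
  also have "F h q = qq Y q h \<bullet> A Y h" using c i d by (simp add: qq_def)
  finally show ?thesis
    using a c i Xo by - (rule iso_cancel_right[OF i(1)], simp_all)
qed

section \<open>Splitting of an induced object and its two adjunctions\<close>

context
  fixes H K X Y j q V
  assumes ind: "ind H K X Y j q" and V: "V = fst X"
begin

lemma indD:
  "subgroup H G" "subgroup K G" "K \<subseteq> H" "finite H" "X \<in> Ob (E K)" "Y \<in> Ob (E H)"
  "j \<in> eh K X Y" "q \<in> eh K Y X" "q \<bullet> j = idn C V"
  "h \<in> H \<Longrightarrow> h \<notin> K \<Longrightarrow> q \<bullet> jj Y j h = zer C (FObj (T h) V) V"
  "\<lbrakk>arr C f; arr C f'; src f = fst Y; src f' = fst Y; trg f = trg f'; \<And>h. h \<in> H \<Longrightarrow> f \<bullet> jj Y j h = f' \<bullet> jj Y j h\<rbrakk>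
    \<Longrightarrow> f = f'"
  using ind unfolding ind_def V by auto

lemma ind_ob: "V \<in> Ob C" "fst Y \<in> Ob C" "fst X = V"
  using E_ObD(1)[OF indD(5,2)] E_ObD(1)[OF indD(6,1)] V by auto

lemma ind_carrier: "h \<in> H \<Longrightarrow> h \<in> carrier G" "h \<in> K \<Longrightarrow> h \<in> carrier G" "h \<in> K \<Longrightarrow> h \<in> H"
  using subgroup.mem_carrier[OF indD(1)] indD(3) by auto

lemmas ind_jj = jj_arr[OF indD(1,6,7), unfolded ind_ob(3)]
lemmas ind_qq = qq_arr[OF indD(1,6,8), unfolded ind_ob(3)]

lemma q_jj:
  assumes "h \<in> K"
  shows "q \<bullet> jj Y j h = A X h"
proof -
  note d = ehD(1-3)[OF indD(7)] ehD(1-3)[OF indD(8)]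
  have "q \<bullet> jj Y j h = (q \<bullet> j) \<bullet> A X h"
    unfolding jj_def ehD(4)[OF indD(7) assms, symmetric]
    using d E_ObD(3)[OF indD(5,2) assms] by simp
  then show ?thesis using indD(9) E_ObD(3)[OF indD(5,2) assms] V by simp
qed

text \<open>All products of translates reduce by T^s to the products
  \<open>q \<bullet> jj Y j u\<close>, which are structure maps of X for u in K and vanish
  otherwise. So translates for different cosets are orthogonal.\<close>

lemma qq_jj:
  assumes s: "s \<in> H" and u: "u \<in> H"
  shows "qq Y q s \<bullet> jj Y j (s \<otimes>\<^bsub>G\<^esub> u) = F s (q \<bullet> jj Y j u) \<bullet> inv_arr C (gam s u V)"
proof -
  note c = ind_carrier(1)[OF s] ind_carrier(1)[OF u]
  note a = ind_jj[OF s] ind_jj[OF u] ind_jj[OF subgroup.m_closed[OF indD(1) s u]] ind_qq[OF s]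
  note d = ehD(1-3)[OF indD(8)]
  note i = E_ObD(3)[OF indD(6,1) s]
  have "qq Y q s \<bullet> A Y s = F s q" using i c d by (simp add: qq_def)
  then have "F s (q \<bullet> jj Y j u) = (qq Y q s \<bullet> A Y s) \<bullet> F s (jj Y j u)" using c a d by simp
  also have "\<dots> = qq Y q s \<bullet> jj Y j (s \<otimes>\<^bsub>G\<^esub> u) \<bullet> gam s u V"
    using c a d i A_jj[OF indD(1,6,7) s u] V by simp
  finally have e: "F s (q \<bullet> jj Y j u) = (qq Y q s \<bullet> jj Y j (s \<otimes>\<^bsub>G\<^esub> u)) \<bullet> gam s u V"
    using c a ind_ob by simp
  show ?thesis unfolding e using c a ind_ob by simp
qed

lemma qq_jj_out:
  assumes s: "s \<in> H" and h: "h \<in> H" and n: "inv\<^bsub>G\<^esub> s \<otimes>\<^bsub>G\<^esub> h \<notin> K"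
  shows "qq Y q s \<bullet> jj Y j h = zer C (FObj (T h) V) (FObj (T s) V)"
proof -
  let ?u = "inv\<^bsub>G\<^esub> s \<otimes>\<^bsub>G\<^esub> h"
  have u: "?u \<in> H" using s h subgroup.m_closed[OF indD(1)] subgroup.m_inv_closed[OF indD(1)] by auto
  have su: "s \<otimes>\<^bsub>G\<^esub> ?u = h" using ind_carrier(1)[OF s] ind_carrier(1)[OF h] by (simp flip: G.m_assoc)
  show ?thesis
    using qq_jj[OF s u] indD(10)[OF u n] ind_carrier(1)[OF s] ind_carrier(1)[OF u] ind_carrier(1)[OF h] ind_ob
    unfolding su by (simp add: su del: G.m_closed)
qed

lemma qq_jj_in:
  assumes s: "s \<in> H" and u: "u \<in> K"
  shows "qq Y q s \<bullet> jj Y j (s \<otimes>\<^bsub>G\<^esub> u) = F s (A X u) \<bullet> inv_arr C (gam s u V)"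
  using qq_jj[OF s ind_carrier(3)[OF u]] q_jj[OF u] by simp

lemma jj_act_inv:
  assumes s: "s \<in> H" and u: "u \<in> K"
  shows "jj Y j s \<bullet> F s (A X u) \<bullet> inv_arr C (gam s u V) = jj Y j (s \<otimes>\<^bsub>G\<^esub> u)"
proof -
  note c = ind_carrier(1)[OF s] ind_carrier(2)[OF u]
  note a = ind_jj[OF s] ind_jj[OF subgroup.m_closed[OF indD(1) s ind_carrier(3)[OF u]]]
  have "jj Y j s \<bullet> F s (A X u) \<bullet> inv_arr C (gam s u V) = (jj Y j (s \<otimes>\<^bsub>G\<^esub> u) \<bullet> gam s u V) \<bullet> inv_arr C (gam s u V)"
    using c a E_ObD(3)[OF indD(5,2) u] ind_ob jj_act[OF indD(1-3,5-7) s u]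
    by (intro cmp_reassoc) auto
  then show ?thesis using c a ind_ob by simp
qed

text \<open>Tested on the jointly epimorphic translates of j: on h j only the representative of the
  coset of h contributes, and it reproduces h j.\<close>

lemma ind_sum:
  assumes R: "left_coset_reps G H K R"
  shows "sm C (fst Y) (fst Y) R (\<lambda>t. jj Y j t \<bullet> qq Y q t) = idn C (fst Y)"
proof -
  have R': "R \<subseteq> H" "finite R" using R indD(4) by (auto simp: left_coset_reps_def intro: finite_subset)
  have Fun: "(\<lambda>t. jj Y j t \<bullet> qq Y q t) \<in> R \<rightarrow> hm C (fst Y) (fst Y)"
    using ind_jj ind_qq R' by auto
  show ?thesis
  proof (rule indD(11))
    fix h assume h: "h \<in> H"
    obtain t u where t: "t \<in> R" "t \<in> H" "u \<in> K" "h = t \<otimes>\<^bsub>G\<^esub> u"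
      "\<And>s. s \<in> R \<Longrightarrow> s \<noteq> t \<Longrightarrow> inv\<^bsub>G\<^esub> s \<otimes>\<^bsub>G\<^esub> h \<notin> K"
      using left_coset_repsE[OF indD(2,1) R h] by metis
    note a = ind_jj[OF h]
    have z: "(jj Y j s \<bullet> qq Y q s) \<bullet> jj Y j h = zer C (FObj (T h) V) (fst Y)" if s: "s \<in> R" "s \<noteq> t" for s
    proof -
      have sH: "s \<in> H" using s R' by auto
      show ?thesis
        using qq_jj_out[OF sH h t(5)[OF s]] ind_jj[OF sH] ind_qq[OF sH] a ind_carrier(1)[OF sH]
          ind_carrier(1)[OF h] ind_ob by simp
    qed
    have "sm C (fst Y) (fst Y) R (\<lambda>t. jj Y j t \<bullet> qq Y q t) \<bullet> jj Y j h
        = sm C (src (jj Y j h)) (fst Y) R (\<lambda>t. (jj Y j t \<bullet> qq Y q t) \<bullet> jj Y j h)"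
      using R' Fun a ind_ob by (intro sm_cmp) auto
    also have "\<dots> = (jj Y j t \<bullet> qq Y q t) \<bullet> jj Y j h"
      using R' Fun a ind_ob z ind_carrier(1)[OF h] t(1) by (intro sm_single) (auto simp: Pi_iff)
    also have "\<dots> = jj Y j t \<bullet> qq Y q t \<bullet> jj Y j h"
      using ind_jj[OF t(2)] ind_qq[OF t(2)] a by simp
    also have "\<dots> = jj Y j h"
      using qq_jj_in[OF t(2,3)] jj_act_inv[OF t(2,3)] t(4) by simp
    finally show "sm C (fst Y) (fst Y) R (\<lambda>t. jj Y j t \<bullet> qq Y q t) \<bullet> jj Y j h = idn C (fst Y) \<bullet> jj Y j h"
      using a by simp
  qed (use Fun ind_ob in auto)
qed

lemma ind_decomposition:
  obtains R where "R \<subseteq> H" "finite R" "(\<lambda>t. jj Y j t \<bullet> qq Y q t) \<in> R \<rightarrow> hm C (fst Y) (fst Y)"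
    "sm C (fst Y) (fst Y) R (\<lambda>t. jj Y j t \<bullet> qq Y q t) = idn C (fst Y)"
proof -
  obtain R where R: "left_coset_reps G H K R" using ex_left_coset_reps[OF indD(2,1,3)] by blast
  have R': "R \<subseteq> H" "finite R" using R indD(4) by (auto simp: left_coset_reps_def intro: finite_subset)
  have "(\<lambda>t. jj Y j t \<bullet> qq Y q t) \<in> R \<rightarrow> hm C (fst Y) (fst Y)" using ind_jj ind_qq R' by auto
  then show thesis using that R' ind_sum[OF R] by blast
qed

text \<open>The translates remain jointly epimorphic after T^g, because the linear functor T^g
  preserves the decomposition of the identity.\<close>

lemma ind_epi:
  assumes g: "g \<in> carrier G" and f: "arr C f" "arr C f'" "src f = FObj (T g) (fst Y)" "src f' = FObj (T g) (fst Y)"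
    "trg f = trg f'" "\<And>h. h \<in> H \<Longrightarrow> f \<bullet> F g (jj Y j h) = f' \<bullet> F g (jj Y j h)"
  shows "f = f'"
proof -
  obtain R where R: "R \<subseteq> H" "finite R" and Fun: "(\<lambda>t. jj Y j t \<bullet> qq Y q t) \<in> R \<rightarrow> hm C (fst Y) (fst Y)"
    and id: "sm C (fst Y) (fst Y) R (\<lambda>t. jj Y j t \<bullet> qq Y q t) = idn C (fst Y)"
    by (rule ind_decomposition)
  let ?Y = "FObj (T g) (fst Y)"
  have Fun': "(\<lambda>t. F g (jj Y j t \<bullet> qq Y q t)) \<in> R \<rightarrow> hm C ?Y ?Y"
    using Fun g by (auto simp: Pi_iff)
  have id': "sm C ?Y ?Y R (\<lambda>t. F g (jj Y j t \<bullet> qq Y q t)) = idn C ?Y"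
    using tensor_autoequivalence.fm_sm[OF tensor_autoequivalence[OF g] ind_ob(2) ind_ob(2) R(2) Fun] id g ind_ob
    by simp
  show ?thesis
  proof (rule sm_jointly_epi[OF _ R(2) Fun' id' f(1-5)])
    fix t assume "t \<in> R"
    then have t: "t \<in> H" using R by auto
    have "f \<bullet> F g (jj Y j t \<bullet> qq Y q t) = (f \<bullet> F g (jj Y j t)) \<bullet> F g (qq Y q t)"
      using f g ind_jj[OF t] ind_qq[OF t] by simp
    also have "\<dots> = f' \<bullet> F g (jj Y j t \<bullet> qq Y q t)"
      unfolding f(6)[OF t] using f(1-5) g ind_jj[OF t] ind_qq[OF t] by simp
    finally show "f \<bullet> F g (jj Y j t \<bullet> qq Y q t) = f' \<bullet> F g (jj Y j t \<bullet> qq Y q t)" .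
  qed (use g ind_ob in simp)
qed

lemma ind_mono:
  assumes f: "arr C f" "arr C f'" "trg f = fst Y" "trg f' = fst Y" "src f = src f'"
    "\<And>h. h \<in> H \<Longrightarrow> qq Y q h \<bullet> f = qq Y q h \<bullet> f'"
  shows "f = f'"
proof -
  obtain R where R: "R \<subseteq> H" "finite R" and Fun: "(\<lambda>t. jj Y j t \<bullet> qq Y q t) \<in> R \<rightarrow> hm C (fst Y) (fst Y)"
    and id: "sm C (fst Y) (fst Y) R (\<lambda>t. jj Y j t \<bullet> qq Y q t) = idn C (fst Y)"
    by (rule ind_decomposition)
  show ?thesis
  proof (rule sm_jointly_mono[OF ind_ob(2) R(2) Fun id f(1-5)])
    fix t assume "t \<in> R"
    then have t: "t \<in> H" using R by auto
    show "(jj Y j t \<bullet> qq Y q t) \<bullet> f = (jj Y j t \<bullet> qq Y q t) \<bullet> f'"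
      using f(1-5) f(6)[OF t] ind_jj[OF t] ind_qq[OF t] by simp
  qed
qed

lemma ind_ext_eq:
  assumes Z: "Z \<in> Ob (E H)" and f: "f \<in> eh H Y Z" "f' \<in> eh H Y Z" "f \<bullet> j = f' \<bullet> j"
  shows "f = f'"
  using f(3) ehD(1-3)[OF f(1)] ehD(1-3)[OF f(2)] jj_cmp[OF indD(1,6) Z indD(7) f(1)] jj_cmp[OF indD(1,6) Z indD(7) f(2)]
  by - (rule indD(11), simp_all)

text \<open>With \<open>ind_ext_eq\<close> this is the left adjunction: H-morphisms out of Y
  correspond to K-morphisms out of X. Equivariance of the extension is checked on the translates of
  j after T^g.\<close>

lemma ind_ext:
  assumes Z: "Z \<in> Ob (E H)" and t: "t \<in> eh K X Z"
  obtains f where "f \<in> eh H Y Z" "f \<bullet> j = t"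
proof -
  obtain R where R: "left_coset_reps G H K R" using ex_left_coset_reps[OF indD(2,1,3)] by blast
  have R': "R \<subseteq> H" "finite R" using R indD(4) by (auto simp: left_coset_reps_def intro: finite_subset)
  have Zo: "fst Z \<in> Ob C" using E_ObD(1)[OF Z indD(1)] .
  \<comment> \<open>On the translate s j the extension is forced to be s t, so f is the sum of the
    (s t) (q s^-1).\<close>
  define f where "f = sm C (fst Y) (fst Z) R (\<lambda>s. jj Z t s \<bullet> qq Y q s)"
  note jZ = jj_arr[OF indD(1) Z t, unfolded ind_ob(3)]
  have Fun: "(\<lambda>s. jj Z t s \<bullet> qq Y q s) \<in> R \<rightarrow> hm C (fst Y) (fst Z)"
    using jZ ind_qq R' by auto
  have fa: "arr C f" "src f = fst Y" "trg f = fst Z" using Fun Zo ind_ob by (auto simp: f_def)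
  have fj: "f \<bullet> jj Y j h = jj Z t h" if h: "h \<in> H" for h
  proof -
    obtain r u where r: "r \<in> R" "r \<in> H" "u \<in> K" "h = r \<otimes>\<^bsub>G\<^esub> u"
      "\<And>s. s \<in> R \<Longrightarrow> s \<noteq> r \<Longrightarrow> inv\<^bsub>G\<^esub> s \<otimes>\<^bsub>G\<^esub> h \<notin> K"
      using left_coset_repsE[OF indD(2,1) R h] by metis
    note a = ind_jj[OF h]
    note c = ind_carrier(1)[OF r(2)] ind_carrier(2)[OF r(3)]
    have z: "(jj Z t s \<bullet> qq Y q s) \<bullet> jj Y j h = zer C (FObj (T h) V) (fst Z)" if s: "s \<in> R" "s \<noteq> r" for s
    proof -
      have sH: "s \<in> H" using s R' by auto
      show ?thesis
        using qq_jj_out[OF sH h r(5)[OF s]] jZ[OF sH] ind_qq[OF sH] a ind_carrier(1)[OF sH]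
          ind_carrier(1)[OF h] ind_ob by simp
    qed
    have "f \<bullet> jj Y j h = sm C (src (jj Y j h)) (fst Z) R (\<lambda>s. (jj Z t s \<bullet> qq Y q s) \<bullet> jj Y j h)"
      unfolding f_def using R' Fun a ind_ob Zo by (intro sm_cmp) auto
    also have "\<dots> = (jj Z t r \<bullet> qq Y q r) \<bullet> jj Y j h"
      using R' Fun a ind_ob Zo z ind_carrier(1)[OF h] r(1) by (intro sm_single) (auto simp: Pi_iff)
    also have "\<dots> = jj Z t r \<bullet> F r (A X u) \<bullet> inv_arr C (gam r u V)"
      using jZ[OF r(2)] ind_qq[OF r(2)] a qq_jj_in[OF r(2,3)] r(4) by simp
    also have "\<dots> = (jj Z t (r \<otimes>\<^bsub>G\<^esub> u) \<bullet> gam r u V) \<bullet> inv_arr C (gam r u V)"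
      using jj_act[OF indD(1-3,5) Z t r(2,3)] jZ[OF r(2)] c E_ObD(3)[OF indD(5,2) r(3)] ind_ob
      by (intro cmp_reassoc) auto
    also have "\<dots> = jj Z t h" using jZ[OF h] c ind_ob r(4) by simp
    finally show ?thesis .
  qed
  have "f \<in> eh H Y Z"
  proof (rule ehI)
    fix g assume g: "g \<in> H"
    note c = ind_carrier(1)[OF g]
    note i = E_ObD(3)[OF indD(6,1) g] E_ObD(3)[OF Z indD(1) g]
    show "f \<bullet> A Y g = A Z g \<bullet> F g f"
    proof (rule ind_epi[OF c])
      fix h assume h: "h \<in> H"
      have gh: "g \<otimes>\<^bsub>G\<^esub> h \<in> H" using indD(1) g h by (rule subgroup.m_closed)
      note a = ind_jj[OF h] ind_jj[OF gh] jZ[OF h] jZ[OF gh] ind_carrier(1)[OF h]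
      have "(f \<bullet> A Y g) \<bullet> F g (jj Y j h) = f \<bullet> jj Y j (g \<otimes>\<^bsub>G\<^esub> h) \<bullet> gam g h V"
        using fa i c a A_jj[OF indD(1,6,7) g h] V by simp
      also have "\<dots> = jj Z t (g \<otimes>\<^bsub>G\<^esub> h) \<bullet> gam g h V"
        using fa c a ind_ob by (intro cmp_reassoc fj gh) auto
      also have "\<dots> = A Z g \<bullet> F g (f \<bullet> jj Y j h)"
        unfolding fj[OF h] using A_jj[OF indD(1) Z t g h] V by simp
      also have "\<dots> = (A Z g \<bullet> F g f) \<bullet> F g (jj Y j h)" using fa i c a by simp
      finally show "(f \<bullet> A Y g) \<bullet> F g (jj Y j h) = (A Z g \<bullet> F g f) \<bullet> F g (jj Y j h)" .
    qed (use fa i c in auto)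
  qed (use fa in auto)
  moreover have "f \<bullet> j = t"
    using fj[OF subgroup.one_closed[OF indD(1)]] jj_one[OF indD(1,6,7)] jj_one[OF indD(1) Z t] by simp
  ultimately show thesis using that by blast
qed

lemma ind_coext_eq:
  assumes Z: "Z \<in> Ob (E H)" and f: "f \<in> eh H Z Y" "f' \<in> eh H Z Y" "q \<bullet> f = q \<bullet> f'"
  shows "f = f'"
  using f(3) ehD(1-3)[OF f(1)] ehD(1-3)[OF f(2)] qq_cmp[OF indD(1,6) Z indD(8) f(1)] qq_cmp[OF indD(1,6) Z indD(8) f(2)]
  by - (rule ind_mono, simp_all)

text \<open>With \<open>ind_coext_eq\<close> this is the right adjunction, realized by the same
  object Y. Everything is tested against the jointly monomorphic translates of q.\<close>

lemma ind_coext: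
  assumes Z: "Z \<in> Ob (E H)" and t: "t \<in> eh K Z X"
  obtains f where "f \<in> eh H Z Y" "q \<bullet> f = t"
proof -
  obtain R where R: "left_coset_reps G H K R" using ex_left_coset_reps[OF indD(2,1,3)] by blast
  have R': "R \<subseteq> H" "finite R" using R indD(4) by (auto simp: left_coset_reps_def intro: finite_subset)
  have Zo: "fst Z \<in> Ob C" using E_ObD(1)[OF Z indD(1)] .
  \<comment> \<open>The dual formula: f is the sum of the (s j) (t s^-1).\<close>
  define f where "f = sm C (fst Z) (fst Y) R (\<lambda>s. jj Y j s \<bullet> qq Z t s)"
  note qZ = qq_arr[OF indD(1) Z t, unfolded ind_ob(3)]
  have Fun: "(\<lambda>s. jj Y j s \<bullet> qq Z t s) \<in> R \<rightarrow> hm C (fst Z) (fst Y)"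
    using qZ ind_jj R' by auto
  have fa: "arr C f" "src f = fst Z" "trg f = fst Y" using Fun Zo ind_ob by (auto simp: f_def)
  have fq: "qq Y q h \<bullet> f = qq Z t h" if h: "h \<in> H" for h
  proof -
    obtain r u where r: "r \<in> R" "r \<in> H" "u \<in> K" "h = r \<otimes>\<^bsub>G\<^esub> u"
      "\<And>s. s \<in> R \<Longrightarrow> s \<noteq> r \<Longrightarrow> inv\<^bsub>G\<^esub> s \<otimes>\<^bsub>G\<^esub> h \<notin> K"
      using left_coset_repsE[OF indD(2,1) R h] by metis
    note a = ind_qq[OF h]
    let ?v = "inv\<^bsub>G\<^esub> u"
    have v: "?v \<in> K" using r(3) indD(2) by (intro subgroup.m_inv_closed)
    note c = ind_carrier(1)[OF r(2)] ind_carrier(2)[OF r(3)] ind_carrier(2)[OF v] ind_carrier(1)[OF h]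
    \<comment> \<open>The surviving term is the one at the representative r, reached from h by the
      inverse of u.\<close>
    have hv: "h \<otimes>\<^bsub>G\<^esub> ?v = r" using r(4) c by (simp add: G.m_assoc)
    have z: "qq Y q h \<bullet> jj Y j s \<bullet> qq Z t s = zer C (fst Z) (FObj (T h) V)" if s: "s \<in> R" "s \<noteq> r" for s
    proof -
      have sH: "s \<in> H" using s R' by auto
      have "inv\<^bsub>G\<^esub> h \<otimes>\<^bsub>G\<^esub> s \<notin> K"
      proof
        assume "inv\<^bsub>G\<^esub> h \<otimes>\<^bsub>G\<^esub> s \<in> K"
        then have "inv\<^bsub>G\<^esub> (inv\<^bsub>G\<^esub> h \<otimes>\<^bsub>G\<^esub> s) \<in> K" using indD(2) by (intro subgroup.m_inv_closed)
        then show False using r(5)[OF s] c ind_carrier(1)[OF sH] by (simp add: G.inv_mult_group)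
      qed
      then have "qq Y q h \<bullet> jj Y j s = zer C (FObj (T s) V) (FObj (T h) V)" by (rule qq_jj_out[OF h sH])
      then have "qq Y q h \<bullet> jj Y j s \<bullet> qq Z t s = zer C (FObj (T s) V) (FObj (T h) V) \<bullet> qq Z t s"
        using a ind_jj[OF sH] qZ[OF sH] by (intro cmp_reassoc) auto
      then show ?thesis using qZ[OF sH] c ind_ob by simp
    qed
    have "qq Y q h \<bullet> f = sm C (fst Z) (trg (qq Y q h)) R (\<lambda>s. qq Y q h \<bullet> jj Y j s \<bullet> qq Z t s)"
      unfolding f_def using R' Fun a ind_ob Zo by (intro cmp_sm) auto
    also have "\<dots> = qq Y q h \<bullet> jj Y j r \<bullet> qq Z t r"
      using R' Fun a ind_ob Zo z c r(1) by (intro sm_single) (auto simp: Pi_iff)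
    also have "\<dots> = (F h (A X ?v) \<bullet> inv_arr C (gam h ?v V)) \<bullet> qq Z t r"
      using qq_jj_in[OF h v] ind_jj[OF r(2)] qZ[OF r(2)] a unfolding hv by (intro cmp_reassoc) auto
    also have "\<dots> = F h (A X ?v) \<bullet> inv_arr C (gam h ?v V) \<bullet> qq Z t r"
      using c E_ObD(3)[OF indD(5,2) v] qZ[OF r(2)] ind_ob hv by (intro cmp_assoc) auto
    also have "\<dots> = qq Z t h"
      using qq_act[OF indD(1-3,5) Z t h v] hv V by simp
    finally show ?thesis .
  qed
  have "f \<in> eh H Z Y"
  proof (rule ehI)
    fix g assume g: "g \<in> H"
    note c = ind_carrier(1)[OF g]
    note i = E_ObD(3)[OF indD(6,1) g] E_ObD(3)[OF Z indD(1) g]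
    show "f \<bullet> A Z g = A Y g \<bullet> F g f"
    proof (rule ind_mono)
      fix h assume h: "h \<in> H"
      define m where "m = inv\<^bsub>G\<^esub> g \<otimes>\<^bsub>G\<^esub> h"
      have m: "m \<in> H" using g h subgroup.m_closed[OF indD(1)] subgroup.m_inv_closed[OF indD(1)] by (auto simp: m_def)
      have gm: "g \<otimes>\<^bsub>G\<^esub> m = h" using c ind_carrier(1)[OF h] by (simp add: m_def flip: G.m_assoc)
      note a = ind_qq[OF h] ind_qq[OF m] qZ[OF h] qZ[OF m] ind_carrier(1)[OF m]
      have "qq Y q h \<bullet> f \<bullet> A Z g = qq Z t h \<bullet> A Z g"
        using fa i a by (intro cmp_reassoc fq h) auto
      also have "\<dots> = gam g m V \<bullet> F g (qq Y q m \<bullet> f)"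
        unfolding fq[OF m] using qq_A[OF indD(1) Z t g m] gm V by simp
      also have "\<dots> = (gam g m V \<bullet> F g (qq Y q m)) \<bullet> F g f" using fa c a ind_ob by simp
      also have "\<dots> = (qq Y q h \<bullet> A Y g) \<bullet> F g f" using qq_A[OF indD(1,6,8) g m] gm V by simp
      also have "\<dots> = qq Y q h \<bullet> A Y g \<bullet> F g f" using fa c a i by simp
      finally show "qq Y q h \<bullet> f \<bullet> A Z g = qq Y q h \<bullet> A Y g \<bullet> F g f" .
    qed (use fa i c in auto)
  qed (use fa in auto)
  moreover have "q \<bullet> f = t"
    using fq[OF subgroup.one_closed[OF indD(1)]] qq_one[OF indD(1,6,8)] qq_one[OF indD(1) Z t] by simp
  ultimately show thesis using that by blast
qed

end

end

section \<open>Comparison with the defining construction of induced objects\<close>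

lemma (in linear_category) dsum_epi:
  assumes d: "dsum C I X S \<iota> \<pi>" and fin: "finite I"
    and f: "arr C f" "arr C f'" "src f = S" "src f' = S" "trg f = trg f'"
      "\<And>i. i \<in> I \<Longrightarrow> f \<bullet> \<iota> i = f' \<bullet> \<iota> i"
  shows "f = f'"
proof -
  have S: "S \<in> Ob C" using d by (simp add: dsum_def)
  have X: "arr C (\<iota> j)" "arr C (\<pi> j)" "src (\<iota> j) = X j" "trg (\<iota> j) = S" "src (\<pi> j) = S" "trg (\<pi> j) = X j"
    if "j \<in> I" for j using d that by (auto simp: dsum_def)
  have ex: "x = sm C S (trg x) I (\<lambda>i. x \<bullet> \<iota> i \<bullet> \<pi> i)" if x: "arr C x" "src x = S" for x
    using cmp_sm[OF S fin, of "\<lambda>i. \<iota> i \<bullet> \<pi> i" S x] X x d by (auto simp: dsum_def)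
  have "f = sm C S (trg f) I (\<lambda>i. f \<bullet> \<iota> i \<bullet> \<pi> i)" using ex f by blast
  also have "\<dots> = sm C S (trg f) I (\<lambda>i. f' \<bullet> \<iota> i \<bullet> \<pi> i)"
  proof (rule sm_cong)
    fix i assume i: "i \<in> I"
    have "f \<bullet> \<iota> i \<bullet> \<pi> i = (f \<bullet> \<iota> i) \<bullet> \<pi> i" using f(1-5) X[OF i] by simp
    also have "\<dots> = (f' \<bullet> \<iota> i) \<bullet> \<pi> i" using f(6)[OF i] by simp
    also have "\<dots> = f' \<bullet> \<iota> i \<bullet> \<pi> i" using f(1-5) X[OF i] by simp
    finally show "f \<bullet> \<iota> i \<bullet> \<pi> i = f' \<bullet> \<iota> i \<bullet> \<pi> i" .
  qed (use f S X in \<open>auto simp: arr_trg\<close>)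
  also have "\<dots> = f'" using ex[OF f(2,4)] f(5) by simp
  finally show ?thesis .
qed

lemma (in tensor_autoequivalence) dsum_fm:
  assumes d: "dsum C I X S \<iota> \<pi>" and fin: "finite I"
  shows "dsum C I (\<lambda>i. FObj F (X i)) (FObj F S) (\<lambda>i. fm F (\<iota> i)) (\<lambda>i. fm F (\<pi> i))"
proof -
  have S: "S \<in> Ob C" using d by (simp add: dsum_def)
  have X: "X j \<in> Ob C" "arr C (\<iota> j)" "arr C (\<pi> j)" "src (\<iota> j) = X j" "trg (\<iota> j) = S" "src (\<pi> j) = S" "trg (\<pi> j) = X j"
    if "j \<in> I" for j using d that by (auto simp: dsum_def)
  have \<pi>\<iota>: "fm F (\<pi> j) \<bullet> fm F (\<iota> l) = fm F (if l = j then idn C (X l) else zer C (X l) (X j))"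
    if "j \<in> I" "l \<in> I" for j l
    using d that X[OF that(1)] X[OF that(2)] by (simp add: dsum_def flip: fm_cmp)
  have "sm C (FObj F S) (FObj F S) I (\<lambda>i. fm F (\<iota> i) \<bullet> fm F (\<pi> i)) = sm C (FObj F S) (FObj F S) I (\<lambda>i. fm F (\<iota> i \<bullet> \<pi> i))"
    using X S by (intro sm_cong) auto
  also have "\<dots> = fm F (sm C S S I (\<lambda>i. \<iota> i \<bullet> \<pi> i))"
    using X S fin by (intro fm_sm[symmetric]) auto
  also have "\<dots> = idn C (FObj F S)" using d S by (simp add: dsum_def)
  finally show ?thesis
    unfolding dsum_def using X S \<pi>\<iota> by auto
qed

context tensor_action
begin

lemma is_induced_obj_arr:
  assumes H: "subgroup H G" and K: "subgroup K G" and KH: "K \<subseteq> H" and X: "X \<in> Ob (E K)"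
  shows "is_induced_obj G C T \<gamma> H K X Y \<longleftrightarrow>
    (\<exists>R i p. left_coset_reps G H K R \<and> dsum C R (\<lambda>t. FObj (T t) (fst X)) (fst Y) i p \<and>
       snd Y \<in> extensional H \<and> (\<forall>g \<in> H. arr C (A Y g)) \<and>
       (\<forall>g \<in> H. \<forall>t \<in> R. \<forall>s \<in> R. \<forall>u \<in> K. g \<otimes>\<^bsub>G\<^esub> t = s \<otimes>\<^bsub>G\<^esub> u \<longrightarrow>
          A Y g \<bullet> F g (i t) = ph X s (i s) u \<bullet> gam g t (fst X)))"
    (is "_ \<longleftrightarrow> (\<exists>R i p. ?P R i p)")
proof -
  obtain V \<mu> where XV: "X = (V, \<mu>)" by (cases X)
  obtain S \<nu> where YS: "Y = (S, \<nu>)" by (cases Y)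
  have Vo: "V \<in> Ob C" using E_ObD(1)[OF X K] XV by simp
  have Hc: "h \<in> carrier G" if "h \<in> H" for h using subgroup.mem_carrier[OF H that] .
  \<comment> \<open>Regrouping the defining composite around \<open>i s\<close> turns it into
    \<open>ph\<close>, the form used from here on.\<close>
  have eq: "(\<nu> g \<cdot> FMor (T g) (\<iota> t) =
          \<iota> s \<cdot> (FMor (T s) (\<mu> u) \<cdot> inv_mor C (FObj (T s) (FObj (T u) V)) (FObj (T (s \<otimes>\<^bsub>G\<^esub> u)) V) (\<gamma> s u V) \<cdot> \<gamma> g t V))
      \<longleftrightarrow> A Y g \<bullet> F g (i t) = ph X s (i s) u \<bullet> gam g t V"
    if "s \<in> H" "t \<in> H" "g \<in> H" "u \<in> K" "g \<otimes>\<^bsub>G\<^esub> t = s \<otimes>\<^bsub>G\<^esub> u" and S: "S \<in> Ob C"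
      and i: "i s = Arrow (FObj (T s) V) (\<iota> s) S" "i t = Arrow (FObj (T t) V) (\<iota> t) S" "arr C (i s)" for s t g u \<iota> i
  proof -
    note iA = E_ObD(3)[OF X K that(4)]
    have c: "s \<in> carrier G" "t \<in> carrier G" "g \<in> carrier G" "u \<in> carrier G"
      using that Hc KH by auto
    have "ph X s (i s) u \<bullet> gam g t V = i s \<bullet> (F s (A X u) \<bullet> inv_arr C (gam s u V)) \<bullet> gam g t V"
      unfolding ph_def using iA c i that(5) Vo XV by simp
    moreover have "(A Y g \<bullet> F g (i t) = i s \<bullet> (F s (A X u) \<bullet> inv_arr C (gam s u V)) \<bullet> gam g t V) \<longleftrightarrow>
      (\<nu> g \<cdot> FMor (T g) (\<iota> t) =
          \<iota> s \<cdot> (FMor (T s) (\<mu> u) \<cdot> inv_mor C (FObj (T s) (FObj (T u) V)) (FObj (T (s \<otimes>\<^bsub>G\<^esub> u)) V) (\<gamma> s u V) \<cdot> \<gamma> g t V))"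
      by (simp add: cmp_def ac_def fm_def inv_arr_def ga_def i XV YS)
    ultimately show ?thesis by simp
  qed
  have act: "(\<nu> g \<in> Hom C (FObj (T g) S) S) \<longleftrightarrow> arr C (A Y g)" if "g \<in> H" "S \<in> Ob C" for g
    using that Hc[OF that(1)] by (simp add: arr_def ac_def YS)
  show ?thesis
  proof
    assume "is_induced_obj G C T \<gamma> H K X Y"
    then obtain R \<iota> \<pi> where R: "left_coset_reps G H K R" and d: "direct_sum C R (\<lambda>t. FObj (T t) V) S \<iota> \<pi>"
      and \<nu>: "\<nu> \<in> extensional H" "\<forall>g \<in> H. \<nu> g \<in> Hom C (FObj (T g) S) S"
      and c: "\<And>g t s u. \<lbrakk>g \<in> H; t \<in> R; s \<in> R; u \<in> K; g \<otimes>\<^bsub>G\<^esub> t = s \<otimes>\<^bsub>G\<^esub> u\<rbrakk> \<Longrightarrow> \<nu> g \<cdot> FMor (T g) (\<iota> t) =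
          \<iota> s \<cdot> (FMor (T s) (\<mu> u) \<cdot> inv_mor C (FObj (T s) (FObj (T u) V)) (FObj (T (s \<otimes>\<^bsub>G\<^esub> u)) V) (\<gamma> s u V) \<cdot> \<gamma> g t V)"
      unfolding is_induced_obj_def XV YS prod.case by blast
    let ?i = "\<lambda>t. Arrow (FObj (T t) V) (\<iota> t) S" and ?p = "\<lambda>t. Arrow S (\<pi> t) (FObj (T t) V)"
    have ds: "dsum C R (\<lambda>t. FObj (T t) V) S ?i ?p" using d unfolding direct_sum_dsum .
    then have S: "S \<in> Ob C" and ia: "\<And>t. t \<in> R \<Longrightarrow> arr C (?i t)" by (auto simp: dsum_def)
    have RH: "R \<subseteq> H" using R by (simp add: left_coset_reps_def)
    have "?P R ?i ?p"
      using R ds \<nu> act S c RH eq[of _ _ _ _ ?i \<iota>] ia by (auto simp: XV YS subset_iff)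
    then show "\<exists>R i p. ?P R i p" by blast
  next
    assume "\<exists>R i p. ?P R i p"
    then obtain R i p where P: "?P R i p" by blast
    have ds: "dsum C R (\<lambda>t. FObj (T t) V) S i p" using P XV YS by simp
    then have S: "S \<in> Ob C"
      and ia: "\<And>t. t \<in> R \<Longrightarrow> arr C (i t)" "\<And>t. t \<in> R \<Longrightarrow> i t = Arrow (FObj (T t) V) ((mor \<circ> i) t) S"
      by (auto simp: dsum_def intro: arrow_eqI)
    have RH: "R \<subseteq> H" using P by (simp add: left_coset_reps_def)
    have "\<forall>g \<in> H. \<forall>t \<in> R. \<forall>s \<in> R. \<forall>u \<in> K. g \<otimes>\<^bsub>G\<^esub> t = s \<otimes>\<^bsub>G\<^esub> u \<longrightarrow> \<nu> g \<cdot> FMor (T g) ((mor \<circ> i) t) =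
          (mor \<circ> i) s \<cdot> (FMor (T s) (\<mu> u) \<cdot> inv_mor C (FObj (T s) (FObj (T u) V)) (FObj (T (s \<otimes>\<^bsub>G\<^esub> u)) V) (\<gamma> s u V) \<cdot> \<gamma> g t V)"
    proof (intro ballI impI)
      fix g t s u assume *: "g \<in> H" "t \<in> R" "s \<in> R" "u \<in> K" "g \<otimes>\<^bsub>G\<^esub> t = s \<otimes>\<^bsub>G\<^esub> u"
      have "A Y g \<bullet> F g (i t) = ph X s (i s) u \<bullet> gam g t V" using P * XV by auto
      then show "\<nu> g \<cdot> FMor (T g) ((mor \<circ> i) t) =
          (mor \<circ> i) s \<cdot> (FMor (T s) (\<mu> u) \<cdot> inv_mor C (FObj (T s) (FObj (T u) V)) (FObj (T (s \<otimes>\<^bsub>G\<^esub> u)) V) (\<gamma> s u V) \<cdot> \<gamma> g t V)"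
        using eq[of s t g u i "mor \<circ> i"] * RH S ia by blast
    qed
    then show "is_induced_obj G C T \<gamma> H K X Y"
      unfolding is_induced_obj_def XV YS prod.case
      using P dsum_direct_sum[OF ds] act S by (intro exI[of _ R] exI[of _ "mor \<circ> i"] exI[of _ "mor \<circ> p"]) (auto simp: YS)
  qed
qed

context
  fixes H K X R i p S V
  assumes H: "subgroup H G" and K: "subgroup K G" and KH: "K \<subseteq> H" and X: "X \<in> Ob (E K)"
    and R: "left_coset_reps G H K R" and fin: "finite R" and V: "V = fst X"
    and d: "dsum C R (\<lambda>t. FObj (T t) V) S i p"
begin

definition rep where "rep h = (SOME t. t \<in> R \<and> inv\<^bsub>G\<^esub> t \<otimes>\<^bsub>G\<^esub> h \<in> K)"
text \<open>Extends the inclusions from representatives to all elements of H by writing h = t u.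
  Once the action is available, \<open>I h\<close> is the translate by h of the map at the unit
  element.\<close>

definition I where "I h = ph X (rep h) (i (rep h)) (inv\<^bsub>G\<^esub> (rep h) \<otimes>\<^bsub>G\<^esub> h)"

lemma summand_typing:
  "V \<in> Ob C" "S \<in> Ob C" "h \<in> H \<Longrightarrow> h \<in> carrier G" "h \<in> K \<Longrightarrow> h \<in> carrier G" "h \<in> K \<Longrightarrow> h \<in> H"
  "t \<in> R \<Longrightarrow> t \<in> H" "t \<in> R \<Longrightarrow> t \<in> carrier G"
  "t \<in> R \<Longrightarrow> arr C (i t)" "t \<in> R \<Longrightarrow> src (i t) = FObj (T t) V" "t \<in> R \<Longrightarrow> trg (i t) = S"
  "t \<in> R \<Longrightarrow> arr C (p t)" "t \<in> R \<Longrightarrow> trg (p t) = FObj (T t) V" "t \<in> R \<Longrightarrow> src (p t) = S"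
  "t \<in> R \<Longrightarrow> s \<in> R \<Longrightarrow> p s \<bullet> i t = (if t = s then idn C (FObj (T t) V) else zer C (FObj (T t) V) (FObj (T s) V))"
  "u \<in> K \<Longrightarrow> iso C (A X u)"
  using E_ObD(1,3)[OF X K] V d subgroup.mem_carrier[OF H] KH R
  by (auto simp: dsum_def left_coset_reps_def)

lemma rep:
  assumes h: "h \<in> H"
  shows "rep h \<in> R" "inv\<^bsub>G\<^esub> (rep h) \<otimes>\<^bsub>G\<^esub> h \<in> K" "h = rep h \<otimes>\<^bsub>G\<^esub> (inv\<^bsub>G\<^esub> (rep h) \<otimes>\<^bsub>G\<^esub> h)"
proof -
  obtain t u where t: "t \<in> R" "t \<in> H" "u \<in> K" "h = t \<otimes>\<^bsub>G\<^esub> u"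
    using left_coset_repsE[OF K H R h] by metis
  have "t \<in> R \<and> inv\<^bsub>G\<^esub> t \<otimes>\<^bsub>G\<^esub> h \<in> K"
    using t summand_typing(3)[OF t(2)] summand_typing(4)[OF t(3)] by (simp flip: G.m_assoc)
  from someI[of "\<lambda>t. t \<in> R \<and> inv\<^bsub>G\<^esub> t \<otimes>\<^bsub>G\<^esub> h \<in> K", OF this]
  have r: "rep h \<in> R \<and> inv\<^bsub>G\<^esub> (rep h) \<otimes>\<^bsub>G\<^esub> h \<in> K" unfolding rep_def .
  then show "rep h \<in> R" "inv\<^bsub>G\<^esub> (rep h) \<otimes>\<^bsub>G\<^esub> h \<in> K" by auto
  show "h = rep h \<otimes>\<^bsub>G\<^esub> (inv\<^bsub>G\<^esub> (rep h) \<otimes>\<^bsub>G\<^esub> h)"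
    using r summand_typing(3)[OF h] summand_typing(7)[of "rep h"] by (simp flip: G.m_assoc)
qed

lemma rep_unique:
  assumes "t \<in> R" "u \<in> K"
  shows "rep (t \<otimes>\<^bsub>G\<^esub> u) = t"
proof -
  note c = summand_typing(7)[OF assms(1)] summand_typing(4)[OF assms(2)]
  have h: "t \<otimes>\<^bsub>G\<^esub> u \<in> H" using H summand_typing(6)[OF assms(1)] summand_typing(5)[OF assms(2)]
    by (rule subgroup.m_closed)
  have k: "inv\<^bsub>G\<^esub> t \<otimes>\<^bsub>G\<^esub> (t \<otimes>\<^bsub>G\<^esub> u) \<in> K" using c assms by (simp flip: G.m_assoc)
  obtain t' where t': "\<And>s. s \<in> R \<Longrightarrow> s \<noteq> t' \<Longrightarrow> inv\<^bsub>G\<^esub> s \<otimes>\<^bsub>G\<^esub> (t \<otimes>\<^bsub>G\<^esub> u) \<notin> K"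
    using left_coset_repsE[OF K H R h] by metis
  show ?thesis using t' k assms(1) rep(1,2)[OF h] by blast
qed

lemma I_eq:
  assumes "t \<in> R" "u \<in> K"
  shows "I (t \<otimes>\<^bsub>G\<^esub> u) = ph X t (i t) u"
  using summand_typing(7)[OF assms(1)] summand_typing(4)[OF assms(2)]
  by (simp add: I_def rep_unique[OF assms] flip: G.m_assoc)

lemma I_R: "t \<in> R \<Longrightarrow> I t = i t"
  using I_eq[of t "\<one>\<^bsub>G\<^esub>"] subgroup.one_closed[OF K] summand_typing E_ObD(5)[OF X K] V
  by (simp add: ph_def)

lemma I_arr:
  assumes "h \<in> H"
  shows "arr C (I h)" "src (I h) = FObj (T h) V" "trg (I h) = S"
  using ph_arr[OF K X _ _ _ V rep(2)[OF assms], of "rep h" "i (rep h)"] summand_typing rep(1)[OF assms]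
    rep(3)[OF assms, symmetric]
  by (auto simp: I_def)

lemma I_act:
  assumes h: "h \<in> H" and v: "v \<in> K"
  shows "I h \<bullet> F h (A X v) = I (h \<otimes>\<^bsub>G\<^esub> v) \<bullet> gam h v V"
proof -
  define t u where "t = rep h" and "u = inv\<^bsub>G\<^esub> (rep h) \<otimes>\<^bsub>G\<^esub> h"
  have t: "t \<in> R" "u \<in> K" "h = t \<otimes>\<^bsub>G\<^esub> u" using rep[OF h] unfolding t_def u_def by auto
  note c = summand_typing(7)[OF t(1)] summand_typing(4)[OF t(2)] summand_typing(4)[OF v]
  have hv: "h \<otimes>\<^bsub>G\<^esub> v = t \<otimes>\<^bsub>G\<^esub> (u \<otimes>\<^bsub>G\<^esub> v)" using c by (simp add: t(3) G.m_assoc)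
  have Ihv: "I (h \<otimes>\<^bsub>G\<^esub> v) = ph X t (i t) (u \<otimes>\<^bsub>G\<^esub> v)"
    unfolding hv by (rule I_eq[OF t(1) subgroup.m_closed[OF K t(2) v]])
  show ?thesis
    unfolding Ihv unfolding t(3) I_eq[OF t(1,2)]
    using c summand_typing(7-9)[OF t(1)] t v by (intro ph_act[OF K X _ _ _ V]) auto
qed

context
  fixes Y
  assumes SY: "fst Y = S" and ext: "snd Y \<in> extensional H" and Aarr: "\<And>g. g \<in> H \<Longrightarrow> arr C (A Y g)"
    and AR: "\<And>g t. g \<in> H \<Longrightarrow> t \<in> R \<Longrightarrow> A Y g \<bullet> F g (i t) = I (g \<otimes>\<^bsub>G\<^esub> t) \<bullet> gam g t V"
begin

text \<open>The action is prescribed on representatives only. For h = t u the equation is obtained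
  after composing with the isomorphism T^g of \<open>gam t u\<close>, where \<open>I h\<close> is
  expressed by \<open>i t\<close>.\<close>

lemma A_I:
  assumes g: "g \<in> H" and h: "h \<in> H"
  shows "A Y g \<bullet> F g (I h) = I (g \<otimes>\<^bsub>G\<^esub> h) \<bullet> gam g h V"
proof -
  define t u where "t = rep h" and "u = inv\<^bsub>G\<^esub> (rep h) \<otimes>\<^bsub>G\<^esub> h"
  have t: "t \<in> R" "u \<in> K" "h = t \<otimes>\<^bsub>G\<^esub> u" using rep[OF h] unfolding t_def u_def by auto
  note tb = summand_typing(6-10)[OF t(1)]
  note c = summand_typing(3)[OF g] summand_typing(4)[OF t(2)] summand_typing(15)[OF t(2)]
  have gt: "g \<otimes>\<^bsub>G\<^esub> t \<in> H" and gh: "g \<otimes>\<^bsub>G\<^esub> h \<in> H" using H g tb(1) h by (auto intro: subgroup.m_closed)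
  note Ia = I_arr[OF h] I_arr[OF gt] I_arr[OF gh]
  have Ih: "I h \<bullet> gam t u V = i t \<bullet> F t (A X u)"
    using I_act[OF tb(1) t(2)] I_R[OF t(1)] t(3) by simp
  have "(A Y g \<bullet> F g (I h)) \<bullet> F g (gam t u V) = A Y g \<bullet> F g (I h \<bullet> gam t u V)"
    using Aarr[OF g] Ia c tb summand_typing(1) SY t(3) by simp
  also have "\<dots> = (A Y g \<bullet> F g (i t)) \<bullet> F g (F t (A X u))"
    unfolding Ih using Aarr[OF g] Ia c tb summand_typing(1) SY V by simp
  also have "\<dots> = I (g \<otimes>\<^bsub>G\<^esub> t) \<bullet> F (g \<otimes>\<^bsub>G\<^esub> t) (A X u) \<bullet> gam g t (FObj (T u) V)"
    unfolding AR[OF g t(1)] using Ia c tb summand_typing(1) V by (simp add: ga_natural)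
  also have "\<dots> = (I (g \<otimes>\<^bsub>G\<^esub> t \<otimes>\<^bsub>G\<^esub> u) \<bullet> gam (g \<otimes>\<^bsub>G\<^esub> t) u V) \<bullet> gam g t (FObj (T u) V)"
    using Ia c tb summand_typing(1) V by (intro cmp_reassoc I_act gt t) auto
  also have "\<dots> = (I (g \<otimes>\<^bsub>G\<^esub> h) \<bullet> gam g h V) \<bullet> F g (gam t u V)"
    using Ia c tb summand_typing(1) t(3) by (simp add: ga_assoc G.m_assoc)
  finally show ?thesis
    using Aarr[OF g] Ia c tb summand_typing(1) SY t(3)
    by - (rule iso_cancel_right[of "F g (gam t u V)"], simp_all)
qed

lemma induced_Ob: "Y \<in> Ob (E H)"
proof (rule E_ObI[OF H _ ext Aarr])
  show So: "fst Y \<in> Ob C" using SY summand_typing by simp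
  fix g h assume g: "g \<in> H" and h: "h \<in> H"
  note c = summand_typing(3)[OF g] summand_typing(3)[OF h]
  have gh: "g \<otimes>\<^bsub>G\<^esub> h \<in> H" using H g h by (rule subgroup.m_closed)
  \<comment> \<open>T^g T^h S is again a direct sum, of the T^g T^h T^t V, so the cocycle condition
    may be checked on these summands.\<close>
  note dd = tensor_autoequivalence.dsum_fm[OF tensor_autoequivalence[OF c(1)]
      tensor_autoequivalence.dsum_fm[OF tensor_autoequivalence[OF c(2)] d fin] fin]
  show "A Y g \<bullet> F g (A Y h) = A Y (g \<otimes>\<^bsub>G\<^esub> h) \<bullet> gam g h (fst Y)"
  proof (rule dsum_epi[OF dd fin])
    fix t assume tR: "t \<in> R"
    note tb = summand_typing(6-10)[OF tR]
    have ht: "h \<otimes>\<^bsub>G\<^esub> t \<in> H" "g \<otimes>\<^bsub>G\<^esub> (h \<otimes>\<^bsub>G\<^esub> t) \<in> H" "g \<otimes>\<^bsub>G\<^esub> h \<otimes>\<^bsub>G\<^esub> t \<in> H"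
      using H g h tb(1) by (auto intro: subgroup.m_closed)
    note Ia = I_arr[OF ht(1)] I_arr[OF ht(2)] I_arr[OF ht(3)]
    have "(A Y g \<bullet> F g (A Y h)) \<bullet> F g (F h (i t)) = A Y g \<bullet> F g (A Y h \<bullet> F h (i t))"
      using Aarr g h c tb SY by simp
    also have "\<dots> = (A Y g \<bullet> F g (I (h \<otimes>\<^bsub>G\<^esub> t))) \<bullet> F g (gam h t V)"
      unfolding AR[OF h tR] using Aarr g c tb SY Ia summand_typing(1) by simp
    also have "\<dots> = I (g \<otimes>\<^bsub>G\<^esub> (h \<otimes>\<^bsub>G\<^esub> t)) \<bullet> gam g (h \<otimes>\<^bsub>G\<^esub> t) V \<bullet> F g (gam h t V)"
      unfolding A_I[OF g ht(1)] using c tb SY Ia summand_typing(1) by simp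
    also have "\<dots> = I (g \<otimes>\<^bsub>G\<^esub> h \<otimes>\<^bsub>G\<^esub> t) \<bullet> gam (g \<otimes>\<^bsub>G\<^esub> h) t V \<bullet> gam g h (FObj (T t) V)"
      using c tb summand_typing(1) by (simp add: ga_assoc G.m_assoc)
    also have "\<dots> = (A Y (g \<otimes>\<^bsub>G\<^esub> h) \<bullet> F (g \<otimes>\<^bsub>G\<^esub> h) (i t)) \<bullet> gam g h (FObj (T t) V)"
      unfolding AR[OF gh tR] using c tb SY Ia summand_typing(1) by simp
    also have "\<dots> = (A Y (g \<otimes>\<^bsub>G\<^esub> h) \<bullet> gam g h (fst Y)) \<bullet> F g (F h (i t))"
      using Aarr[OF gh] c tb SY So summand_typing(1) by (simp add: ga_natural)
    finally show "(A Y g \<bullet> F g (A Y h)) \<bullet> F g (F h (i t)) = (A Y (g \<otimes>\<^bsub>G\<^esub> h) \<bullet> gam g h (fst Y)) \<bullet> F g (F h (i t))" .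
  qed (use Aarr g h gh c SY So in auto)
next
  have o: "\<one>\<^bsub>G\<^esub> \<in> H" using H by (rule subgroup.one_closed)
  have So: "fst Y \<in> Ob C" using SY summand_typing by simp
  show "A Y \<one>\<^bsub>G\<^esub> = idn C (fst Y)"
  proof (rule dsum_epi[OF d fin])
    fix t assume tR: "t \<in> R"
    note tb = summand_typing(6-10)[OF tR]
    show "A Y \<one>\<^bsub>G\<^esub> \<bullet> i t = idn C (fst Y) \<bullet> i t"
      using AR[OF o tR] tb I_R[OF tR] SY summand_typing(1) by simp
  qed (use Aarr[OF o] SY So in auto)
qed

lemma induced_ind: 
  assumes finH: "finite H"
  shows "\<exists>j q. ind H K X Y j q"
proof -
  note Y = induced_Ob
  note b = summand_typing(1,2)
  have o: "\<one>\<^bsub>G\<^esub> \<in> H" "\<one>\<^bsub>G\<^esub> \<in> K" using H K by (auto intro: subgroup.one_closed)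
  define j where "j = I \<one>\<^bsub>G\<^esub>"
  have j: "arr C j" "src j = V" "trg j = S" using I_arr[OF o(1)] b by (auto simp: j_def)
  have jj: "jj Y j h = I h" if h: "h \<in> H" for h
    using A_I[OF h o(1)] summand_typing(3)[OF h] b I_arr[OF h] by (simp add: jj_def j_def)
  have jeh: "j \<in> eh K X Y"
  proof (rule ehI)
    fix u assume u: "u \<in> K"
    have "j \<bullet> A X u = I u"
      using I_act[OF o(1) u] summand_typing(4,5,15)[OF u] b I_arr[of u] by (simp add: j_def)
    then show "j \<bullet> A X u = A Y u \<bullet> F u j" using jj[OF summand_typing(5)[OF u]] by (simp add: jj_def)
  qed (use j SY V in auto)
  \<comment> \<open>The representative of the trivial coset; it lies in K but need not be the unit
    element.\<close>
  define t0 where "t0 = rep \<one>\<^bsub>G\<^esub>"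
  have t0: "t0 \<in> R" "t0 \<in> K"
  proof -
    show "t0 \<in> R" using rep(1)[OF o(1)] by (simp add: t0_def)
    then have "inv\<^bsub>G\<^esub> t0 \<in> K" using rep(2)[OF o(1)] summand_typing(7)[of t0] by (simp add: t0_def)
    then show "t0 \<in> K"
      using subgroup.m_inv_closed[OF K] G.inv_inv[OF summand_typing(7)[OF \<open>t0 \<in> R\<close>]] by metis
  qed
  note tb = summand_typing(6-13)[OF t0(1)] summand_typing(15)[OF t0(2)]
  \<comment> \<open>Projection to the summand of the trivial coset, followed by the structure map at
    t0, which leads from there back to V.\<close>
  define q where "q = A X t0 \<bullet> p t0"
  have q: "arr C q" "src q = S" "trg q = V" using tb V by (auto simp: q_def)
  have qI: "q \<bullet> I h = (if h \<in> K then A X h else zer C (FObj (T h) V) V)" if h: "h \<in> H" for h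
  proof -
    define t u where "t = rep h" and "u = inv\<^bsub>G\<^esub> (rep h) \<otimes>\<^bsub>G\<^esub> h"
    have t: "t \<in> R" "u \<in> K" "h = t \<otimes>\<^bsub>G\<^esub> u" using rep[OF h] unfolding t_def u_def by auto
    note tb' = summand_typing(6-10)[OF t(1)]
    note c = summand_typing(4,15)[OF t(2)]
    have Ih: "I h = i t \<bullet> F t (A X u) \<bullet> inv_arr C (gam t u V)"
      using I_eq[OF t(1,2)] t(3) V by (simp add: ph_def)
    have pi: "p t0 \<bullet> I h = (p t0 \<bullet> i t) \<bullet> F t (A X u) \<bullet> inv_arr C (gam t u V)"
      unfolding Ih using tb tb' c b V by simp
    show ?thesis
    proof (cases "t = t0")
      case True
      then have hK: "h \<in> K" using t t0 K by (auto intro: subgroup.m_closed)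
      have "q \<bullet> I h = A X t0 \<bullet> p t0 \<bullet> I h" unfolding q_def using tb I_arr[OF h] V by simp
      also have "\<dots> = (A X t0 \<bullet> F t0 (A X u)) \<bullet> inv_arr C (gam t0 u V)"
        unfolding pi using summand_typing(14)[OF t(1) t0(1)] True tb tb' c b V by simp
      also have "\<dots> = A X h"
        unfolding E_ObD(4)[OF X K t0(2) t(2)] using True t(3) tb c b V summand_typing(15)[OF hK] by simp
      finally show ?thesis using hK by simp
    next
      case False
      have hK: "h \<notin> K"
      proof
        assume hK: "h \<in> K"
        have "h = t0 \<otimes>\<^bsub>G\<^esub> (inv\<^bsub>G\<^esub> t0 \<otimes>\<^bsub>G\<^esub> h)" using tb summand_typing(3)[OF h] by (simp flip: G.m_assoc)
        moreover have "inv\<^bsub>G\<^esub> t0 \<otimes>\<^bsub>G\<^esub> h \<in> K"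
          using t0(2) hK K by (auto intro: subgroup.m_closed subgroup.m_inv_closed)
        ultimately have "rep h = t0" using rep_unique[OF t0(1)] by metis
        then show False using False t_def by simp
      qed
      have "q \<bullet> I h = A X t0 \<bullet> p t0 \<bullet> I h" unfolding q_def using tb I_arr[OF h] V by simp
      also have "\<dots> = zer C (FObj (T h) V) V"
        unfolding pi using summand_typing(14)[OF t(1) t0(1)] False tb tb' c b V t(3) by simp
      finally show ?thesis using hK by simp
    qed
  qed
  have epi: "f = f'" if "g \<in> carrier G" "arr C f" "arr C f'" "src f = FObj (T g) S" "src f' = FObj (T g) S" "trg f = trg f'"
    "\<And>t. t \<in> R \<Longrightarrow> f \<bullet> F g (I t) = f' \<bullet> F g (I t)" for f f' g
    using dsum_epi[OF tensor_autoequivalence.dsum_fm[OF tensor_autoequivalence[OF that(1)] d fin] fin that(2-6)] that(7) I_R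
    by simp
  have qeh: "q \<in> eh K Y X"
  proof (rule ehI)
    fix u assume u: "u \<in> K"
    note ub = summand_typing(4,5,15)[OF u]
    show "q \<bullet> A Y u = A X u \<bullet> F u q"
    proof (rule epi[OF ub(1)])
      fix t assume tR: "t \<in> R"
      then have t: "t \<in> H" by (rule summand_typing)
      note tc = summand_typing(3)[OF t]
      have ut: "u \<otimes>\<^bsub>G\<^esub> t \<in> H" using H ub(2) t by (rule subgroup.m_closed)
      note Ia = I_arr[OF t] I_arr[OF ut]
      \<comment> \<open>Multiplication by u in K preserves membership in K, so both sides of the
        equivariance of q fall under the same case of \<open>qI\<close>.\<close>
      have utK: "u \<otimes>\<^bsub>G\<^esub> t \<in> K \<longleftrightarrow> t \<in> K"
      proof
        assume "u \<otimes>\<^bsub>G\<^esub> t \<in> K"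
        then have "inv\<^bsub>G\<^esub> u \<otimes>\<^bsub>G\<^esub> (u \<otimes>\<^bsub>G\<^esub> t) \<in> K" using u K by (auto intro: subgroup.m_closed subgroup.m_inv_closed)
        then show "t \<in> K" using ub tc by (simp flip: G.m_assoc)
      qed (use u K in \<open>auto intro: subgroup.m_closed\<close>)
      have "(q \<bullet> A Y u) \<bullet> F u (I t) = (q \<bullet> I (u \<otimes>\<^bsub>G\<^esub> t)) \<bullet> gam u t V"
        using q Aarr[OF ub(2)] SY Ia ub tc b A_I[OF ub(2) t] by simp
      also have "\<dots> = A X u \<bullet> F u (q \<bullet> I t)"
        unfolding qI[OF ut] qI[OF t] utK using ub tc b V E_ObD(4)[OF X K u, of t] by simp
      also have "\<dots> = (A X u \<bullet> F u q) \<bullet> F u (I t)" using q Ia ub tc V by simp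
      finally show "(q \<bullet> A Y u) \<bullet> F u (I t) = (A X u \<bullet> F u q) \<bullet> F u (I t)" .
    qed (use q Aarr[OF ub(2)] SY ub V in auto)
  qed (use q SY V in auto)
  have "ind H K X Y j q"
    unfolding ind_def
  proof (intro conjI ballI allI impI)
    show "q \<bullet> j = idn C (fst X)" using qI[OF o(1)] o E_ObD(5)[OF X K] by (simp add: j_def)
    show "q \<bullet> jj Y j h = zer C (FObj (T h) (fst X)) (fst X)" if "h \<in> H - K" for h
      using that jj qI V by auto
    fix f f' assume f: "arr C f" "arr C f'" "src f = fst Y" "src f' = fst Y" "trg f = trg f'"
      "\<forall>h\<in>H. f \<bullet> jj Y j h = f' \<bullet> jj Y j h"
    have "f \<bullet> i t = f' \<bullet> i t" if t: "t \<in> R" for t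
      using f(6) jj[OF summand_typing(6)[OF t]] I_R[OF t] summand_typing(6)[OF t] by auto
    then show "f = f'"
      using dsum_epi[OF d fin f(1,2)] f(3-5) SY by simp
  qed (use H K KH finH X Y jeh qeh in auto)
  then show ?thesis by blast
qed

end

lemma ex_induced_action:
  obtains Y where "fst Y = S" "snd Y \<in> extensional H" "\<And>g. g \<in> H \<Longrightarrow> arr C (A Y g)"
    "\<And>g t. g \<in> H \<Longrightarrow> t \<in> R \<Longrightarrow> A Y g \<bullet> F g (i t) = I (g \<otimes>\<^bsub>G\<^esub> t) \<bullet> gam g t V"
proof -
  note b = summand_typing(1,2)
  \<comment> \<open>The action of g is forced on each summand: it sends the copy at t to the
    translate at g t.\<close>
  define N where "N g = sm C (FObj (T g) S) S R (\<lambda>t. I (g \<otimes>\<^bsub>G\<^esub> t) \<bullet> gam g t V \<bullet> F g (p t))" for g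
  define Y where "Y = (S, \<lambda>g \<in> H. mor (N g))"
  have Fun: "(\<lambda>t. I (g \<otimes>\<^bsub>G\<^esub> t) \<bullet> gam g t V \<bullet> F g (p t)) \<in> R \<rightarrow> hm C (FObj (T g) S) S" if g: "g \<in> H" for g
    using summand_typing I_arr[of "g \<otimes>\<^bsub>G\<^esub> _"] subgroup.m_closed[OF H g] g by auto
  have Na: "arr C (N g)" "src (N g) = FObj (T g) S" "trg (N g) = S" if g: "g \<in> H" for g
    using Fun[OF g] b summand_typing(3)[OF g] by (auto simp: N_def)
  have AY: "A Y g = N g" if "g \<in> H" for g
    using that Na[OF that] by (auto simp: Y_def ac_def intro: arrow_eqI)
  show thesis
  proof (rule that[of Y])
    show "fst Y = S" "snd Y \<in> extensional H" by (auto simp: Y_def)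
    show "arr C (A Y g)" if "g \<in> H" for g using that AY Na by simp
    fix g t assume g: "g \<in> H" and t: "t \<in> R"
    note c = summand_typing(3)[OF g] summand_typing(6-13)[OF t]
    have gs: "g \<otimes>\<^bsub>G\<^esub> s \<in> H" if "s \<in> R" for s using H g summand_typing(6)[OF that] by (rule subgroup.m_closed)
    have pi: "F g (p s) \<bullet> F g (i t) = F g (if t = s then idn C (FObj (T t) V) else zer C (FObj (T t) V) (FObj (T s) V))"
      if "s \<in> R" for s
      using summand_typing(14)[OF t that] c summand_typing(6-13)[OF that] by (simp flip: T_simps(4))
    have "A Y g \<bullet> F g (i t) = sm C (src (F g (i t))) S R (\<lambda>s. (I (g \<otimes>\<^bsub>G\<^esub> s) \<bullet> gam g s V \<bullet> F g (p s)) \<bullet> F g (i t))"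
      unfolding AY[OF g] N_def using Fun[OF g] b c fin by (intro sm_cmp) auto
    also have "\<dots> = (I (g \<otimes>\<^bsub>G\<^esub> t) \<bullet> gam g t V \<bullet> F g (p t)) \<bullet> F g (i t)"
    proof (rule sm_single)
      fix s assume s: "s \<in> R" "s \<noteq> t"
      show "(I (g \<otimes>\<^bsub>G\<^esub> s) \<bullet> gam g s V \<bullet> F g (p s)) \<bullet> F g (i t) = zer C (src (F g (i t))) S"
        using pi[OF s(1)] s c summand_typing(6-13)[OF s(1)] I_arr[OF gs[OF s(1)]] b by simp
    qed (use Fun[OF g] b c fin t in \<open>auto simp: Pi_iff\<close>)
    also have "\<dots> = I (g \<otimes>\<^bsub>G\<^esub> t) \<bullet> gam g t V"
      using pi[OF t] c I_arr[OF gs[OF t]] b by simp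
    finally show "A Y g \<bullet> F g (i t) = I (g \<otimes>\<^bsub>G\<^esub> t) \<bullet> gam g t V" .
  qed
qed

end

lemma is_induced_obj_ind:
  assumes H: "subgroup H G" and K: "subgroup K G" and KH: "K \<subseteq> H" and fin: "finite H" and X: "X \<in> Ob (E K)"
    and Y: "is_induced_obj G C T \<gamma> H K X Y"
  shows "\<exists>j q. ind H K X Y j q"
proof -
  obtain R i p where R: "left_coset_reps G H K R" and d: "dsum C R (\<lambda>t. FObj (T t) (fst X)) (fst Y) i p"
    and Y': "snd Y \<in> extensional H" "\<And>g. g \<in> H \<Longrightarrow> arr C (A Y g)"
    and c: "\<And>g t s u. \<lbrakk>g \<in> H; t \<in> R; s \<in> R; u \<in> K; g \<otimes>\<^bsub>G\<^esub> t = s \<otimes>\<^bsub>G\<^esub> u\<rbrakk> \<Longrightarrow>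
          A Y g \<bullet> F g (i t) = ph X s (i s) u \<bullet> gam g t (fst X)"
    using Y unfolding is_induced_obj_arr[OF H K KH X] by blast
  have RH: "R \<subseteq> H" using R by (simp add: left_coset_reps_def)
  have finR: "finite R" using fin RH by (rule finite_subset[rotated])
  note ctx = H K KH X R finR refl d
  \<comment> \<open>The defining condition for g t = s u, with s the representative of g t and u the
    remaining factor.\<close>
  have "A Y g \<bullet> F g (i t) = I K X R i (g \<otimes>\<^bsub>G\<^esub> t) \<bullet> gam g t (fst X)" if g: "g \<in> H" and t: "t \<in> R" for g t
  proof -
    have gt: "g \<otimes>\<^bsub>G\<^esub> t \<in> H" using H g t RH by (auto intro: subgroup.m_closed)
    show ?thesis
      using c[OF g t rep(1)[OF ctx gt] rep(2)[OF ctx gt] rep(3)[OF ctx gt]] by (simp add: I_def[OF ctx])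
  qed
  from induced_ind[OF ctx refl Y' this fin] show ?thesis by blast
qed

lemma ex_is_induced_obj:
  assumes H: "subgroup H G" and K: "subgroup K G" and KH: "K \<subseteq> H" and fin: "finite H" and X: "X \<in> Ob (E K)"
  shows "\<exists>Y. is_induced_obj G C T \<gamma> H K X Y"
proof -
  obtain R where R: "left_coset_reps G H K R" using ex_left_coset_reps[OF K H KH] by blast
  have RH: "R \<subseteq> H" using R by (simp add: left_coset_reps_def)
  have finR: "finite R" using fin RH by (rule finite_subset[rotated])
  have "FObj (T t) (fst X) \<in> Ob C" if "t \<in> R" for t
    using that RH subgroup.mem_carrier[OF H] E_ObD(1)[OF X K] by auto
  from ex_dsum[OF finR, of "\<lambda>t. FObj (T t) (fst X)", OF this] obtain S i p
    where d: "dsum C R (\<lambda>t. FObj (T t) (fst X)) S i p" by blast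
  note ctx = H K KH X R finR refl d
  obtain Y where Y: "fst Y = S" "snd Y \<in> extensional H" "\<And>g. g \<in> H \<Longrightarrow> arr C (A Y g)"
    "\<And>g t. g \<in> H \<Longrightarrow> t \<in> R \<Longrightarrow> A Y g \<bullet> F g (i t) = I K X R i (g \<otimes>\<^bsub>G\<^esub> t) \<bullet> gam g t (fst X)"
    using ex_induced_action[OF ctx] by metis
  have "A Y g \<bullet> F g (i t) = ph X s (i s) u \<bullet> gam g t (fst X)"
    if "g \<in> H" "t \<in> R" "s \<in> R" "u \<in> K" "g \<otimes>\<^bsub>G\<^esub> t = s \<otimes>\<^bsub>G\<^esub> u" for g t s u
    using Y(4)[OF that(1,2)] I_eq[OF ctx that(3,4)] that(5) by simp
  then show ?thesis
    unfolding is_induced_obj_arr[OF H K KH X] using R d Y by blast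
qed

end

section \<open>Uniqueness, transitivity and tensor products of induced objects\<close>

context tensor_action
begin

lemma eh_res_obj' [simp]:
  "K \<subseteq> H \<Longrightarrow> eh K (res_obj H X) Y = eh K X Y" "K \<subseteq> H \<Longrightarrow> eh K X (res_obj H Y) = eh K X Y"
  by (auto simp: eh_def subset_iff)

lemma cmp_eh_sub:
  assumes "subgroup K G" "res_obj K X \<in> Ob (E K)" "res_obj K Y \<in> Ob (E K)" "res_obj K Z \<in> Ob (E K)"
    and "u \<in> eh K X Y" "t \<in> eh K Y Z"
  shows "t \<bullet> u \<in> eh K X Z"
  using cmp_eh[OF assms(1-4), of u t] assms(5,6) by simp

lemma jj_res_obj [simp]: "h \<in> K \<Longrightarrow> jj (res_obj K Y) j h = jj Y j h"
  by (simp add: jj_def)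

lemma res_obj_res_obj: "J \<subseteq> K \<Longrightarrow> res_obj J (res_obj K X) = res_obj J X"
  by (auto simp: res_obj_def fun_eq_iff split: prod.split)

lemma res_obj_id:
  assumes "X \<in> Ob (E H)" "subgroup H G"
  shows "res_obj H X = X"
  using E_ObD(2)[OF assms] by (cases X) (simp add: res_obj_def extensional_restrict)

lemma ind_refl:
  assumes H: "subgroup H G" and fin: "finite H" and X: "X \<in> Ob (E H)"
  shows "ind H H X X (idn C (fst X)) (idn C (fst X))"
  unfolding ind_def
proof (intro conjI allI impI)
  note ob = E_ObD(1)[OF X H]
  show "idn C (fst X) \<in> eh H X X" by (rule idn_eh[OF X H])
  then show "idn C (fst X) \<in> eh H X X" .
  fix f f' assume f: "arr C f" "arr C f'" "src f = fst X" "src f' = fst X" "trg f = trg f'"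
    "\<forall>h\<in>H. f \<bullet> jj X (idn C (fst X)) h = f' \<bullet> jj X (idn C (fst X)) h"
  have o: "\<one>\<^bsub>G\<^esub> \<in> H" using H by (rule subgroup.one_closed)
  have "f \<bullet> jj X (idn C (fst X)) \<one>\<^bsub>G\<^esub> = f' \<bullet> jj X (idn C (fst X)) \<one>\<^bsub>G\<^esub>" using f(6) o by blast
  then show "f = f'" using f(1-5) ob E_ObD(5)[OF X H] by (simp add: jj_def)
qed (use assms E_ObD(1)[OF X H] in auto)

text \<open>Both objects have the universal property of a left adjoint at X, so the extensions of j'
  and of j are mutually inverse.\<close>

lemma ind_unique:
  assumes Y: "ind H K X Y j q" and Z: "ind H K X Z j' q'"
  obtains f where "f \<in> eh H Y Z" "iso C f"
proof -
  note dY = indD[OF Y refl] and dZ = indD[OF Z refl]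
  obtain f where f: "f \<in> eh H Y Z" "f \<bullet> j = j'" using ind_ext[OF Y refl dZ(6,7)] .
  obtain g where g: "g \<in> eh H Z Y" "g \<bullet> j' = j" using ind_ext[OF Z refl dY(6,7)] .
  note df = ehD(1-3)[OF f(1)] and dg = ehD(1-3)[OF g(1)] and dj = ehD(1-3)[OF dY(7)] and dj' = ehD(1-3)[OF dZ(7)]
  have "g \<bullet> f = idn C (fst Y)"
  proof (rule ind_ext_eq[OF Y refl dY(6)])
    show "(g \<bullet> f) \<bullet> j = idn C (fst Y) \<bullet> j" using df dg dj f(2) g(2) by simp
  qed (use cmp_eh[OF dY(1,6) dZ(6) dY(6) f(1) g(1)] idn_eh[OF dY(6,1)] in auto)
  moreover have "f \<bullet> g = idn C (fst Z)"
  proof (rule ind_ext_eq[OF Z refl dZ(6)])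
    show "(f \<bullet> g) \<bullet> j' = idn C (fst Z) \<bullet> j'" using df dg dj' f(2) g(2) by simp
  qed (use cmp_eh[OF dY(1) dZ(6) dY(6) dZ(6) g(1) f(1)] idn_eh[OF dZ(6,1)] in auto)
  ultimately have "iso C f" using df dg by (intro isoI[of f g]) auto
  then show thesis using that f(1) by blast
qed

text \<open>An h outside J lies either in K, where q kills the translate, or outside K, where q'
  already does. Joint epimorphy is tested in two stages, with \<open>ind_epi\<close> handling the
  inner translates after T^h.\<close>

lemma ind_trans:
  assumes Y: "ind K J X Y j q" and Z: "ind H K Y Z j' q'"
  shows "ind H J X Z (j' \<bullet> j) (q \<bullet> q')"
proof -
  note dY = indD[OF Y refl] and dZ = indD[OF Z refl]
  note H = dZ(1) and K = dZ(2) and J = dY(2)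
  have JH: "J \<subseteq> H" using dY(3) dZ(3) by simp
  note dj = ehD(1-3)[OF dY(7)] and dj' = ehD(1-3)[OF dZ(7)] and dq = ehD(1-3)[OF dY(8)] and dq' = ehD(1-3)[OF dZ(8)]
  note XoJ = res_obj_Ob[OF J J subset_refl dY(5)] and YoJ = res_obj_Ob[OF K J dY(3,6)] and ZoJ = res_obj_Ob[OF H J JH dZ(6)]
  note ZoK = res_obj_Ob[OF H K dZ(3,6)]
  note ob = E_ObD(1)[OF dY(5) J] E_ObD(1)[OF dY(6) K] E_ObD(1)[OF dZ(6) H]
  note jeh = cmp_eh_sub[OF J XoJ YoJ ZoJ dY(7) eh_mono[OF dY(3) dZ(7)]]
  have jjj: "jj Z (j' \<bullet> j) h = jj Z j' h \<bullet> F h j" if "h \<in> H" for h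
    using jj_cmp_right[OF H dZ(6,7) dj(1,3) that] .
  show ?thesis
    unfolding ind_def
  proof (intro conjI ballI allI impI)
    show "j' \<bullet> j \<in> eh J X Z" by (rule jeh)
    show "q \<bullet> q' \<in> eh J Z X" by (rule cmp_eh_sub[OF J ZoJ YoJ XoJ eh_mono[OF dY(3) dZ(8)] dY(8)])
    have "(q \<bullet> q') \<bullet> j' \<bullet> j = q \<bullet> (q' \<bullet> j') \<bullet> j" using dj dj' dq dq' by simp
    then show "(q \<bullet> q') \<bullet> j' \<bullet> j = idn C (fst X)" using dj dY(9) dZ(9) by simp
    fix h assume h: "h \<in> H - J"
    have hH: "h \<in> H" using h by simp
    note c = subgroup.mem_carrier[OF H hH]
    note a = jj_arr[OF H dZ(6,7) hH]
    have e: "(q \<bullet> q') \<bullet> jj Z (j' \<bullet> j) h = q \<bullet> (q' \<bullet> jj Z j' h) \<bullet> F h j"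
      using dq dq' dj a c hH by (simp add: jjj)
    show "(q \<bullet> q') \<bullet> jj Z (j' \<bullet> j) h = zer C (FObj (T h) (fst X)) (fst X)"
    proof (cases "h \<in> K")
      case True
      then show ?thesis
        unfolding e q_jj[OF Z refl True] using dY(10)[OF True] h by (simp add: jj_def)
    next
      case False
      then show ?thesis unfolding e dZ(10)[OF hH False] using c dq dj ob by simp
    qed
  next
    fix f f' assume f: "arr C f" "arr C f'" "src f = fst Z" "src f' = fst Z" "trg f = trg f'"
      "\<forall>h\<in>H. f \<bullet> jj Z (j' \<bullet> j) h = f' \<bullet> jj Z (j' \<bullet> j) h"
    show "f = f'"
    proof (rule dZ(11)[OF f(1-5)])
      fix h assume h: "h \<in> H"
      note c = subgroup.mem_carrier[OF H h]
      note a = jj_arr[OF H dZ(6,7) h]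
      show "f \<bullet> jj Z j' h = f' \<bullet> jj Z j' h"
      proof (rule ind_epi[OF Y refl c])
        fix u assume u: "u \<in> K"
        have uH: "u \<in> H" using u dZ(3) by auto
        have hu: "h \<otimes>\<^bsub>G\<^esub> u \<in> H" using H h uH by (rule subgroup.m_closed)
        note cu = subgroup.mem_carrier[OF H uH]
        note au = jj_arr[OF K dY(6,7) u] jj_arr[OF H dZ(6) jeh uH] jj_arr[OF H dZ(6) jeh hu]
        have "j' \<bullet> jj Y j u = jj Z (j' \<bullet> j) u"
          using jj_cmp[OF K dY(6) ZoK dY(7), of j' u] dZ(7) u by simp
        then have "jj Z j' h \<bullet> F h (jj Y j u) = A Z h \<bullet> F h (jj Z (j' \<bullet> j) u)"
          unfolding jj_def[of Z j' h] using c dj' au E_ObD(3)[OF dZ(6) H h] by (simp flip: T_simps(4))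
        also have "\<dots> = jj Z (j' \<bullet> j) (h \<otimes>\<^bsub>G\<^esub> u) \<bullet> gam h u (fst X)"
          by (rule A_jj[OF H dZ(6) jeh h uH])
        finally have e: "jj Z j' h \<bullet> F h (jj Y j u) = jj Z (j' \<bullet> j) (h \<otimes>\<^bsub>G\<^esub> u) \<bullet> gam h u (fst X)" .
        have e': "(x \<bullet> jj Z j' h) \<bullet> F h (jj Y j u) = (x \<bullet> jj Z (j' \<bullet> j) (h \<otimes>\<^bsub>G\<^esub> u)) \<bullet> gam h u (fst X)"
          if "arr C x" "src x = fst Z" for x
          using that a au c cu e ob by simp
        show "(f \<bullet> jj Z j' h) \<bullet> F h (jj Y j u) = (f' \<bullet> jj Z j' h) \<bullet> F h (jj Y j u)"
          unfolding e'[OF f(1,3)] e'[OF f(2,4)] using f(6) hu by simp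
      qed (use f(1-5) a in auto)
    qed
  qed (use H J JH dZ dY in auto)
qed

text \<open>H acts on B by isomorphisms, so a translate of j \<otimes> B is, up to an isomorphism of
  its source, the translate of j tensored with B. On classes this becomes (G2).\<close>

lemma ind_tensor_right:
  assumes Y: "ind H K X Y j q" and B: "B \<in> Ob (E H)"
  shows "ind H K (eT K X (res_obj K B)) (eT H Y B) (j \<boxtimes> idn C (fst B)) (q \<boxtimes> idn C (fst B))"
proof -
  note dY = indD[OF Y refl]
  note H = dY(1) and K = dY(2) and KH = dY(3)
  let ?b = "idn C (fst B)"
  note dj = ehD(1-3)[OF dY(7)] and dq = ehD(1-3)[OF dY(8)]
  note BK = res_obj_Ob[OF H K KH B] and YK = res_obj_Ob[OF H K KH dY(6)]
  note ob = E_ObD(1)[OF dY(5) K] E_ObD(1)[OF dY(6) H] E_ObD(1)[OF B H]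
  have b: "?b \<in> eh K (res_obj K B) (res_obj K B)" using idn_eh[OF BK K] by simp
  have jeh: "j \<boxtimes> ?b \<in> eh K (eT K X (res_obj K B)) (eT H Y B)"
    using tn_eh[OF K dY(5) YK BK BK _ b, of j] dY(7) by (simp flip: res_obj_eT[OF KH])
  have qeh: "q \<boxtimes> ?b \<in> eh K (eT H Y B) (eT K X (res_obj K B))"
    using tn_eh[OF K YK dY(5) BK BK _ b, of q] dY(8) by (simp flip: res_obj_eT[OF KH])
  have jjT: "jj (eT H Y B) (j \<boxtimes> ?b) h = (jj Y j h \<boxtimes> ?b) \<bullet> (idn C (FObj (T h) (fst X)) \<boxtimes> A B h) \<bullet> f2 C (T h) (fst X) (fst B)"
    if h: "h \<in> H" for h
  proof -
    note c = subgroup.mem_carrier[OF H h] and i = E_ObD(3)[OF dY(6) H h] E_ObD(3)[OF B H h]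
    have "jj (eT H Y B) (j \<boxtimes> ?b) h = (A Y h \<boxtimes> A B h) \<bullet> (F h j \<boxtimes> idn C (FObj (T h) (fst B))) \<bullet> f2 C (T h) (fst X) (fst B)"
      using h c i dj ob T_f2_natural[of h j ?b "fst Y" "fst B"] by (simp add: jj_def A_eT)
    then show ?thesis using h c i dj ob by (simp add: tn_cmp_cmp jj_def)
  qed
  show ?thesis
    unfolding ind_def
  proof (intro conjI ballI allI impI)
    show "(q \<boxtimes> ?b) \<bullet> (j \<boxtimes> ?b) = idn C (fst (eT K X (res_obj K B)))"
      using dj dq dY(9) ob by (simp add: tn_cmp)
    fix h assume h: "h \<in> H - K"
    then have hH: "h \<in> H" by simp
    note c = subgroup.mem_carrier[OF H hH] and i = E_ObD(3)[OF B H hH]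
    note a = jj_arr[OF H dY(6,7) hH]
    show "(q \<boxtimes> ?b) \<bullet> jj (eT H Y B) (j \<boxtimes> ?b) h
        = zer C (FObj (T h) (fst (eT K X (res_obj K B)))) (fst (eT K X (res_obj K B)))"
      unfolding jjT[OF hH] using dY(10)[OF hH] h c a dq i ob by (simp add: tn_cmp_cmp)
  next
    fix f f' assume f: "arr C f" "arr C f'" "src f = fst (eT H Y B)" "src f' = fst (eT H Y B)" "trg f = trg f'"
      "\<forall>h\<in>H. f \<bullet> jj (eT H Y B) (j \<boxtimes> ?b) h = f' \<bullet> jj (eT H Y B) (j \<boxtimes> ?b) h"
    have e: "f \<bullet> (jj Y j h \<boxtimes> ?b) = f' \<bullet> (jj Y j h \<boxtimes> ?b)" if h: "h \<in> H" for h
    proof -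
      note c = subgroup.mem_carrier[OF H h] and i = E_ObD(3)[OF B H h]
      note a = jj_arr[OF H dY(6,7) h]
      let ?w = "(idn C (FObj (T h) (fst X)) \<boxtimes> A B h) \<bullet> f2 C (T h) (fst X) (fst B)"
      have w: "iso C ?w" "src ?w = FObj (T h) (TObj C (fst X) (fst B))" "trg ?w = TObj C (FObj (T h) (fst X)) (fst B)"
        using c i ob by auto
      have "f \<bullet> (jj Y j h \<boxtimes> ?b) \<bullet> ?w = f' \<bullet> (jj Y j h \<boxtimes> ?b) \<bullet> ?w"
        unfolding jjT[OF h, symmetric] using f(6) h by blast
      then have "(f \<bullet> (jj Y j h \<boxtimes> ?b)) \<bullet> ?w = (f' \<bullet> (jj Y j h \<boxtimes> ?b)) \<bullet> ?w"
        using f(1-5) a w ob c i by simp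
      then show ?thesis
        using f(1-5) a w ob by - (rule iso_cancel_right[OF w(1)], simp_all)
    qed
    \<comment> \<open>Joint epimorphy is recovered from the decomposition of the identity, which
      tensoring with B preserves.\<close>
    obtain R where R: "R \<subseteq> H" "finite R" and Fun: "(\<lambda>t. jj Y j t \<bullet> qq Y q t) \<in> R \<rightarrow> hm C (fst Y) (fst Y)"
      and id: "sm C (fst Y) (fst Y) R (\<lambda>t. jj Y j t \<bullet> qq Y q t) = idn C (fst Y)"
      by (rule ind_decomposition[OF Y refl])
    let ?Y = "TObj C (fst Y) (fst B)"
    have Fun': "(\<lambda>t. (jj Y j t \<bullet> qq Y q t) \<boxtimes> ?b) \<in> R \<rightarrow> hm C ?Y ?Y" using Fun ob by (auto simp: Pi_iff)
    have id': "sm C ?Y ?Y R (\<lambda>t. (jj Y j t \<bullet> qq Y q t) \<boxtimes> ?b) = idn C ?Y"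
      using sm_tn(1)[OF ob(2,2) R(2) Fun, of ?b] id ob by simp
    show "f = f'"
    proof (rule sm_jointly_epi[OF _ R(2) Fun' id'])
      fix t assume "t \<in> R"
      then have t: "t \<in> H" using R by auto
      note a = jj_arr[OF H dY(6,7) t] qq_arr[OF H dY(6,8) t]
      have s: "(jj Y j t \<bullet> qq Y q t) \<boxtimes> ?b = (jj Y j t \<boxtimes> ?b) \<bullet> (qq Y q t \<boxtimes> ?b)"
        using a ob by (simp add: tn_cmp)
      have "f \<bullet> ((jj Y j t \<bullet> qq Y q t) \<boxtimes> ?b) = (f \<bullet> (jj Y j t \<boxtimes> ?b)) \<bullet> (qq Y q t \<boxtimes> ?b)"
        unfolding s using f(1-5) a ob by simp
      also have "\<dots> = f' \<bullet> ((jj Y j t \<bullet> qq Y q t) \<boxtimes> ?b)"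
        unfolding s e[OF t] using f(1-5) a ob by simp
      finally show "f \<bullet> ((jj Y j t \<bullet> qq Y q t) \<boxtimes> ?b) = f' \<bullet> ((jj Y j t \<bullet> qq Y q t) \<boxtimes> ?b)" .
    qed (use f(1-5) ob in simp_all)
  qed (use H K KH dY(4) eT_Ob[OF K dY(5) BK] eT_Ob[OF H dY(6) B] jeh qeh in auto)
qed

text \<open>The mirror image of \<open>ind_tensor_right\<close>, treated separately because the
  tensor product carries no symmetry. On classes it becomes (G3).\<close>

lemma ind_tensor_left:
  assumes Y: "ind H K X Y j q" and B: "B \<in> Ob (E H)"
  shows "ind H K (eT K (res_obj K B) X) (eT H B Y) (idn C (fst B) \<boxtimes> j) (idn C (fst B) \<boxtimes> q)"
proof -
  note dY = indD[OF Y refl]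
  note H = dY(1) and K = dY(2) and KH = dY(3)
  let ?b = "idn C (fst B)"
  note dj = ehD(1-3)[OF dY(7)] and dq = ehD(1-3)[OF dY(8)]
  note BK = res_obj_Ob[OF H K KH B] and YK = res_obj_Ob[OF H K KH dY(6)]
  note ob = E_ObD(1)[OF dY(5) K] E_ObD(1)[OF dY(6) H] E_ObD(1)[OF B H]
  have b: "?b \<in> eh K (res_obj K B) (res_obj K B)" using idn_eh[OF BK K] by simp
  have jeh: "?b \<boxtimes> j \<in> eh K (eT K (res_obj K B) X) (eT H B Y)"
    using tn_eh[OF K BK BK dY(5) YK b, of j] dY(7) by (simp flip: res_obj_eT[OF KH])
  have qeh: "?b \<boxtimes> q \<in> eh K (eT H B Y) (eT K (res_obj K B) X)"
    using tn_eh[OF K BK BK YK dY(5) b, of q] dY(8) by (simp flip: res_obj_eT[OF KH])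
  have jjT: "jj (eT H B Y) (?b \<boxtimes> j) h = (?b \<boxtimes> jj Y j h) \<bullet> (A B h \<boxtimes> idn C (FObj (T h) (fst X))) \<bullet> f2 C (T h) (fst B) (fst X)"
    if h: "h \<in> H" for h
  proof -
    note c = subgroup.mem_carrier[OF H h] and i = E_ObD(3)[OF dY(6) H h] E_ObD(3)[OF B H h]
    have "jj (eT H B Y) (?b \<boxtimes> j) h = (A B h \<boxtimes> A Y h) \<bullet> (idn C (FObj (T h) (fst B)) \<boxtimes> F h j) \<bullet> f2 C (T h) (fst B) (fst X)"
      using h c i dj ob T_f2_natural[of h ?b j "fst B" "fst Y"] by (simp add: jj_def A_eT)
    then show ?thesis using h c i dj ob by (simp add: tn_cmp_cmp jj_def)
  qed
  show ?thesis
    unfolding ind_def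
  proof (intro conjI ballI allI impI)
    show "(?b \<boxtimes> q) \<bullet> (?b \<boxtimes> j) = idn C (fst (eT K (res_obj K B) X))"
      using dj dq dY(9) ob by (simp add: tn_cmp)
    fix h assume h: "h \<in> H - K"
    then have hH: "h \<in> H" by simp
    note c = subgroup.mem_carrier[OF H hH] and i = E_ObD(3)[OF B H hH]
    note a = jj_arr[OF H dY(6,7) hH]
    show "(?b \<boxtimes> q) \<bullet> jj (eT H B Y) (?b \<boxtimes> j) h
        = zer C (FObj (T h) (fst (eT K (res_obj K B) X))) (fst (eT K (res_obj K B) X))"
      unfolding jjT[OF hH] using dY(10)[OF hH] h c a dq i ob by (simp add: tn_cmp_cmp)
  next
    fix f f' assume f: "arr C f" "arr C f'" "src f = fst (eT H B Y)" "src f' = fst (eT H B Y)" "trg f = trg f'"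
      "\<forall>h\<in>H. f \<bullet> jj (eT H B Y) (?b \<boxtimes> j) h = f' \<bullet> jj (eT H B Y) (?b \<boxtimes> j) h"
    have e: "f \<bullet> (?b \<boxtimes> jj Y j h) = f' \<bullet> (?b \<boxtimes> jj Y j h)" if h: "h \<in> H" for h
    proof -
      note c = subgroup.mem_carrier[OF H h] and i = E_ObD(3)[OF B H h]
      note a = jj_arr[OF H dY(6,7) h]
      let ?w = "(A B h \<boxtimes> idn C (FObj (T h) (fst X))) \<bullet> f2 C (T h) (fst B) (fst X)"
      have w: "iso C ?w" "src ?w = FObj (T h) (TObj C (fst B) (fst X))" "trg ?w = TObj C (fst B) (FObj (T h) (fst X))"
        using c i ob by auto
      have "f \<bullet> (?b \<boxtimes> jj Y j h) \<bullet> ?w = f' \<bullet> (?b \<boxtimes> jj Y j h) \<bullet> ?w"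
        unfolding jjT[OF h, symmetric] using f(6) h by blast
      then have "(f \<bullet> (?b \<boxtimes> jj Y j h)) \<bullet> ?w = (f' \<bullet> (?b \<boxtimes> jj Y j h)) \<bullet> ?w"
        using f(1-5) a w ob c i by simp
      then show ?thesis
        using f(1-5) a w ob by - (rule iso_cancel_right[OF w(1)], simp_all)
    qed
    obtain R where R: "R \<subseteq> H" "finite R" and Fun: "(\<lambda>t. jj Y j t \<bullet> qq Y q t) \<in> R \<rightarrow> hm C (fst Y) (fst Y)"
      and id: "sm C (fst Y) (fst Y) R (\<lambda>t. jj Y j t \<bullet> qq Y q t) = idn C (fst Y)"
      by (rule ind_decomposition[OF Y refl])
    let ?Y = "TObj C (fst B) (fst Y)"
    have Fun': "(\<lambda>t. ?b \<boxtimes> (jj Y j t \<bullet> qq Y q t)) \<in> R \<rightarrow> hm C ?Y ?Y" using Fun ob by (auto simp: Pi_iff)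
    have id': "sm C ?Y ?Y R (\<lambda>t. ?b \<boxtimes> (jj Y j t \<bullet> qq Y q t)) = idn C ?Y"
      using sm_tn(2)[OF ob(2,2) R(2) Fun, of ?b] id ob by simp
    show "f = f'"
    proof (rule sm_jointly_epi[OF _ R(2) Fun' id'])
      fix t assume "t \<in> R"
      then have t: "t \<in> H" using R by auto
      note a = jj_arr[OF H dY(6,7) t] qq_arr[OF H dY(6,8) t]
      have s: "?b \<boxtimes> (jj Y j t \<bullet> qq Y q t) = (?b \<boxtimes> jj Y j t) \<bullet> (?b \<boxtimes> qq Y q t)"
        using a ob by (simp add: tn_cmp)
      have "f \<bullet> (?b \<boxtimes> (jj Y j t \<bullet> qq Y q t)) = (f \<bullet> (?b \<boxtimes> jj Y j t)) \<bullet> (?b \<boxtimes> qq Y q t)"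
        unfolding s using f(1-5) a ob by simp
      also have "\<dots> = f' \<bullet> (?b \<boxtimes> (jj Y j t \<bullet> qq Y q t))"
        unfolding s e[OF t] using f(1-5) a ob by simp
      finally show "f \<bullet> (?b \<boxtimes> (jj Y j t \<bullet> qq Y q t)) = f' \<bullet> (?b \<boxtimes> (jj Y j t \<bullet> qq Y q t))" .
    qed (use f(1-5) ob in simp_all)
  qed (use H K KH dY(4) eT_Ob[OF K BK dY(5)] eT_Ob[OF H B dY(6)] jeh qeh in auto)
qed

subsection \<open>Exactness of the structure functors\<close>

text \<open>Exactness in C^H in the form of rules on morphisms of C: existence and uniqueness of
  factorizations, for kernel and cokernel. \<open>ses_I\<close> is the converse, and exactness of
  induction is proved by passing between the two.\<close>

lemma ses_D:
  assumes H: "subgroup H G" and s: "ses H X a Y b Z"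
  shows "X \<in> Ob (E H)" "Y \<in> Ob (E H)" "Z \<in> Ob (E H)" "a \<in> eh H X Y" "b \<in> eh H Y Z" "b \<bullet> a = zer C (fst X) (fst Z)"
    and "\<And>W t. W \<in> Ob (E H) \<Longrightarrow> t \<in> eh H W Y \<Longrightarrow> b \<bullet> t = zer C (fst W) (fst Z) \<Longrightarrow> \<exists>w \<in> eh H W X. a \<bullet> w = t"
    and "\<And>W w w'. W \<in> Ob (E H) \<Longrightarrow> w \<in> eh H W X \<Longrightarrow> w' \<in> eh H W X \<Longrightarrow> a \<bullet> w = a \<bullet> w' \<Longrightarrow> w = w'"
    and "\<And>W t. W \<in> Ob (E H) \<Longrightarrow> t \<in> eh H Y W \<Longrightarrow> t \<bullet> a = zer C (fst X) (fst W) \<Longrightarrow> \<exists>w \<in> eh H Z W. w \<bullet> b = t"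
    and "\<And>W w w'. W \<in> Ob (E H) \<Longrightarrow> w \<in> eh H Z W \<Longrightarrow> w' \<in> eh H Z W \<Longrightarrow> w \<bullet> b = w' \<bullet> b \<Longrightarrow> w = w'"
proof -
  show o: "X \<in> Ob (E H)" "Y \<in> Ob (E H)" "Z \<in> Ob (E H)" "a \<in> eh H X Y" "b \<in> eh H Y Z"
    using s by (auto simp: ses_def)
  have k: "b \<bullet> a = zer C (fst X) (fst Z) \<and>
    (\<forall>W \<in> Ob (E H). \<forall>t \<in> eh H W Y. b \<bullet> t = zer C (fst W) (fst Z) \<longrightarrow> (\<exists>!w. w \<in> eh H W X \<and> a \<bullet> w = t))"
    using s E_ker_arr[OF H o(2,3,1,5,4)] by (simp add: ses_def)
  have c: "\<forall>W \<in> Ob (E H). \<forall>t \<in> eh H Y W. t \<bullet> a = zer C (fst X) (fst W) \<longrightarrow> (\<exists>!w. w \<in> eh H Z W \<and> w \<bullet> b = t)"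
    using s E_cok_arr[OF H o(1,2,3,4,5)] by (simp add: ses_def)
  show z: "b \<bullet> a = zer C (fst X) (fst Z)" using k by blast
  show "\<exists>w \<in> eh H W X. a \<bullet> w = t" if "W \<in> Ob (E H)" "t \<in> eh H W Y" "b \<bullet> t = zer C (fst W) (fst Z)" for W t
    using k that by blast
  show "\<exists>w \<in> eh H Z W. w \<bullet> b = t" if "W \<in> Ob (E H)" "t \<in> eh H Y W" "t \<bullet> a = zer C (fst X) (fst W)" for W t
    using c that by blast
  note da = ehD(1-3)[OF o(4)] and db = ehD(1-3)[OF o(5)]
  show "w = w'" if W: "W \<in> Ob (E H)" and w: "w \<in> eh H W X" "w' \<in> eh H W X" "a \<bullet> w = a \<bullet> w'" for W w w'
  proof -
    note dw = ehD(1-3)[OF w(1)]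
    have "b \<bullet> a \<bullet> w = zer C (fst X) (fst Z) \<bullet> w" using da db dw by (intro cmp_reassoc z) auto
    then have "b \<bullet> a \<bullet> w = zer C (fst W) (fst Z)" using dw E_ObD(1)[OF o(3) H] by simp
    moreover have "a \<bullet> w \<in> eh H W Y" by (rule cmp_eh[OF H W o(1,2) w(1) o(4)])
    ultimately have "\<exists>!v. v \<in> eh H W X \<and> a \<bullet> v = a \<bullet> w" using k W by blast
    then show ?thesis using w by metis
  qed
  show "w = w'" if W: "W \<in> Ob (E H)" and w: "w \<in> eh H Z W" "w' \<in> eh H Z W" "w \<bullet> b = w' \<bullet> b" for W w w'
  proof -
    note dw = ehD(1-3)[OF w(1)]
    have "(w \<bullet> b) \<bullet> a = w \<bullet> b \<bullet> a" using da db dw by (intro cmp_assoc) auto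
    then have "(w \<bullet> b) \<bullet> a = zer C (fst X) (fst W)" using z dw E_ObD(1)[OF o(1) H] by simp
    moreover have "w \<bullet> b \<in> eh H Y W" by (rule cmp_eh[OF H o(2,3) W o(5) w(1)])
    ultimately have "\<exists>!v. v \<in> eh H Z W \<and> v \<bullet> b = w \<bullet> b" using c W by blast
    then show ?thesis using w by metis
  qed
qed

lemma ses_I:
  assumes H: "subgroup H G"
    and o: "X \<in> Ob (E H)" "Y \<in> Ob (E H)" "Z \<in> Ob (E H)" "a \<in> eh H X Y" "b \<in> eh H Y Z" "b \<bullet> a = zer C (fst X) (fst Z)"
    and "\<And>W t. W \<in> Ob (E H) \<Longrightarrow> t \<in> eh H W Y \<Longrightarrow> b \<bullet> t = zer C (fst W) (fst Z) \<Longrightarrow> \<exists>w \<in> eh H W X. a \<bullet> w = t"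
    and "\<And>W w w'. W \<in> Ob (E H) \<Longrightarrow> w \<in> eh H W X \<Longrightarrow> w' \<in> eh H W X \<Longrightarrow> a \<bullet> w = a \<bullet> w' \<Longrightarrow> w = w'"
    and "\<And>W t. W \<in> Ob (E H) \<Longrightarrow> t \<in> eh H Y W \<Longrightarrow> t \<bullet> a = zer C (fst X) (fst W) \<Longrightarrow> \<exists>w \<in> eh H Z W. w \<bullet> b = t"
    and "\<And>W w w'. W \<in> Ob (E H) \<Longrightarrow> w \<in> eh H Z W \<Longrightarrow> w' \<in> eh H Z W \<Longrightarrow> w \<bullet> b = w' \<bullet> b \<Longrightarrow> w = w'"
  shows "ses H X a Y b Z"
proof -
  have "ker_arr (E H) (Arrow Y (mor b) Z) (Arrow X (mor a) Y)"
    unfolding E_ker_arr[OF H o(2,3,1,5,4)] using assms(7-9) by metis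
  moreover have "cok_arr (E H) (Arrow X (mor a) Y) (Arrow Y (mor b) Z)"
    unfolding E_cok_arr[OF H o(1,2,3,4,5)] using assms(7,10,11) by metis
  ultimately show ?thesis using o by (simp add: ses_def)
qed

text \<open>Induction is both left and right adjoint to restriction, hence exact.\<close>

lemma ses_ind:
  assumes s: "ses K X a X' b X''"
    and Y: "ind H K X Y j q" "ind H K X' Y' j' q'" "ind H K X'' Y'' j'' q''"
  shows "\<exists>f g. ses H Y f Y' g Y''"
proof -
  note d = indD[OF Y(1) refl] and d' = indD[OF Y(2) refl] and d'' = indD[OF Y(3) refl]
  note H = d(1) and K = d(2) and KH = d(3)
  note S = ses_D[OF K s]
  note YK = res_obj_Ob[OF H K KH d(6)] and YK' = res_obj_Ob[OF H K KH d'(6)] and YK'' = res_obj_Ob[OF H K KH d''(6)]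
  note da = ehD(1-3)[OF S(4)] and db = ehD(1-3)[OF S(5)]
  note dj = ehD(1-3)[OF d(7)] ehD(1-3)[OF d'(7)] ehD(1-3)[OF d''(7)]
  note dq = ehD(1-3)[OF d(8)] ehD(1-3)[OF d'(8)] ehD(1-3)[OF d''(8)]
  note ob = E_ObD(1)[OF d(5) K] E_ObD(1)[OF d'(5) K] E_ObD(1)[OF d''(5) K] E_ObD(1)[OF d(6) H] E_ObD(1)[OF d'(6) H] E_ObD(1)[OF d''(6) H]
  \<comment> \<open>The map f obtained from the left universal property also satisfies the condition
    that determines a map by the right one. So the same f serves both halves of exactness.\<close>
  have q_f: "q2 \<bullet> f = c \<bullet> q1"
    if I1: "ind H K X1 Y1 j1 q1" and I2: "ind H K X2 Y2 j2 q2" and c: "c \<in> eh K X1 X2"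
      and f: "f \<in> eh H Y1 Y2" "f \<bullet> j1 = j2 \<bullet> c"
    for X1 Y1 j1 q1 X2 Y2 j2 q2 c f
  proof (rule indD(11)[OF I1 refl])
    note e1 = indD[OF I1 refl] and e2 = indD[OF I2 refl]
    note a = ehD(1-3)[OF c] ehD(1-3)[OF f(1)] ehD(1-3)[OF e1(8)] ehD(1-3)[OF e2(8)]
    note ob = E_ObD(1)[OF e1(5) K] E_ObD(1)[OF e2(5) K]
    show "arr C (q2 \<bullet> f)" "arr C (c \<bullet> q1)" "src (q2 \<bullet> f) = fst Y1" "src (c \<bullet> q1) = fst Y1" "trg (q2 \<bullet> f) = trg (c \<bullet> q1)"
      using a by auto
    fix h assume h: "h \<in> H"
    note g = subgroup.mem_carrier[OF H h]
    note ja = jj_arr[OF H e1(6,7) h] jj_arr[OF H e2(6,7) h]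
    have "(q2 \<bullet> f) \<bullet> jj Y1 j1 h = q2 \<bullet> jj Y2 (j2 \<bullet> c) h"
      using a ja jj_cmp[OF H e1(6) e2(6) e1(7) f(1) h] f(2) by simp
    also have "\<dots> = (q2 \<bullet> jj Y2 j2 h) \<bullet> F h c"
      using a ja g jj_cmp_right[OF H e2(6,7) _ _ h, of c] by simp
    also have "\<dots> = c \<bullet> q1 \<bullet> jj Y1 j1 h"
    proof (cases "h \<in> K")
      case True
      then show ?thesis using q_jj[OF I1 refl True] q_jj[OF I2 refl True] ehD(4)[OF c True] by simp
    next
      case False
      then show ?thesis using e1(10)[OF h False] e2(10)[OF h False] a g ob by simp
    qed
    finally show "(q2 \<bullet> f) \<bullet> jj Y1 j1 h = (c \<bullet> q1) \<bullet> jj Y1 j1 h" using a ja by simp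
  qed
  have "j' \<bullet> a \<in> eh K X Y'" using cmp_eh[OF K S(1,2) YK' S(4), of j'] d'(7) by simp
  then obtain f where f: "f \<in> eh H Y Y'" "f \<bullet> j = j' \<bullet> a" using ind_ext[OF Y(1) refl d'(6)] by metis
  have "j'' \<bullet> b \<in> eh K X' Y''" using cmp_eh[OF K S(2,3) YK'' S(5), of j''] d''(7) by simp
  then obtain g where g: "g \<in> eh H Y' Y''" "g \<bullet> j' = j'' \<bullet> b" using ind_ext[OF Y(2) refl d''(6)] by metis
  note df = ehD(1-3)[OF f(1)] and dg = ehD(1-3)[OF g(1)]
  have qf: "q' \<bullet> f = a \<bullet> q" by (rule q_f[OF Y(1,2) S(4) f])
  have qg: "q'' \<bullet> g = b \<bullet> q'" by (rule q_f[OF Y(2,3) S(5) g])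
  have "ses H Y f Y' g Y''"
  proof (rule ses_I[OF H d(6) d'(6) d''(6) f(1) g(1)])
    show "g \<bullet> f = zer C (fst Y) (fst Y'')"
    proof (rule ind_ext_eq[OF Y(1) refl d''(6)])
      show "g \<bullet> f \<in> eh H Y Y''" by (rule cmp_eh[OF H d(6) d'(6) d''(6) f(1) g(1)])
      show "zer C (fst Y) (fst Y'') \<in> eh H Y Y''" by (rule zer_eh[OF H d(6) d''(6)])
      have "(g \<bullet> f) \<bullet> j = (g \<bullet> j') \<bullet> a" using df dg dj da f(2) by simp
      also have "\<dots> = j'' \<bullet> b \<bullet> a" unfolding g(2) using dj da db by simp
      finally show "(g \<bullet> f) \<bullet> j = zer C (fst Y) (fst Y'') \<bullet> j" using S(6) dj ob by simp
    qed
  next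
    fix W t assume W: "W \<in> Ob (E H)" and t: "t \<in> eh H W Y'" and z: "g \<bullet> t = zer C (fst W) (fst Y'')"
    note WK = res_obj_Ob[OF H K KH W] and dt = ehD(1-3)[OF t] and Wo = E_ObD(1)[OF W H]
    have qt: "q' \<bullet> t \<in> eh K (res_obj K W) X'"
      using cmp_eh[OF K WK YK' S(2), of t q'] eh_mono[OF KH t] d'(8) by simp
    have "b \<bullet> q' \<bullet> t = (q'' \<bullet> g) \<bullet> t" using db dq dt by (intro cmp_reassoc) (auto simp: qg)
    also have "\<dots> = zer C (fst W) (fst X'')" using dq dg dt z ob Wo by simp
    finally obtain w where w: "w \<in> eh K (res_obj K W) X" "a \<bullet> w = q' \<bullet> t"
      using S(7)[OF WK qt] by auto
    then have w1: "w \<in> eh K W X" by simp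
    \<comment> \<open>Kernel half: the factorization is found in C^K and lifted by the right
      adjunction.\<close>
    obtain v where v: "v \<in> eh H W Y" "q \<bullet> v = w" using ind_coext[OF Y(1) refl W w1] .
    note dv = ehD(1-3)[OF v(1)]
    have "f \<bullet> v = t"
    proof (rule ind_coext_eq[OF Y(2) refl W _ t])
      show "f \<bullet> v \<in> eh H W Y'" by (rule cmp_eh[OF H W d(6) d'(6) v(1) f(1)])
      have "q' \<bullet> f \<bullet> v = (a \<bullet> q) \<bullet> v" using dq df dv by (intro cmp_reassoc qf) auto
      then show "q' \<bullet> f \<bullet> v = q' \<bullet> t" using w(2) v(2) da dq dv by simp
    qed
    then show "\<exists>w\<in>eh H W Y. f \<bullet> w = t" using v by blast
  next
    fix W w w' assume W: "W \<in> Ob (E H)" and w: "w \<in> eh H W Y" "w' \<in> eh H W Y" "f \<bullet> w = f \<bullet> w'"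
    note WK = res_obj_Ob[OF H K KH W]
    have qw: "q \<bullet> v \<in> eh K (res_obj K W) X" if "v \<in> eh H W Y" for v
      using cmp_eh[OF K WK YK S(1), of v q] eh_mono[OF KH that] d(8) by simp
    have aqv: "a \<bullet> q \<bullet> v = q' \<bullet> f \<bullet> v" if "v \<in> eh H W Y" for v
    proof -
      have "q' \<bullet> f \<bullet> v = (a \<bullet> q) \<bullet> v" using dq df ehD(1-3)[OF that] by (intro cmp_reassoc qf) auto
      then show ?thesis using da dq ehD(1-3)[OF that] by simp
    qed
    have "q \<bullet> w = q \<bullet> w'"
      by (rule S(8)[OF WK qw[OF w(1)] qw[OF w(2)]]) (simp add: aqv w)
    then show "w = w'" by (rule ind_coext_eq[OF Y(1) refl W w(1,2)])
  next
    fix W t assume W: "W \<in> Ob (E H)" and t: "t \<in> eh H Y' W" and z: "t \<bullet> f = zer C (fst Y) (fst W)"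
    note WK = res_obj_Ob[OF H K KH W] and dt = ehD(1-3)[OF t] and Wo = E_ObD(1)[OF W H]
    have tj: "t \<bullet> j' \<in> eh K X' (res_obj K W)"
      using cmp_eh[OF K S(2) YK' WK, of j' t] eh_mono[OF KH t] d'(7) by simp
    have "(t \<bullet> j') \<bullet> a = t \<bullet> f \<bullet> j" using da dj dt f(2) by simp
    also have "\<dots> = zer C (fst Y) (fst W) \<bullet> j" using dj df dt z by (intro cmp_reassoc) auto
    finally obtain w where w: "w \<in> eh K X'' (res_obj K W)" "w \<bullet> b = t \<bullet> j'"
      using S(9)[OF WK tj] dj Wo by auto
    then have w1: "w \<in> eh K X'' W" by simp
    \<comment> \<open>Cokernel half: the factorization is found in C^K and extended by the left
      adjunction.\<close>
    obtain v where v: "v \<in> eh H Y'' W" "v \<bullet> j'' = w" using ind_ext[OF Y(3) refl W w1] .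
    note dv = ehD(1-3)[OF v(1)]
    have "v \<bullet> g = t"
    proof (rule ind_ext_eq[OF Y(2) refl W _ t])
      show "v \<bullet> g \<in> eh H Y' W" by (rule cmp_eh[OF H d'(6) d''(6) W g(1) v(1)])
      have "(v \<bullet> g) \<bullet> j' = v \<bullet> j'' \<bullet> b" using dv dg dj g(2) by simp
      also have "\<dots> = w \<bullet> b" using dv dj db by (intro cmp_reassoc v) auto
      finally show "(v \<bullet> g) \<bullet> j' = t \<bullet> j'" using w(2) by simp
    qed
    then show "\<exists>w\<in>eh H Y'' W. w \<bullet> g = t" using v by blast
  next
    fix W w w' assume W: "W \<in> Ob (E H)" and w: "w \<in> eh H Y'' W" "w' \<in> eh H Y'' W" "w \<bullet> g = w' \<bullet> g"
    note WK = res_obj_Ob[OF H K KH W]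
    have wj: "v \<bullet> j'' \<in> eh K X'' (res_obj K W)" if "v \<in> eh H Y'' W" for v
      using cmp_eh[OF K S(3) YK'' WK, of j'' v] eh_mono[OF KH that] d''(7) by simp
    have vjb: "(v \<bullet> j'') \<bullet> b = (v \<bullet> g) \<bullet> j'" if "v \<in> eh H Y'' W" for v
      using dj db dg ehD(1-3)[OF that] g(2) by simp
    have "w \<bullet> j'' = w' \<bullet> j''"
      by (rule S(10)[OF WK wj[OF w(1)] wj[OF w(2)]]) (simp only: vjb w)
    then show "w = w'" by (rule ind_ext_eq[OF Y(3) refl W w(1,2)])
  qed
  then show ?thesis by blast
qed

lemma ex_ind:
  assumes "subgroup H G" "subgroup K G" "K \<subseteq> H" "finite H" "X \<in> Ob (E K)"
  shows "\<exists>Y j q. ind H K X Y j q"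
  using ex_is_induced_obj[OF assms] is_induced_obj_ind[OF assms] by blast

text \<open>A test object W of C^K is replaced by an object induced from it. By the two adjunctions,
  morphisms out of W and into W correspond to morphisms of C^H, where exactness is given.\<close>

lemma ses_res:
  assumes H: "subgroup H G" and K: "subgroup K G" and KH: "K \<subseteq> H" and fin: "finite H" and s: "ses H X a X' b X''"
  shows "ses K (res_obj K X) a (res_obj K X') b (res_obj K X'')"
proof -
  note S = ses_D[OF H s]
  note XK = res_obj_Ob[OF H K KH S(1)] res_obj_Ob[OF H K KH S(2)] res_obj_Ob[OF H K KH S(3)]
  note da = ehD(1-3)[OF S(4)] and db = ehD(1-3)[OF S(5)]
  note ob = E_ObD(1)[OF S(1) H] E_ObD(1)[OF S(2) H] E_ObD(1)[OF S(3) H]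
  show ?thesis
  proof (rule ses_I[OF K XK])
    show "a \<in> eh K (res_obj K X) (res_obj K X')" "b \<in> eh K (res_obj K X') (res_obj K X'')"
      using eh_mono[OF KH S(4)] eh_mono[OF KH S(5)] by simp_all
    show "b \<bullet> a = zer C (fst (res_obj K X)) (fst (res_obj K X''))" using S(6) by simp
  next
    fix W t assume W: "W \<in> Ob (E K)" and "t \<in> eh K W (res_obj K X')" and z: "b \<bullet> t = zer C (fst W) (fst (res_obj K X''))"
    then have t: "t \<in> eh K W X'" by simp
    obtain Y j q where Y: "ind H K W Y j q" using ex_ind[OF H K KH fin W] by blast
    note d = indD[OF Y refl]
    note dj = ehD(1-3)[OF d(7)] and Yo = E_ObD(1)[OF d(6) H]
    obtain f where f: "f \<in> eh H Y X'" "f \<bullet> j = t" using ind_ext[OF Y refl S(2) t] .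
    note df = ehD(1-3)[OF f(1)]
    have "b \<bullet> f = zer C (fst Y) (fst X'')"
    proof (rule ind_ext_eq[OF Y refl S(3)])
      show "b \<bullet> f \<in> eh H Y X''" by (rule cmp_eh[OF H d(6) S(2,3) f(1) S(5)])
      show "zer C (fst Y) (fst X'') \<in> eh H Y X''" by (rule zer_eh[OF H d(6) S(3)])
      show "(b \<bullet> f) \<bullet> j = zer C (fst Y) (fst X'') \<bullet> j" using db df dj f(2) z ob by simp
    qed
    then obtain w where w: "w \<in> eh H Y X" "a \<bullet> w = f" using S(7)[OF d(6) f(1)] by blast
    note dw = ehD(1-3)[OF w(1)]
    have "w \<bullet> j \<in> eh K W (res_obj K X)"
      using cmp_eh[OF K W res_obj_Ob[OF H K KH d(6)] XK(1), of j w] d(7) eh_mono[OF KH w(1)] by simp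
    moreover have "a \<bullet> w \<bullet> j = t"
    proof -
      have "a \<bullet> w \<bullet> j = f \<bullet> j" using da dw dj by (intro cmp_reassoc w) auto
      then show ?thesis using f(2) by simp
    qed
    ultimately show "\<exists>w\<in>eh K W (res_obj K X). a \<bullet> w = t" by blast
  next
    fix W w w' assume W: "W \<in> Ob (E K)" and "w \<in> eh K W (res_obj K X)" "w' \<in> eh K W (res_obj K X)" and e: "a \<bullet> w = a \<bullet> w'"
    then have w: "w \<in> eh K W X" "w' \<in> eh K W X" by simp_all
    obtain Y j q where Y: "ind H K W Y j q" using ex_ind[OF H K KH fin W] by blast
    note d = indD[OF Y refl]
    note dj = ehD(1-3)[OF d(7)]
    obtain f where f: "f \<in> eh H Y X" "f \<bullet> j = w" using ind_ext[OF Y refl S(1) w(1)] .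
    obtain f' where f': "f' \<in> eh H Y X" "f' \<bullet> j = w'" using ind_ext[OF Y refl S(1) w(2)] .
    have "a \<bullet> f = a \<bullet> f'"
    proof (rule ind_ext_eq[OF Y refl S(2)])
      show "a \<bullet> f \<in> eh H Y X'" "a \<bullet> f' \<in> eh H Y X'"
        using cmp_eh[OF H d(6) S(1,2) _ S(4)] f f' by blast+
      show "(a \<bullet> f) \<bullet> j = (a \<bullet> f') \<bullet> j"
        using e f(2) f'(2) da dj ehD(1-3)[OF f(1)] ehD(1-3)[OF f'(1)] by simp
    qed
    then have "f = f'" by (rule S(8)[OF d(6) f(1) f'(1)])
    then show "w = w'" using f f' by simp
  next
    fix W t assume W: "W \<in> Ob (E K)" and "t \<in> eh K (res_obj K X') W" and z: "t \<bullet> a = zer C (fst (res_obj K X)) (fst W)"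
    then have t: "t \<in> eh K X' W" by simp
    obtain Y j q where Y: "ind H K W Y j q" using ex_ind[OF H K KH fin W] by blast
    note d = indD[OF Y refl]
    note dq = ehD(1-3)[OF d(8)] and Yo = E_ObD(1)[OF d(6) H]
    obtain f where f: "f \<in> eh H X' Y" "q \<bullet> f = t" using ind_coext[OF Y refl S(2) t] .
    note df = ehD(1-3)[OF f(1)]
    have "f \<bullet> a = zer C (fst X) (fst Y)"
    proof (rule ind_coext_eq[OF Y refl S(1)])
      show "f \<bullet> a \<in> eh H X Y" by (rule cmp_eh[OF H S(1,2) d(6) S(4) f(1)])
      show "zer C (fst X) (fst Y) \<in> eh H X Y" by (rule zer_eh[OF H S(1) d(6)])
      have "q \<bullet> f \<bullet> a = t \<bullet> a" using da df dq by (intro cmp_reassoc f) auto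
      then show "q \<bullet> f \<bullet> a = q \<bullet> zer C (fst X) (fst Y)" using z ob dq by simp
    qed
    then obtain w where w: "w \<in> eh H X'' Y" "w \<bullet> b = f" using S(9)[OF d(6) f(1)] by blast
    note dw = ehD(1-3)[OF w(1)]
    have "q \<bullet> w \<in> eh K (res_obj K X'') W"
      using cmp_eh[OF K XK(3) res_obj_Ob[OF H K KH d(6)] W, of w q] d(8) eh_mono[OF KH w(1)] by simp
    moreover have "(q \<bullet> w) \<bullet> b = t" using db dw dq w(2) f(2) by simp
    ultimately show "\<exists>w\<in>eh K (res_obj K X'') W. w \<bullet> b = t" by blast
  next
    fix W w w' assume W: "W \<in> Ob (E K)" and "w \<in> eh K (res_obj K X'') W" "w' \<in> eh K (res_obj K X'') W" and e: "w \<bullet> b = w' \<bullet> b"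
    then have w: "w \<in> eh K X'' W" "w' \<in> eh K X'' W" by simp_all
    obtain Y j q where Y: "ind H K W Y j q" using ex_ind[OF H K KH fin W] by blast
    note d = indD[OF Y refl]
    note dq = ehD(1-3)[OF d(8)]
    obtain f where f: "f \<in> eh H X'' Y" "q \<bullet> f = w" using ind_coext[OF Y refl S(3) w(1)] .
    obtain f' where f': "f' \<in> eh H X'' Y" "q \<bullet> f' = w'" using ind_coext[OF Y refl S(3) w(2)] .
    note df = ehD(1-3)[OF f(1)] ehD(1-3)[OF f'(1)]
    have "f \<bullet> b = f' \<bullet> b"
    proof (rule ind_coext_eq[OF Y refl S(2)])
      show "f \<bullet> b \<in> eh H X' Y" "f' \<bullet> b \<in> eh H X' Y"
        using cmp_eh[OF H S(2,3) d(6) S(5)] f f' by blast+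
      have "q \<bullet> f \<bullet> b = w \<bullet> b" using db dq df by (intro cmp_reassoc f) auto
      moreover have "q \<bullet> f' \<bullet> b = w' \<bullet> b" using db dq df by (intro cmp_reassoc f') auto
      ultimately show "q \<bullet> f \<bullet> b = q \<bullet> f' \<bullet> b" using e by simp
    qed
    then have "f = f'" by (rule S(10)[OF d(6) f(1) f'(1)])
    then show "w = w'" using f f' by simp
  qed
qed

text \<open>Restricting to the trivial subgroup shows that forgetting the action is exact.\<close>

lemma ses_forget:
  assumes H: "subgroup H G" and fin: "finite H" and s: "ses H X a X' b X''"
  shows "ker_arr C b a" "cok_arr C a b"
proof -
  let ?I = "{\<one>\<^bsub>G\<^esub>}"
  have I: "subgroup ?I G" by (rule G.triv_subgroup)
  have IH: "?I \<subseteq> H" using subgroup.one_closed[OF H] by simp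
  note S0 = ses_D[OF H s]
  note S = ses_D[OF I ses_res[OF H I IH fin s], unfolded fst_res_obj]
  note da = ehD(1-3)[OF S0(4)] and db = ehD(1-3)[OF S0(5)]
  \<comment> \<open>Every object of C becomes a test object for the trivial subgroup, and every
    morphism of C is then equivariant.\<close>
  define triv where "triv M = (M, \<lambda>h\<in>?I. Idn C M)" for M
  have fst_triv [simp]: "fst (triv M) = M" for M by (simp add: triv_def)
  have At: "A (triv M) \<one>\<^bsub>G\<^esub> = idn C M" if "M \<in> Ob C" for M
    using that by (simp add: triv_def ac_def idn_def)
  have triv: "triv M \<in> Ob (E ?I)" if M: "M \<in> Ob C" for M
    using M At[OF M] by (intro E_ObI[OF I]) (auto simp: triv_def)
  have A1: "A X \<one>\<^bsub>G\<^esub> = idn C (fst X)" "A X' \<one>\<^bsub>G\<^esub> = idn C (fst X')" "A X'' \<one>\<^bsub>G\<^esub> = idn C (fst X'')"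
    using E_ObD(5)[OF S0(1) H] E_ObD(5)[OF S0(2) H] E_ObD(5)[OF S0(3) H] by auto
  have eh1: "t \<in> eh ?I W Z \<longleftrightarrow> arr C t \<and> src t = fst W \<and> trg t = fst Z"
    if "A W \<one>\<^bsub>G\<^esub> = idn C (fst W)" "A Z \<one>\<^bsub>G\<^esub> = idn C (fst Z)" for t W Z
    using that by (auto simp: eh_def)
  have to: "t \<in> eh ?I (triv M) (res_obj ?I Z) \<longleftrightarrow> arr C t \<and> src t = M \<and> trg t = fst Z"
    and from': "t \<in> eh ?I (res_obj ?I Z) (triv M) \<longleftrightarrow> arr C t \<and> src t = fst Z \<and> trg t = M"
    if "M \<in> Ob C" "A Z \<one>\<^bsub>G\<^esub> = idn C (fst Z)" for t M Z
    using eh1[of "triv M" Z t] eh1[of Z "triv M" t] At[OF that(1)] that by auto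
  show "ker_arr C b a"
  proof (rule ker_arrI)
    show "b \<bullet> a = zer C (src a) (trg b)" using S0(6) da db by simp
    fix t assume t: "arr C t" "trg t = src b" "b \<bullet> t = zer C (src t) (trg b)"
    then have M: "src t \<in> Ob C" by (simp add: arr_src)
    show "\<exists>w. arr C w \<and> src w = src t \<and> trg w = src a \<and> a \<bullet> w = t"
      using S(7)[OF triv[OF M], of t] to[OF M A1(1)] to[OF M A1(2), of t] t da db by auto
  next
    fix w w' assume w: "arr C w" "arr C w'" "src w = src w'" "trg w = src a" "trg w' = src a" "a \<bullet> w = a \<bullet> w'"
    then have M: "src w \<in> Ob C" by (simp add: arr_src)
    have "w \<in> eh ?I (triv (src w)) (res_obj ?I X)" "w' \<in> eh ?I (triv (src w)) (res_obj ?I X)"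
      unfolding to[OF M A1(1)] using w da by simp_all
    then show "w = w'" using S(8)[OF triv[OF M] _ _ w(6)] by blast
  qed (use da db in auto)
  show "cok_arr C a b"
  proof (rule cok_arrI)
    show "b \<bullet> a = zer C (src a) (trg b)" using S0(6) da db by simp
    fix t assume t: "arr C t" "src t = trg a" "t \<bullet> a = zer C (src a) (trg t)"
    then have M: "trg t \<in> Ob C" by (simp add: arr_trg)
    show "\<exists>w. arr C w \<and> src w = trg b \<and> trg w = trg t \<and> w \<bullet> b = t"
      using S(9)[OF triv[OF M], of t] from'[OF M A1(3)] from'[OF M A1(2), of t] t da db by auto
  next
    fix w w' assume w: "arr C w" "arr C w'" "trg w = trg w'" "src w = trg b" "src w' = trg b" "w \<bullet> b = w' \<bullet> b"
    then have M: "trg w \<in> Ob C" by (simp add: arr_trg)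
    have "w \<in> eh ?I (res_obj ?I X'') (triv (trg w))" "w' \<in> eh ?I (res_obj ?I X'') (triv (trg w))"
      unfolding from'[OF M A1(3)] using w db by simp_all
    then show "w = w'" using S(10)[OF triv[OF M] _ _ w(6)] by blast
  qed (use da db in auto)
qed

text \<open>Exactness passes to C by \<open>ses_forget\<close>, where T^x is exact, and returns by
  \<open>sesI\<close>. The two tensor products below are treated in the same way.\<close>

lemma ses_cj:
  assumes H: "subgroup H G" and fin: "finite H" and x: "x \<in> carrier G" and s: "ses H X a X' b X''"
  shows "ses (conj_set G x H) (cj H x X) (F x a) (cj H x X') (F x b) (cj H x X'')"
proof -
  note S = ses_D[OF H s]
  note k = ses_forget[OF H fin s]
  note e = tensor_autoequivalence.fm_ses[OF tensor_autoequivalence[OF x] ehD(1)[OF S(4)] ehD(1)[OF S(5)] k]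
  show ?thesis
    by (rule sesI[OF conj_set_subgroup[OF H x] cj_Ob[OF H x S(1)] cj_Ob[OF H x S(2)] cj_Ob[OF H x S(3)]
        F_cj_eh[OF H x S(1,2,4)] F_cj_eh[OF H x S(2,3,5)] e])
qed

lemma ses_eT_left:
  assumes H: "subgroup H G" and fin: "finite H" and B: "B \<in> Ob (E H)" and s: "ses H X a X' b X''"
  shows "ses H (eT H B X) (idn C (fst B) \<boxtimes> a) (eT H B X') (idn C (fst B) \<boxtimes> b) (eT H B X'')"
proof -
  note S = ses_D[OF H s]
  note k = ses_forget[OF H fin s] and Bo = E_ObD(1)[OF B H]
  note i = idn_eh[OF B H]
  show ?thesis
    by (rule sesI[OF H eT_Ob[OF H B S(1)] eT_Ob[OF H B S(2)] eT_Ob[OF H B S(3)]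
        tn_eh[OF H B B S(1,2) i S(4)] tn_eh[OF H B B S(2,3) i S(5)]
        ker_arr_tn_left[OF Bo ehD(1)[OF S(5)] k(1)] cok_arr_tn_left[OF Bo ehD(1)[OF S(4)] k(2)]])
qed

lemma ses_eT_right:
  assumes H: "subgroup H G" and fin: "finite H" and B: "B \<in> Ob (E H)" and s: "ses H X a X' b X''"
  shows "ses H (eT H X B) (a \<boxtimes> idn C (fst B)) (eT H X' B) (b \<boxtimes> idn C (fst B)) (eT H X'' B)"
proof -
  note S = ses_D[OF H s]
  note k = ses_forget[OF H fin s] and Bo = E_ObD(1)[OF B H]
  note i = idn_eh[OF B H]
  show ?thesis
    by (rule sesI[OF H eT_Ob[OF H S(1) B] eT_Ob[OF H S(2) B] eT_Ob[OF H S(3) B]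
        tn_eh[OF H S(1,2) B B S(4) i] tn_eh[OF H S(2,3) B B S(5) i]
        ker_arr_tn_right[OF Bo ehD(1)[OF S(5)] k(1)] cok_arr_tn_right[OF Bo ehD(1)[OF S(4)] k(2)]])
qed

end

context tensor_action
begin

subsection \<open>The Mackey formula\<close>

lemma double_coset_repsE:
  assumes H: "subgroup H G" and K: "subgroup K G" and D: "double_coset_reps G H K D" and g: "g \<in> carrier G"
  obtains x h u where "x \<in> D" "h \<in> H" "u \<in> K" "g = h \<otimes>\<^bsub>G\<^esub> x \<otimes>\<^bsub>G\<^esub> u"
proof -
  have "\<exists>!x. x \<in> D \<and> g \<in> (H #>\<^bsub>G\<^esub> x) <#>\<^bsub>G\<^esub> K" using D g by (simp add: double_coset_reps_def)
  then obtain x where "x \<in> D" "g \<in> (H #>\<^bsub>G\<^esub> x) <#>\<^bsub>G\<^esub> K" by blast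
  then show thesis using that by (auto simp: set_mult_def r_coset_def)
qed

text \<open>The condition on y^-1 h x puts x into the double coset of y.\<close>

lemma double_coset_reps_eq:
  assumes H: "subgroup H G" and K: "subgroup K G" and D: "double_coset_reps G H K D"
    and x: "x \<in> D" and y: "y \<in> D" and h: "h \<in> H" and k: "inv\<^bsub>G\<^esub> y \<otimes>\<^bsub>G\<^esub> (h \<otimes>\<^bsub>G\<^esub> x) \<in> K"
  shows "x = y"
proof -
  have c: "x \<in> carrier G" "y \<in> carrier G" using D x y by (auto simp: double_coset_reps_def)
  have hc: "h \<in> carrier G" using H h by (rule subgroup.mem_carrier)
  have "\<exists>!z. z \<in> D \<and> x \<in> (H #>\<^bsub>G\<^esub> z) <#>\<^bsub>G\<^esub> K" using D c by (simp add: double_coset_reps_def)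
  moreover have "x \<in> (H #>\<^bsub>G\<^esub> x) <#>\<^bsub>G\<^esub> K"
  proof -
    have "x = \<one>\<^bsub>G\<^esub> \<otimes>\<^bsub>G\<^esub> x \<otimes>\<^bsub>G\<^esub> \<one>\<^bsub>G\<^esub>" using c by simp
    then show ?thesis
      using subgroup.one_closed[OF H] subgroup.one_closed[OF K] by (fastforce simp: set_mult_def r_coset_def)
  qed
  moreover have "x \<in> (H #>\<^bsub>G\<^esub> y) <#>\<^bsub>G\<^esub> K"
  proof -
    have "x = inv\<^bsub>G\<^esub> h \<otimes>\<^bsub>G\<^esub> y \<otimes>\<^bsub>G\<^esub> (inv\<^bsub>G\<^esub> y \<otimes>\<^bsub>G\<^esub> (h \<otimes>\<^bsub>G\<^esub> x))"
    proof -
      have "y \<otimes>\<^bsub>G\<^esub> (inv\<^bsub>G\<^esub> y \<otimes>\<^bsub>G\<^esub> (h \<otimes>\<^bsub>G\<^esub> x)) = h \<otimes>\<^bsub>G\<^esub> x" using c hc by (simp flip: G.m_assoc)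
      then have "inv\<^bsub>G\<^esub> h \<otimes>\<^bsub>G\<^esub> y \<otimes>\<^bsub>G\<^esub> (inv\<^bsub>G\<^esub> y \<otimes>\<^bsub>G\<^esub> (h \<otimes>\<^bsub>G\<^esub> x)) = inv\<^bsub>G\<^esub> h \<otimes>\<^bsub>G\<^esub> (h \<otimes>\<^bsub>G\<^esub> x)"
        using c hc by (simp add: G.m_assoc)
      then show ?thesis using c hc by (simp flip: G.m_assoc)
    qed
    moreover have "inv\<^bsub>G\<^esub> h \<in> H" using H h by (rule subgroup.m_inv_closed)
    ultimately show ?thesis using k by (auto simp: set_mult_def r_coset_def)
  qed
  ultimately show ?thesis using x y by blast
qed

text \<open>The summand of the double coset of \<open>x\<close> is cut out by the translates \<open>jj Y j x\<close> and
  \<open>qq Y q x\<close> of the inclusion and the projection.\<close>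

lemma mackey_class:
  assumes R: "cring R" and fin: "finite (carrier G)" and H: "subgroup H G" and K: "subgroup K G"
    and Y: "ind (carrier G) K X Y j q" and D: "double_coset_reps G H K D"
    and Z: "\<And>x. x \<in> D \<Longrightarrow> ind H (conj_set G x K \<inter> H) (res_obj (conj_set G x K \<inter> H) (cj K x X)) (Z x) (jz x) (qz x)"
  shows "K0_class R (E H) (res_obj H Y) = (\<Oplus>\<^bsub>K0 R (E H)\<^esub> x \<in> D. K0_class R (E H) (Z x))"
proof -
  let ?G = "carrier G"
  let ?L = "\<lambda>x. conj_set G x K \<inter> H" and ?W = "\<lambda>x. res_obj (conj_set G x K \<inter> H) (cj K x X)"
  define V where "V = fst X"
  note dY = indD[OF Y V_def]
  note GG = dY(1)
  have Dc: "x \<in> carrier G" if "x \<in> D" for x using that D by (auto simp: double_coset_reps_def)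
  have finD: "finite D" using D fin by (auto simp: double_coset_reps_def intro: finite_subset)
  have Hc: "h \<in> carrier G" if "h \<in> H" for h using subgroup.mem_carrier[OF H that] .
  have HG: "H \<subseteq> carrier G" using Hc by auto
  have YH: "res_obj H Y \<in> Ob (E H)" by (rule res_obj_Ob[OF GG H HG dY(6)])
  have Vo: "V \<in> Ob C" and Yo: "fst Y \<in> Ob C" and fX: "fst X = V" using ind_ob[OF Y V_def] by auto
  note ja = ind_jj[OF Y V_def] and qa = ind_qq[OF Y V_def]
  have L: "subgroup (?L x) G" if "x \<in> D" for x
    using G.subgroups_Inter_pair[OF conj_set_subgroup[OF K Dc[OF that]] H] .
  \<comment> \<open>The action of l on the restricted conjugate, with the element u = x^-1 l x of K
    made explicit.\<close>
  have LE: "\<exists>u \<in> K. l \<otimes>\<^bsub>G\<^esub> x = x \<otimes>\<^bsub>G\<^esub> u \<and>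
      A (?W x) l = F x (A X u) \<bullet> inv_arr C (gam x u V) \<bullet> gam l x V" if l: "l \<in> ?L x" and x: "x \<in> D" for l x
  proof -
    obtain u where u: "u \<in> K" "l \<otimes>\<^bsub>G\<^esub> x = x \<otimes>\<^bsub>G\<^esub> u" "l \<in> carrier G"
      using conj_setE[OF K Dc[OF x], of l] l by blast
    have "A (?W x) l = A (cj K x X) l" using l by simp
    also have "\<dots> = F x (A X u) \<bullet> inv_arr C (gam x u V) \<bullet> gam l x V"
      unfolding A_cj[OF K Dc[OF x] dY(5) u(1,3,2)] ph_def
      using Dc[OF x] u Vo fX E_ObD(3)[OF dY(5) K u(1)] subgroup.mem_carrier[OF K u(1)] by simp
    finally show ?thesis using u by blast
  qed
  \<comment> \<open>The translate at x is equivariant for the intersection of H with the conjugate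
    of K. Hence it extends to an H-morphism from \<open>Z x\<close> by the left adjunction, and its
    counterpart \<open>qq Y q x\<close> lifts by the right one.\<close>
  have jx: "jj Y j x \<in> eh (?L x) (?W x) Y" if x: "x \<in> D" for x
  proof (rule ehI)
    note xc = Dc[OF x]
    show "arr C (jj Y j x)" "src (jj Y j x) = fst (?W x)" "trg (jj Y j x) = fst Y"
      using ja[OF xc] fX by auto
    fix l assume l: "l \<in> ?L x"
    then have lc: "l \<in> carrier G" using Hc by auto
    obtain u where u: "u \<in> K" "l \<otimes>\<^bsub>G\<^esub> x = x \<otimes>\<^bsub>G\<^esub> u" "A (?W x) l = F x (A X u) \<bullet> inv_arr C (gam x u V) \<bullet> gam l x V"
      using LE[OF l x] by blast
    note uc = subgroup.mem_carrier[OF K u(1)] and iA = E_ObD(3)[OF dY(5) K u(1)]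
    have xu: "x \<otimes>\<^bsub>G\<^esub> u \<in> carrier G" using xc uc by simp
    have "jj Y j x \<bullet> A (?W x) l = (jj Y j x \<bullet> F x (A X u) \<bullet> inv_arr C (gam x u V)) \<bullet> gam l x V"
      unfolding u(3) using ja[OF xc] xc uc lc iA Vo fX u(2) by simp
    also have "\<dots> = jj Y j (l \<otimes>\<^bsub>G\<^esub> x) \<bullet> gam l x V"
      unfolding jj_act_inv[OF Y V_def xc u(1)] u(2) ..
    also have "\<dots> = A Y l \<bullet> F l (jj Y j x)"
      using A_jj[OF GG dY(6,7) lc xc] fX by simp
    finally show "jj Y j x \<bullet> A (?W x) l = A Y l \<bullet> F l (jj Y j x)" .
  qed
  have qx: "qq Y q x \<in> eh (?L x) Y (?W x)" if x: "x \<in> D" for x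
  proof (rule ehI)
    note xc = Dc[OF x]
    show "arr C (qq Y q x)" "src (qq Y q x) = fst Y" "trg (qq Y q x) = fst (?W x)"
      using qa[OF xc] fX by auto
    fix l assume l: "l \<in> ?L x"
    then have lc: "l \<in> carrier G" using Hc by auto
    obtain u where u: "u \<in> K" "l \<otimes>\<^bsub>G\<^esub> x = x \<otimes>\<^bsub>G\<^esub> u" "A (?W x) l = F x (A X u) \<bullet> inv_arr C (gam x u V) \<bullet> gam l x V"
      using LE[OF l x] by blast
    note uc = subgroup.mem_carrier[OF K u(1)] and iA = E_ObD(3)[OF dY(5) K u(1)]
    have xu: "x \<otimes>\<^bsub>G\<^esub> u \<in> carrier G" using xc uc by simp
    have "A (?W x) l \<bullet> F l (qq Y q x) = F x (A X u) \<bullet> inv_arr C (gam x u V) \<bullet> gam l x V \<bullet> F l (qq Y q x)"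
      unfolding u(3) using qa[OF xc] xc uc lc iA Vo fX u(2) by simp
    also have "gam l x V \<bullet> F l (qq Y q x) = qq Y q (x \<otimes>\<^bsub>G\<^esub> u) \<bullet> A Y l"
      using qq_A[OF GG dY(6,8) lc xc] fX u(2) by simp
    also have "F x (A X u) \<bullet> inv_arr C (gam x u V) \<bullet> qq Y q (x \<otimes>\<^bsub>G\<^esub> u) \<bullet> A Y l
        = (F x (A X u) \<bullet> inv_arr C (gam x u V) \<bullet> qq Y q (x \<otimes>\<^bsub>G\<^esub> u)) \<bullet> A Y l"
      using qa[OF xu] xc uc lc iA Vo fX E_ObD(3)[OF dY(6) GG lc] by simp
    also have "\<dots> = qq Y q x \<bullet> A Y l"
      using qq_act[OF GG K dY(3,5,6,8) xc u(1)] fX by simp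
    finally show "qq Y q x \<bullet> A Y l = A (?W x) l \<bullet> F l (qq Y q x)" by simp
  qed
  have "\<exists>i \<in> eh H (Z x) (res_obj H Y). i \<bullet> jz x = jj Y j x" if x: "x \<in> D" for x
  proof -
    have t: "jj Y j x \<in> eh (?L x) (?W x) (res_obj H Y)" using jx[OF x] by (simp only: eh_res_obj'(2)[OF Int_lower2])
    show ?thesis using ind_ext[OF Z[OF x] refl YH t] by blast
  qed
  then obtain i where i: "\<And>x. x \<in> D \<Longrightarrow> i x \<in> eh H (Z x) (res_obj H Y)" "\<And>x. x \<in> D \<Longrightarrow> i x \<bullet> jz x = jj Y j x"
    by metis
  have "\<exists>p \<in> eh H (res_obj H Y) (Z x). qz x \<bullet> p = qq Y q x" if x: "x \<in> D" for x
  proof -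
    have t: "qq Y q x \<in> eh (?L x) (res_obj H Y) (?W x)" using qx[OF x] by (simp only: eh_res_obj'(1)[OF Int_lower2])
    show ?thesis using ind_coext[OF Z[OF x] refl YH t] by blast
  qed
  then obtain p where p: "\<And>x. x \<in> D \<Longrightarrow> p x \<in> eh H (res_obj H Y) (Z x)" "\<And>x. x \<in> D \<Longrightarrow> qz x \<bullet> p x = qq Y q x"
    by metis
  note dZ = indD[OF Z refl]
  have ia: "arr C (i x)" "src (i x) = fst (Z x)" "trg (i x) = fst Y"
    and pa: "arr C (p x)" "src (p x) = fst Y" "trg (p x) = fst (Z x)"
    and jza: "arr C (jz x)" "src (jz x) = FObj (T x) V" "trg (jz x) = fst (Z x)"
    and qza: "arr C (qz x)" "src (qz x) = fst (Z x)" "trg (qz x) = FObj (T x) V"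
    and Zo: "fst (Z x) \<in> Ob C" if x: "x \<in> D" for x
    using ehD(1-3)[OF i(1)[OF x]] ehD(1-3)[OF p(1)[OF x]] ehD(1-3)[OF dZ(7)[OF x]] ehD(1-3)[OF dZ(8)[OF x]]
      E_ObD(1)[OF dZ(6)[OF x] H] fX by auto
  note jza' = jj_arr[OF H dZ(6) dZ(7)]
  \<comment> \<open>Under \<open>i x\<close> the translates of \<open>jz x\<close> by h in H become
    the translates of j at the elements h x.\<close>
  have ijz: "i x \<bullet> jj (Z x) (jz x) h = jj Y j (h \<otimes>\<^bsub>G\<^esub> x) \<bullet> gam h x V" if x: "x \<in> D" and h: "h \<in> H" for x h
  proof -
    have "i x \<bullet> jj (Z x) (jz x) h = jj (res_obj H Y) (jj Y j x) h"
      using jj_cmp[OF H dZ(6)[OF x] YH dZ(7)[OF x] i(1)[OF x] h] i(2)[OF x] by simp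
    also have "\<dots> = A Y h \<bullet> F h (jj Y j x)" using h by (simp add: jj_def)
    also have "\<dots> = jj Y j (h \<otimes>\<^bsub>G\<^esub> x) \<bullet> gam h x V"
      using A_jj[OF GG dY(6,7) Hc[OF h] Dc[OF x]] fX by simp
    finally show ?thesis .
  qed
  \<comment> \<open>Compared after \<open>qz y\<close> and on the translates of \<open>jz x\<close>.
    The entry at h depends on whether y^-1 h x lies in K: this forces x = y, and for x = y it says
    that h lies in the conjugate of K.\<close>
  have orth: "p y \<bullet> i x = (if x = y then idn C (fst (Z x)) else zer C (fst (Z x)) (fst (Z y)))"
    if x: "x \<in> D" and y: "y \<in> D" for x y
  proof -
    note xc = Dc[OF x] and yc = Dc[OF y]
    have pi: "p y \<bullet> i x \<in> eh H (Z x) (Z y)"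
      by (rule cmp_eh[OF H dZ(6)[OF x] YH dZ(6)[OF y] i(1)[OF x] p(1)[OF y]])
    have qpi: "qz y \<bullet> p y \<bullet> i x = qq Y q y \<bullet> i x"
      using qza[OF y] pa[OF y] ia[OF x] by (intro cmp_reassoc p(2) y) auto
    have qi: "(qq Y q y \<bullet> i x) \<bullet> jj (Z x) (jz x) h = (qq Y q y \<bullet> jj Y j (h \<otimes>\<^bsub>G\<^esub> x)) \<bullet> gam h x V"
      if h: "h \<in> H" for h
      using ijz[OF x h] qa[OF yc] ia[OF x] jza'[OF x x h] ja[of "h \<otimes>\<^bsub>G\<^esub> x"] Hc[OF h] xc Vo fX by simp
    show ?thesis
    proof (cases "x = y")
      case True
      \<comment> \<open>Tested on the translates of \<open>jz x\<close>: for h in the intersection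
        subgroup both sides give its action on T^x X, for other h in H both vanish.\<close>
      have "qq Y q x \<bullet> i x = qz x"
      proof (rule dZ(11)[OF x])
        fix h assume h: "h \<in> H"
        note hc = Hc[OF h]
        show "(qq Y q x \<bullet> i x) \<bullet> jj (Z x) (jz x) h = qz x \<bullet> jj (Z x) (jz x) h"
        proof (cases "h \<in> ?L x")
          case hL: True
          obtain u where u: "u \<in> K" "h \<otimes>\<^bsub>G\<^esub> x = x \<otimes>\<^bsub>G\<^esub> u" "A (?W x) h = F x (A X u) \<bullet> inv_arr C (gam x u V) \<bullet> gam h x V"
            using LE[OF hL x] by blast
          show ?thesis
            unfolding qi[OF h, unfolded True[symmetric]] q_jj[OF Z[OF x] refl hL] u(2,3) qq_jj_in[OF Y V_def xc u(1)]
            using xc hc Vo fX u(2) E_ObD(3)[OF dY(5) K u(1)] subgroup.mem_carrier[OF K u(1)] by simp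
        next
          case hL: False
          have "inv\<^bsub>G\<^esub> x \<otimes>\<^bsub>G\<^esub> (h \<otimes>\<^bsub>G\<^esub> x) \<notin> K"
          proof
            assume k: "inv\<^bsub>G\<^esub> x \<otimes>\<^bsub>G\<^esub> (h \<otimes>\<^bsub>G\<^esub> x) \<in> K"
            have "h \<otimes>\<^bsub>G\<^esub> x = x \<otimes>\<^bsub>G\<^esub> (inv\<^bsub>G\<^esub> x \<otimes>\<^bsub>G\<^esub> (h \<otimes>\<^bsub>G\<^esub> x))" using xc hc by (simp flip: G.m_assoc)
            then have "h \<in> conj_set G x K" using conj_setI[OF K xc k hc] by simp
            then show False using hL h by simp
          qed
          then have "qq Y q x \<bullet> jj Y j (h \<otimes>\<^bsub>G\<^esub> x) = zer C (FObj (T (h \<otimes>\<^bsub>G\<^esub> x)) V) (FObj (T x) V)"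
            using xc hc by (intro qq_jj_out[OF Y V_def]) auto
          then show ?thesis
            unfolding qi[OF h, unfolded True[symmetric]] dZ(10)[OF x h hL] using xc hc Vo fX by simp
        qed
      qed (use qa[OF xc] ia[OF x] qza[OF x] in auto)
      then have "qz x \<bullet> p x \<bullet> i x = qz x \<bullet> idn C (fst (Z x))"
        using qpi True qza[OF x] by simp
      then have "p x \<bullet> i x = idn C (fst (Z x))"
        using ind_coext_eq[OF Z[OF x] refl dZ(6)[OF x]] pi True idn_eh[OF dZ(6)[OF x] H] by blast
      then show ?thesis using True by simp
    next
      case False
      have "qq Y q y \<bullet> i x = zer C (fst (Z x)) (FObj (T y) V)"
      proof (rule dZ(11)[OF x])
        fix h assume h: "h \<in> H"
        note hc = Hc[OF h]
        have "inv\<^bsub>G\<^esub> y \<otimes>\<^bsub>G\<^esub> (h \<otimes>\<^bsub>G\<^esub> x) \<notin> K"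
          using double_coset_reps_eq[OF H K D x y h] False by blast
        then have "qq Y q y \<bullet> jj Y j (h \<otimes>\<^bsub>G\<^esub> x) = zer C (FObj (T (h \<otimes>\<^bsub>G\<^esub> x)) V) (FObj (T y) V)"
          using xc yc hc by (intro qq_jj_out[OF Y V_def]) auto
        then show "(qq Y q y \<bullet> i x) \<bullet> jj (Z x) (jz x) h = zer C (fst (Z x)) (FObj (T y) V) \<bullet> jj (Z x) (jz x) h"
          unfolding qi[OF h] using xc yc hc Vo fX jza'[OF x x h] by simp
      qed (use qa[OF yc] ia[OF x] Zo[OF x] Vo yc in auto)
      then have "qz y \<bullet> p y \<bullet> i x = qz y \<bullet> zer C (fst (Z x)) (fst (Z y))"
        using qpi qza[OF y] Zo[OF x] by simp
      then have "p y \<bullet> i x = zer C (fst (Z x)) (fst (Z y))"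
        using ind_coext_eq[OF Z[OF y] refl dZ(6)[OF x]] pi zer_eh[OF H dZ(6)[OF x] dZ(6)[OF y]] by blast
      then show ?thesis using False by simp
    qed
  qed
  have Fun: "(\<lambda>x. i x \<bullet> p x) \<in> D \<rightarrow> hm C (fst Y) (fst Y)" using ia pa by auto
  let ?s = "sm C (fst Y) (fst Y) D (\<lambda>x. i x \<bullet> p x)"
  have sa: "arr C ?s" using Fun Yo by simp
  have si: "?s \<bullet> i x = i x" if x: "x \<in> D" for x
  proof -
    have "?s \<bullet> i x = sm C (src (i x)) (fst Y) D (\<lambda>y. (i y \<bullet> p y) \<bullet> i x)"
      using Fun ia[OF x] Yo finD by (intro sm_cmp) auto
    also have "\<dots> = (i x \<bullet> p x) \<bullet> i x"
    proof (rule sm_single)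
      fix y assume y: "y \<in> D" "y \<noteq> x"
      show "(i y \<bullet> p y) \<bullet> i x = zer C (src (i x)) (fst Y)"
        using orth[OF x y(1)] y ia[OF x] ia[OF y(1)] pa[OF y(1)] Zo[OF x] by simp
    qed (use Fun ia[OF x] Zo[OF x] Yo finD x in \<open>auto simp: Pi_iff arr_src\<close>)
    also have "\<dots> = i x" using orth[OF x x] ia[OF x] pa[OF x] by simp
    finally show ?thesis .
  qed
  \<comment> \<open>Every g is of the form h x u, so the translate of j at g factors through
    \<open>i x\<close>, which the sum fixes.\<close>
  have id: "?s = idn C (fst Y)"
  proof (rule dY(11))
    fix g assume g: "g \<in> carrier G"
    obtain x h u where x: "x \<in> D" "h \<in> H" "u \<in> K" "g = h \<otimes>\<^bsub>G\<^esub> x \<otimes>\<^bsub>G\<^esub> u"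
      using double_coset_repsE[OF H K D g] .
    note xc = Dc[OF x(1)] and hc = Hc[OF x(2)] and uc = subgroup.mem_carrier[OF K x(3)]
    note iA = E_ObD(3)[OF dY(5) K x(3)]
    have hx: "h \<otimes>\<^bsub>G\<^esub> x \<in> carrier G" using hc xc by simp
    have "jj Y j (h \<otimes>\<^bsub>G\<^esub> x) = (i x \<bullet> jj (Z x) (jz x) h) \<bullet> inv_arr C (gam h x V)"
      unfolding ijz[OF x(1,2)] using ja[OF hx] hc xc Vo by simp
    then have j1: "jj Y j (h \<otimes>\<^bsub>G\<^esub> x) = i x \<bullet> jj (Z x) (jz x) h \<bullet> inv_arr C (gam h x V)"
      using ia[OF x(1)] jza'[OF x(1) x(1,2)] hc xc Vo fX by simp
    have j2: "jj Y j g = jj Y j (h \<otimes>\<^bsub>G\<^esub> x) \<bullet> F (h \<otimes>\<^bsub>G\<^esub> x) (A X u) \<bullet> inv_arr C (gam (h \<otimes>\<^bsub>G\<^esub> x) u V)"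
      using jj_act_inv[OF Y V_def hx x(3)] x(4) by simp
    have s1: "?s \<bullet> jj Y j (h \<otimes>\<^bsub>G\<^esub> x) = jj Y j (h \<otimes>\<^bsub>G\<^esub> x)"
    proof -
      have "?s \<bullet> jj Y j (h \<otimes>\<^bsub>G\<^esub> x) = i x \<bullet> jj (Z x) (jz x) h \<bullet> inv_arr C (gam h x V)"
        unfolding j1 using sa ia[OF x(1)] jza'[OF x(1) x(1,2)] hc xc Vo fX by (intro cmp_reassoc si x) auto
      then show ?thesis using j1 by simp
    qed
    have "?s \<bullet> jj Y j g = jj Y j (h \<otimes>\<^bsub>G\<^esub> x) \<bullet> F (h \<otimes>\<^bsub>G\<^esub> x) (A X u) \<bullet> inv_arr C (gam (h \<otimes>\<^bsub>G\<^esub> x) u V)"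
      unfolding j2 using sa ja[OF hx] hx uc Vo iA fX by (intro cmp_reassoc s1) auto
    then show "?s \<bullet> jj Y j g = idn C (fst Y) \<bullet> jj Y j g" using j2 ja[OF g] by simp
  qed (use sa Yo in auto)
  show ?thesis
    by (rule E_class_dsum[OF R H finD YH dZ(6) i(1) p(1) orth]) (use id in auto)
qed

end

section \<open>The Green functor\<close>

lemma mod_hom_plus:
  assumes "module R N" "f \<in> mod_hom R M N" "g \<in> mod_hom R M N"
  shows "(\<lambda>x. f x \<oplus>\<^bsub>N\<^esub> g x) \<in> mod_hom R M N"
proof -
  interpret N: module R N by fact
  note c = mod_hom_closed[OF assms(2)] mod_hom_closed[OF assms(3)]
  show ?thesis
    by (rule mod_homI)
      (simp_all add: c mod_hom_add[OF assms(2)] mod_hom_add[OF assms(3)] mod_hom_smult[OF assms(2)]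
        mod_hom_smult[OF assms(3)] N.smult_r_distr N.a_ac)
qed

lemma mod_hom_scale:
  assumes "module R N" "f \<in> mod_hom R M N" "r \<in> carrier R"
  shows "(\<lambda>x. r \<odot>\<^bsub>N\<^esub> f x) \<in> mod_hom R M N"
proof -
  interpret N: module R N by fact
  note c = mod_hom_closed[OF assms(2)]
  show ?thesis
    by (rule mod_homI)
      (simp_all add: assms(3) c mod_hom_add[OF assms(2)] mod_hom_smult[OF assms(2)] N.smult_r_distr
        N.smult_assoc1[symmetric] N.R.m_comm)
qed

lemma mod_hom_sum:
  assumes "module R N" "finite D" "\<And>x. x \<in> D \<Longrightarrow> f x \<in> mod_hom R M N"
  shows "(\<lambda>v. \<Oplus>\<^bsub>N\<^esub> x \<in> D. f x v) \<in> mod_hom R M N"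
proof -
  interpret N: module R N by fact
  note c = mod_hom_closed[OF assms(3)]
  show ?thesis
  proof (rule mod_homI)
    fix v assume v: "v \<in> carrier M"
    show "(\<Oplus>\<^bsub>N\<^esub> x \<in> D. f x v) \<in> carrier N" using c v by (intro N.finsum_closed) auto
    fix w assume w: "w \<in> carrier M"
    have "(\<Oplus>\<^bsub>N\<^esub> x \<in> D. f x (v \<oplus>\<^bsub>M\<^esub> w)) = (\<Oplus>\<^bsub>N\<^esub> x \<in> D. f x v \<oplus>\<^bsub>N\<^esub> f x w)"
      using v w c mod_hom_add[OF assms(3)] by (intro N.finsum_cong') auto
    also have "\<dots> = (\<Oplus>\<^bsub>N\<^esub> x \<in> D. f x v) \<oplus>\<^bsub>N\<^esub> (\<Oplus>\<^bsub>N\<^esub> x \<in> D. f x w)"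
      using v w c by (intro N.finsum_addf) auto
    finally show "(\<Oplus>\<^bsub>N\<^esub> x \<in> D. f x (v \<oplus>\<^bsub>M\<^esub> w)) = (\<Oplus>\<^bsub>N\<^esub> x \<in> D. f x v) \<oplus>\<^bsub>N\<^esub> (\<Oplus>\<^bsub>N\<^esub> x \<in> D. f x w)" .
  next
    fix r v assume r: "r \<in> carrier R" and v: "v \<in> carrier M"
    have "(\<Oplus>\<^bsub>N\<^esub> x \<in> D. f x (r \<odot>\<^bsub>M\<^esub> v)) = (\<Oplus>\<^bsub>N\<^esub> x \<in> D. r \<odot>\<^bsub>N\<^esub> f x v)"
      using v r c mod_hom_smult[OF assms(3)] by (intro N.finsum_cong') auto
    also have "\<dots> = r \<odot>\<^bsub>N\<^esub> (\<Oplus>\<^bsub>N\<^esub> x \<in> D. f x v)"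
      using v r c assms(2) by (intro N.finsum_smult_ldistr[symmetric]) auto
    finally show "(\<Oplus>\<^bsub>N\<^esub> x \<in> D. f x (r \<odot>\<^bsub>M\<^esub> v)) = r \<odot>\<^bsub>N\<^esub> (\<Oplus>\<^bsub>N\<^esub> x \<in> D. f x v)" .
  qed
qed

lemma module_mult_one_update:
  assumes "module R M"
  shows "module R (M\<lparr>monoid.mult := m, one := u\<rparr>)"
proof -
  interpret M: module R M by fact
  have "abelian_group (M\<lparr>monoid.mult := m, one := u\<rparr>)"
    using M.abelian_group_axioms
    unfolding abelian_group_def abelian_monoid_def abelian_group_axioms_def by simp
  then show ?thesis
    by (intro moduleI) (auto simp: M.R.cring_axioms M.smult_l_distr M.smult_r_distr M.smult_assoc1 M.is_cring)
qed

text \<open>The coefficient ring R is independent of k; the final theorem takes the integers in one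
  instance and k in the other.\<close>

locale K0_green = tensor_action k C G T \<gamma> + R: cring R
  for k and C (structure) and G and T and \<gamma> and R +
  assumes finite_G: "finite (carrier G)"
begin

abbreviation "K H \<equiv> K0 R (E H)"
abbreviation "cls H \<equiv> K0_class R (E H)"

lemma K_module: "module R (K H)" by (rule K0_module[OF R.cring_axioms])

lemma cls_closed: "X \<in> Ob (E H) \<Longrightarrow> cls H X \<in> carrier (K H)"
  by (rule K0_class_closed[OF R.cring_axioms])

lemma fin_sub: "subgroup H G \<Longrightarrow> finite H"
  using finite_G subgroup.subset finite_subset by metis

lemma cls_ses: "subgroup H G \<Longrightarrow> ses H X a Y b Z \<Longrightarrow> cls H Y = cls H X \<oplus>\<^bsub>K H\<^esub> cls H Z"
  using K0_class_ses[OF R.cring_axioms ses_short_exact] by blast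

lemma K_ext:
  assumes "module R P" "\<phi> \<in> mod_hom R (K H) P" "\<psi> \<in> mod_hom R (K H) P"
    and "\<And>X. X \<in> Ob (E H) \<Longrightarrow> \<phi> (cls H X) = \<psi> (cls H X)" and "v \<in> carrier (K H)"
  shows "\<phi> v = \<psi> v"
  by (rule K0_hom_eqI[OF R.cring_axioms assms])

section \<open>Operations on Grothendieck groups\<close>

definition res_map where "res_map H L = K0_lift R (E H) (K L) (\<lambda>X. cls L (res_obj L X))"

definition conj_map where "conj_map H g = K0_lift R (E H) (K (conj_set G g H)) (\<lambda>X. cls (conj_set G g H) (cj H g X))"

text \<open>An induced object is chosen for each X; by \<open>cls_ind_unique\<close> its class does
  not depend on the choice.\<close>

definition ind_map where
  "ind_map H L = K0_lift R (E L) (K H) (\<lambda>X. cls H (SOME Y. is_induced_obj G C T \<gamma> H L X Y))"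

text \<open>The product is extended in two stages: linearly in the second factor for a fixed object
  X here, and then in the first factor for a fixed element w in \<open>mul\<close>.\<close>

definition mul_obj where "mul_obj H X = K0_lift R (E H) (K H) (\<lambda>Y. cls H (eT H X Y))"

definition mul where "mul H v w = K0_lift R (E H) (K H) (\<lambda>X. mul_obj H X w) v"

lemma K_lift:
  assumes H: "subgroup H G" and P: "module R P"
    and c: "\<forall>X \<in> Ob (E H). \<phi> X \<in> carrier P"
    and a: "\<forall>X f Y g Z. ses H X f Y g Z \<longrightarrow> \<phi> Y = \<phi> X \<oplus>\<^bsub>P\<^esub> \<phi> Z"
  shows "K0_lift R (E H) P \<phi> \<in> mod_hom R (K H) P"
    and "X \<in> Ob (E H) \<Longrightarrow> K0_lift R (E H) P \<phi> (cls H X) = \<phi> X"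
proof -
  have a': "\<phi> Y = \<phi> X \<oplus>\<^bsub>P\<^esub> \<phi> Z" if "short_exact (E H) X f Y g Z" for X f Y g Z
    using that a unfolding short_exact_ses[OF H] by blast
  have c': "\<phi> X \<in> carrier P" if "X \<in> Ob (E H)" for X using that c by blast
  show "K0_lift R (E H) P \<phi> \<in> mod_hom R (K H) P"
    by (rule K0_lift(1)[OF R.cring_axioms P c' a'])
  show "K0_lift R (E H) P \<phi> (cls H X) = \<phi> X" if "X \<in> Ob (E H)"
    by (rule K0_lift(2)[OF R.cring_axioms P c' a' that])
qed

lemma res_map:
  assumes H: "subgroup H G" and L: "subgroup L G" and LH: "L \<subseteq> H"
  shows "res_map H L \<in> mod_hom R (K H) (K L)" and "X \<in> Ob (E H) \<Longrightarrow> res_map H L (cls H X) = cls L (res_obj L X)"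
proof -
  have c: "\<forall>X \<in> Ob (E H). cls L (res_obj L X) \<in> carrier (K L)"
    using cls_closed[OF res_obj_Ob[OF H L LH]] by blast
  have a: "\<forall>X f Y g Z. ses H X f Y g Z \<longrightarrow>
      cls L (res_obj L Y) = cls L (res_obj L X) \<oplus>\<^bsub>K L\<^esub> cls L (res_obj L Z)"
    using cls_ses[OF L ses_res[OF H L LH fin_sub[OF H]]] by blast
  note l = K_lift[OF H K_module c a, folded res_map_def]
  show "res_map H L \<in> mod_hom R (K H) (K L)" by (rule l)
  show "X \<in> Ob (E H) \<Longrightarrow> res_map H L (cls H X) = cls L (res_obj L X)" by (rule l)
qed

lemma conj_map:
  assumes H: "subgroup H G" and g: "g \<in> carrier G"
  shows "conj_map H g \<in> mod_hom R (K H) (K (conj_set G g H))"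
    and "X \<in> Ob (E H) \<Longrightarrow> conj_map H g (cls H X) = cls (conj_set G g H) (cj H g X)"
proof -
  let ?L = "conj_set G g H"
  note L = conj_set_subgroup[OF H g]
  have c: "\<forall>X \<in> Ob (E H). cls ?L (cj H g X) \<in> carrier (K ?L)"
    using cls_closed[OF cj_Ob[OF H g]] by blast
  have a: "\<forall>X f Y h Z. ses H X f Y h Z \<longrightarrow> cls ?L (cj H g Y) = cls ?L (cj H g X) \<oplus>\<^bsub>K ?L\<^esub> cls ?L (cj H g Z)"
    using cls_ses[OF L ses_cj[OF H fin_sub[OF H] g]] by blast
  note l = K_lift[OF H K_module c a, folded conj_map_def]
  show "conj_map H g \<in> mod_hom R (K H) (K ?L)" by (rule l)
  show "X \<in> Ob (E H) \<Longrightarrow> conj_map H g (cls H X) = cls ?L (cj H g X)" by (rule l)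
qed

lemma cls_ind_unique: "ind H L X Y j q \<Longrightarrow> ind H L X Y' j' q' \<Longrightarrow> cls H Y = cls H Y'"
  using ind_unique[of H L X Y j q Y' j' q'] E_class_iso[OF R.cring_axioms] indD(1,6)[OF _ refl] by metis

lemma ind_map:
  assumes H: "subgroup H G" and L: "subgroup L G" and LH: "L \<subseteq> H"
  shows "ind_map H L \<in> mod_hom R (K L) (K H)"
    and "ind H L X Y j q \<Longrightarrow> ind_map H L (cls L X) = cls H Y"
proof -
  let ?I = "\<lambda>X. SOME Y. is_induced_obj G C T \<gamma> H L X Y"
  have I: "\<exists>j q. ind H L X (?I X) j q" if X: "X \<in> Ob (E L)" for X
    using is_induced_obj_ind[OF H L LH fin_sub[OF H] X someI_ex[OF ex_is_induced_obj[OF H L LH fin_sub[OF H] X]]] .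
  have c: "\<forall>X \<in> Ob (E L). cls H (?I X) \<in> carrier (K H)"
    using I indD(6)[OF _ refl] cls_closed by blast
  have a: "\<forall>X f Y g Z. ses L X f Y g Z \<longrightarrow> cls H (?I Y) = cls H (?I X) \<oplus>\<^bsub>K H\<^esub> cls H (?I Z)"
  proof (intro allI impI)
    fix X f Y g Z assume s: "ses L X f Y g Z"
    obtain j1 q1 j2 q2 j3 q3 where i: "ind H L X (?I X) j1 q1" "ind H L Y (?I Y) j2 q2" "ind H L Z (?I Z) j3 q3"
      using I[OF ses_D(1)[OF L s]] I[OF ses_D(2)[OF L s]] I[OF ses_D(3)[OF L s]] by blast
    show "cls H (?I Y) = cls H (?I X) \<oplus>\<^bsub>K H\<^esub> cls H (?I Z)" using ses_ind[OF s i] cls_ses[OF H] by blast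
  qed
  note l = K_lift[OF L K_module c a, folded ind_map_def]
  show "ind_map H L \<in> mod_hom R (K L) (K H)" by (rule l)
  assume i: "ind H L X Y j q"
  then have X: "X \<in> Ob (E L)" using indD(5)[OF _ refl] by blast
  then show "ind_map H L (cls L X) = cls H Y"
    using l(2)[OF X] I[OF X] cls_ind_unique[OF i] by metis
qed

lemma mul_obj:
  assumes H: "subgroup H G" and X: "X \<in> Ob (E H)"
  shows "mul_obj H X \<in> mod_hom R (K H) (K H)" and "Y \<in> Ob (E H) \<Longrightarrow> mul_obj H X (cls H Y) = cls H (eT H X Y)"
proof -
  have c: "\<forall>Y \<in> Ob (E H). cls H (eT H X Y) \<in> carrier (K H)"
    using cls_closed[OF eT_Ob[OF H X]] by blast
  have a: "\<forall>Y f Z g W. ses H Y f Z g W \<longrightarrow> cls H (eT H X Z) = cls H (eT H X Y) \<oplus>\<^bsub>K H\<^esub> cls H (eT H X W)"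
    using cls_ses[OF H ses_eT_left[OF H fin_sub[OF H] X]] by blast
  note l = K_lift[OF H K_module c a, folded mul_obj_def]
  show "mul_obj H X \<in> mod_hom R (K H) (K H)" by (rule l)
  show "Y \<in> Ob (E H) \<Longrightarrow> mul_obj H X (cls H Y) = cls H (eT H X Y)" by (rule l)
qed

text \<open>The extension in the first factor requires \<open>mul_obj H X w\<close> to be additive
  in X. Both sides of that equation are linear in w, so it reduces to exactness of tensoring with an
  object on the right.\<close>

lemma mul_left:
  assumes H: "subgroup H G" and w: "w \<in> carrier (K H)"
  shows "(\<lambda>v. mul H v w) \<in> mod_hom R (K H) (K H)" and "X \<in> Ob (E H) \<Longrightarrow> mul H (cls H X) w = mul_obj H X w"
proof -
  have c: "\<forall>X \<in> Ob (E H). mul_obj H X w \<in> carrier (K H)"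
    using mod_hom_closed[OF mul_obj(1)[OF H] w] by blast
  have a: "\<forall>X f Y g Z. ses H X f Y g Z \<longrightarrow> mul_obj H Y w = mul_obj H X w \<oplus>\<^bsub>K H\<^esub> mul_obj H Z w"
  proof (intro allI impI)
    fix X f Y g Z assume s: "ses H X f Y g Z"
    note o = ses_D(1-3)[OF H s]
    show "mul_obj H Y w = mul_obj H X w \<oplus>\<^bsub>K H\<^esub> mul_obj H Z w"
    proof (rule K_ext[OF K_module mul_obj(1)[OF H o(2)] mod_hom_plus[OF K_module mul_obj(1)[OF H o(1)] mul_obj(1)[OF H o(3)]] _ w])
      fix W assume W: "W \<in> Ob (E H)"
      show "mul_obj H Y (cls H W) = mul_obj H X (cls H W) \<oplus>\<^bsub>K H\<^esub> mul_obj H Z (cls H W)"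
        unfolding mul_obj(2)[OF H o(1) W] mul_obj(2)[OF H o(2) W] mul_obj(2)[OF H o(3) W]
        by (rule cls_ses[OF H ses_eT_right[OF H fin_sub[OF H] W s]])
    qed
  qed
  note l = K_lift[OF H K_module c a, folded mul_def]
  show "(\<lambda>v. mul H v w) \<in> mod_hom R (K H) (K H)" unfolding mul_def by (rule K_lift(1)[OF H K_module c a])
  show "X \<in> Ob (E H) \<Longrightarrow> mul H (cls H X) w = mul_obj H X w" by (rule l)
qed

lemma mul_cls: "subgroup H G \<Longrightarrow> X \<in> Ob (E H) \<Longrightarrow> Y \<in> Ob (E H) \<Longrightarrow> mul H (cls H X) (cls H Y) = cls H (eT H X Y)"
  using mul_left(2) mul_obj(2) cls_closed by metis

lemma mul_closed: "subgroup H G \<Longrightarrow> v \<in> carrier (K H) \<Longrightarrow> w \<in> carrier (K H) \<Longrightarrow> mul H v w \<in> carrier (K H)"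
  using mod_hom_closed[OF mul_left(1)] by blast

text \<open>Linearity in the second factor holds by construction when v is a class, and extends to
  all v because the product is already linear in the first factor.\<close>

lemma mul_right:
  assumes H: "subgroup H G" and v: "v \<in> carrier (K H)"
  shows "(\<lambda>w. mul H v w) \<in> mod_hom R (K H) (K H)"
proof (rule mod_homI)
  interpret M: module R "K H" by (rule K_module)
  fix w assume w: "w \<in> carrier (K H)"
  show "mul H v w \<in> carrier (K H)" by (rule mul_closed[OF H v w])
  fix w' assume w': "w' \<in> carrier (K H)"
  show "mul H v (w \<oplus>\<^bsub>K H\<^esub> w') = mul H v w \<oplus>\<^bsub>K H\<^esub> mul H v w'"
    by (rule K_ext[OF K_module mul_left(1)[OF H] mod_hom_plus[OF K_module mul_left(1)[OF H w] mul_left(1)[OF H w']] _ v])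
      (use w w' in \<open>simp_all add: mul_left(2)[OF H] mod_hom_add[OF mul_obj(1)[OF H]]\<close>)
next
  interpret M: module R "K H" by (rule K_module)
  fix r w assume r: "r \<in> carrier R" and w: "w \<in> carrier (K H)"
  show "mul H v (r \<odot>\<^bsub>K H\<^esub> w) = r \<odot>\<^bsub>K H\<^esub> mul H v w"
    by (rule K_ext[OF K_module mul_left(1)[OF H] mod_hom_scale[OF K_module mul_left(1)[OF H w] r] _ v])
      (use r w in \<open>simp_all add: mul_left(2)[OF H] mod_hom_smult[OF mul_obj(1)[OF H]]\<close>)
qed

text \<open>Both sides are linear in each variable, so the variables are replaced by classes one
  after another, and the equivariant associator settles the remaining case.\<close>

lemma mul_assoc:
  assumes H: "subgroup H G" and u: "u \<in> carrier (K H)" and v: "v \<in> carrier (K H)" and w: "w \<in> carrier (K H)"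
  shows "mul H (mul H u v) w = mul H u (mul H v w)"
proof (rule K_ext[OF K_module _ _ _ u])
  show "(\<lambda>u. mul H (mul H u v) w) \<in> mod_hom R (K H) (K H)"
    by (rule mod_hom_comp[OF mul_left(1)[OF H v] mul_left(1)[OF H w]])
  show "(\<lambda>u. mul H u (mul H v w)) \<in> mod_hom R (K H) (K H)"
    by (rule mul_left(1)[OF H mul_closed[OF H v w]])
  fix X assume X: "X \<in> Ob (E H)"
  show "mul H (mul H (cls H X) v) w = mul H (cls H X) (mul H v w)"
  proof (rule K_ext[OF K_module _ _ _ v])
    show "(\<lambda>v. mul H (mul H (cls H X) v) w) \<in> mod_hom R (K H) (K H)"
      by (rule mod_hom_comp[OF mul_right[OF H cls_closed[OF X]] mul_left(1)[OF H w]])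
    show "(\<lambda>v. mul H (cls H X) (mul H v w)) \<in> mod_hom R (K H) (K H)"
      by (rule mod_hom_comp[OF mul_left(1)[OF H w] mul_right[OF H cls_closed[OF X]]])
    fix Y assume Y: "Y \<in> Ob (E H)"
    show "mul H (mul H (cls H X) (cls H Y)) w = mul H (cls H X) (mul H (cls H Y) w)"
    proof (rule K_ext[OF K_module _ _ _ w])
      show "(\<lambda>w. mul H (mul H (cls H X) (cls H Y)) w) \<in> mod_hom R (K H) (K H)"
        by (rule mul_right[OF H mul_closed[OF H cls_closed[OF X] cls_closed[OF Y]]])
      show "(\<lambda>w. mul H (cls H X) (mul H (cls H Y) w)) \<in> mod_hom R (K H) (K H)"
        by (rule mod_hom_comp[OF mul_right[OF H cls_closed[OF Y]] mul_right[OF H cls_closed[OF X]]])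
      fix Z assume Z: "Z \<in> Ob (E H)"
      have "cls H (eT H (eT H X Y) Z) = cls H (eT H X (eT H Y Z))"
        using E_class_iso[OF R.cring_axioms H _ _ al_eh[OF H X Y Z]] eT_Ob[OF H] X Y Z E_ObD(1)[OF _ H] by simp
      then show "mul H (mul H (cls H X) (cls H Y)) (cls H Z) = mul H (cls H X) (mul H (cls H Y) (cls H Z))"
        using X Y Z eT_Ob[OF H] by (simp add: mul_cls[OF H])
    qed
  qed
qed

lemma mul_one:
  assumes H: "subgroup H G" and v: "v \<in> carrier (K H)"
  shows "mul H (cls H (Unit (E H))) v = v" and "mul H v (cls H (Unit (E H))) = v"
proof -
  note U = eU_Ob[OF H]
  have id: "(\<lambda>v. v) \<in> mod_hom R (K H) (K H)" by (rule mod_homI) auto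
  show "mul H (cls H (Unit (E H))) v = v"
  proof (rule K_ext[OF K_module mul_right[OF H cls_closed[OF U]] id _ v])
    fix X assume X: "X \<in> Ob (E H)"
    show "mul H (cls H (Unit (E H))) (cls H X) = cls H X"
      using E_class_iso[OF R.cring_axioms H _ _ lu_eh[OF H X]] eT_Ob[OF H U X] X U E_ObD(1)[OF _ H] by (simp add: mul_cls[OF H])
  qed
  show "mul H v (cls H (Unit (E H))) = v"
  proof (rule K_ext[OF K_module mul_left(1)[OF H cls_closed[OF U]] id _ v])
    fix X assume X: "X \<in> Ob (E H)"
    show "mul H (cls H X) (cls H (Unit (E H))) = cls H X"
      using E_class_iso[OF R.cring_axioms H _ _ ru_eh[OF H X]] eT_Ob[OF H X U] X U E_ObD(1)[OF _ H] by (simp add: mul_cls[OF H])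
  qed
qed

text \<open>Both sides are bilinear, so agreement on classes suffices. It is applied to restriction
  and to conjugation.\<close>

lemma mul_hom:
  assumes H: "subgroup H G" and L: "subgroup L G" and f: "f \<in> mod_hom R (K H) (K L)"
    and cl: "\<And>X Y. X \<in> Ob (E H) \<Longrightarrow> Y \<in> Ob (E H) \<Longrightarrow> f (cls H (eT H X Y)) = mul L (f (cls H X)) (f (cls H Y))"
    and v: "v \<in> carrier (K H)" and w: "w \<in> carrier (K H)"
  shows "f (mul H v w) = mul L (f v) (f w)"
proof (rule K_ext[OF K_module _ _ _ v])
  note fc = mod_hom_closed[OF f]
  show "(\<lambda>v. f (mul H v w)) \<in> mod_hom R (K H) (K L)" by (rule mod_hom_comp[OF mul_left(1)[OF H w] f])
  show "(\<lambda>v. mul L (f v) (f w)) \<in> mod_hom R (K H) (K L)" by (rule mod_hom_comp[OF f mul_left(1)[OF L fc[OF w]]])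
  fix X assume X: "X \<in> Ob (E H)"
  show "f (mul H (cls H X) w) = mul L (f (cls H X)) (f w)"
  proof (rule K_ext[OF K_module _ _ _ w])
    show "(\<lambda>w. f (mul H (cls H X) w)) \<in> mod_hom R (K H) (K L)"
      by (rule mod_hom_comp[OF mul_right[OF H cls_closed[OF X]] f])
    show "(\<lambda>w. mul L (f (cls H X)) (f w)) \<in> mod_hom R (K H) (K L)"
      by (rule mod_hom_comp[OF f mul_right[OF L fc[OF cls_closed[OF X]]]])
    fix Y assume Y: "Y \<in> Ob (E H)"
    show "f (mul H (cls H X) (cls H Y)) = mul L (f (cls H X)) (f (cls H Y))"
      using cl[OF X Y] mul_cls[OF H X Y] by simp
  qed
qed

section \<open>Verification of the axioms\<close>

definition K0_mackey where
  "K0_mackey = \<lparr>Val = (\<lambda>H. (K H)\<lparr>monoid.mult := mul H, one := cls H (Unit (E H))\<rparr>),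
     Ind = ind_map, Res = res_map, Cnj = conj_map\<rparr>"

lemma K0_mackey_sel [simp]:
  "carrier (Val K0_mackey H) = carrier (K H)" "zero (Val K0_mackey H) = zero (K H)"
  "add (Val K0_mackey H) = add (K H)" "smult (Val K0_mackey H) = smult (K H)"
  "monoid.mult (Val K0_mackey H) = mul H" "one (Val K0_mackey H) = cls H (Unit (E H))"
  "Ind K0_mackey = ind_map" "Res K0_mackey = res_map" "Cnj K0_mackey = conj_map"
  by (simp_all add: K0_mackey_def)

lemma K0_mackey_module: "module R (Val K0_mackey H)"
  using module_mult_one_update[OF K_module] by (simp add: K0_mackey_def)

lemma K0_mackey_mod_hom [simp]: "mod_hom R (Val K0_mackey H) (Val K0_mackey L) = mod_hom R (K H) (K L)"
  by (simp add: mod_hom_def)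

lemma K0_mackey_finsum [simp]: "finsum (Val K0_mackey H) = finsum (K H)"
  by (intro ext) (simp add: finsum_def K0_mackey_def)

lemma K0_mackey_data: "K0_data R G C T \<gamma> K0_mackey"
  unfolding K0_data_def Let_def
proof (intro conjI allI impI ballI)
  fix H L X assume H: "subgroup H G" "subgroup L G" "L \<subseteq> H" and X: "X \<in> Ob (E L)"
  show "\<exists>Y. is_induced_obj G C T \<gamma> H L X Y"
    by (rule ex_is_induced_obj[OF H fin_sub[OF H(1)] X])
  fix Y assume "is_induced_obj G C T \<gamma> H L X Y"
  then show "Ind K0_mackey H L (cls L X) = cls H Y"
    using is_induced_obj_ind[OF H fin_sub[OF H(1)] X] ind_map(2)[OF H] by fastforce
qed (use mul_cls res_map(2) conj_map(2) in simp_all)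

lemma K0_mackey_functor: "mackey_functor R G K0_mackey"
proof (intro mackey_functor.intro mackey_functor_axioms.intro)
  show "cring R" "group G" "finite (carrier G)" using finite_G by (auto intro: R.cring_axioms)
  have id: "(\<lambda>v. v) \<in> mod_hom R (K H) (K H)" for H by (rule mod_homI) auto
  fix H assume H: "subgroup H G"
  show "module R (Val K0_mackey H)" by (rule K0_mackey_module)
  show "Ind K0_mackey H L \<in> mod_hom R (Val K0_mackey L) (Val K0_mackey H)"
    "Res K0_mackey H L \<in> mod_hom R (Val K0_mackey H) (Val K0_mackey L)"
    if "subgroup L G" "L \<subseteq> H" for L using ind_map(1)[OF H that] res_map(1)[OF H that] by simp_all
  show "Cnj K0_mackey H g \<in> mod_hom R (Val K0_mackey H) (Val K0_mackey (conj_set G g H))"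
    if "g \<in> carrier G" for g using conj_map(1)[OF H that] by simp
  show "Ind K0_mackey H H v = v" if "v \<in> carrier (Val K0_mackey H)" for v
  proof -
    have "ind_map H H v = v"
      by (rule K_ext[OF K_module ind_map(1)[OF H H subset_refl] id])
        (use that ind_map(2)[OF H H subset_refl ind_refl[OF H fin_sub[OF H]]] in auto)
    then show ?thesis by simp
  qed
  show "Res K0_mackey H H v = v" if "v \<in> carrier (Val K0_mackey H)" for v
  proof -
    have "res_map H H v = v"
      by (rule K_ext[OF K_module res_map(1)[OF H H subset_refl] id])
        (use that res_map(2)[OF H H subset_refl] res_obj_id[OF _ H] in auto)
    then show ?thesis by simp
  qed
  show "Cnj K0_mackey H h v = v" if h: "h \<in> H" and v: "v \<in> carrier (Val K0_mackey H)" for h v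
  proof -
    have hc: "h \<in> carrier G" using H h by (rule subgroup.mem_carrier)
    have "conj_map H h v = v"
    proof (rule K_ext[OF K_module _ id])
      show "conj_map H h \<in> mod_hom R (K H) (K H)" using conj_map(1)[OF H hc] conj_set_mem_eq[OF H h] by simp
      fix X assume X: "X \<in> Ob (E H)"
      note e = A_cj_eh[OF H h X]
      have c: "conj_set G h H = H" by (rule conj_set_mem_eq[OF H h])
      show "conj_map H h (cls H X) = cls H X"
        using conj_map(2)[OF H hc X] E_class_iso[OF R.cring_axioms H _ X _ E_ObD(3)[OF X H h]] cj_Ob[OF H hc X] e
        unfolding c by simp
    qed (use v in simp)
    then show ?thesis by simp
  qed
  show "Cnj K0_mackey (conj_set G g H) h (Cnj K0_mackey H g v) = Cnj K0_mackey H (h \<otimes>\<^bsub>G\<^esub> g) v"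
    if g: "g \<in> carrier G" and h: "h \<in> carrier G" and v: "v \<in> carrier (Val K0_mackey H)" for g h v
  proof -
    note gH = conj_set_subgroup[OF H g]
    have hg: "h \<otimes>\<^bsub>G\<^esub> g \<in> carrier G" using g h by simp
    have c: "conj_set G h (conj_set G g H) = conj_set G (h \<otimes>\<^bsub>G\<^esub> g) H" by (rule conj_set_conj[OF H g h])
    have "conj_map (conj_set G g H) h (conj_map H g v) = conj_map H (h \<otimes>\<^bsub>G\<^esub> g) v"
    proof (rule K_ext[OF K_module mod_hom_comp[OF conj_map(1)[OF H g] conj_map(1)[OF gH h]]])
      show "conj_map H (h \<otimes>\<^bsub>G\<^esub> g) \<in> mod_hom R (K H) (K (conj_set G h (conj_set G g H)))"
        unfolding c by (rule conj_map(1)[OF H hg])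
      fix X assume X: "X \<in> Ob (E H)"
      note gX = cj_Ob[OF H g X]
      have "conj_map (conj_set G g H) h (conj_map H g (cls H X)) = cls (conj_set G (h \<otimes>\<^bsub>G\<^esub> g) H) (cj (conj_set G g H) h (cj H g X))"
        unfolding conj_map(2)[OF H g X] conj_map(2)[OF gH h gX] c ..
      also have "\<dots> = cls (conj_set G (h \<otimes>\<^bsub>G\<^esub> g) H) (cj H (h \<otimes>\<^bsub>G\<^esub> g) X)"
        by (rule E_class_iso[OF R.cring_axioms conj_set_subgroup[OF H hg] cj_Ob[OF gH h gX, unfolded c] cj_Ob[OF H hg X]
              gam_cj_eh[OF H g h X]]) (use g h E_ObD(1)[OF X H] in simp)
      also have "\<dots> = conj_map H (h \<otimes>\<^bsub>G\<^esub> g) (cls H X)" by (rule conj_map(2)[OF H hg X, symmetric])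
      finally show "conj_map (conj_set G g H) h (conj_map H g (cls H X)) = conj_map H (h \<otimes>\<^bsub>G\<^esub> g) (cls H X)" .
    qed (use v in simp)
    then show ?thesis by simp
  qed
  fix L J assume L: "subgroup L G" and J: "subgroup J G" and JL: "J \<subseteq> L" and LH: "L \<subseteq> H"
  have JH: "J \<subseteq> H" using JL LH by simp
  show "Res K0_mackey L J (Res K0_mackey H L v) = Res K0_mackey H J v" if v: "v \<in> carrier (Val K0_mackey H)" for v
  proof -
    have "res_map L J (res_map H L v) = res_map H J v"
      by (rule K_ext[OF K_module mod_hom_comp[OF res_map(1)[OF H L LH] res_map(1)[OF L J JL]] res_map(1)[OF H J JH]])
        (use v in \<open>simp_all add: res_map(2)[OF H L LH] res_map(2)[OF L J JL] res_map(2)[OF H J JH] res_obj_Ob[OF H L LH] res_obj_res_obj[OF JL]\<close>)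
    then show ?thesis by simp
  qed
  show "Ind K0_mackey H L (Ind K0_mackey L J v) = Ind K0_mackey H J v" if v: "v \<in> carrier (Val K0_mackey J)" for v
  proof -
    have "ind_map H L (ind_map L J v) = ind_map H J v"
    proof (rule K_ext[OF K_module mod_hom_comp[OF ind_map(1)[OF L J JL] ind_map(1)[OF H L LH]] ind_map(1)[OF H J JH]])
      fix X assume X: "X \<in> Ob (E J)"
      obtain Y j q where Y: "ind L J X Y j q" using ex_ind[OF L J JL fin_sub[OF L] X] by blast
      obtain Z j' q' where Z: "ind H L Y Z j' q'" using ex_ind[OF H L LH fin_sub[OF H] indD(6)[OF Y refl]] by blast
      show "ind_map H L (ind_map L J (cls J X)) = ind_map H J (cls J X)"
        using ind_map(2)[OF L J JL Y] ind_map(2)[OF H L LH Z] ind_map(2)[OF H J JH ind_trans[OF Y Z]] by simp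
    qed (use v in simp)
    then show ?thesis by simp
  qed
next
  fix L H D v assume L: "subgroup L G" and H: "subgroup H G" and D: "double_coset_reps G H L D"
    and v: "v \<in> carrier (Val K0_mackey L)"
  let ?G = "carrier G" and ?M = "\<lambda>x. conj_set G x L" and ?N = "\<lambda>x. conj_set G x L \<inter> H"
  have GG: "subgroup ?G G" by (rule G.subgroup_self)
  have HG: "H \<subseteq> ?G" and LG: "L \<subseteq> ?G" using H L by (auto dest: subgroup.subset)
  have Dc: "x \<in> carrier G" if "x \<in> D" for x using that D by (auto simp: double_coset_reps_def)
  have finD: "finite D" using D finite_G by (auto simp: double_coset_reps_def intro: finite_subset)
  have M: "subgroup (?M x) G" if "x \<in> D" for x by (rule conj_set_subgroup[OF L Dc[OF that]])
  have N: "subgroup (?N x) G" if "x \<in> D" for x by (rule G.subgroups_Inter_pair[OF M[OF that] H])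
  have hom: "(\<lambda>v. ind_map H (?N x) (res_map (?M x) (?N x) (conj_map L x v))) \<in> mod_hom R (K L) (K H)" if x: "x \<in> D" for x
    by (rule mod_hom_comp[OF mod_hom_comp[OF conj_map(1)[OF L Dc[OF x]] res_map(1)[OF M[OF x] N[OF x] Int_lower1]] ind_map(1)[OF H N[OF x] Int_lower2]])
  have "res_map ?G H (ind_map ?G L v) = (\<Oplus>\<^bsub>K H\<^esub> x \<in> D. ind_map H (?N x) (res_map (?M x) (?N x) (conj_map L x v)))"
  proof (rule K_ext[OF K_module mod_hom_comp[OF ind_map(1)[OF GG L LG] res_map(1)[OF GG H HG]] mod_hom_sum[OF K_module finD hom]])
    fix X assume X: "X \<in> Ob (E L)"
    obtain Y j q where Y: "ind ?G L X Y j q" using ex_ind[OF GG L LG finite_G X] by blast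
    \<comment> \<open>Induced objects are chosen for all double cosets at once, as the family that
      \<open>mackey_class\<close> takes.\<close>
    have "\<forall>x \<in> D. \<exists>Z j q. ind H (?N x) (res_obj (?N x) (cj L x X)) Z j q"
      using ex_ind[OF H N Int_lower2 fin_sub[OF H] res_obj_Ob[OF M N Int_lower1 cj_Ob[OF L Dc X]]] by blast
    then obtain Z jz qz where Z: "\<And>x. x \<in> D \<Longrightarrow> ind H (?N x) (res_obj (?N x) (cj L x X)) (Z x) (jz x) (qz x)"
      by metis
    interpret KH: module R "K H" by (rule K_module)
    have "res_map ?G H (ind_map ?G L (cls L X)) = cls H (res_obj H Y)"
      using ind_map(2)[OF GG L LG Y] res_map(2)[OF GG H HG indD(6)[OF Y refl]] by simp
    also have "\<dots> = (\<Oplus>\<^bsub>K H\<^esub> x \<in> D. cls H (Z x))"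
      by (rule mackey_class[OF R.cring_axioms finite_G H L Y D Z])
    also have "\<dots> = (\<Oplus>\<^bsub>K H\<^esub> x \<in> D. ind_map H (?N x) (res_map (?M x) (?N x) (conj_map L x (cls L X))))"
    proof (rule KH.finsum_cong')
      fix x assume x: "x \<in> D"
      show "cls H (Z x) = ind_map H (?N x) (res_map (?M x) (?N x) (conj_map L x (cls L X)))"
        using conj_map(2)[OF L Dc[OF x] X] res_map(2)[OF M[OF x] N[OF x] Int_lower1 cj_Ob[OF L Dc[OF x] X]]
          ind_map(2)[OF H N[OF x] Int_lower2 Z[OF x]] by simp
    qed (use mod_hom_closed[OF hom cls_closed[OF X]] in auto)
    finally show "res_map ?G H (ind_map ?G L (cls L X)) = (\<Oplus>\<^bsub>K H\<^esub> x \<in> D. ind_map H (?N x) (res_map (?M x) (?N x) (conj_map L x (cls L X))))" .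
  qed (use v in simp_all)
  then show "Res K0_mackey ?G H (Ind K0_mackey ?G L v) = (\<Oplus>\<^bsub>Val K0_mackey H\<^esub> x \<in> D. Ind K0_mackey H (?N x)
      (Res K0_mackey (?M x) (?N x) (Cnj K0_mackey L x v)))"
    by simp
qed

lemma K0_mackey_green: "green_functor R G K0_mackey"
proof (intro green_functor.intro K0_mackey_functor green_functor_axioms.intro)
  fix H assume H: "subgroup H G"
  interpret V: module R "Val K0_mackey H" by (rule K0_mackey_module)
  note l = mul_left(1)[OF H] and r = mul_right[OF H] and U = cls_closed[OF eU_Ob[OF H]]
  show "ring (Val K0_mackey H)"
  proof (rule ringI)
    show "abelian_group (Val K0_mackey H)" ..
    show "monoid (Val K0_mackey H)"
      by (rule monoidI) (simp_all add: mul_closed[OF H] U mul_assoc[OF H] mul_one[OF H])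
  qed (simp_all add: mod_hom_add[OF l] mod_hom_add[OF r])
  show "(s \<odot>\<^bsub>Val K0_mackey H\<^esub> v) \<otimes>\<^bsub>Val K0_mackey H\<^esub> w = s \<odot>\<^bsub>Val K0_mackey H\<^esub> (v \<otimes>\<^bsub>Val K0_mackey H\<^esub> w)"
    "v \<otimes>\<^bsub>Val K0_mackey H\<^esub> (s \<odot>\<^bsub>Val K0_mackey H\<^esub> w) = s \<odot>\<^bsub>Val K0_mackey H\<^esub> (v \<otimes>\<^bsub>Val K0_mackey H\<^esub> w)"
    if "s \<in> carrier R" "v \<in> carrier (Val K0_mackey H)" "w \<in> carrier (Val K0_mackey H)" for s v w
    using that by (simp_all add: mod_hom_smult[OF l] mod_hom_smult[OF r])
  show "Cnj K0_mackey H g \<in> ring_hom (Val K0_mackey H) (Val K0_mackey (conj_set G g H))" if g: "g \<in> carrier G" for g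
  proof (rule ring_hom_memI)
    let ?L = "conj_set G g H"
    note L = conj_set_subgroup[OF H g] and f = conj_map(1)[OF H g]
    fix v w assume v: "v \<in> carrier (Val K0_mackey H)"
    then show "Cnj K0_mackey H g v \<in> carrier (Val K0_mackey ?L)" using mod_hom_closed[OF f] by simp
    assume w: "w \<in> carrier (Val K0_mackey H)"
    show "Cnj K0_mackey H g (v \<oplus>\<^bsub>Val K0_mackey H\<^esub> w) = Cnj K0_mackey H g v \<oplus>\<^bsub>Val K0_mackey ?L\<^esub> Cnj K0_mackey H g w"
      using v w mod_hom_add[OF f] by simp
    have "conj_map H g (mul H v w) = mul ?L (conj_map H g v) (conj_map H g w)"
    proof (rule mul_hom[OF H L f])
      fix X Y assume X: "X \<in> Ob (E H)" and Y: "Y \<in> Ob (E H)"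
      note o = cj_Ob[OF H g X] cj_Ob[OF H g Y] eT_Ob[OF H X Y]
      have "cls ?L (cj H g (eT H X Y)) = cls ?L (eT ?L (cj H g X) (cj H g Y))"
        by (rule E_class_iso[OF R.cring_axioms L cj_Ob[OF H g o(3)] eT_Ob[OF L o(1,2)] f2_cj_eh[OF H g X Y]])
          (use g E_ObD(1)[OF X H] E_ObD(1)[OF Y H] in simp)
      then show "conj_map H g (cls H (eT H X Y)) = mul ?L (conj_map H g (cls H X)) (conj_map H g (cls H Y))"
        using X Y o by (simp add: conj_map(2)[OF H g] mul_cls[OF L])
    qed (use v w in simp_all)
    then show "Cnj K0_mackey H g (v \<otimes>\<^bsub>Val K0_mackey H\<^esub> w) = Cnj K0_mackey H g v \<otimes>\<^bsub>Val K0_mackey ?L\<^esub> Cnj K0_mackey H g w"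
      by simp
  next
    let ?L = "conj_set G g H"
    note L = conj_set_subgroup[OF H g]
    have "cls ?L (cj H g (Unit (E H))) = cls ?L (Unit (E ?L))"
      by (rule E_class_iso[OF R.cring_axioms L cj_Ob[OF H g eU_Ob[OF H]] eU_Ob[OF L] f0_cj_eh[OF H g]]) (use g in simp)
    then show "Cnj K0_mackey H g \<one>\<^bsub>Val K0_mackey H\<^esub> = \<one>\<^bsub>Val K0_mackey ?L\<^esub>"
      using conj_map(2)[OF H g eU_Ob[OF H]] by simp
  qed
  fix L assume L: "subgroup L G" and LH: "L \<subseteq> H"
  note f = res_map(1)[OF H L LH] and i = ind_map(1)[OF H L LH]
  note fc = mod_hom_closed[OF f] and ic = mod_hom_closed[OF i]
  show "Res K0_mackey H L \<in> ring_hom (Val K0_mackey H) (Val K0_mackey L)"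
  proof (rule ring_hom_memI)
    fix v w assume v: "v \<in> carrier (Val K0_mackey H)"
    then show "Res K0_mackey H L v \<in> carrier (Val K0_mackey L)" using fc by simp
    assume w: "w \<in> carrier (Val K0_mackey H)"
    show "Res K0_mackey H L (v \<oplus>\<^bsub>Val K0_mackey H\<^esub> w) = Res K0_mackey H L v \<oplus>\<^bsub>Val K0_mackey L\<^esub> Res K0_mackey H L w"
      using v w mod_hom_add[OF f] by simp
    have "res_map H L (mul H v w) = mul L (res_map H L v) (res_map H L w)"
      by (rule mul_hom[OF H L f])
        (use v w in \<open>simp_all add: res_map(2)[OF H L LH] mul_cls[OF L] res_obj_Ob[OF H L LH] eT_Ob[OF H] res_obj_eT[OF LH]\<close>)
    then show "Res K0_mackey H L (v \<otimes>\<^bsub>Val K0_mackey H\<^esub> w) = Res K0_mackey H L v \<otimes>\<^bsub>Val K0_mackey L\<^esub> Res K0_mackey H L w"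
      by simp
  next
    show "Res K0_mackey H L \<one>\<^bsub>Val K0_mackey H\<^esub> = \<one>\<^bsub>Val K0_mackey L\<^esub>"
      using res_map(2)[OF H L LH eU_Ob[OF H]] res_obj_eU[OF LH] by simp
  qed
  fix v w assume "v \<in> carrier (Val K0_mackey L)" "w \<in> carrier (Val K0_mackey H)"
  then have v: "v \<in> carrier (K L)" and w: "w \<in> carrier (K H)" by simp_all
  note lL = mul_left(1)[OF L] and rL = mul_right[OF L]
  \<comment> \<open>Both sides are linear in v and, once v is a class, in w; on classes the identity
    is \<open>ind_tensor_right\<close>.\<close>
  have "ind_map H L (mul L v (res_map H L w)) = mul H (ind_map H L v) w"
  proof (rule K_ext[OF K_module mod_hom_comp[OF lL[OF fc[OF w]] i] mod_hom_comp[OF i l[OF w]] _ v])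
    fix X assume X: "X \<in> Ob (E L)"
    obtain Y j q where Y: "ind H L X Y j q" using ex_ind[OF H L LH fin_sub[OF H] X] by blast
    note cX = cls_closed[OF X]
    show "ind_map H L (mul L (cls L X) (res_map H L w)) = mul H (ind_map H L (cls L X)) w"
    proof (rule K_ext[OF K_module mod_hom_comp[OF mod_hom_comp[OF f rL[OF cX]] i] r[OF ic[OF cX]] _ w])
      fix B assume B: "B \<in> Ob (E H)"
      show "ind_map H L (mul L (cls L X) (res_map H L (cls H B))) = mul H (ind_map H L (cls L X)) (cls H B)"
        using ind_map(2)[OF H L LH Y] ind_map(2)[OF H L LH ind_tensor_right[OF Y B]] X B
          mul_cls[OF L X res_obj_Ob[OF H L LH B]] mul_cls[OF H indD(6)[OF Y refl] B] res_map(2)[OF H L LH B] by simp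
    qed
  qed
  then show "Ind K0_mackey H L (v \<otimes>\<^bsub>Val K0_mackey L\<^esub> Res K0_mackey H L w) = Ind K0_mackey H L v \<otimes>\<^bsub>Val K0_mackey H\<^esub> w"
    by simp
  have "ind_map H L (mul L (res_map H L w) v) = mul H w (ind_map H L v)"
  proof (rule K_ext[OF K_module mod_hom_comp[OF rL[OF fc[OF w]] i] mod_hom_comp[OF i r[OF w]] _ v])
    fix X assume X: "X \<in> Ob (E L)"
    obtain Y j q where Y: "ind H L X Y j q" using ex_ind[OF H L LH fin_sub[OF H] X] by blast
    note cX = cls_closed[OF X]
    show "ind_map H L (mul L (res_map H L w) (cls L X)) = mul H w (ind_map H L (cls L X))"
    proof (rule K_ext[OF K_module mod_hom_comp[OF mod_hom_comp[OF f lL[OF cX]] i] l[OF ic[OF cX]] _ w])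
      fix B assume B: "B \<in> Ob (E H)"
      show "ind_map H L (mul L (res_map H L (cls H B)) (cls L X)) = mul H (cls H B) (ind_map H L (cls L X))"
        using ind_map(2)[OF H L LH Y] ind_map(2)[OF H L LH ind_tensor_left[OF Y B]] X B
          mul_cls[OF L res_obj_Ob[OF H L LH B] X] mul_cls[OF H B indD(6)[OF Y refl]] res_map(2)[OF H L LH B] by simp
    qed
  qed
  then show "Ind K0_mackey H L (Res K0_mackey H L w \<otimes>\<^bsub>Val K0_mackey L\<^esub> v) = w \<otimes>\<^bsub>Val K0_mackey H\<^esub> Ind K0_mackey H L v"
    by simp
qed

end

theorem theorem1p2:
  fixes k :: "('k, 'x) ring_scheme"
    and C :: "('k, 'o, 'm, 'z) mon_cat_scheme"
    and G :: "('g, 'y) monoid_scheme"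
    and T :: "'g \<Rightarrow> ('o, 'm) tens_fun"
    and \<gamma> :: "'g \<Rightarrow> 'g \<Rightarrow> 'o \<Rightarrow> 'm"
  assumes "field k"
    and "tensor_category k C"
    and "group G"
    and "finite (carrier G)"
    and "tensor_action k C G T \<gamma>"
  shows "(\<exists>a. K0_data \<Z> G C T \<gamma> a \<and> green_functor \<Z> G a) \<and>
         (\<exists>a. K0_data k G C T \<gamma> a \<and> green_functor k G a)"
proof -
  \<comment> \<open>The integers give the Grothendieck rings themselves, and k gives their extension
    of scalars; both are instances of one construction.\<close>
  have Z: "K0_green k C G T \<gamma> \<Z>"
    by (intro K0_green.intro K0_green_axioms.intro assms int_is_cring)
  have F: "K0_green k C G T \<gamma> k"
    by (intro K0_green.intro K0_green_axioms.intro assms fieldE(1))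
  show ?thesis
    using K0_green.K0_mackey_data[OF Z] K0_green.K0_mackey_green[OF Z]
      K0_green.K0_mackey_data[OF F] K0_green.K0_mackey_green[OF F] by blast
qed

end
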